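(* Let $\Bbbk$ be a field of characteristic $0$. Let $A$ be the Hopf algebra over $\Bbbk$ generated by $g,h$ subject to $g^2=1$, $gh=-hg$, with $g$ group-like and $\Delta(h)=g\otimes h+h\otimes 1$. Let $\mathcal C$ be the full subcategory of the category $\mathrm{Rep}(A)$ of finite dimensional left $A$-modules consisting of those modules on which $h^2$ acts by a semisimple (diagonalizable) linear operator with integer eigenvalues. Then $\mathcal C$ is a tensor subcategory of $\mathrm{Rep}(A)$, and $\mathcal C$ is tensor equivalent to the category of finite dimensional right $H$-comodules for a co-Frobenius Hopf algebra $H$ which is not of finite type over its Hopf socle.
   Context: A Hopf algebra is co-Frobenius if it has a nonzero integral, i.e. a nonzero linear map $\int:H\to\Bbbk$ with $\int(h_{(2)})h_{(1)}=\int(h)1_H$ for all $h\in H$. For a Hopf algebra $H$ with bijective antipode, the Hopf socle $H_{\mathrm{soc}}$ is the span of the matrix coefficients of those simple right $H$-comodules $W$ such that $V\otimes W$ and $W\otimes V$ are semisimple for every simple right $H$-comodule $V$; it is a Hopf subalgebra. $H$ is of finite type over $H_{\mathrm{soc}}$ if $H$ is a finitely generated (right, equivalently left) $H_{\mathrm{soc}}$-module under multiplication. "Integer eigenvalues" refers to the image of $\mathbb Z$ in $\Bbbk$. A tensor subcategory is an abelian subcategory containing the unit object and closed under tensor products and duals. *)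

theory Defs
  imports "HOL-Library.Poly_Mapping" "Jordan_Normal_Form.Char_Poly"
begin

section \<open>Free algebras and tensor powers\<close>

datatype 'x word = Word (letters: "'x list")

instantiation word :: (type) monoid_add
begin

definition zero_word :: "'a word" where "zero_word = Word []"

definition plus_word :: "'a word \<Rightarrow> 'a word \<Rightarrow> 'a word" where
  "plus_word u v = Word (letters u @ letters v)"

instance
  by standard (simp_all add: zero_word_def plus_word_def)

end

text \<open>
  The free unital algebra on \<open>'x\<close> is the monoid algebra of the free monoid \<open>'x word\<close>, with the
  convolution product of \<open>Poly_Mapping\<close>.  The empty word is \<open>0\<close>, so \<open>Poly_Mapping.single 0 c\<close> is the
  scalar \<open>c\<close>.
\<close>

type_synonym ('k, 'x) free_algebra = "'x word \<Rightarrow>\<^sub>0 'k"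

definition monomial :: "'x list \<Rightarrow> ('k::field, 'x) free_algebra" where
  "monomial xs = Poly_Mapping.single (Word xs) 1"

definition two_sided_ideal :: "'r::ring_1 set \<Rightarrow> bool" where
  "two_sided_ideal I \<longleftrightarrow> 0 \<in> I \<and> (\<forall>x\<in>I. \<forall>y\<in>I. x + y \<in> I) \<and> (\<forall>r. \<forall>x\<in>I. r * x \<in> I \<and> x * r \<in> I)"

text \<open>
  For a vector space \<open>V\<close> with scalar multiplication \<open>s\<close>, the quotient of the free algebra on the set
  \<open>V\<close> by the ideal generated by \<open>linear_relations s\<close> is the tensor algebra \<open>T(V)\<close>.  It contains every
  tensor power of \<open>V\<close>, so two formal sums of tensors of length \<open>n\<close> represent the same element of
  the \<open>n\<close>-th tensor power iff they are congruent modulo this ideal.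
\<close>

definition linear_relations :: "('k::field \<Rightarrow> 'v::ab_group_add \<Rightarrow> 'v) \<Rightarrow> ('k, 'v) free_algebra set" where
  "linear_relations s =
     {monomial [x + y] - monomial [x] - monomial [y] | x y. True} \<union>
     {monomial [s c x] - Poly_Mapping.single 0 c * monomial [x] | c x. True}"

definition same_tensor ::
  "('k::field \<Rightarrow> 'v::ab_group_add \<Rightarrow> 'v) \<Rightarrow> 'v list list \<Rightarrow> 'v list list \<Rightarrow> bool" where
  "same_tensor s ts us \<longleftrightarrow>
     sum_list (map monomial ts) - sum_list (map monomial us)
       \<in> two_sided_ideal hull (linear_relations s)"


section \<open>Hopf algebras\<close>

text \<open>
  \<open>comult H x\<close> is a list \<open>[(x\<^sub>1, x\<^sub>2), \<dots>]\<close> of pairs whose formal sum represents \<open>\<Delta>(x)\<close> in the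
  tensor square of \<open>H\<close> (Sweedler notation).  Only the represented tensor matters: all equations
  between tensors are stated with \<open>same_tensor\<close>.
\<close>

record ('k, 'a) hopf_alg =
  scale :: "'k \<Rightarrow> 'a \<Rightarrow> 'a"
  hmult :: "'a \<Rightarrow> 'a \<Rightarrow> 'a"
  hone :: "'a"
  comult :: "'a \<Rightarrow> ('a \<times> 'a) list"
  counit :: "'a \<Rightarrow> 'k"
  antipode :: "'a \<Rightarrow> 'a"

definition same_tensor2 ::
  "('k::field, 'a::ab_group_add) hopf_alg \<Rightarrow> ('a \<times> 'a) list \<Rightarrow> ('a \<times> 'a) list \<Rightarrow> bool" where
  "same_tensor2 H ts us \<longleftrightarrow>
     same_tensor (scale H) (map (\<lambda>(x, y). [x, y]) ts) (map (\<lambda>(x, y). [x, y]) us)"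

locale unital_algebra = vector_space "scale H"
  for H :: "('k::field, 'a::ab_group_add) hopf_alg" +
  assumes mult_assoc: "hmult H (hmult H x y) z = hmult H x (hmult H y z)"
    and one_mult: "hmult H (hone H) x = x"
    and mult_one: "hmult H x (hone H) = x"
    and mult_add_left: "hmult H (x + y) z = hmult H x z + hmult H y z"
    and mult_add_right: "hmult H x (y + z) = hmult H x y + hmult H x z"
    and mult_scale_left: "hmult H (scale H c x) y = scale H c (hmult H x y)"
    and mult_scale_right: "hmult H x (scale H c y) = scale H c (hmult H x y)"

locale hopf_algebra = unital_algebra H
  for H :: "('k::field, 'a::ab_group_add) hopf_alg" +
  assumes comult_add: "same_tensor2 H (comult H (x + y)) (comult H x @ comult H y)"
    and comult_scale:
      "same_tensor2 H (comult H (scale H c x)) (map (\<lambda>(x\<^sub>1, x\<^sub>2). (scale H c x\<^sub>1, x\<^sub>2)) (comult H x))"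
    and coassoc: "same_tensor (scale H)
        [[x\<^sub>1\<^sub>1, x\<^sub>1\<^sub>2, x\<^sub>2]. (x\<^sub>1, x\<^sub>2) \<leftarrow> comult H x, (x\<^sub>1\<^sub>1, x\<^sub>1\<^sub>2) \<leftarrow> comult H x\<^sub>1]
        [[x\<^sub>1, x\<^sub>2\<^sub>1, x\<^sub>2\<^sub>2]. (x\<^sub>1, x\<^sub>2) \<leftarrow> comult H x, (x\<^sub>2\<^sub>1, x\<^sub>2\<^sub>2) \<leftarrow> comult H x\<^sub>2]"
    and counit_linear: "Vector_Spaces.linear (scale H) (*) (counit H)"
    and counit_left: "(\<Sum>(x\<^sub>1, x\<^sub>2)\<leftarrow>comult H x. scale H (counit H x\<^sub>1) x\<^sub>2) = x"
    and counit_right: "(\<Sum>(x\<^sub>1, x\<^sub>2)\<leftarrow>comult H x. scale H (counit H x\<^sub>2) x\<^sub>1) = x"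
    and comult_one: "same_tensor2 H (comult H (hone H)) [(hone H, hone H)]"
    and comult_mult: "same_tensor2 H (comult H (hmult H x y))
        [(hmult H x\<^sub>1 y\<^sub>1, hmult H x\<^sub>2 y\<^sub>2). (x\<^sub>1, x\<^sub>2) \<leftarrow> comult H x, (y\<^sub>1, y\<^sub>2) \<leftarrow> comult H y]"
    and counit_one: "counit H (hone H) = 1"
    and counit_mult: "counit H (hmult H x y) = counit H x * counit H y"
    and antipode_linear: "Vector_Spaces.linear (scale H) (scale H) (antipode H)"
    and antipode_left:
      "(\<Sum>(x\<^sub>1, x\<^sub>2)\<leftarrow>comult H x. hmult H (antipode H x\<^sub>1) x\<^sub>2) = scale H (counit H x) (hone H)"
    and antipode_right:
      "(\<Sum>(x\<^sub>1, x\<^sub>2)\<leftarrow>comult H x. hmult H x\<^sub>1 (antipode H x\<^sub>2)) = scale H (counit H x) (hone H)"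

definition group_like :: "('k::field, 'a::ab_group_add) hopf_alg \<Rightarrow> 'a \<Rightarrow> bool" where
  "group_like H x \<longleftrightarrow> same_tensor2 H (comult H x) [(x, x)] \<and> counit H x = 1"

definition is_integral :: "('k::field, 'a::ab_group_add) hopf_alg \<Rightarrow> ('a \<Rightarrow> 'k) \<Rightarrow> bool" where
  "is_integral H f \<longleftrightarrow> Vector_Spaces.linear (scale H) (*) f \<and>
     (\<forall>x. (\<Sum>(x\<^sub>1, x\<^sub>2)\<leftarrow>comult H x. scale H (f x\<^sub>2) x\<^sub>1) = scale H (f x) (hone H))"

definition co_Frobenius :: "('k::field, 'a::ab_group_add) hopf_alg \<Rightarrow> bool" where
  "co_Frobenius H \<longleftrightarrow> (\<exists>f. is_integral H f \<and> (\<exists>x. f x \<noteq> 0))"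

text \<open>Finite generation of \<open>H\<close> as a right module over a subalgebra \<open>K\<close>.\<close>

definition finite_type_over :: "('k::field, 'a::ab_group_add) hopf_alg \<Rightarrow> 'a set \<Rightarrow> bool" where
  "finite_type_over H K \<longleftrightarrow>
     (\<exists>F. finite F \<and> (\<forall>x. \<exists>k. (\<forall>f\<in>F. k f \<in> K) \<and> x = (\<Sum>f\<in>F. hmult H f (k f))))"

definition free_eval ::
  "('k::field, 'a::ab_group_add) hopf_alg \<Rightarrow> ('x \<Rightarrow> 'a) \<Rightarrow> ('k, 'x) free_algebra \<Rightarrow> 'a" where
  "free_eval A \<phi> p = (\<Sum>w\<in>Poly_Mapping.keys p.
     scale A (Poly_Mapping.lookup p w) (foldr (\<lambda>x. hmult A (\<phi> x)) (letters w) (hone A)))"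

text \<open>
  The algebra \<open>A\<close> is generated by the elements \<open>\<phi> x\<close> subject to the relations \<open>r = 0\<close> for \<open>r \<in> R\<close>.
\<close>

definition presented_by ::
  "('k::field, 'a::ab_group_add) hopf_alg \<Rightarrow> ('x \<Rightarrow> 'a) \<Rightarrow> ('k, 'x) free_algebra set \<Rightarrow> bool" where
  "presented_by A \<phi> R \<longleftrightarrow>
     surj (free_eval A \<phi>) \<and> {p. free_eval A \<phi> p = 0} = two_sided_ideal hull R"

datatype gen = Gen_g | Gen_h

definition relations_A :: "('k::field, gen) free_algebra set" where
  "relations_A = {monomial [Gen_g, Gen_g] - 1, monomial [Gen_g, Gen_h] + monomial [Gen_h, Gen_g]}"


section \<open>Linear, abelian and monoidal categories\<close>

text \<open>Hom-sets of different pairs of objects may overlap.  \<open>g \<star> f\<close> is \<open>g\<close> after \<open>f\<close>.\<close>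

record ('k, 'o, 'm) lin_cat =
  Obj :: "'o set"
  Hom :: "'o \<Rightarrow> 'o \<Rightarrow> 'm set"
  Comp :: "'m \<Rightarrow> 'm \<Rightarrow> 'm"  (infixr \<open>\<star>\<index>\<close> 70)
  Id :: "'o \<Rightarrow> 'm"
  Add :: "'m \<Rightarrow> 'm \<Rightarrow> 'm"
  Zero :: "'o \<Rightarrow> 'o \<Rightarrow> 'm"
  Scale :: "'k \<Rightarrow> 'm \<Rightarrow> 'm"

locale linear_category =
  fixes C :: "('k::field, 'o, 'm, 'z) lin_cat_scheme" (structure)
  assumes id_hom: "X \<in> Obj C \<Longrightarrow> Id C X \<in> Hom C X X"
    and comp_hom: "\<lbrakk>X \<in> Obj C; Y \<in> Obj C; Z \<in> Obj C; f \<in> Hom C X Y; g \<in> Hom C Y Z\<rbrakk>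
      \<Longrightarrow> g \<star> f \<in> Hom C X Z"
    and comp_id: "\<lbrakk>X \<in> Obj C; Y \<in> Obj C; f \<in> Hom C X Y\<rbrakk> \<Longrightarrow> f \<star> Id C X = f"
    and id_comp: "\<lbrakk>X \<in> Obj C; Y \<in> Obj C; f \<in> Hom C X Y\<rbrakk> \<Longrightarrow> Id C Y \<star> f = f"
    and comp_assoc: "\<lbrakk>W \<in> Obj C; X \<in> Obj C; Y \<in> Obj C; Z \<in> Obj C;
      f \<in> Hom C W X; g \<in> Hom C X Y; h \<in> Hom C Y Z\<rbrakk> \<Longrightarrow> (h \<star> g) \<star> f = h \<star> (g \<star> f)"
    and hom_group: "\<lbrakk>X \<in> Obj C; Y \<in> Obj C\<rbrakk>
      \<Longrightarrow> comm_group \<lparr>carrier = Hom C X Y, mult = Add C, one = Zero C X Y\<rparr>"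
    and scale_hom: "\<lbrakk>X \<in> Obj C; Y \<in> Obj C; f \<in> Hom C X Y\<rbrakk> \<Longrightarrow> Scale C c f \<in> Hom C X Y"
    and scale_add_right: "\<lbrakk>X \<in> Obj C; Y \<in> Obj C; f \<in> Hom C X Y; g \<in> Hom C X Y\<rbrakk>
      \<Longrightarrow> Scale C c (Add C f g) = Add C (Scale C c f) (Scale C c g)"
    and scale_add_left: "\<lbrakk>X \<in> Obj C; Y \<in> Obj C; f \<in> Hom C X Y\<rbrakk>
      \<Longrightarrow> Scale C (c + d) f = Add C (Scale C c f) (Scale C d f)"
    and scale_scale: "\<lbrakk>X \<in> Obj C; Y \<in> Obj C; f \<in> Hom C X Y\<rbrakk>
      \<Longrightarrow> Scale C c (Scale C d f) = Scale C (c * d) f"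
    and scale_one: "\<lbrakk>X \<in> Obj C; Y \<in> Obj C; f \<in> Hom C X Y\<rbrakk> \<Longrightarrow> Scale C 1 f = f"
    and comp_add_left: "\<lbrakk>X \<in> Obj C; Y \<in> Obj C; Z \<in> Obj C; f \<in> Hom C X Y;
      g \<in> Hom C Y Z; h \<in> Hom C Y Z\<rbrakk> \<Longrightarrow> Add C g h \<star> f = Add C (g \<star> f) (h \<star> f)"
    and comp_add_right: "\<lbrakk>X \<in> Obj C; Y \<in> Obj C; Z \<in> Obj C; f \<in> Hom C X Y;
      g \<in> Hom C X Y; h \<in> Hom C Y Z\<rbrakk> \<Longrightarrow> h \<star> Add C f g = Add C (h \<star> f) (h \<star> g)"
    and comp_scale_left: "\<lbrakk>X \<in> Obj C; Y \<in> Obj C; Z \<in> Obj C; f \<in> Hom C X Y; g \<in> Hom C Y Z\<rbrakk>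
      \<Longrightarrow> Scale C c g \<star> f = Scale C c (g \<star> f)"
    and comp_scale_right: "\<lbrakk>X \<in> Obj C; Y \<in> Obj C; Z \<in> Obj C; f \<in> Hom C X Y; g \<in> Hom C Y Z\<rbrakk>
      \<Longrightarrow> g \<star> Scale C c f = Scale C c (g \<star> f)"

definition inverse_mor :: "('k, 'o, 'm, 'z) lin_cat_scheme \<Rightarrow> 'o \<Rightarrow> 'o \<Rightarrow> 'm \<Rightarrow> 'm \<Rightarrow> bool" where
  "inverse_mor C X Y f g \<longleftrightarrow> f \<in> Hom C X Y \<and> g \<in> Hom C Y X \<and>
     g \<star>\<^bsub>C\<^esub> f = Id C X \<and> f \<star>\<^bsub>C\<^esub> g = Id C Y"

definition iso_mor :: "('k, 'o, 'm, 'z) lin_cat_scheme \<Rightarrow> 'o \<Rightarrow> 'o \<Rightarrow> 'm \<Rightarrow> bool" where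
  "iso_mor C X Y f \<longleftrightarrow> (\<exists>g. inverse_mor C X Y f g)"

definition mono_mor :: "('k, 'o, 'm, 'z) lin_cat_scheme \<Rightarrow> 'o \<Rightarrow> 'o \<Rightarrow> 'm \<Rightarrow> bool" where
  "mono_mor C X Y f \<longleftrightarrow> f \<in> Hom C X Y \<and>
     (\<forall>Z\<in>Obj C. \<forall>u\<in>Hom C Z X. \<forall>v\<in>Hom C Z X. f \<star>\<^bsub>C\<^esub> u = f \<star>\<^bsub>C\<^esub> v \<longrightarrow> u = v)"

definition epi_mor :: "('k, 'o, 'm, 'z) lin_cat_scheme \<Rightarrow> 'o \<Rightarrow> 'o \<Rightarrow> 'm \<Rightarrow> bool" where
  "epi_mor C X Y f \<longleftrightarrow> f \<in> Hom C X Y \<and>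
     (\<forall>Z\<in>Obj C. \<forall>u\<in>Hom C Y Z. \<forall>v\<in>Hom C Y Z. u \<star>\<^bsub>C\<^esub> f = v \<star>\<^bsub>C\<^esub> f \<longrightarrow> u = v)"

definition zero_object :: "('k, 'o, 'm, 'z) lin_cat_scheme \<Rightarrow> 'o \<Rightarrow> bool" where
  "zero_object C Z \<longleftrightarrow> Z \<in> Obj C \<and>
     (\<forall>X\<in>Obj C. Hom C X Z = {Zero C X Z} \<and> Hom C Z X = {Zero C Z X})"

text \<open>\<open>P\<close> is a direct sum of \<open>X\<close> and \<open>Y\<close>.\<close>

definition direct_sum :: "('k, 'o, 'm, 'z) lin_cat_scheme \<Rightarrow> 'o \<Rightarrow> 'o \<Rightarrow> 'o \<Rightarrow> bool" where
  "direct_sum C X Y P \<longleftrightarrow> P \<in> Obj C \<and>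
     (\<exists>i\<in>Hom C X P. \<exists>j\<in>Hom C Y P. \<exists>p\<in>Hom C P X. \<exists>q\<in>Hom C P Y.
        p \<star>\<^bsub>C\<^esub> i = Id C X \<and> q \<star>\<^bsub>C\<^esub> j = Id C Y \<and>
        p \<star>\<^bsub>C\<^esub> j = Zero C Y X \<and> q \<star>\<^bsub>C\<^esub> i = Zero C X Y \<and>
        Add C (i \<star>\<^bsub>C\<^esub> p) (j \<star>\<^bsub>C\<^esub> q) = Id C P)"

definition is_kernel :: "('k, 'o, 'm, 'z) lin_cat_scheme \<Rightarrow> 'o \<Rightarrow> 'o \<Rightarrow> 'm \<Rightarrow> 'o \<Rightarrow> 'm \<Rightarrow> bool" where
  "is_kernel C X Y f K k \<longleftrightarrow> K \<in> Obj C \<and> k \<in> Hom C K X \<and> f \<star>\<^bsub>C\<^esub> k = Zero C K Y \<and>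
     (\<forall>Z\<in>Obj C. \<forall>u\<in>Hom C Z X. f \<star>\<^bsub>C\<^esub> u = Zero C Z Y \<longrightarrow> (\<exists>!v. v \<in> Hom C Z K \<and> k \<star>\<^bsub>C\<^esub> v = u))"

definition is_cokernel :: "('k, 'o, 'm, 'z) lin_cat_scheme \<Rightarrow> 'o \<Rightarrow> 'o \<Rightarrow> 'm \<Rightarrow> 'o \<Rightarrow> 'm \<Rightarrow> bool" where
  "is_cokernel C X Y f Q q \<longleftrightarrow> Q \<in> Obj C \<and> q \<in> Hom C Y Q \<and> q \<star>\<^bsub>C\<^esub> f = Zero C X Q \<and>
     (\<forall>Z\<in>Obj C. \<forall>u\<in>Hom C Y Z. u \<star>\<^bsub>C\<^esub> f = Zero C X Z \<longrightarrow> (\<exists>!v. v \<in> Hom C Q Z \<and> v \<star>\<^bsub>C\<^esub> q = u))"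

locale abelian_category = linear_category C
  for C :: "('k::field, 'o, 'm, 'z) lin_cat_scheme" (structure) +
  assumes has_zero_object: "\<exists>Z. zero_object C Z"
    and has_direct_sums: "\<lbrakk>X \<in> Obj C; Y \<in> Obj C\<rbrakk> \<Longrightarrow> \<exists>P. direct_sum C X Y P"
    and has_kernels: "\<lbrakk>X \<in> Obj C; Y \<in> Obj C; f \<in> Hom C X Y\<rbrakk> \<Longrightarrow> \<exists>K k. is_kernel C X Y f K k"
    and has_cokernels: "\<lbrakk>X \<in> Obj C; Y \<in> Obj C; f \<in> Hom C X Y\<rbrakk> \<Longrightarrow> \<exists>Q q. is_cokernel C X Y f Q q"
    and mono_normal: "\<lbrakk>X \<in> Obj C; Y \<in> Obj C; mono_mor C X Y f\<rbrakk>
      \<Longrightarrow> \<exists>Z\<in>Obj C. \<exists>g\<in>Hom C Y Z. is_kernel C Y Z g X f"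
    and epi_normal: "\<lbrakk>X \<in> Obj C; Y \<in> Obj C; epi_mor C X Y f\<rbrakk>
      \<Longrightarrow> \<exists>Z\<in>Obj C. \<exists>g\<in>Hom C Z X. is_cokernel C Z X g Y f"

definition simple_object :: "('k, 'o, 'm, 'z) lin_cat_scheme \<Rightarrow> 'o \<Rightarrow> bool" where
  "simple_object C X \<longleftrightarrow> X \<in> Obj C \<and> \<not> zero_object C X \<and>
     (\<forall>Y\<in>Obj C. \<forall>f. mono_mor C Y X f \<longrightarrow> zero_object C Y \<or> iso_mor C Y X f)"

text \<open>Finite, possibly empty, direct sums of simple objects.\<close>

inductive semisimple_object :: "('k, 'o, 'm, 'z) lin_cat_scheme \<Rightarrow> 'o \<Rightarrow> bool"
  for C :: "('k, 'o, 'm, 'z) lin_cat_scheme" where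
  "zero_object C X \<Longrightarrow> semisimple_object C X"
| "\<lbrakk>semisimple_object C X; simple_object C Y; direct_sum C X Y P\<rbrakk> \<Longrightarrow> semisimple_object C P"

abbreviation full_subcategory ::
  "('k, 'o, 'm, 'z) lin_cat_scheme \<Rightarrow> 'o set \<Rightarrow> ('k, 'o, 'm, 'z) lin_cat_scheme" where
  "full_subcategory D S \<equiv> D\<lparr>Obj := S\<rparr>"

text \<open>The full subcategory on \<open>S\<close> is abelian and its inclusion functor is exact.\<close>

definition abelian_subcategory :: "('k::field, 'o, 'm, 'z) lin_cat_scheme \<Rightarrow> 'o set \<Rightarrow> bool" where
  "abelian_subcategory D S \<longleftrightarrow> S \<subseteq> Obj D \<and> abelian_category (full_subcategory D S) \<and>
     (\<forall>X\<in>S. \<forall>Y\<in>S. \<forall>f\<in>Hom D X Y.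
        (\<forall>K k. is_kernel (full_subcategory D S) X Y f K k \<longrightarrow> is_kernel D X Y f K k) \<and>
        (\<forall>Q q. is_cokernel (full_subcategory D S) X Y f Q q \<longrightarrow> is_cokernel D X Y f Q q))"

record ('k, 'o, 'm) mon_cat = "('k, 'o, 'm) lin_cat" +
  TensO :: "'o \<Rightarrow> 'o \<Rightarrow> 'o"  (infixr \<open>\<boxtimes>\<index>\<close> 75)
  TensM :: "'m \<Rightarrow> 'm \<Rightarrow> 'm"  (infixr \<open>\<boxtimes>\<^sub>m\<index>\<close> 75)
  Unit :: "'o"
  Assoc :: "'o \<Rightarrow> 'o \<Rightarrow> 'o \<Rightarrow> 'm"  \<comment> \<open>\<open>(X \<boxtimes> Y) \<boxtimes> Z \<rightarrow> X \<boxtimes> (Y \<boxtimes> Z)\<close>\<close>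
  LUnit :: "'o \<Rightarrow> 'm"  \<comment> \<open>\<open>Unit \<boxtimes> X \<rightarrow> X\<close>\<close>
  RUnit :: "'o \<Rightarrow> 'm"  \<comment> \<open>\<open>X \<boxtimes> Unit \<rightarrow> X\<close>\<close>

locale monoidal_category = linear_category C
  for C :: "('k::field, 'o, 'm, 'z) mon_cat_scheme" (structure) +
  assumes unit_obj: "Unit C \<in> Obj C"
    and tens_obj: "\<lbrakk>X \<in> Obj C; Y \<in> Obj C\<rbrakk> \<Longrightarrow> X \<boxtimes> Y \<in> Obj C"
    and tens_hom: "\<lbrakk>X \<in> Obj C; X' \<in> Obj C; Y \<in> Obj C; Y' \<in> Obj C; f \<in> Hom C X X'; g \<in> Hom C Y Y'\<rbrakk>
      \<Longrightarrow> f \<boxtimes>\<^sub>m g \<in> Hom C (X \<boxtimes> Y) (X' \<boxtimes> Y')"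
    and tens_id: "\<lbrakk>X \<in> Obj C; Y \<in> Obj C\<rbrakk> \<Longrightarrow> Id C X \<boxtimes>\<^sub>m Id C Y = Id C (X \<boxtimes> Y)"
    and tens_comp: "\<lbrakk>X \<in> Obj C; X' \<in> Obj C; X'' \<in> Obj C; Y \<in> Obj C; Y' \<in> Obj C; Y'' \<in> Obj C;
      f \<in> Hom C X X'; f' \<in> Hom C X' X''; g \<in> Hom C Y Y'; g' \<in> Hom C Y' Y''\<rbrakk>
      \<Longrightarrow> (f' \<star> f) \<boxtimes>\<^sub>m (g' \<star> g) = (f' \<boxtimes>\<^sub>m g') \<star> (f \<boxtimes>\<^sub>m g)"
    and tens_add_left: "\<lbrakk>X \<in> Obj C; X' \<in> Obj C; Y \<in> Obj C; Y' \<in> Obj C;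
      f \<in> Hom C X X'; f' \<in> Hom C X X'; g \<in> Hom C Y Y'\<rbrakk>
      \<Longrightarrow> Add C f f' \<boxtimes>\<^sub>m g = Add C (f \<boxtimes>\<^sub>m g) (f' \<boxtimes>\<^sub>m g)"
    and tens_add_right: "\<lbrakk>X \<in> Obj C; X' \<in> Obj C; Y \<in> Obj C; Y' \<in> Obj C;
      f \<in> Hom C X X'; g \<in> Hom C Y Y'; g' \<in> Hom C Y Y'\<rbrakk>
      \<Longrightarrow> f \<boxtimes>\<^sub>m Add C g g' = Add C (f \<boxtimes>\<^sub>m g) (f \<boxtimes>\<^sub>m g')"
    and tens_scale: "\<lbrakk>X \<in> Obj C; X' \<in> Obj C; Y \<in> Obj C; Y' \<in> Obj C; f \<in> Hom C X X'; g \<in> Hom C Y Y'\<rbrakk>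
      \<Longrightarrow> Scale C c f \<boxtimes>\<^sub>m g = Scale C c (f \<boxtimes>\<^sub>m g) \<and> f \<boxtimes>\<^sub>m Scale C c g = Scale C c (f \<boxtimes>\<^sub>m g)"
    and assoc_iso: "\<lbrakk>X \<in> Obj C; Y \<in> Obj C; Z \<in> Obj C\<rbrakk>
      \<Longrightarrow> iso_mor C ((X \<boxtimes> Y) \<boxtimes> Z) (X \<boxtimes> (Y \<boxtimes> Z)) (Assoc C X Y Z)"
    and assoc_natural: "\<lbrakk>X \<in> Obj C; X' \<in> Obj C; Y \<in> Obj C; Y' \<in> Obj C; Z \<in> Obj C; Z' \<in> Obj C;
      f \<in> Hom C X X'; g \<in> Hom C Y Y'; h \<in> Hom C Z Z'\<rbrakk>
      \<Longrightarrow> Assoc C X' Y' Z' \<star> ((f \<boxtimes>\<^sub>m g) \<boxtimes>\<^sub>m h) = (f \<boxtimes>\<^sub>m (g \<boxtimes>\<^sub>m h)) \<star> Assoc C X Y Z"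
    and lunit_iso: "X \<in> Obj C \<Longrightarrow> iso_mor C (Unit C \<boxtimes> X) X (LUnit C X)"
    and lunit_natural: "\<lbrakk>X \<in> Obj C; Y \<in> Obj C; f \<in> Hom C X Y\<rbrakk>
      \<Longrightarrow> LUnit C Y \<star> (Id C (Unit C) \<boxtimes>\<^sub>m f) = f \<star> LUnit C X"
    and runit_iso: "X \<in> Obj C \<Longrightarrow> iso_mor C (X \<boxtimes> Unit C) X (RUnit C X)"
    and runit_natural: "\<lbrakk>X \<in> Obj C; Y \<in> Obj C; f \<in> Hom C X Y\<rbrakk>
      \<Longrightarrow> RUnit C Y \<star> (f \<boxtimes>\<^sub>m Id C (Unit C)) = f \<star> RUnit C X"
    and pentagon: "\<lbrakk>W \<in> Obj C; X \<in> Obj C; Y \<in> Obj C; Z \<in> Obj C\<rbrakk>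
      \<Longrightarrow> (Id C W \<boxtimes>\<^sub>m Assoc C X Y Z) \<star> Assoc C W (X \<boxtimes> Y) Z \<star> (Assoc C W X Y \<boxtimes>\<^sub>m Id C Z)
        = Assoc C W X (Y \<boxtimes> Z) \<star> Assoc C (W \<boxtimes> X) Y Z"
    and triangle: "\<lbrakk>X \<in> Obj C; Y \<in> Obj C\<rbrakk>
      \<Longrightarrow> (Id C X \<boxtimes>\<^sub>m LUnit C Y) \<star> Assoc C X (Unit C) Y = RUnit C X \<boxtimes>\<^sub>m Id C Y"

text \<open>
  \<open>Y\<close> is a left dual of \<open>X\<close>.  The two zig-zag identities are written without inverting the unit
  constraints.
\<close>

definition left_dual :: "('k, 'o, 'm, 'z) mon_cat_scheme \<Rightarrow> 'o \<Rightarrow> 'o \<Rightarrow> bool" where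
  "left_dual C X Y \<longleftrightarrow>
     (\<exists>ev\<in>Hom C (Y \<boxtimes>\<^bsub>C\<^esub> X) (Unit C). \<exists>coev\<in>Hom C (Unit C) (X \<boxtimes>\<^bsub>C\<^esub> Y). \<exists>b.
        inverse_mor C ((Y \<boxtimes>\<^bsub>C\<^esub> X) \<boxtimes>\<^bsub>C\<^esub> Y) (Y \<boxtimes>\<^bsub>C\<^esub> (X \<boxtimes>\<^bsub>C\<^esub> Y)) (Assoc C Y X Y) b \<and>
        RUnit C X \<star>\<^bsub>C\<^esub> (Id C X \<boxtimes>\<^sub>m\<^bsub>C\<^esub> ev) \<star>\<^bsub>C\<^esub> Assoc C X Y X \<star>\<^bsub>C\<^esub> (coev \<boxtimes>\<^sub>m\<^bsub>C\<^esub> Id C X) = LUnit C X \<and>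
        LUnit C Y \<star>\<^bsub>C\<^esub> (ev \<boxtimes>\<^sub>m\<^bsub>C\<^esub> Id C Y) \<star>\<^bsub>C\<^esub> b \<star>\<^bsub>C\<^esub> (Id C Y \<boxtimes>\<^sub>m\<^bsub>C\<^esub> coev) = RUnit C Y)"

definition tensor_subcategory :: "('k::field, 'o, 'm, 'z) mon_cat_scheme \<Rightarrow> 'o set \<Rightarrow> bool" where
  "tensor_subcategory D S \<longleftrightarrow> abelian_subcategory D S \<and> Unit D \<in> S \<and>
     (\<forall>X\<in>S. \<forall>Y\<in>S. X \<boxtimes>\<^bsub>D\<^esub> Y \<in> S) \<and>
     (\<forall>X\<in>S. (\<exists>Y\<in>S. left_dual D X Y) \<and> (\<exists>Y\<in>S. left_dual D Y X))"

text \<open>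
  A \<open>'k\<close>-linear monoidal functor which is an equivalence of categories.  \<open>FM X Y\<close> is the action on
  \<open>Hom C X Y\<close>; \<open>J X Y : FO X \<boxtimes> FO Y \<rightarrow> FO (X \<boxtimes> Y)\<close> and \<open>\<phi> : Unit D \<rightarrow> FO (Unit C)\<close> are the
  monoidal constraints.
\<close>

locale tensor_equivalence = C: monoidal_category C + D: monoidal_category D
  for C :: "('k::field, 'o, 'm, 'z) mon_cat_scheme"
    and D :: "('k, 'p, 'n, 'y) mon_cat_scheme" +
  fixes FO :: "'o \<Rightarrow> 'p" and FM :: "'o \<Rightarrow> 'o \<Rightarrow> 'm \<Rightarrow> 'n" and J :: "'o \<Rightarrow> 'o \<Rightarrow> 'n" and \<phi> :: "'n"
  assumes fun_obj: "X \<in> Obj C \<Longrightarrow> FO X \<in> Obj D"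
    and fun_id: "X \<in> Obj C \<Longrightarrow> FM X X (Id C X) = Id D (FO X)"
    and fun_comp: "\<lbrakk>X \<in> Obj C; Y \<in> Obj C; Z \<in> Obj C; f \<in> Hom C X Y; g \<in> Hom C Y Z\<rbrakk>
      \<Longrightarrow> FM X Z (g \<star>\<^bsub>C\<^esub> f) = FM Y Z g \<star>\<^bsub>D\<^esub> FM X Y f"
    and fun_add: "\<lbrakk>X \<in> Obj C; Y \<in> Obj C; f \<in> Hom C X Y; g \<in> Hom C X Y\<rbrakk>
      \<Longrightarrow> FM X Y (Add C f g) = Add D (FM X Y f) (FM X Y g)"
    and fun_scale: "\<lbrakk>X \<in> Obj C; Y \<in> Obj C; f \<in> Hom C X Y\<rbrakk>
      \<Longrightarrow> FM X Y (Scale C c f) = Scale D c (FM X Y f)"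
    and fully_faithful: "\<lbrakk>X \<in> Obj C; Y \<in> Obj C\<rbrakk>
      \<Longrightarrow> bij_betw (FM X Y) (Hom C X Y) (Hom D (FO X) (FO Y))"
    and essentially_surjective: "V \<in> Obj D \<Longrightarrow> \<exists>X\<in>Obj C. \<exists>f. iso_mor D (FO X) V f"
    and J_iso: "\<lbrakk>X \<in> Obj C; Y \<in> Obj C\<rbrakk>
      \<Longrightarrow> iso_mor D (FO X \<boxtimes>\<^bsub>D\<^esub> FO Y) (FO (X \<boxtimes>\<^bsub>C\<^esub> Y)) (J X Y)"
    and J_natural: "\<lbrakk>X \<in> Obj C; X' \<in> Obj C; Y \<in> Obj C; Y' \<in> Obj C; f \<in> Hom C X X'; g \<in> Hom C Y Y'\<rbrakk>
      \<Longrightarrow> FM (X \<boxtimes>\<^bsub>C\<^esub> Y) (X' \<boxtimes>\<^bsub>C\<^esub> Y') (f \<boxtimes>\<^sub>m\<^bsub>C\<^esub> g) \<star>\<^bsub>D\<^esub> J X Y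
        = J X' Y' \<star>\<^bsub>D\<^esub> (FM X X' f \<boxtimes>\<^sub>m\<^bsub>D\<^esub> FM Y Y' g)"
    and \<phi>_iso: "iso_mor D (Unit D) (FO (Unit C)) \<phi>"
    and J_assoc: "\<lbrakk>X \<in> Obj C; Y \<in> Obj C; Z \<in> Obj C\<rbrakk>
      \<Longrightarrow> FM ((X \<boxtimes>\<^bsub>C\<^esub> Y) \<boxtimes>\<^bsub>C\<^esub> Z) (X \<boxtimes>\<^bsub>C\<^esub> (Y \<boxtimes>\<^bsub>C\<^esub> Z)) (Assoc C X Y Z)
          \<star>\<^bsub>D\<^esub> J (X \<boxtimes>\<^bsub>C\<^esub> Y) Z \<star>\<^bsub>D\<^esub> (J X Y \<boxtimes>\<^sub>m\<^bsub>D\<^esub> Id D (FO Z))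
        = J X (Y \<boxtimes>\<^bsub>C\<^esub> Z) \<star>\<^bsub>D\<^esub> (Id D (FO X) \<boxtimes>\<^sub>m\<^bsub>D\<^esub> J Y Z) \<star>\<^bsub>D\<^esub> Assoc D (FO X) (FO Y) (FO Z)"
    and J_lunit: "X \<in> Obj C \<Longrightarrow> LUnit D (FO X)
        = FM (Unit C \<boxtimes>\<^bsub>C\<^esub> X) X (LUnit C X) \<star>\<^bsub>D\<^esub> J (Unit C) X \<star>\<^bsub>D\<^esub> (\<phi> \<boxtimes>\<^sub>m\<^bsub>D\<^esub> Id D (FO X))"
    and J_runit: "X \<in> Obj C \<Longrightarrow> RUnit D (FO X)
        = FM (X \<boxtimes>\<^bsub>C\<^esub> Unit C) X (RUnit C X) \<star>\<^bsub>D\<^esub> J X (Unit C) \<star>\<^bsub>D\<^esub> (Id D (FO X) \<boxtimes>\<^sub>m\<^bsub>D\<^esub> \<phi>)"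

definition tensor_equivalent ::
  "('k::field, 'o, 'm, 'z) mon_cat_scheme \<Rightarrow> ('k, 'p, 'n, 'y) mon_cat_scheme \<Rightarrow> bool" where
  "tensor_equivalent C D \<longleftrightarrow> (\<exists>FO FM J \<phi>. tensor_equivalence C D FO FM J \<phi>)"


section \<open>Finite dimensional modules and comodules\<close>

text \<open>
  Finite dimensional vector spaces are the coordinate spaces \<open>k\<^sup>n\<close>, and linear maps are matrices acting
  on column vectors.  The tensor product of \<open>k\<^sup>m\<close> and \<open>k\<^sup>n\<close> is identified with \<open>k\<^sup>m\<^sup>n\<close>, where
  \<open>e\<^sub>i \<otimes> e\<^sub>j\<close> is the basis vector with index \<open>i * n + j\<close>.  With this convention the canonical
  associativity and unit isomorphisms of vector spaces are identity matrices.
\<close>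

definition kronecker :: "'k::semiring_0 mat \<Rightarrow> 'k mat \<Rightarrow> 'k mat" where
  "kronecker M N = mat (dim_row M * dim_row N) (dim_col M * dim_col N)
     (\<lambda>(i, j). M $$ (i div dim_row N, j div dim_col N) * N $$ (i mod dim_row N, j mod dim_col N))"

text \<open>
  A left \<open>A\<close>-module of dimension \<open>n\<close> is a pair \<open>(n, \<rho>)\<close>, where the matrix \<open>\<rho> a\<close> is the action of
  \<open>a\<close> on \<open>k\<^sup>n\<close>.
\<close>

type_synonym ('k, 'a) fd_module = "nat \<times> ('a \<Rightarrow> 'k mat)"

definition is_fd_module :: "('k::field, 'a::ab_group_add) hopf_alg \<Rightarrow> ('k, 'a) fd_module \<Rightarrow> bool" where
  "is_fd_module A = (\<lambda>(n, \<rho>).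
     (\<forall>a. \<rho> a \<in> carrier_mat n n) \<and>
     (\<forall>a b. \<rho> (a + b) = \<rho> a + \<rho> b) \<and>
     (\<forall>c a. \<rho> (scale A c a) = c \<cdot>\<^sub>m \<rho> a) \<and>
     \<rho> (hone A) = 1\<^sub>m n \<and>
     (\<forall>a b. \<rho> (hmult A a b) = \<rho> a * \<rho> b))"

text \<open>\<open>a\<close> acts on a tensor product as \<open>\<Sum> \<rho> a\<^sub>1 \<otimes> \<sigma> a\<^sub>2\<close>; the sum of matrices is taken entrywise.\<close>

definition module_tensor ::
  "('k::field, 'a::ab_group_add) hopf_alg \<Rightarrow> ('k, 'a) fd_module \<Rightarrow> ('k, 'a) fd_module \<Rightarrow> ('k, 'a) fd_module"
where
  "module_tensor A = (\<lambda>(m, \<rho>) (n, \<sigma>).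
     (m * n, \<lambda>a. mat (m * n) (m * n)
        (\<lambda>ij. \<Sum>(a\<^sub>1, a\<^sub>2)\<leftarrow>comult A a. kronecker (\<rho> a\<^sub>1) (\<sigma> a\<^sub>2) $$ ij)))"

definition Rep :: "('k::field, 'a::ab_group_add) hopf_alg \<Rightarrow> ('k, ('k, 'a) fd_module, 'k mat) mon_cat" where
  "Rep A = \<lparr>
     Obj = {X. is_fd_module A X},
     Hom = (\<lambda>(m, \<rho>) (n, \<sigma>). {F \<in> carrier_mat n m. \<forall>a. F * \<rho> a = \<sigma> a * F}),
     Comp = (\<lambda>G F. G * F),
     Id = (\<lambda>X. 1\<^sub>m (fst X)),
     Add = (\<lambda>F G. F + G),
     Zero = (\<lambda>X Y. 0\<^sub>m (fst Y) (fst X)),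
     Scale = (\<lambda>c F. c \<cdot>\<^sub>m F),
     TensO = module_tensor A,
     TensM = kronecker,
     Unit = (1, \<lambda>a. mat 1 1 (\<lambda>_. counit A a)),
     Assoc = (\<lambda>X Y Z. 1\<^sub>m (fst X * fst Y * fst Z)),
     LUnit = (\<lambda>X. 1\<^sub>m (fst X)),
     RUnit = (\<lambda>X. 1\<^sub>m (fst X)) \<rparr>"

text \<open>
  A right \<open>H\<close>-comodule of dimension \<open>n\<close> is a pair \<open>(n, c)\<close>, where the matrix \<open>c\<close> over \<open>H\<close> encodes the
  coaction \<open>e\<^sub>j \<mapsto> \<Sum>\<^sub>i e\<^sub>i \<otimes> c\<^sub>i\<^sub>j\<close> on \<open>k\<^sup>n\<close>.  Comparing coefficients of the \<open>e\<^sub>i\<close>, coassociativity says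
  \<open>\<Delta>(c\<^sub>i\<^sub>j) = \<Sum>\<^sub>l c\<^sub>i\<^sub>l \<otimes> c\<^sub>l\<^sub>j\<close>, counitality says \<open>\<epsilon>(c\<^sub>i\<^sub>j) = \<delta>\<^sub>i\<^sub>j\<close>, and colinearity of
  a matrix \<open>F\<close> from \<open>(m, c)\<close> to \<open>(n, d)\<close> says \<open>\<Sum>\<^sub>l F\<^sub>i\<^sub>l c\<^sub>l\<^sub>j = \<Sum>\<^sub>l F\<^sub>l\<^sub>j d\<^sub>i\<^sub>l\<close>.
\<close>

type_synonym 'h fd_comodule = "nat \<times> 'h mat"

definition is_fd_comodule :: "('k::field, 'h::ab_group_add) hopf_alg \<Rightarrow> 'h fd_comodule \<Rightarrow> bool" where
  "is_fd_comodule H = (\<lambda>(n, c).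
     c \<in> carrier_mat n n \<and>
     (\<forall>i<n. \<forall>j<n.
        same_tensor2 H (comult H (c $$ (i, j))) (map (\<lambda>l. (c $$ (i, l), c $$ (l, j))) [0..<n]) \<and>
        counit H (c $$ (i, j)) = (if i = j then 1 else 0)))"

text \<open>The coaction on a tensor product is \<open>v \<otimes> w \<mapsto> v\<^sub>0 \<otimes> w\<^sub>0 \<otimes> v\<^sub>1 w\<^sub>1\<close>.\<close>

definition comodule_tensor ::
  "('k::field, 'h::ab_group_add) hopf_alg \<Rightarrow> 'h fd_comodule \<Rightarrow> 'h fd_comodule \<Rightarrow> 'h fd_comodule" where
  "comodule_tensor H = (\<lambda>(m, c) (n, d).
     (m * n, mat (m * n) (m * n)
        (\<lambda>(i, j). hmult H (c $$ (i div n, j div n)) (d $$ (i mod n, j mod n)))))"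

definition Comod :: "('k::field, 'h::ab_group_add) hopf_alg \<Rightarrow> ('k, 'h fd_comodule, 'k mat) mon_cat" where
  "Comod H = \<lparr>
     Obj = {X. is_fd_comodule H X},
     Hom = (\<lambda>(m, c) (n, d). {F \<in> carrier_mat n m. \<forall>i<n. \<forall>j<m.
       (\<Sum>l<m. scale H (F $$ (i, l)) (c $$ (l, j))) = (\<Sum>l<n. scale H (F $$ (l, j)) (d $$ (i, l)))}),
     Comp = (\<lambda>G F. G * F),
     Id = (\<lambda>X. 1\<^sub>m (fst X)),
     Add = (\<lambda>F G. F + G),
     Zero = (\<lambda>X Y. 0\<^sub>m (fst Y) (fst X)),
     Scale = (\<lambda>c F. c \<cdot>\<^sub>m F),
     TensO = comodule_tensor H,
     TensM = kronecker,
     Unit = (1, mat 1 1 (\<lambda>_. hone H)),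
     Assoc = (\<lambda>X Y Z. 1\<^sub>m (fst X * fst Y * fst Z)),
     LUnit = (\<lambda>X. 1\<^sub>m (fst X)),
     RUnit = (\<lambda>X. 1\<^sub>m (fst X)) \<rparr>"

text \<open>
  Simple comodules are finite dimensional, so it suffices to let \<open>V\<close> and \<open>W\<close> range over \<open>Comod H\<close>.
  The matrix coefficients of \<open>(n, c)\<close> are spanned by the entries of \<open>c\<close>.
\<close>

definition hopf_socle :: "('k::field, 'h::ab_group_add) hopf_alg \<Rightarrow> 'h set" where
  "hopf_socle H = module.span (scale H) (\<Union>W \<in> {W. simple_object (Comod H) W \<and>
     (\<forall>V. simple_object (Comod H) V \<longrightarrow>
        semisimple_object (Comod H) (V \<boxtimes>\<^bsub>Comod H\<^esub> W) \<and>
        semisimple_object (Comod H) (W \<boxtimes>\<^bsub>Comod H\<^esub> V))}. elements_mat (snd W))"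

definition diagonalizable :: "'k::field mat \<Rightarrow> bool" where
  "diagonalizable M \<longleftrightarrow> (\<exists>D. diagonal_mat D \<and> similar_mat M D)"

definition integral_h2_modules ::
  "('k::field, 'a::ab_group_add) hopf_alg \<Rightarrow> 'a \<Rightarrow> ('k, 'a) fd_module set" where
  "integral_h2_modules A h = {(n, \<rho>). (n, \<rho>) \<in> Obj (Rep A) \<and>
     diagonalizable (\<rho> (hmult A h h)) \<and> (\<forall>e. eigenvalue (\<rho> (hmult A h h)) e \<longrightarrow> e \<in> \<int>)}"

end

theory Submission
  imports Defs "HOL-Library.Countable_Set"
begin

text \<open>A representation of \<open>A\<close> is a vector space with an involution \<open>G\<close> and an operator \<open>M\<close> that anticommute, that is, a
  super vector space with an odd operator, and \<open>h\<^sup>2\<close> acts by \<open>M\<^sup>2\<close>.  As \<open>h\<^sup>2\<close> is primitive, its eigenvalues add under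
  tensor products and change sign under duals.  For a diagonalizable operator, invariant subspaces and
  quotients are again diagonalizable with eigenvalues among the old ones.  Hence the integral modules form a
  tensor subcategory (\<open>integral_tensor_subcategory\<close>).

  Their matrix coefficients are linear combinations of the functionals
  \<open>x(N, a, b) : g\<^sup>c h\<^sup>2\<^sup>k\<^sup>+\<^sup>d \<mapsto> (-1)\<^sup>a\<^sup>c N\<^sup>k \<delta>(b, d)\<close> on \<open>A\<close>, with \<open>N\<close> an integer and \<open>a\<close>, \<open>b\<close> bits.  Dualizing the structure of
  \<open>A\<close>, these span a Hopf algebra \<open>H\<close> (\<open>H_hopf_algebra\<close>), with the coefficient at \<open>x(0, 0, 1)\<close> as a nonzero
  integral (\<open>H_co_Frobenius\<close>).  A comodule carries the matrices \<open>G\<close> and \<open>M\<close> obtained by evaluating its coefficients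
  at \<open>g\<close> and \<open>h\<close>.  Conversely, the coaction is recovered from the projections onto the common eigenspaces of \<open>M\<^sup>2\<close>
  and \<open>G\<close>, which exist because \<open>M\<^sup>2\<close> is diagonalizable with integer eigenvalues.  So modules and comodules are both
  identified, with the same morphisms and the same tensor products, with one category of pairs \<open>(G, M)\<close>
  (\<open>Rep_identification\<close>, \<open>Comod_identification\<close>), and this gives the tensor equivalence
  (\<open>tensor_equivalent_if_identified\<close>).

  On a simple object \<open>M\<^sup>2\<close> is a scalar \<open>N\<close>, by the argument of Schur's lemma.  If \<open>N \<noteq> 0\<close>, there is a two-dimensional simple
  object \<open>V\<close> on which \<open>M\<^sup>2 = -N\<close>.  On \<open>V \<otimes> W\<close> the odd operator is then nonzero with square zero.  This is
  impossible on a semisimple object, because on a simple one \<open>M\<^sup>2 = 0\<close> implies \<open>M = 0\<close>.  Therefore only simple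
  objects with \<open>N = 0\<close> contribute to the Hopf socle, which lies in the span of the \<open>x(0, a, b)\<close>
  (\<open>hopf_socle_degree_zero\<close>).  But \<open>H\<close> is graded by \<open>N\<close> and nonzero in infinitely many degrees, so it is
  not finitely generated over a subspace of degree zero (\<open>H_not_finite_type\<close>).\<close>

section \<open>Matrix algebra with dimension side conditions\<close>

lemma mat_entry:
  fixes A B :: "'k::semiring_0 mat"
  assumes "i < dim_row A" "j < dim_col B" "dim_col A = dim_row B"
  shows "(A * B) $$ (i, j) = (\<Sum>k<dim_row B. A $$ (i, k) * B $$ (k, j))"
  using assms by (simp add: scalar_prod_def lessThan_atLeast0)

\<comment> \<open>otherwise entries of products unfold into scalar products, to which the laws below do not apply\<close>
declare index_mult_mat(1) [simp del]

text \<open>The laws of matrix algebra with side conditions that are equations between dimensions, so that the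
  simplifier can discharge them; membership in \<open>carrier_mat\<close> would leave the inner dimensions to be guessed.\<close>

lemma mat_assoc:
  fixes A B C :: "'k::semiring_0 mat"
  assumes "dim_col A = dim_row B" "dim_col B = dim_row C"
  shows "(A * B) * C = A * (B * C)"
  using assms by (intro assoc_mult_mat) auto

lemma mat_dist_right:
  fixes A B C :: "'k::semiring_0 mat"
  assumes "dim_col A = dim_row B" "dim_row B = dim_row C" "dim_col B = dim_col C"
  shows "A * (B + C) = A * B + A * C"
  using assms by (intro mult_add_distrib_mat) auto

lemma mat_dist_left:
  fixes A B C :: "'k::semiring_0 mat"
  assumes "dim_col A = dim_row C" "dim_row A = dim_row B" "dim_col A = dim_col B"
  shows "(A + B) * C = A * C + B * C"
  using assms by (intro add_mult_distrib_mat) auto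

lemma mat_smult_left:
  fixes A B :: "'k::comm_semiring_0 mat"
  assumes "dim_col A = dim_row B"
  shows "(c \<cdot>\<^sub>m A) * B = c \<cdot>\<^sub>m (A * B)"
  using assms by (intro mult_smult_assoc_mat) auto

lemma mat_smult_right:
  fixes A B :: "'k::comm_semiring_0 mat"
  assumes "dim_col A = dim_row B"
  shows "A * (c \<cdot>\<^sub>m B) = c \<cdot>\<^sub>m (A * B)"
  using assms by (intro mult_smult_distrib) auto

lemma mat_one_left: "dim_row A = n \<Longrightarrow> 1\<^sub>m n * A = (A :: 'k::semiring_1 mat)"
  by (rule left_mult_one_mat) auto

lemma mat_one_right: "dim_col A = n \<Longrightarrow> A * 1\<^sub>m n = (A :: 'k::semiring_1 mat)"
  by (rule right_mult_one_mat) auto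

lemma mat_zero_left:
  "dim_row A = n \<Longrightarrow> dim_col A = k \<Longrightarrow> 0\<^sub>m m n * A = (0\<^sub>m m k :: 'k::semiring_1 mat)"
  by (rule left_mult_zero_mat) auto

lemma mat_zero_right:
  "dim_row A = k \<Longrightarrow> dim_col A = m \<Longrightarrow> A * 0\<^sub>m m n = (0\<^sub>m k n :: 'k::semiring_1 mat)"
  by (rule right_mult_zero_mat) auto

lemma mat_add_assoc:
  fixes A B C :: "'k::ab_group_add mat"
  assumes "dim_row A = dim_row B" "dim_row B = dim_row C" "dim_col A = dim_col B" "dim_col B = dim_col C"
  shows "(A + B) + C = A + (B + C)"
  using assms by (intro eq_matI) (auto simp: add.assoc)

lemma mat_add_comm:
  fixes A B :: "'k::ab_group_add mat"
  assumes "dim_row A = dim_row B" "dim_col A = dim_col B"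
  shows "A + B = B + A"
  using assms by (intro eq_matI) (auto simp: add.commute)

lemma smult_one_mat: "(1::'k::semiring_1) \<cdot>\<^sub>m A = A"
  by (intro eq_matI) auto

lemma smult_smult_mat: "c \<cdot>\<^sub>m (d \<cdot>\<^sub>m A) = (c * d :: 'k::semiring_1) \<cdot>\<^sub>m A"
  by (intro eq_matI) (auto simp: mult.assoc)

lemma one_mat_zero_iff: "(1\<^sub>m r :: 'k::zero_neq_one mat) = 0\<^sub>m r r \<longleftrightarrow> r = 0"
proof
  assume eq: "(1\<^sub>m r :: 'k mat) = 0\<^sub>m r r"
  show "r = 0"
  proof (rule ccontr)
    assume "r \<noteq> 0"
    then have "(1\<^sub>m r :: 'k mat) $$ (0, 0) = 1" "(0\<^sub>m r r :: 'k mat) $$ (0, 0) = 0" by auto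
    with eq show False by simp
  qed
qed auto

lemmas mat_algebra = mat_assoc mat_dist_left mat_dist_right mat_smult_left mat_smult_right
  mat_one_left mat_one_right mat_zero_left mat_zero_right

text \<open>Two matrices that are mutually inverse are square; in characteristic zero this is read off
  from the traces of the two products.\<close>

lemma inverse_mats_square:
  fixes A B :: "'k::field_char_0 mat"
  assumes A: "A \<in> carrier_mat n s" and B: "B \<in> carrier_mat s n"
    and AB: "A * B = 1\<^sub>m n" and BA: "B * A = 1\<^sub>m s"
  shows "n = s"
proof -
  have "of_nat n = (\<Sum>i<n. (A * B) $$ (i, i))" using AB by simp
  also have "\<dots> = (\<Sum>i<n. \<Sum>k<s. A $$ (i, k) * B $$ (k, i))"
    using A B by (intro sum.cong) (auto simp: mat_entry)
  also have "\<dots> = (\<Sum>k<s. \<Sum>i<n. B $$ (k, i) * A $$ (i, k))"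
    by (subst sum.swap) (simp add: mult.commute)
  also have "\<dots> = (\<Sum>k<s. (B * A) $$ (k, k))"
    using A B by (intro sum.cong) (auto simp: mat_entry)
  also have "\<dots> = of_nat s" using BA by simp
  finally show ?thesis by (simp only: of_nat_eq_iff)
qed

subsection \<open>Juxtaposition of matrices\<close>

definition hcat :: "'k mat \<Rightarrow> 'k mat \<Rightarrow> 'k mat" where
  "hcat A B = mat (dim_row A) (dim_col A + dim_col B)
     (\<lambda>(i, j). if j < dim_col A then A $$ (i, j) else B $$ (i, j - dim_col A))"

definition vcat :: "'k mat \<Rightarrow> 'k mat \<Rightarrow> 'k mat" where
  "vcat A B = mat (dim_row A + dim_row B) (dim_col A)
     (\<lambda>(i, j). if i < dim_row A then A $$ (i, j) else B $$ (i - dim_row A, j))"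

lemma dim_cat [simp]:
  "dim_row (hcat A B) = dim_row A" "dim_col (hcat A B) = dim_col A + dim_col B"
  "dim_row (vcat A B) = dim_row A + dim_row B" "dim_col (vcat A B) = dim_col A"
  by (auto simp: hcat_def vcat_def)

lemma sum_lessThan_split:
  "(\<Sum>k<(m::nat) + n. f k) = (\<Sum>k<m. f k) + (\<Sum>k<n. f (k + m) :: 'b::comm_monoid_add)"
proof -
  have "(\<Sum>k<m + n. f k) = (\<Sum>k\<in>{0..<m}. f k) + (\<Sum>k\<in>{m..<m + n}. f k)"
    by (simp add: sum.atLeastLessThan_concat lessThan_atLeast0)
  also have "(\<Sum>k\<in>{m..<m + n}. f k) = (\<Sum>k\<in>{0..<n}. f (k + m))"
    using sum.shift_bounds_nat_ivl[of f 0 m n] by (simp add: add.commute)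
  finally show ?thesis by (simp add: lessThan_atLeast0)
qed

lemma hcat_vcat:
  fixes A B C D :: "'k::semiring_0 mat"
  assumes "dim_row A = dim_row B" "dim_col A = dim_row C" "dim_col B = dim_row D" "dim_col C = dim_col D"
  shows "hcat A B * vcat C D = A * C + B * D"
  using assms
  by (intro eq_matI)
     (auto simp: mat_entry sum_lessThan_split hcat_def vcat_def intro!: arg_cong2[where f="(+)"] sum.cong)

lemma vcat_hcat:
  fixes A B C D :: "'k::semiring_0 mat"
  assumes "dim_col A = dim_row C" "dim_col A = dim_col B" "dim_row C = dim_row D"
  shows "vcat A B * hcat C D = four_block_mat (A * C) (A * D) (B * C) (B * D)"
  using assms by (intro eq_matI) (auto simp: mat_entry hcat_def vcat_def intro!: sum.cong)

lemma mult_hcat: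
  fixes A B F :: "'k::semiring_0 mat"
  assumes "dim_row A = dim_row B" "dim_col F = dim_row A"
  shows "F * hcat A B = hcat (F * A) (F * B)"
  using assms by (intro eq_matI) (auto simp: mat_entry hcat_def intro!: sum.cong)

lemma mult_vcat:
  fixes A B F :: "'k::semiring_0 mat"
  assumes "dim_col A = dim_col B" "dim_row F = dim_col A"
  shows "vcat A B * F = vcat (A * F) (B * F)"
  using assms by (intro eq_matI) (auto simp: mat_entry vcat_def intro!: sum.cong)

subsection \<open>Splitting kernels and cokernels\<close>

text \<open>The kernel of a nonzero row vector: its pivot coordinate is solved for in terms of the
  remaining ones, which serve as coordinates of the kernel.\<close>

lemma row_kernel_splitting:
  fixes w :: "'k::field mat"
  assumes w: "w \<in> carrier_mat 1 r" and nz: "w \<noteq> 0\<^sub>m 1 r"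
  shows "\<exists>s K L v. K \<in> carrier_mat r s \<and> L \<in> carrier_mat s r \<and> v \<in> carrier_mat r 1 \<and>
    w * K = 0\<^sub>m 1 s \<and> L * K = 1\<^sub>m s \<and> K * L + v * w = 1\<^sub>m r"
proof -
  obtain j where j: "j < r" "w $$ (0, j) \<noteq> 0"
  proof (rule ccontr)
    assume "\<not> thesis"
    with that have "\<And>j. j < r \<Longrightarrow> w $$ (0, j) = 0" by blast
    then have "w = 0\<^sub>m 1 r" using w by (intro eq_matI) auto
    with nz show False by simp
  qed
  define skip where "skip k = (if k < j then k else k + 1)" for k
  define unskip where "unskip i = (if i < j then i else i - 1)" for i
  have skip: "skip k \<noteq> j" "k < r - 1 \<Longrightarrow> skip k < r" "skip k = skip k' \<longleftrightarrow> k = k'" for k k'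
    by (auto simp: skip_def)
  have unskip: "i = skip k \<longleftrightarrow> k = unskip i" "i < r \<Longrightarrow> unskip i < r - 1" if "i \<noteq> j" for i k
    using that j by (auto simp: skip_def unskip_def split: if_splits)
  define K where "K = mat r (r - 1) (\<lambda>(i, k). if i = skip k then 1
     else if i = j then - (w $$ (0, skip k) / w $$ (0, j)) else 0)"
  define L where "L = mat (r - 1) r (\<lambda>(k, i). if i = skip k then 1 else 0 :: 'k)"
  define v where "v = mat r 1 (\<lambda>(i, _). if i = j then 1 / w $$ (0, j) else 0)"
  have dims: "dim_row w = 1" "dim_col w = r" "dim_row K = r" "dim_col K = r - 1"
    "dim_row L = r - 1" "dim_col L = r" "dim_row v = r" "dim_col v = 1"
    using w by (auto simp: K_def L_def v_def)
  have wK: "w * K = 0\<^sub>m 1 (r - 1)"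
  proof (intro eq_matI)
    fix i k assume ik: "i < dim_row (0\<^sub>m 1 (r - 1) :: 'k mat)" "k < dim_col (0\<^sub>m 1 (r - 1) :: 'k mat)"
    have "(w * K) $$ (i, k) = (\<Sum>l<r. w $$ (0, l) * K $$ (l, k))"
      using ik by (simp add: mat_entry dims)
    also have "\<dots> = (\<Sum>l<r. (if l = skip k then w $$ (0, l) else 0)
        + (if l = j then - w $$ (0, skip k) else 0))"
      using ik skip(1)[of k] j by (intro sum.cong) (auto simp: K_def)
    also have "\<dots> = 0" using ik j skip(2)[of k] by (simp add: sum.distrib sum.delta)
    finally show "(w * K) $$ (i, k) = 0\<^sub>m 1 (r - 1) $$ (i, k)" using ik by simp
  qed (auto simp: dims)
  have LK: "L * K = 1\<^sub>m (r - 1)"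
  proof (intro eq_matI)
    fix i k assume ik: "i < dim_row (1\<^sub>m (r - 1) :: 'k mat)" "k < dim_col (1\<^sub>m (r - 1) :: 'k mat)"
    have "(L * K) $$ (i, k) = (\<Sum>l<r. L $$ (i, l) * K $$ (l, k))"
      using ik by (simp add: mat_entry dims)
    also have "\<dots> = (\<Sum>l<r. if l = skip i then K $$ (l, k) else 0)"
      using ik by (intro sum.cong) (auto simp: L_def)
    also have "\<dots> = K $$ (skip i, k)" using ik skip(2)[of i] by (simp add: sum.delta)
    also have "\<dots> = 1\<^sub>m (r - 1) $$ (i, k)"
      using ik skip(2)[of i] skip(1)[of i] skip(3)[of i k] by (auto simp: K_def)
    finally show "(L * K) $$ (i, k) = 1\<^sub>m (r - 1) $$ (i, k)" .
  qed (auto simp: dims)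
  have KL: "(K * L) $$ (i, l) = (if l = j then 0 else K $$ (i, unskip l))" if "i < r" "l < r" for i l
  proof -
    have "(K * L) $$ (i, l) = (\<Sum>k<r - 1. K $$ (i, k) * L $$ (k, l))"
      using that by (simp add: mat_entry dims)
    also have "\<dots> = (\<Sum>k<r - 1. if l \<noteq> j \<and> k = unskip l then K $$ (i, k) else 0)"
      using that unskip(1)[of l] skip(1) by (intro sum.cong) (auto simp: L_def)
    also have "\<dots> = (if l = j then 0 else K $$ (i, unskip l))"
      using that unskip(2)[of l] by (auto simp: sum.delta)
    finally show ?thesis .
  qed
  have "K * L + v * w = 1\<^sub>m r"
  proof (intro eq_matI)
    fix i l assume "i < dim_row (1\<^sub>m r :: 'k mat)" "l < dim_col (1\<^sub>m r :: 'k mat)"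
    then have il: "i < r" "l < r" by auto
    have "(v * w) $$ (i, l) = (if i = j then w $$ (0, l) / w $$ (0, j) else 0)"
      using il by (simp add: mat_entry dims, simp add: v_def)
    moreover have "l \<noteq> j \<Longrightarrow> skip (unskip l) = l" by (auto simp: skip_def unskip_def)
    ultimately show "(K * L + v * w) $$ (i, l) = 1\<^sub>m r $$ (i, l)"
      using il KL[OF il] unskip(2)[of l] j by (auto simp: dims K_def)
  qed (auto simp: dims)
  moreover have "K \<in> carrier_mat r (r - 1)" "L \<in> carrier_mat (r - 1) r" "v \<in> carrier_mat r 1"
    by (intro carrier_matI; simp only: dims)+
  ultimately show ?thesis using wK LK
    by (intro exI[of _ "r - 1"] exI[of _ K] exI[of _ L] exI[of _ v] conjI)
qed

text \<open>The columns of \<open>K\<close> form a basis of the kernel of \<open>F\<close>, \<open>L\<close> is a left inverse of \<open>K\<close> and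
  \<open>R\<close> inverts \<open>F\<close> on the complement \<open>ker L\<close>.  One row of \<open>F\<close> is added at a time: the
  kernel of the bigger matrix is the kernel of the new row restricted to the old kernel.\<close>

lemma kernel_splitting:
  fixes F :: "'k::field mat"
  assumes "F \<in> carrier_mat n m"
  shows "\<exists>r K L R. K \<in> carrier_mat m r \<and> L \<in> carrier_mat r m \<and> R \<in> carrier_mat m n \<and>
    F * K = 0\<^sub>m n r \<and> L * K = 1\<^sub>m r \<and> K * L + R * F = 1\<^sub>m m"
  using assms
proof (induction n arbitrary: F)
  case 0
  show ?case
    by (rule exI[of _ m], rule exI[of _ "1\<^sub>m m"], rule exI[of _ "1\<^sub>m m"], rule exI[of _ "0\<^sub>m m 0"])
       (use 0 in \<open>auto intro!: eq_matI simp: mat_entry\<close>)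
next
  case (Suc n)
  define F' where "F' = mat n m (\<lambda>(i, j). F $$ (i, j))"
  define f where "f = mat 1 m (\<lambda>(i, j). F $$ (n, j))"
  have F: "F = vcat F' f"
    using Suc.prems by (intro eq_matI) (auto simp: F'_def f_def vcat_def less_Suc_eq)
  have "F' \<in> carrier_mat n m" by (simp add: F'_def)
  from Suc.IH[OF this] obtain r K L R where
    KLR: "K \<in> carrier_mat m r" "L \<in> carrier_mat r m" "R \<in> carrier_mat m n"
    "F' * K = 0\<^sub>m n r" "L * K = 1\<^sub>m r" and sum: "K * L + R * F' = 1\<^sub>m m" by blast
  have dims: "dim_row F' = n" "dim_col F' = m" "dim_row f = 1" "dim_col f = m"
    "dim_row K = m" "dim_col K = r" "dim_row L = r" "dim_col L = m" "dim_row R = m" "dim_col R = n"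
    using KLR by (auto simp: F'_def f_def)
  show ?case
  proof (cases "f * K = 0\<^sub>m 1 r")
    case True
    have "F * K = 0\<^sub>m (Suc n) r"
      unfolding F using True KLR(4)
      by (subst mult_vcat) (auto simp: dims vcat_def intro!: eq_matI)
    moreover have "hcat R (0\<^sub>m m 1) * F = R * F'"
      unfolding F by (subst hcat_vcat) (auto simp: dims mat_algebra intro!: eq_matI)
    ultimately show ?thesis using KLR sum
      by (intro exI[of _ r] exI[of _ K] exI[of _ L] exI[of _ "hcat R (0\<^sub>m m 1)"]) auto
  next
    case False
    have "f * K \<in> carrier_mat 1 r" using dims by auto
    from row_kernel_splitting[OF this False] obtain s K' L' v where
      v: "K' \<in> carrier_mat r s" "L' \<in> carrier_mat s r" "v \<in> carrier_mat r 1"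
      "f * K * K' = 0\<^sub>m 1 s" "L' * K' = 1\<^sub>m s" and sum': "K' * L' + v * (f * K) = 1\<^sub>m r" by blast
    have dims': "dim_row K' = r" "dim_col K' = s" "dim_row L' = s" "dim_col L' = r"
      "dim_row v = r" "dim_col v = 1" using v by auto
    note dims = dims dims'
    have "F * (K * K') = (F * K) * K'" unfolding F by (simp add: mat_algebra dims)
    also have "\<dots> = 0\<^sub>m (Suc n) s"
      unfolding F using v(4) KLR(4) dims
      by (simp add: mult_vcat mat_algebra) (auto simp: vcat_def intro!: eq_matI)
    finally have FK: "F * (K * K') = 0\<^sub>m (Suc n) s" .
    have LK: "(L' * L) * (K * K') = 1\<^sub>m s"
    proof -
      have "(L' * L) * (K * K') = L' * ((L * K) * K')" by (simp add: mat_algebra dims)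
      then show ?thesis using KLR(5) v(5) by (simp add: mat_algebra dims)
    qed
    define R2 where "R2 = hcat (R + (-1) \<cdot>\<^sub>m (K * v * f * R)) (K * v)"
    have "R2 * F = (R + (-1) \<cdot>\<^sub>m (K * v * f * R)) * F' + (K * v) * f"
      unfolding F R2_def by (subst hcat_vcat) (auto simp: dims)
    also have "\<dots> = R * F' + ((-1) \<cdot>\<^sub>m (K * (v * (f * (R * F')))) + K * (v * f))"
      by (simp add: mat_algebra dims mat_add_assoc)
    finally have R2F: "R2 * F = R * F' + ((-1) \<cdot>\<^sub>m (K * (v * (f * (R * F')))) + K * (v * f))" .
    have "f = f * (K * L + R * F')" using sum by (simp add: mat_algebra dims)
    also have "\<dots> = f * (K * L) + f * (R * F')" by (simp add: mat_algebra dims)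
    finally have "K * (v * f) = K * (v * (f * (K * L) + f * (R * F')))" by simp
    also have "\<dots> = K * (v * (f * (K * L))) + K * (v * (f * (R * F')))" by (simp add: mat_algebra dims)
    finally have "(-1) \<cdot>\<^sub>m (K * (v * (f * (R * F')))) + K * (v * f) = K * (v * (f * (K * L)))"
      using dims by (auto intro!: eq_matI)
    with R2F have R2F: "R2 * F = R * F' + K * (v * (f * (K * L)))" by simp
    have "K * L = K * ((K' * L' + v * (f * K)) * L)" using sum' by (simp add: mat_algebra dims)
    also have "\<dots> = (K * K') * (L' * L) + K * (v * (f * (K * L)))" by (simp add: mat_algebra dims)
    finally have KL: "K * L = (K * K') * (L' * L) + K * (v * (f * (K * L)))" .
    have "(K * K') * (L' * L) + R2 * F
        = ((K * K') * (L' * L) + K * (v * (f * (K * L)))) + R * F'"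
      unfolding R2F by (intro eq_matI) (auto simp: dims algebra_simps)
    also have "\<dots> = K * L + R * F'" unfolding KL[symmetric] ..
    finally have "(K * K') * (L' * L) + R2 * F = K * L + R * F'" .
    then have one: "(K * K') * (L' * L) + R2 * F = 1\<^sub>m m" using sum by simp
    have "K * K' \<in> carrier_mat m s" "L' * L \<in> carrier_mat s m" "R2 \<in> carrier_mat m (Suc n)"
      by (intro carrier_matI; simp add: dims R2_def)+
    with FK LK one show ?thesis
      by (intro exI[of _ s] exI[of _ "K * K'"] exI[of _ "L' * L"] exI[of _ R2] conjI)
  qed
qed

text \<open>The transpose of \<open>kernel_splitting\<close>.\<close>

lemma cokernel_splitting:
  fixes F :: "'k::field mat"
  assumes F: "F \<in> carrier_mat n m"
  shows "\<exists>r C D R. C \<in> carrier_mat r n \<and> D \<in> carrier_mat n r \<and> R \<in> carrier_mat m n \<and>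
    C * F = 0\<^sub>m r m \<and> C * D = 1\<^sub>m r \<and> D * C + F * R = 1\<^sub>m n"
proof -
  have "transpose_mat F \<in> carrier_mat m n" using F by simp
  from kernel_splitting[OF this] obtain r K L R where KLR: "K \<in> carrier_mat n r"
    "L \<in> carrier_mat r n" "R \<in> carrier_mat n m" and eqs: "transpose_mat F * K = 0\<^sub>m m r"
    "L * K = 1\<^sub>m r" "K * L + R * transpose_mat F = 1\<^sub>m n" by blast
  have "transpose_mat K * F = transpose_mat (transpose_mat F * K)"
    using KLR F by (subst transpose_mult[of _ m n _ r]) auto
  moreover have "transpose_mat K * transpose_mat L = transpose_mat (L * K)"
    using KLR F by (subst transpose_mult[of _ r n _ r]) auto
  moreover have "transpose_mat (K * L + R * transpose_mat F) =
      transpose_mat L * transpose_mat K + F * transpose_mat R"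
    using KLR F by (subst transpose_add[of _ n n])
      (auto simp: transpose_mult[of K n r L n] transpose_mult[of R n m _ n])
  ultimately show ?thesis using KLR eqs
    by (intro exI[of _ r] exI[of _ "transpose_mat K"] exI[of _ "transpose_mat L"]
      exI[of _ "transpose_mat R"]) auto
qed

text \<open>The image of an idempotent \<open>E\<close> is the kernel of \<open>1 - E\<close>.\<close>

lemma idempotent_splitting:
  fixes E :: "'k::field mat"
  assumes E: "E \<in> carrier_mat n n" and idem: "E * E = E"
  shows "\<exists>r K L. K \<in> carrier_mat n r \<and> L \<in> carrier_mat r n \<and> L * K = 1\<^sub>m r \<and> K * L = E"
proof -
  define E' where "E' = 1\<^sub>m n + (-1) \<cdot>\<^sub>m E"
  have dE: "dim_row E = n" "dim_col E = n" "dim_row E' = n" "dim_col E' = n" using E by (auto simp: E'_def)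
  then have "E' \<in> carrier_mat n n" by auto
  from kernel_splitting[OF this] obtain r K L R where KLR: "K \<in> carrier_mat n r"
    "L \<in> carrier_mat r n" "R \<in> carrier_mat n n" and eqs: "E' * K = 0\<^sub>m n r"
    "L * K = 1\<^sub>m r" and one: "K * L + R * E' = 1\<^sub>m n" by blast
  have dims: "dim_row K = n" "dim_col K = r" "dim_row L = r" "dim_col L = n" "dim_row R = n" "dim_col R = n"
    using KLR by auto
  have "E' * E = E + (-1) \<cdot>\<^sub>m (E * E)" by (simp add: E'_def mat_algebra dE)
  then have E'E: "E' * E = 0\<^sub>m n n" unfolding idem using dE by (auto intro!: eq_matI)
  have "K * L * E = (K * L + R * E') * E"
    using E'E by (simp add: mat_algebra dims dE, intro eq_matI) (auto simp: dims dE)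
  then have KLE: "K * (L * E) = E" using one by (simp add: mat_algebra dims dE)
  have "K = E' * K + E * K" by (simp add: E'_def mat_algebra dims dE, intro eq_matI) (auto simp: dims dE)
  then have "E * K = K" using eqs(1) dims dE
    by (metis carrier_matI dim_row_mat(1) index_mult_mat(2) index_mult_mat(3) left_add_zero_mat)
  then have "(L * E) * K = 1\<^sub>m r" using eqs(2) by (simp add: mat_algebra dims dE)
  with KLE show ?thesis using KLR E by (intro exI[of _ r] exI[of _ K] exI[of _ "L * E"]) auto
qed

section \<open>Kronecker products\<close>

lemma dim_kronecker [simp]:
  "dim_row (kronecker A B) = dim_row A * dim_row B"
  "dim_col (kronecker A B) = dim_col A * dim_col B"
  by (auto simp: kronecker_def)

lemma pair_index_bounds:
  assumes "(k::nat) < m * n"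
  shows "k div n < m" "k mod n < n"
proof -
  show "k div n < m" using assms by (simp add: less_mult_imp_div_less)
  have "n \<noteq> 0" using assms by (cases n) auto
  then show "k mod n < n" by simp
qed

lemma kronecker_entry:
  assumes "i < dim_row A * dim_row B" "j < dim_col A * dim_col B"
  shows "kronecker A B $$ (i, j) =
    A $$ (i div dim_row B, j div dim_col B) * B $$ (i mod dim_row B, j mod dim_col B)"
  using assms by (simp add: kronecker_def)

lemma sum_pair_index:
  fixes f :: "nat \<Rightarrow> nat \<Rightarrow> 'b::comm_monoid_add"
  shows "(\<Sum>k<m * n. f (k div n) (k mod n)) = (\<Sum>i<m. \<Sum>j<n. f i j)"
proof -
  have "(\<Sum>k<m * n. f (k div n) (k mod n)) = (\<Sum>i<m. \<Sum>k\<in>{i * n..<i * n + n}. f (k div n) (k mod n))"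
    by (rule sum.nat_group[symmetric])
  also have "\<dots> = (\<Sum>i<m. \<Sum>j<n. f i j)"
  proof (rule sum.cong[OF refl])
    fix i
    have "(\<Sum>k\<in>{i * n..<i * n + n}. f (k div n) (k mod n))
        = (\<Sum>j\<in>{0..<n}. f ((j + i * n) div n) ((j + i * n) mod n))"
      using sum.shift_bounds_nat_ivl[of "\<lambda>k. f (k div n) (k mod n)" 0 "i * n" n]
      by (simp add: add.commute)
    also have "\<dots> = (\<Sum>j\<in>{0..<n}. f i j)" by (rule sum.cong) auto
    finally show "(\<Sum>k\<in>{i * n..<i * n + n}. f (k div n) (k mod n)) = (\<Sum>j<n. f i j)"
      by (simp add: lessThan_atLeast0)
  qed
  finally show ?thesis .
qed

lemma kronecker_mult:
  fixes A B C D :: "'k::comm_semiring_0 mat"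
  assumes "dim_col A = dim_row C" "dim_col B = dim_row D"
  shows "kronecker A B * kronecker C D = kronecker (A * C) (B * D)"
proof (intro eq_matI)
  fix i j assume "i < dim_row (kronecker (A * C) (B * D))" "j < dim_col (kronecker (A * C) (B * D))"
  then have ij: "i < dim_row A * dim_row B" "j < dim_col C * dim_col D" by auto
  note b = pair_index_bounds[OF ij(1)] pair_index_bounds[OF ij(2)]
  have "(kronecker A B * kronecker C D) $$ (i, j)
      = (\<Sum>k<dim_row C * dim_row D. kronecker A B $$ (i, k) * kronecker C D $$ (k, j))"
    using ij assms by (simp add: mat_entry)
  also have "\<dots> = (\<Sum>k<dim_row C * dim_row D.
      (\<lambda>p q. (A $$ (i div dim_row B, p) * C $$ (p, j div dim_col D)) *
        (B $$ (i mod dim_row B, q) * D $$ (q, j mod dim_col D))) (k div dim_row D) (k mod dim_row D))"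
    using ij assms by (intro sum.cong) (auto simp: kronecker_entry algebra_simps)
  also have "\<dots> = (\<Sum>p<dim_row C. \<Sum>q<dim_row D.
      (A $$ (i div dim_row B, p) * C $$ (p, j div dim_col D)) *
        (B $$ (i mod dim_row B, q) * D $$ (q, j mod dim_col D)))"
    by (rule sum_pair_index)
  also have "\<dots> = (A * C) $$ (i div dim_row B, j div dim_col D) * (B * D) $$ (i mod dim_row B, j mod dim_col D)"
    using b assms by (simp add: mat_entry sum_product)
  finally show "(kronecker A B * kronecker C D) $$ (i, j) = kronecker (A * C) (B * D) $$ (i, j)"
    using ij by (simp add: kronecker_entry)
qed auto

lemma kronecker_assoc:
  fixes A B C :: "'k::semiring_0 mat"
  shows "kronecker (kronecker A B) C = kronecker A (kronecker B C)"
proof (intro eq_matI)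
  fix i j assume "i < dim_row (kronecker A (kronecker B C))" "j < dim_col (kronecker A (kronecker B C))"
  then have ij: "i < dim_row A * dim_row B * dim_row C" "j < dim_col A * dim_col B * dim_col C" by auto
  have b: "i div dim_row C < dim_row A * dim_row B" "j div dim_col C < dim_col A * dim_col B"
    "i mod dim_row C < dim_row C" "j mod dim_col C < dim_col C"
    using pair_index_bounds ij by blast+
  have b': "i mod (dim_row B * dim_row C) < dim_row B * dim_row C"
    "j mod (dim_col B * dim_col C) < dim_col B * dim_col C"
    using ij by (auto intro!: pair_index_bounds(2) simp: mult.assoc)
  have reindex: "k div (r * s) = k div s div r" "k mod (r * s) mod s = k mod s"
    "s \<noteq> 0 \<Longrightarrow> k mod (r * s) div s = k div s mod r" for k r s :: nat
    using div_mult2_eq[of k s r] mod_mult2_eq[of k s r] by (auto simp: mult.commute)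
  have nz: "dim_row C \<noteq> 0" "dim_col C \<noteq> 0" using b(3,4) by linarith+
  show "kronecker (kronecker A B) C $$ (i, j) = kronecker A (kronecker B C) $$ (i, j)"
    using ij b b' nz by (simp add: kronecker_entry reindex mult.assoc)
qed (auto simp: mult.assoc)

lemma kronecker_one: "kronecker (1\<^sub>m m) (1\<^sub>m n) = (1\<^sub>m (m * n) :: 'k::semiring_1 mat)"
proof (intro eq_matI)
  fix i j assume "i < dim_row (1\<^sub>m (m * n) :: 'k mat)" "j < dim_col (1\<^sub>m (m * n) :: 'k mat)"
  then have ij: "i < m * n" "j < m * n" by auto
  have "i = j \<longleftrightarrow> i div n = j div n \<and> i mod n = j mod n" by (metis div_mult_mod_eq)
  then show "kronecker (1\<^sub>m m) (1\<^sub>m n) $$ (i, j) = (1\<^sub>m (m * n) :: 'k mat) $$ (i, j)"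
    using ij pair_index_bounds[OF ij(1)] pair_index_bounds[OF ij(2)]
    by (auto simp: kronecker_entry)
qed auto

lemma kronecker_one_left: "kronecker (1\<^sub>m 1) A = (A :: 'k::semiring_1 mat)"
  by (intro eq_matI) (auto simp: kronecker_entry)

lemma kronecker_one_right: "kronecker A (1\<^sub>m 1) = (A :: 'k::semiring_1 mat)"
  by (intro eq_matI) (auto simp: kronecker_entry)

lemma kronecker_add_left:
  fixes A B C :: "'k::semiring_0 mat"
  assumes "dim_row A = dim_row B" "dim_col A = dim_col B"
  shows "kronecker (A + B) C = kronecker A C + kronecker B C"
  using assms pair_index_bounds
  by (intro eq_matI) (auto simp: kronecker_entry algebra_simps)

lemma kronecker_add_right:
  fixes A B C :: "'k::semiring_0 mat"
  assumes "dim_row A = dim_row B" "dim_col A = dim_col B"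
  shows "kronecker C (A + B) = kronecker C A + kronecker C B"
  using assms pair_index_bounds(2)[of _ "dim_row C" "dim_row B"] pair_index_bounds(2)[of _ "dim_col C" "dim_col B"]
  by (intro eq_matI) (auto simp: kronecker_entry algebra_simps)

lemma kronecker_smult_left:
  "kronecker (c \<cdot>\<^sub>m A) B = c \<cdot>\<^sub>m kronecker A (B :: 'k::comm_semiring_1 mat)"
  using pair_index_bounds by (intro eq_matI) (auto simp: kronecker_entry algebra_simps)

lemma kronecker_smult_right:
  "kronecker A (c \<cdot>\<^sub>m B) = c \<cdot>\<^sub>m kronecker A (B :: 'k::comm_semiring_1 mat)"
  using pair_index_bounds by (intro eq_matI) (auto simp: kronecker_entry algebra_simps)

section \<open>Families of matrices\<close>

definition msum :: "nat \<Rightarrow> nat \<Rightarrow> ('i \<Rightarrow> 'k::comm_monoid_add mat) \<Rightarrow> 'i set \<Rightarrow> 'k mat" where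
  "msum m n f I = mat m n (\<lambda>ij. \<Sum>k\<in>I. f k $$ ij)"

lemma dim_msum [simp]: "dim_row (msum m n f I) = m" "dim_col (msum m n f I) = n"
  by (auto simp: msum_def)

lemma msum_mult_left:
  fixes A :: "'k::comm_semiring_1 mat"
  assumes "\<And>k. k \<in> I \<Longrightarrow> f k \<in> carrier_mat m n" "dim_col A = m"
  shows "A * msum m n f I = msum (dim_row A) n (\<lambda>k. A * f k) I"
proof (intro eq_matI)
  fix i j assume "i < dim_row (msum (dim_row A) n (\<lambda>k. A * f k) I)"
    "j < dim_col (msum (dim_row A) n (\<lambda>k. A * f k) I)"
  then have ij: "i < dim_row A" "j < n" by auto
  have "(A * msum m n f I) $$ (i, j) = (\<Sum>l<m. A $$ (i, l) * (\<Sum>k\<in>I. f k $$ (l, j)))"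
    using ij assms by (simp add: mat_entry) (simp add: msum_def)
  also have "\<dots> = (\<Sum>k\<in>I. \<Sum>l<m. A $$ (i, l) * f k $$ (l, j))"
    by (subst sum.swap) (simp add: sum_distrib_left)
  also have "\<dots> = (\<Sum>k\<in>I. (A * f k) $$ (i, j))"
    using ij assms by (intro sum.cong) (auto simp: mat_entry dest!: assms(1))
  finally show "(A * msum m n f I) $$ (i, j) = msum (dim_row A) n (\<lambda>k. A * f k) I $$ (i, j)"
    using ij by (simp add: msum_def)
qed auto

lemma msum_mult_right:
  fixes A :: "'k::comm_semiring_1 mat"
  assumes "\<And>k. k \<in> I \<Longrightarrow> f k \<in> carrier_mat m n" "dim_row A = n"
  shows "msum m n f I * A = msum m (dim_col A) (\<lambda>k. f k * A) I"
proof (intro eq_matI)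
  fix i j assume "i < dim_row (msum m (dim_col A) (\<lambda>k. f k * A) I)"
    "j < dim_col (msum m (dim_col A) (\<lambda>k. f k * A) I)"
  then have ij: "i < m" "j < dim_col A" by auto
  have "(msum m n f I * A) $$ (i, j) = (\<Sum>l<n. (\<Sum>k\<in>I. f k $$ (i, l)) * A $$ (l, j))"
    using ij assms by (simp add: mat_entry) (simp add: msum_def)
  also have "\<dots> = (\<Sum>k\<in>I. \<Sum>l<n. f k $$ (i, l) * A $$ (l, j))"
    by (subst sum.swap) (simp add: sum_distrib_right)
  also have "\<dots> = (\<Sum>k\<in>I. (f k * A) $$ (i, j))"
    using ij assms by (intro sum.cong) (auto simp: mat_entry dest!: assms(1))
  finally show "(msum m n f I * A) $$ (i, j) = msum m (dim_col A) (\<lambda>k. f k * A) I $$ (i, j)"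
    using ij by (simp add: msum_def)
qed auto

lemma msum_cong: "(\<And>k. k \<in> I \<Longrightarrow> f k = g k) \<Longrightarrow> msum m n f I = msum m n g I"
  unfolding msum_def by (intro cong_mat) (auto intro: sum.cong)

lemma msum_delta:
  assumes "finite I" "f i \<in> carrier_mat m n" "\<And>k. k \<in> I \<Longrightarrow> k \<noteq> i \<Longrightarrow> f k = 0\<^sub>m m n"
  shows "msum m n f I = (if i \<in> I then f i else 0\<^sub>m m n)"
proof (intro eq_matI)
  fix a b assume "a < dim_row (if i \<in> I then f i else 0\<^sub>m m n)" "b < dim_col (if i \<in> I then f i else 0\<^sub>m m n)"
  then have ab: "a < m" "b < n" using assms(2) by (auto split: if_splits)
  have "(\<Sum>k\<in>I. f k $$ (a, b)) = (\<Sum>k\<in>I. if k = i then f i $$ (a, b) else 0)"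
    using ab assms(3) by (intro sum.cong) auto
  then show "msum m n f I $$ (a, b) = (if i \<in> I then f i else 0\<^sub>m m n) $$ (a, b)"
    using ab assms(1) by (simp add: msum_def sum.delta)
qed (use assms(2) in auto)

section \<open>Diagonalizable matrices with integer eigenvalues\<close>

definition int_diagonal :: "nat \<Rightarrow> (nat \<Rightarrow> int) \<Rightarrow> 'k::ring_1 mat" where
  "int_diagonal s d = mat s s (\<lambda>(i, j). if i = j then of_int (d i) else 0)"

text \<open>The size \<open>s\<close> is kept independent of the size of \<open>Q\<close>, with which it agrees by
  \<open>inverse_mats_square\<close>: change-of-basis matrices that are assembled from blocks then need no
  bookkeeping of dimensions.\<close>

definition int_diagonalizable :: "'k::ring_1 mat \<Rightarrow> bool" where
  "int_diagonalizable Q \<longleftrightarrow> (\<exists>s T T' d. T \<in> carrier_mat (dim_row Q) s \<and> T' \<in> carrier_mat s (dim_row Q) \<and>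
     T * T' = 1\<^sub>m (dim_row Q) \<and> T' * T = 1\<^sub>m s \<and> Q = T * int_diagonal s d * T')"

lemma int_diagonal_carrier [simp]: "int_diagonal s d \<in> carrier_mat s s"
  "dim_row (int_diagonal s d) = s" "dim_col (int_diagonal s d) = s"
  by (auto simp: int_diagonal_def)

lemma int_diagonal_mult_entry:
  assumes "dim_row Y = s" "i < s" "j < dim_col Y"
  shows "(int_diagonal s d * Y) $$ (i, j) = of_int (d i) * Y $$ (i, j)"
proof -
  have "(int_diagonal s d * Y) $$ (i, j) = (\<Sum>l<s. int_diagonal s d $$ (i, l) * Y $$ (l, j))"
    using assms by (simp add: mat_entry)
  also have "\<dots> = (\<Sum>l<s. if l = i then of_int (d i) * Y $$ (i, j) else 0)"
    using assms by (intro sum.cong) (auto simp: int_diagonal_def)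
  finally show ?thesis using assms by (simp add: sum.delta)
qed

lemma int_diagonalizableE:
  assumes "int_diagonalizable Q" "Q \<in> carrier_mat n n"
  obtains s T T' d where "dim_row T = n" "dim_col T = s" "dim_row T' = s" "dim_col T' = n"
    "T * T' = 1\<^sub>m n" "T' * T = 1\<^sub>m s" "Q = T * (int_diagonal s d * T')"
proof -
  have d: "dim_row Q = n" using assms(2) by simp
  obtain s T T' d where T: "T \<in> carrier_mat n s" "T' \<in> carrier_mat s n"
    and eq: "T * T' = 1\<^sub>m n" "T' * T = 1\<^sub>m s" "Q = T * int_diagonal s d * T'"
    using assms(1) unfolding int_diagonalizable_def d by blast
  have dims: "dim_row T = n" "dim_col T = s" "dim_row T' = s" "dim_col T' = n" using T by auto
  have "Q = T * (int_diagonal s d * T')" unfolding eq(3) by (rule mat_assoc) (simp_all add: dims)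
  from that[OF dims eq(1,2) this] show thesis .
qed

lemma int_diagonalizableI:
  assumes "dim_row T = n" "dim_col T = s" "dim_row T' = s" "dim_col T' = n"
    "T * T' = 1\<^sub>m n" "T' * T = 1\<^sub>m s" "Q = T * (int_diagonal s d * T')"
  shows "int_diagonalizable Q"
proof -
  have n: "dim_row Q = n" unfolding assms(7) using assms(1) by simp
  have "T \<in> carrier_mat n s" "T' \<in> carrier_mat s n" using assms(1-4) by (intro carrier_matI; simp)+
  moreover have "Q = T * int_diagonal s d * T'"
    unfolding assms(7) by (rule mat_assoc[symmetric]) (simp_all add: assms(1-4))
  ultimately show ?thesis
    unfolding int_diagonalizable_def n using assms(5,6) by blast
qed

lemma int_diagonalizable_scalar: "int_diagonalizable (of_int j \<cdot>\<^sub>m 1\<^sub>m r :: 'k::comm_ring_1 mat)"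
proof (rule int_diagonalizableI[where n = r and s = r])
  show "of_int j \<cdot>\<^sub>m 1\<^sub>m r = 1\<^sub>m r * (int_diagonal r (\<lambda>_. j) * 1\<^sub>m r :: 'k mat)"
    by (simp add: mat_algebra) (auto simp: int_diagonal_def intro!: eq_matI)
qed (auto simp: mat_algebra)

text \<open>\<open>K\<close>, \<open>K'\<close> are the inclusions and \<open>L\<close>, \<open>L'\<close> the projections of a direct sum decomposition that \<open>Q\<close>
  respects; eigenbases of the two summands together form an eigenbasis for \<open>Q\<close>.\<close>

lemma int_diagonalizable_biproduct:
  fixes Q :: "'k::comm_ring_1 mat"
  assumes K: "K \<in> carrier_mat n r" "L \<in> carrier_mat r n" and K': "K' \<in> carrier_mat n r'" "L' \<in> carrier_mat r' n"
    and inv: "L * K = 1\<^sub>m r" "L' * K' = 1\<^sub>m r'" "L * K' = 0\<^sub>m r r'" "L' * K = 0\<^sub>m r' r"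
      "K * L + K' * L' = 1\<^sub>m n"
    and X: "X \<in> carrier_mat r r" "X' \<in> carrier_mat r' r'" "int_diagonalizable X" "int_diagonalizable X'"
    and Q: "Q = K * X * L + K' * X' * L'"
  shows "int_diagonalizable Q"
proof -
  obtain s T U d where T: "dim_row T = r" "dim_col T = s" "dim_row U = s" "dim_col U = r"
    "T * U = 1\<^sub>m r" "U * T = 1\<^sub>m s" "X = T * (int_diagonal s d * U)"
    using X(3,1) by (rule int_diagonalizableE)
  obtain s' T' U' d' where T': "dim_row T' = r'" "dim_col T' = s'" "dim_row U' = s'" "dim_col U' = r'"
    "T' * U' = 1\<^sub>m r'" "U' * T' = 1\<^sub>m s'" "X' = T' * (int_diagonal s' d' * U')"
    using X(4,2) by (rule int_diagonalizableE)
  have dims: "dim_row K = n" "dim_col K = r" "dim_row L = r" "dim_col L = n"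
    "dim_row K' = n" "dim_col K' = r'" "dim_row L' = r'" "dim_col L' = n"
    using K K' by auto
  note dims = dims T(1-4) T'(1-4)
  have cancel: "dim_row Y = r \<Longrightarrow> L * (K * Y) = Y" "dim_row Y = r' \<Longrightarrow> L' * (K' * Y) = Y"
    "dim_row Y = r' \<Longrightarrow> L * (K' * Y) = 0\<^sub>m r (dim_col Y)"
    "dim_row Y = r \<Longrightarrow> L' * (K * Y) = 0\<^sub>m r' (dim_col Y)"
    "dim_row Y = r \<Longrightarrow> T * (U * Y) = Y" "dim_row Y = r' \<Longrightarrow> T' * (U' * Y) = Y" for Y
    using inv(1-4) T(5) T'(5) by (simp_all add: mat_assoc[symmetric] dims mat_one_left mat_zero_left)
  show ?thesis
  proof (rule int_diagonalizableI[where n = n and s = "s + s'"])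
    define d'' where "d'' i = (if i < s then d i else d' (i - s))" for i
    show "hcat (K * T) (K' * T') * vcat (U * L) (U' * L') = 1\<^sub>m n"
      by (subst hcat_vcat) (simp_all add: dims mat_algebra cancel inv(5))
    show "vcat (U * L) (U' * L') * hcat (K * T) (K' * T') = 1\<^sub>m (s + s')"
      by (subst vcat_hcat) (auto simp: dims mat_algebra cancel T(6) T'(6) intro!: eq_matI)
    have "int_diagonal (s + s') d'' * vcat (U * L) (U' * L')
        = vcat (int_diagonal s d * (U * L)) (int_diagonal s' d' * (U' * L'))"
    proof (intro eq_matI)
      fix i j assume "i < dim_row (vcat (int_diagonal s d * (U * L)) (int_diagonal s' d' * (U' * L')))"
        "j < dim_col (vcat (int_diagonal s d * (U * L)) (int_diagonal s' d' * (U' * L')))"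
      then have ij: "i < s + s'" "j < n" by (auto simp: dims)
      show "(int_diagonal (s + s') d'' * vcat (U * L) (U' * L')) $$ (i, j) =
          vcat (int_diagonal s d * (U * L)) (int_diagonal s' d' * (U' * L')) $$ (i, j)"
        using ij by (subst int_diagonal_mult_entry) (auto simp: dims vcat_def int_diagonal_mult_entry d''_def)
    qed (auto simp: dims)
    then show "Q = hcat (K * T) (K' * T') * (int_diagonal (s + s') d'' * vcat (U * L) (U' * L'))"
      unfolding Q T(7) T'(7) by (simp add: hcat_vcat dims mat_algebra)
  qed (auto simp: dims)
qed

subsection \<open>Characterization by an annihilating polynomial\<close>

fun root_product :: "int list \<Rightarrow> 'k::ring_1 mat \<Rightarrow> 'k mat" where
  "root_product [] Q = 1\<^sub>m (dim_row Q)"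
| "root_product (i # is) Q = (Q + (- of_int i) \<cdot>\<^sub>m 1\<^sub>m (dim_row Q)) * root_product is Q"

lemma dim_root_product [simp]:
  "dim_row (root_product is Q) = dim_row Q" "dim_col (root_product is Q) = dim_row Q"
  by (induction "is") auto

lemma root_product_intertwine:
  fixes Q :: "'k::comm_ring_1 mat"
  assumes "Q \<in> carrier_mat n n" "Q' \<in> carrier_mat r r" "K \<in> carrier_mat n r" "Q * K = K * Q'"
  shows "root_product is Q * K = K * root_product is Q'"
proof (induction "is")
  case (Cons i "is")
  have d: "dim_row Q = n" "dim_col Q = n" "dim_row Q' = r" "dim_col Q' = r" "dim_row K = n" "dim_col K = r"
    using assms by auto
  have "root_product (i # is) Q * K = (Q + (- of_int i) \<cdot>\<^sub>m 1\<^sub>m n) * (root_product is Q * K)"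
    by (simp add: mat_algebra d)
  also have "\<dots> = (Q * K + (- of_int i) \<cdot>\<^sub>m K) * root_product is Q'"
    unfolding Cons by (simp add: mat_algebra d)
  also have "\<dots> = K * root_product (i # is) Q'"
    unfolding assms(4) by (simp add: mat_algebra d)
  finally show ?case .
qed (use assms in \<open>auto simp: mat_algebra\<close>)

lemma root_product_eigen:
  fixes Q :: "'k::comm_ring_1 mat"
  assumes "Q \<in> carrier_mat n n" "X \<in> carrier_mat n r" "Q * X = of_int j \<cdot>\<^sub>m X"
  shows "root_product is Q * X = of_int (\<Prod>i\<leftarrow>is. j - i) \<cdot>\<^sub>m X"
proof (induction "is")
  case (Cons i "is")
  have d: "dim_row Q = n" "dim_col Q = n" "dim_row X = n" "dim_col X = r" using assms by auto
  have "root_product (i # is) Q * X = (Q + (- of_int i) \<cdot>\<^sub>m 1\<^sub>m n) * (root_product is Q * X)"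
    by (simp add: mat_algebra d)
  also have "\<dots> = of_int (\<Prod>i\<leftarrow>is. j - i) \<cdot>\<^sub>m (of_int j \<cdot>\<^sub>m X + (- of_int i) \<cdot>\<^sub>m X)"
    unfolding Cons using assms(3) by (simp add: mat_algebra d)
  also have "\<dots> = of_int (\<Prod>i\<leftarrow>i # is. j - i) \<cdot>\<^sub>m X"
    by (intro eq_matI) (auto simp: algebra_simps)
  finally show ?case .
qed (use assms in \<open>auto simp: mat_algebra smult_one_mat\<close>)

lemma int_diagonalizable_imp_root_product:
  fixes Q :: "'k::field_char_0 mat"
  assumes "int_diagonalizable Q" "Q \<in> carrier_mat n n"
  shows "\<exists>is. distinct is \<and> root_product is Q = 0\<^sub>m n n"
proof -
  obtain s T T' d where T: "dim_row T = n" "dim_col T = s" "dim_row T' = s" "dim_col T' = n"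
    "T * T' = 1\<^sub>m n" "T' * T = 1\<^sub>m s" "Q = T * (int_diagonal s d * T')"
    using assms by (rule int_diagonalizableE)
  define "is" where "is = remdups (map d [0..<s])"
  have rp: "root_product js (int_diagonal s d :: 'k mat) = int_diagonal s (\<lambda>i. \<Prod>k\<leftarrow>js. d i - k)" for js
  proof (induction js)
    case (Cons k js)
    show ?case
    proof (intro eq_matI)
      fix i j assume "i < dim_row (int_diagonal s (\<lambda>i. \<Prod>k\<leftarrow>k # js. d i - k) :: 'k mat)"
        "j < dim_col (int_diagonal s (\<lambda>i. \<Prod>k\<leftarrow>k # js. d i - k) :: 'k mat)"
      then have ij: "i < s" "j < s" by auto
      have "root_product (k # js) (int_diagonal s d :: 'k mat) $$ (i, j) =
          (\<Sum>l<s. (int_diagonal s d + (- of_int k) \<cdot>\<^sub>m 1\<^sub>m s) $$ (i, l)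
            * int_diagonal s (\<lambda>i. \<Prod>k\<leftarrow>js. d i - k) $$ (l, j))"
        using ij by (simp add: Cons mat_entry)
      also have "\<dots> = (\<Sum>l<s. if l = i then of_int (d i - k)
          * int_diagonal s (\<lambda>i. \<Prod>k\<leftarrow>js. d i - k) $$ (i, j) else 0)"
        using ij by (intro sum.cong) (auto simp: int_diagonal_def)
      also have "\<dots> = int_diagonal s (\<lambda>i. \<Prod>k\<leftarrow>k # js. d i - k) $$ (i, j)"
        using ij by (simp add: sum.delta) (auto simp: int_diagonal_def)
      finally show "root_product (k # js) (int_diagonal s d :: 'k mat) $$ (i, j)
          = int_diagonal s (\<lambda>i. \<Prod>k\<leftarrow>k # js. d i - k) $$ (i, j)" .
    qed auto
  qed (auto simp: int_diagonal_def intro!: eq_matI)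
  have "(\<Prod>k\<leftarrow>is. d i - k) = 0" if "i < s" for i
    using that by (auto simp: prod_list_zero_iff is_def)
  then have "int_diagonal s (\<lambda>i. \<Prod>k\<leftarrow>is. d i - k) = (0\<^sub>m s s :: 'k mat)"
    by (auto simp: int_diagonal_def intro!: eq_matI)
  then have z: "root_product is (int_diagonal s d :: 'k mat) = 0\<^sub>m s s" by (simp add: rp)
  have "Q * T = T * (int_diagonal s d * (T' * T))" using T(1-4) by (simp add: T(7) mat_algebra)
  then have "Q * T = T * int_diagonal s d" by (simp add: T(6) mat_algebra)
  then have "root_product is Q * T = T * root_product is (int_diagonal s d)"
    by (rule root_product_intertwine[OF assms(2) int_diagonal_carrier(1) carrier_matI[OF T(1,2)]])
  then have "(root_product is Q * T) * T' = 0\<^sub>m n n" using T(1-4) by (simp add: z mat_algebra)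
  moreover have "dim_row Q = n" using assms(2) by simp
  ultimately have "root_product is Q = 0\<^sub>m n n" using T(1-5) assms(2) by (simp add: mat_algebra)
  then show ?thesis by (intro exI[of _ "is"]) (simp add: is_def)
qed

text \<open>Divide off one root \<open>j\<close> at a time: up to a nonzero scalar the product over the remaining
  roots is the idempotent onto the \<open>j\<close>-eigenspace, because the roots are distinct.\<close>

lemma root_product_imp_int_diagonalizable:
  fixes Q :: "'k::field_char_0 mat"
  assumes "distinct is" "Q \<in> carrier_mat n n" "root_product is Q = 0\<^sub>m n n"
  shows "int_diagonalizable Q"
  using assms
proof (induction "is" arbitrary: n Q)
  case Nil
  then have "n = 0" using one_mat_zero_iff[of n, where 'k = 'k] by auto
  with Nil have "Q = of_int 0 \<cdot>\<^sub>m 1\<^sub>m 0" by auto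
  then show ?case by (simp only: int_diagonalizable_scalar)
next
  case (Cons j "is")
  define N where "N = root_product is Q"
  define c where "c = (\<Prod>i\<leftarrow>is. j - i)"
  have c: "(of_int c :: 'k) \<noteq> 0" using Cons.prems(1) by (auto simp: c_def prod_list_zero_iff)
  have dQ: "dim_row Q = n" "dim_col Q = n" using Cons.prems(2) by auto
  have dN: "dim_row N = n" "dim_col N = n" by (auto simp: N_def dQ)
  have "(Q + (- of_int j) \<cdot>\<^sub>m 1\<^sub>m n) * N = 0\<^sub>m n n" using Cons.prems(3) by (simp add: N_def dQ)
  then have "Q * N + (- of_int j) \<cdot>\<^sub>m N = 0\<^sub>m n n" by (simp add: mat_algebra dQ dN)
  then have QN: "Q * N = of_int j \<cdot>\<^sub>m N"
  proof -
    assume *: "Q * N + (- of_int j) \<cdot>\<^sub>m N = 0\<^sub>m n n"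
    show ?thesis
    proof (intro eq_matI)
      fix a b assume "a < dim_row (of_int j \<cdot>\<^sub>m N)" "b < dim_col (of_int j \<cdot>\<^sub>m N)"
      moreover from this have "(Q * N + (- of_int j) \<cdot>\<^sub>m N) $$ (a, b) = 0" by (simp add: * dN)
      ultimately show "(Q * N) $$ (a, b) = (of_int j \<cdot>\<^sub>m N) $$ (a, b)" by (simp add: dN dQ)
    qed (auto simp: dN dQ)
  qed
  have NQ: "N * Q = Q * N"
    unfolding N_def using Cons.prems(2) by (intro root_product_intertwine) auto
  define E where "E = (1 / of_int c) \<cdot>\<^sub>m N"
  have dE: "dim_row E = n" "dim_col E = n" by (auto simp: E_def dN)
  have QE: "Q * E = of_int j \<cdot>\<^sub>m E" "E * Q = Q * E"
    by (simp_all add: E_def mat_algebra dN dQ QN NQ smult_smult_mat mult.commute)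
  have NE: "N = of_int c \<cdot>\<^sub>m E" using c by (simp add: E_def smult_smult_mat smult_one_mat)
  have "N * N = of_int c \<cdot>\<^sub>m N"
    using root_product_eigen[OF Cons.prems(2) carrier_matI[OF dN] QN, of "is"]
    unfolding N_def[symmetric] c_def[symmetric] .
  then have EE: "E * E = E"
    using c by (simp add: E_def mat_algebra dN smult_smult_mat)
  define E' where "E' = 1\<^sub>m n + (-1) \<cdot>\<^sub>m E"
  have dE': "dim_row E' = n" "dim_col E' = n" by (auto simp: E'_def dE)
  have EE': "E * E' = 0\<^sub>m n n" "E' * E = 0\<^sub>m n n"
    by (simp_all add: E'_def mat_algebra dE EE) (auto simp: dE intro!: eq_matI)
  have "E' * E' = E' + (-1) \<cdot>\<^sub>m (E * E')"
    by (subst (1) E'_def) (simp add: mat_algebra dE dE')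
  then have E'E': "E' * E' = E'" unfolding EE' by (auto simp: dE' intro!: eq_matI)
  obtain r K L where KL: "K \<in> carrier_mat n r" "L \<in> carrier_mat r n" "L * K = 1\<^sub>m r" "K * L = E"
    using idempotent_splitting[OF carrier_matI[OF dE] EE] by blast
  obtain r' K' L' where KL': "K' \<in> carrier_mat n r'" "L' \<in> carrier_mat r' n" "L' * K' = 1\<^sub>m r'" "K' * L' = E'"
    using idempotent_splitting[OF carrier_matI[OF dE'] E'E'] by blast
  have dims: "dim_row K = n" "dim_col K = r" "dim_row L = r" "dim_col L = n"
    "dim_row K' = n" "dim_col K' = r'" "dim_row L' = r'" "dim_col L' = n"
    using KL KL' by auto
  note dims = dims dQ dE dE'
  have "K = (K * L) * K" using KL(3) by (simp add: mat_algebra dims)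
  then have EK: "E * K = K" using KL(4) by simp
  have "K' = (K' * L') * K'" using KL'(3) by (simp add: mat_algebra dims)
  then have E'K': "E' * K' = K'" using KL'(4) by simp
  have "L = L * (K * L)" using KL(3) by (simp add: mat_algebra dims mat_assoc[symmetric])
  then have LE: "L * E = L" using KL(4) by simp
  have "L' = L' * (K' * L')" using KL'(3) by (simp add: mat_algebra dims mat_assoc[symmetric])
  then have L'E': "L' * E' = L'" using KL'(4) by simp
  have "L * K' = (L * E) * (E' * K')" using LE E'K' by simp
  also have "\<dots> = L * ((E * E') * K')" by (simp add: mat_algebra dims)
  finally have LK': "L * K' = 0\<^sub>m r r'" by (simp add: EE' mat_algebra dims)
  have "L' * K = (L' * E') * (E * K)" using L'E' EK by simp
  also have "\<dots> = L' * ((E' * E) * K)" by (simp add: mat_algebra dims)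
  finally have L'K: "L' * K = 0\<^sub>m r' r" by (simp add: EE' mat_algebra dims)
  define Q' where "Q' = L' * (Q * K')"
  have dQ': "dim_row Q' = r'" "dim_col Q' = r'" by (auto simp: Q'_def dims)
  have QE': "Q * E' = E' * Q" by (simp add: E'_def mat_algebra dims QE)
  have "K' * Q' = (K' * L') * (Q * K')" by (simp add: Q'_def mat_algebra dims)
  also have "\<dots> = (Q * E') * K'" by (simp add: KL'(4) QE' mat_algebra dims)
  also have "\<dots> = Q * K'" by (simp add: mat_algebra dims E'K')
  finally have QK': "Q * K' = K' * Q'" by simp
  have "N * K' = K' * root_product is Q'"
    unfolding N_def by (rule root_product_intertwine[OF Cons.prems(2) carrier_matI[OF dQ'] KL'(1) QK'])
  moreover have "N * K' = 0\<^sub>m n r'"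
  proof -
    have "E * K' = K * (L * K')" by (simp add: KL(4)[symmetric] mat_algebra dims)
    then have "E * K' = 0\<^sub>m n r'" by (simp add: LK' mat_algebra dims)
    then show ?thesis by (simp add: NE mat_algebra dims)
  qed
  ultimately have "K' * root_product is Q' = 0\<^sub>m n r'" by simp
  then have "L' * (K' * root_product is Q') = 0\<^sub>m r' r'" by (simp add: mat_algebra dims)
  then have "root_product is Q' = 0\<^sub>m r' r'"
    using KL'(3) by (simp add: mat_assoc[symmetric] dims dQ' mat_one_left)
  then have Q': "int_diagonalizable Q'"
    using Cons.prems(1) by (intro Cons.IH[OF _ carrier_matI[OF dQ']]) simp_all
  have one: "K * L + K' * L' = 1\<^sub>m n" unfolding KL(4) KL'(4) E'_def
    by (intro eq_matI) (auto simp: dE)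
  have "Q = Q * (K * L + K' * L')" by (simp add: one mat_algebra dims)
  also have "\<dots> = Q * E + (Q * K') * L'" by (simp add: mat_algebra dims KL(4))
  also have "\<dots> = K * (of_int j \<cdot>\<^sub>m 1\<^sub>m r) * L + K' * Q' * L'"
    by (simp add: QE QK' mat_algebra dims dQ' KL(4))
  finally have Q: "Q = K * (of_int j \<cdot>\<^sub>m 1\<^sub>m r) * L + K' * Q' * L'" .
  have "of_int j \<cdot>\<^sub>m 1\<^sub>m r \<in> carrier_mat r r" by simp
  then show ?case
    by (rule int_diagonalizable_biproduct[OF KL(1,2) KL'(1,2) KL(3) KL'(3) LK' L'K one
      _ carrier_matI[OF dQ'] int_diagonalizable_scalar Q' Q])
qed

text \<open>An annihilating polynomial with distinct roots also annihilates the restriction to an invariant subspace.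
  Here \<open>K\<close> is the inclusion of the subspace and \<open>L\<close> a projection onto it.\<close>

lemma int_diagonalizable_restrict:
  fixes Q :: "'k::field_char_0 mat"
  assumes "int_diagonalizable Q" "Q \<in> carrier_mat n n" "Q' \<in> carrier_mat r r"
    and K: "K \<in> carrier_mat n r" "L \<in> carrier_mat r n" "L * K = 1\<^sub>m r" "Q * K = K * Q'"
  shows "int_diagonalizable Q'"
proof -
  obtain "is" where "is": "distinct is" "root_product is Q = 0\<^sub>m n n"
    using int_diagonalizable_imp_root_product[OF assms(1,2)] by blast
  have d: "dim_row K = n" "dim_col K = r" "dim_row L = r" "dim_col L = n" "dim_row Q' = r" using K assms(3) by auto
  have "K * root_product is Q' = 0\<^sub>m n r"
    using root_product_intertwine[OF assms(2,3) K(1,4), of "is"] "is"(2) d by (simp add: mat_algebra)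
  then have "L * (K * root_product is Q') = 0\<^sub>m r r" using d by (simp add: mat_algebra)
  then have "root_product is Q' = 0\<^sub>m r r"
    using K(3) by (simp add: mat_assoc[symmetric] d mat_one_left)
  with "is"(1) assms(3) show ?thesis by (rule root_product_imp_int_diagonalizable)
qed

lemma int_diagonalizable_quotient:
  fixes Q :: "'k::field_char_0 mat"
  assumes "int_diagonalizable Q" "Q \<in> carrier_mat n n" "Q' \<in> carrier_mat r r"
    and C: "C \<in> carrier_mat r n" "D \<in> carrier_mat n r" "C * D = 1\<^sub>m r" "C * Q = Q' * C"
  shows "int_diagonalizable Q'"
proof -
  obtain "is" where "is": "distinct is" "root_product is Q = 0\<^sub>m n n"
    using int_diagonalizable_imp_root_product[OF assms(1,2)] by blast
  have d: "dim_row C = r" "dim_col C = n" "dim_row D = n" "dim_col D = r" "dim_row Q' = r" using C assms(3) by auto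
  have "root_product is Q' * C = 0\<^sub>m r n"
    using root_product_intertwine[OF assms(3,2) C(1) C(4)[symmetric], of "is"] "is"(2) d by (simp add: mat_algebra)
  then have "root_product is Q' * C * D = 0\<^sub>m r r" using d by (simp add: mat_algebra)
  then have "root_product is Q' = 0\<^sub>m r r"
    using C(3) by (simp add: mat_assoc d mat_one_right)
  with "is"(1) assms(3) show ?thesis by (rule root_product_imp_int_diagonalizable)
qed

text \<open>Tensor products of eigenvectors are eigenvectors, and their eigenvalues add up.\<close>

lemma int_diagonalizable_kronecker_sum:
  fixes Q R :: "'k::field_char_0 mat"
  assumes "int_diagonalizable Q" "Q \<in> carrier_mat m m" "int_diagonalizable R" "R \<in> carrier_mat n n"
  shows "int_diagonalizable (kronecker Q (1\<^sub>m n) + kronecker (1\<^sub>m m) R)"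
proof -
  obtain s T U d where T: "dim_row T = m" "dim_col T = s" "dim_row U = s" "dim_col U = m"
    "T * U = 1\<^sub>m m" "U * T = 1\<^sub>m s" "Q = T * (int_diagonal s d * U)"
    using assms(1,2) by (rule int_diagonalizableE)
  obtain s' T' U' d' where T': "dim_row T' = n" "dim_col T' = s'" "dim_row U' = s'" "dim_col U' = n"
    "T' * U' = 1\<^sub>m n" "U' * T' = 1\<^sub>m s'" "R = T' * (int_diagonal s' d' * U')"
    using assms(3,4) by (rule int_diagonalizableE)
  have one: "1\<^sub>m n = T' * (1\<^sub>m s' * U')" "1\<^sub>m m = T * (1\<^sub>m s * U)"
    using T T' by (simp_all add: mat_algebra)
  show ?thesis
  proof (rule int_diagonalizableI[where n = "m * n" and s = "s * s'"])
    show "kronecker T T' * kronecker U U' = 1\<^sub>m (m * n)" using T T' by (simp add: kronecker_mult kronecker_one)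
    show "kronecker U U' * kronecker T T' = 1\<^sub>m (s * s')" using T T' by (simp add: kronecker_mult kronecker_one)
    have D: "int_diagonal (s * s') (\<lambda>k. d (k div s') + d' (k mod s'))
        = kronecker (int_diagonal s d) (1\<^sub>m s') + kronecker (1\<^sub>m s) (int_diagonal s' d' :: 'k mat)"
    proof (intro eq_matI, goal_cases)
      case (1 i j)
      then have ij: "i < s * s'" "j < s * s'" by auto
      have "i = j \<longleftrightarrow> i div s' = j div s' \<and> i mod s' = j mod s'" by (metis div_mult_mod_eq)
      then show ?case
        using ij pair_index_bounds[OF ij(1)] pair_index_bounds[OF ij(2)]
        by (auto simp: kronecker_entry int_diagonal_def)
    qed auto
    show "kronecker Q (1\<^sub>m n) + kronecker (1\<^sub>m m) R
        = kronecker T T' * (int_diagonal (s * s') (\<lambda>k. d (k div s') + d' (k mod s')) * kronecker U U')"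
      unfolding T(7) T'(7) D one using T(1-4) T'(1-4)
      by (simp add: mat_dist_left mat_dist_right kronecker_mult)
  qed (use T T' in auto)
qed

text \<open>For an object and its dual, the actions of \<open>h\<^sup>2\<close> are related in this way.\<close>

lemma int_diagonalizable_neg_transpose:
  fixes Q :: "'k::field_char_0 mat"
  assumes "int_diagonalizable Q" "Q \<in> carrier_mat n n"
  shows "int_diagonalizable ((-1) \<cdot>\<^sub>m transpose_mat Q)"
proof -
  obtain s T U d where T: "dim_row T = n" "dim_col T = s" "dim_row U = s" "dim_col U = n"
    "T * U = 1\<^sub>m n" "U * T = 1\<^sub>m s" "Q = T * (int_diagonal s d * U)"
    using assms by (rule int_diagonalizableE)
  have tr: "transpose_mat (A * B) = transpose_mat B * transpose_mat A" if "dim_col A = dim_row B" for A B :: "'k mat"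
    using that by (intro transpose_mult[of _ "dim_row A" "dim_col A" _ "dim_col B"]) auto
  show ?thesis
  proof (rule int_diagonalizableI[where n = n and s = s])
    show "transpose_mat U * transpose_mat T = 1\<^sub>m n" using T by (simp add: tr[symmetric])
    show "transpose_mat T * transpose_mat U = 1\<^sub>m s" using T by (simp add: tr[symmetric])
    have D: "int_diagonal s (\<lambda>i. - d i) = (-1) \<cdot>\<^sub>m transpose_mat (int_diagonal s d :: 'k mat)"
      by (auto simp: int_diagonal_def intro!: eq_matI)
    show "(-1) \<cdot>\<^sub>m transpose_mat Q = transpose_mat U * (int_diagonal s (\<lambda>i. - d i) * transpose_mat T)"
      unfolding D T(7) using T(1-4) by (simp add: tr mat_algebra)
  qed (use T in auto)
qed

subsection \<open>Comparison with similarity to a diagonal matrix\<close>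

lemma int_diagonalizable_iff:
  fixes Q :: "'k::field_char_0 mat"
  assumes Q: "Q \<in> carrier_mat n n"
  shows "int_diagonalizable Q \<longleftrightarrow> diagonalizable Q \<and> (\<forall>e. eigenvalue Q e \<longrightarrow> e \<in> \<int>)"
proof -
  have ev: "eigenvalue Q e \<longleftrightarrow> (\<exists>i<n. e = D $$ (i, i))"
    if "similar_mat Q D" "diagonal_mat D" for D e
  proof -
    have D: "D \<in> carrier_mat n n" using that(1) Q
      unfolding similar_mat_def similar_mat_wit_def Let_def by auto
    have "upper_triangular D" using that(2) D by (auto simp: diagonal_mat_def)
    then have "char_poly D = (\<Prod>a\<leftarrow>diag_mat D. [:- a, 1:])"
      by (rule char_poly_upper_triangular[OF D])
    moreover have "char_poly Q = char_poly D" using that(1) by (rule char_poly_similar)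
    ultimately have "eigenvalue Q e \<longleftrightarrow> poly (\<Prod>a\<leftarrow>diag_mat D. [:- a, 1:]) e = 0"
      using eigenvalue_root_char_poly[OF Q] by simp
    also have "\<dots> \<longleftrightarrow> e \<in> set (diag_mat D)"
      by (auto simp: poly_prod_list prod_list_zero_iff)
    also have "\<dots> \<longleftrightarrow> (\<exists>i<n. e = D $$ (i, i))" using D by (auto simp: diag_mat_def)
    finally show ?thesis .
  qed
  show ?thesis
  proof
    assume "int_diagonalizable Q"
    then obtain s T U d where T: "dim_row T = n" "dim_col T = s" "dim_row U = s" "dim_col U = n"
      "T * U = 1\<^sub>m n" "U * T = 1\<^sub>m s" "Q = T * (int_diagonal s d * U)"
      using Q by (rule int_diagonalizableE)
    have s: "s = n" by (rule inverse_mats_square[OF carrier_matI[OF T(3,4)] carrier_matI[OF T(1,2)] T(6,5)])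
    have "similar_mat_wit Q (int_diagonal n d) T U"
    proof (rule similar_mat_witI[of _ _ n])
      show "Q = T * int_diagonal n d * U" unfolding T(7) using T(1-4) s by (simp add: mat_assoc)
    qed (use T Q s in auto)
    then have sim: "similar_mat Q (int_diagonal n d)" unfolding similar_mat_def by blast
    moreover have diag: "diagonal_mat (int_diagonal n d :: 'k mat)" by (auto simp: diagonal_mat_def int_diagonal_def)
    ultimately show "diagonalizable Q \<and> (\<forall>e. eigenvalue Q e \<longrightarrow> e \<in> \<int>)"
      unfolding diagonalizable_def ev[OF sim diag] by (auto simp: int_diagonal_def)
  next
    assume R: "diagonalizable Q \<and> (\<forall>e. eigenvalue Q e \<longrightarrow> e \<in> \<int>)"
    then obtain D where D: "diagonal_mat D" "similar_mat Q D" unfolding diagonalizable_def by blast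
    have "\<forall>i\<in>{..<n}. \<exists>k. D $$ (i, i) = of_int k"
      using R ev[OF D(2,1)] by (auto elim!: Ints_cases)
    then obtain d where d: "\<And>i. i < n \<Longrightarrow> D $$ (i, i) = of_int (d i)" by (metis lessThan_iff)
    obtain T U where T: "similar_mat_wit Q D T U" using D(2) unfolding similar_mat_def by blast
    then have T: "T \<in> carrier_mat n n" "U \<in> carrier_mat n n" "D \<in> carrier_mat n n" "T * U = 1\<^sub>m n" "U * T = 1\<^sub>m n" "Q = T * D * U"
      using Q unfolding similar_mat_wit_def Let_def by auto
    have "D = int_diagonal n d" using T(3) D(1) d
      by (auto simp: int_diagonal_def diagonal_mat_def intro!: eq_matI)
    with T show "int_diagonalizable Q"
      by (intro int_diagonalizableI[of T n n U Q d]) (auto simp: mat_algebra)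
  qed
qed

subsection \<open>Spectral projections\<close>

text \<open>Idempotency and orthogonality of the \<open>P N\<close> follow from these conditions, as does the vanishing of \<open>P N\<close> for
  \<open>N\<close> outside \<open>I\<close>.  Only the short list of equations has to be checked when such a family is constructed.\<close>

definition spectral_family :: "nat \<Rightarrow> 'k::comm_ring_1 mat \<Rightarrow> int set \<Rightarrow> (int \<Rightarrow> 'k mat) \<Rightarrow> bool" where
  "spectral_family n Q I P \<longleftrightarrow> finite I \<and> Q \<in> carrier_mat n n \<and> (\<forall>N. P N \<in> carrier_mat n n) \<and>
     msum n n P I = 1\<^sub>m n \<and> (\<forall>N. Q * P N = of_int N \<cdot>\<^sub>m P N \<and> P N * Q = of_int N \<cdot>\<^sub>m P N)"

lemma spectral_family_exists:
  fixes Q :: "'k::field_char_0 mat"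
  assumes "int_diagonalizable Q" "Q \<in> carrier_mat n n"
  shows "\<exists>I P. spectral_family n Q I P"
proof -
  obtain s T U d where T: "dim_row T = n" "dim_col T = s" "dim_row U = s" "dim_col U = n"
    "T * U = 1\<^sub>m n" "U * T = 1\<^sub>m s" "Q = T * (int_diagonal s d * U)"
    using assms by (rule int_diagonalizableE)
  define B where "B N = (int_diagonal s (\<lambda>i. if d i = N then 1 else 0) :: 'k mat)" for N
  define P where "P N = T * (B N * U)" for N
  define I where "I = d ` {..<s}"
  have dB: "dim_row (B N) = s" "dim_col (B N) = s" for N by (auto simp: B_def)
  have dP: "dim_row (P N) = n" "dim_col (P N) = n" for N by (auto simp: P_def T)
  have DD: "int_diagonal s e * int_diagonal s e' = (int_diagonal s (\<lambda>i. e i * e' i) :: 'k mat)" for e e'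
    by (intro eq_matI) (auto simp: int_diagonal_mult_entry, auto simp: int_diagonal_def)
  have cancel: "U * (T * Y) = Y" if "dim_row Y = s" for Y
    using that T(1-6) by (simp add: mat_assoc[symmetric] mat_one_left)
  have DB: "int_diagonal s d * B N = of_int N \<cdot>\<^sub>m B N" "B N * int_diagonal s d = of_int N \<cdot>\<^sub>m B N" for N
    unfolding B_def DD by (auto simp: int_diagonal_def intro!: eq_matI)
  have "Q * P N = T * ((int_diagonal s d * B N) * U)" "P N * Q = T * ((B N * int_diagonal s d) * U)" for N
    unfolding P_def T(7) using T(1-4) by (simp_all add: mat_algebra dB cancel)
  then have QP: "Q * P N = of_int N \<cdot>\<^sub>m P N" "P N * Q = of_int N \<cdot>\<^sub>m P N" for N
    unfolding DB P_def using T(1-4) by (simp_all add: mat_algebra dB)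
  have B: "B N \<in> carrier_mat s s" and BU: "B N * U \<in> carrier_mat s n" and PC: "P N \<in> carrier_mat n n" for N
    by (intro carrier_matI; simp add: dB dP T(1-4))+
  have "msum n n P I = T * msum s n (\<lambda>N. B N * U) I"
    unfolding P_def using T(1,2) by (subst msum_mult_left[OF BU]) simp_all
  also have "msum s n (\<lambda>N. B N * U) I = msum s s B I * U"
    using T(3,4) by (subst msum_mult_right[OF B]) simp_all
  also have "msum s s B I = 1\<^sub>m s"
  proof (intro eq_matI, goal_cases)
    case (1 i j)
    then have "msum s s B I $$ (i, j) = (\<Sum>N\<in>I. if N = d i then (if i = j then 1 else 0) else 0)"
      by (auto simp: msum_def B_def int_diagonal_def intro!: sum.cong)
    with 1 show ?case by (auto simp: I_def sum.delta)
  qed auto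
  finally have "msum n n P I = 1\<^sub>m n" using T(1-5) by (simp add: mat_algebra)
  with QP assms(2) dP show ?thesis
    by (intro exI[of _ I] exI[of _ P]) (auto simp: spectral_family_def I_def PC)
qed

text \<open>The product of the \<open>Q - i\<close> over \<open>I\<close> kills every \<open>P N\<close>, hence also their sum, which is \<open>1\<close>.\<close>

lemma spectral_family_root_product:
  assumes "spectral_family n Q I P"
  shows "root_product (sorted_list_of_set I) Q = 0\<^sub>m n n"
proof -
  note a = assms[unfolded spectral_family_def]
  let ?R = "root_product (sorted_list_of_set I) Q"
  have dR: "dim_row ?R = n" "dim_col ?R = n" using a by auto
  have RP: "?R * P N = 0\<^sub>m n n" if "N \<in> I" for N
  proof -
    have PN: "P N \<in> carrier_mat n n" using a by blast
    have "?R * P N = of_int (\<Prod>i\<leftarrow>sorted_list_of_set I. N - i) \<cdot>\<^sub>m P N"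
      using a PN by (intro root_product_eigen[of _ n _ n]) auto
    moreover have "(\<Prod>i\<leftarrow>sorted_list_of_set I. N - i) = 0" using a that by (auto simp: prod_list_zero_iff)
    ultimately have "?R * P N = 0 \<cdot>\<^sub>m P N" by simp
    also have "\<dots> = 0\<^sub>m n n" using PN by (intro eq_matI) auto
    finally show ?thesis .
  qed
  have "?R = ?R * msum n n P I" using a dR by (simp add: mat_one_right)
  also have "\<dots> = msum n n (\<lambda>N. ?R * P N) I" using a dR by (subst msum_mult_left) auto
  also have "\<dots> = msum n n (\<lambda>N. 0\<^sub>m n n) I" by (rule msum_cong) (rule RP)
  also have "\<dots> = 0\<^sub>m n n" by (auto simp: msum_def intro!: eq_matI)
  finally show ?thesis .
qed

text \<open>An intertwiner preserves eigenvalues, so \<open>P' L * F * P N\<close> vanishes for \<open>L \<noteq> N\<close>.\<close>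

lemma spectral_family_intertwine:
  fixes Q :: "'k::field_char_0 mat"
  assumes P: "spectral_family m Q I P" and P': "spectral_family n Q' I' P'"
    and F: "F \<in> carrier_mat n m" and QF: "F * Q = Q' * F"
  shows "F * P N = P' N * F"
proof -
  note p = P[unfolded spectral_family_def] and p' = P'[unfolded spectral_family_def]
  have dims: "dim_row (P N) = m" "dim_col (P N) = m" "dim_row (P' N) = n" "dim_col (P' N) = n"
    "dim_row Q = m" "dim_col Q = m" "dim_row Q' = n" "dim_col Q' = n" "dim_row F = n" "dim_col F = m" for N
    using p p' F by auto
  have off: "P' L * (F * P N) = 0\<^sub>m n m" if "L \<noteq> N" for L N
  proof -
    have "of_int N \<cdot>\<^sub>m (P' L * (F * P N)) = P' L * (F * (Q * P N))" using p by (simp add: mat_algebra dims)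
    also have "\<dots> = P' L * ((F * Q) * P N)" by (simp add: mat_algebra dims)
    also have "\<dots> = (P' L * Q') * (F * P N)" unfolding QF by (simp add: mat_algebra dims)
    also have "\<dots> = of_int L \<cdot>\<^sub>m (P' L * (F * P N))" using p' by (simp add: mat_algebra dims)
    finally have eq: "of_int N \<cdot>\<^sub>m (P' L * (F * P N)) = of_int L \<cdot>\<^sub>m (P' L * (F * P N))" .
    show ?thesis
    proof (intro eq_matI)
      fix i j assume "i < dim_row (0\<^sub>m n m :: 'k mat)" "j < dim_col (0\<^sub>m n m :: 'k mat)"
      moreover from this have "of_int N * (P' L * (F * P N)) $$ (i, j) = of_int L * (P' L * (F * P N)) $$ (i, j)"
        using arg_cong[OF eq, of "\<lambda>M. M $$ (i, j)"] by (simp add: dims)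
      ultimately show "(P' L * (F * P N)) $$ (i, j) = 0\<^sub>m n m $$ (i, j)"
        using that by (simp add: mult_cancel_right)
    qed (auto simp: dims)
  qed
  have fin: "finite I" "finite I'" using p p' by auto
  have c: "P' N * (F * P N) \<in> carrier_mat n m" by (intro carrier_matI; simp add: dims)
  have "F * P N = msum n n P' I' * (F * P N)" using p' by (simp add: mat_algebra dims)
  also have "\<dots> = msum n m (\<lambda>L. P' L * (F * P N)) I'" using p' dims by (subst msum_mult_right) auto
  also have "\<dots> = (if N \<in> I' then P' N * (F * P N) else 0\<^sub>m n m)"
    using fin c by (intro msum_delta) (auto intro: off)
  finally have eq: "F * P N = (if N \<in> I' then P' N * (F * P N) else 0\<^sub>m n m)" .
  have 1: "F * P N = P' N * (F * P N)"
  proof (cases "N \<in> I'")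
    case False
    then have "F * P N = 0\<^sub>m n m" using eq by simp
    then show ?thesis by (simp add: mat_zero_right dims)
  qed (use eq in simp)
  have "P' N * F = (P' N * F) * msum m m P I" using p by (simp add: mat_algebra dims)
  also have "\<dots> = msum n m (\<lambda>L. (P' N * F) * P L) I" using p dims by (subst msum_mult_left) auto
  also have "\<dots> = msum n m (\<lambda>L. P' N * (F * P L)) I" by (intro msum_cong) (simp add: mat_assoc dims)
  also have "\<dots> = (if N \<in> I then P' N * (F * P N) else 0\<^sub>m n m)"
    using fin c by (intro msum_delta) (auto intro: off)
  finally have eq: "P' N * F = (if N \<in> I then P' N * (F * P N) else 0\<^sub>m n m)" .
  have 2: "P' N * F = P' N * (F * P N)"
  proof (cases "N \<in> I")
    case False
    then have "P' N * F = 0\<^sub>m n m" using eq by simp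
    then show ?thesis by (simp add: mat_assoc[symmetric] mat_zero_left dims)
  qed (use eq in simp)
  from 1 2 show ?thesis by simp
qed

text \<open>Different eigenvalues force \<open>P N * P L = 0\<close>; as the projections sum to \<open>1\<close>, each of them is then
  idempotent.\<close>

lemma spectral_family_orthogonal:
  fixes Q :: "'k::field_char_0 mat"
  assumes P: "spectral_family n Q I P"
  shows "P N * P L = (if N = L then P N else 0\<^sub>m n n)"
proof -
  note p = P[unfolded spectral_family_def]
  have dims: "dim_row (P N) = n" "dim_col (P N) = n" "dim_row Q = n" "dim_col Q = n" for N using p by auto
  have off: "P N * P L = 0\<^sub>m n n" if "N \<noteq> L" for N L
  proof -
    have "of_int L \<cdot>\<^sub>m (P N * P L) = P N * (Q * P L)" using p by (simp add: mat_algebra dims)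
    also have "\<dots> = (P N * Q) * P L" by (simp add: mat_algebra dims)
    also have "\<dots> = of_int N \<cdot>\<^sub>m (P N * P L)" using p by (simp add: mat_algebra dims)
    finally have eq: "of_int L \<cdot>\<^sub>m (P N * P L) = of_int N \<cdot>\<^sub>m (P N * P L)" .
    show ?thesis
    proof (intro eq_matI)
      fix i j assume "i < dim_row (0\<^sub>m n n :: 'k mat)" "j < dim_col (0\<^sub>m n n :: 'k mat)"
      moreover from this have "of_int L * (P N * P L) $$ (i, j) = of_int N * (P N * P L) $$ (i, j)"
        using arg_cong[OF eq, of "\<lambda>M. M $$ (i, j)"] by (simp add: dims)
      ultimately show "(P N * P L) $$ (i, j) = 0\<^sub>m n n $$ (i, j)"
        using that by (simp add: mult_cancel_right)
    qed (auto simp: dims)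
  qed
  have "P N = msum n n P I * P N" using p by (simp add: mat_algebra dims)
  also have "\<dots> = msum n n (\<lambda>L. P L * P N) I" using p dims by (subst msum_mult_right) auto
  also have "\<dots> = (if N \<in> I then P N * P N else 0\<^sub>m n n)"
  proof (rule msum_delta)
    show "finite I" using p by blast
    show "P N * P N \<in> carrier_mat n n" by (intro carrier_matI; simp add: dims)
  qed (rule off)
  finally have eq: "(if N \<in> I then P N * P N else 0\<^sub>m n n) = P N" by (rule sym)
  have "P N * P N = P N"
  proof (cases "N \<in> I")
    case False
    then have "P N = 0\<^sub>m n n" using eq by simp
    then show ?thesis by (simp add: mat_zero_left)
  qed (use eq in simp)
  with off show ?thesis by auto
qed

section \<open>Categories with the same morphisms\<close>

text \<open>A functor that is the identity on morphisms and surjective on objects, strictly compatible with all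
  the structure.  Both the module category and the comodule category are compared in this way with one
  category of pairs of matrices, and every notion of category theory is transported along such functors.\<close>

locale hom_identification =
  fixes D :: "('k::field, 'p, 'm, 'y) mon_cat_scheme" and C :: "('k, 'o, 'm, 'z) mon_cat_scheme"
    and V :: "'p \<Rightarrow> 'o"
  assumes obj: "V ` Obj D = Obj C"
    and hom: "X \<in> Obj D \<Longrightarrow> Y \<in> Obj D \<Longrightarrow> Hom D X Y = Hom C (V X) (V Y)"
    and comp: "g \<star>\<^bsub>D\<^esub> f = g \<star>\<^bsub>C\<^esub> f"
    and ident: "Id D X = Id C (V X)"
    and add: "Add D = Add C"
    and zero: "Zero D X Y = Zero C (V X) (V Y)"
    and scale: "Scale D c f = Scale C c f"
    and tens_closed: "X \<in> Obj D \<Longrightarrow> Y \<in> Obj D \<Longrightarrow> X \<boxtimes>\<^bsub>D\<^esub> Y \<in> Obj D"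
    and tens: "X \<in> Obj D \<Longrightarrow> Y \<in> Obj D \<Longrightarrow> V (X \<boxtimes>\<^bsub>D\<^esub> Y) = V X \<boxtimes>\<^bsub>C\<^esub> V Y"
    and tensm: "f \<boxtimes>\<^sub>m\<^bsub>D\<^esub> g = f \<boxtimes>\<^sub>m\<^bsub>C\<^esub> g"
    and unit_closed: "Unit D \<in> Obj D"
    and unit: "V (Unit D) = Unit C"
    and assoc: "Assoc D X Y Z = Assoc C (V X) (V Y) (V Z)"
    and lunit: "LUnit D X = LUnit C (V X)"
    and runit: "RUnit D X = RUnit C (V X)"
begin

lemma V_obj: "X \<in> Obj D \<Longrightarrow> V X \<in> Obj C"
  using obj by blast

lemma obj_lift: "Y \<in> Obj C \<Longrightarrow> \<exists>X\<in>Obj D. V X = Y"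
  by (metis imageE obj)

lemma ball_Obj: "(\<forall>X\<in>Obj C. P X) \<longleftrightarrow> (\<forall>X\<in>Obj D. P (V X))"
  unfolding obj[symmetric] by blast

lemmas structure_eqs = hom comp ident add zero scale tens_closed tens tensm unit_closed unit assoc lunit runit

lemma inverse_mor_iff: "X \<in> Obj D \<Longrightarrow> Y \<in> Obj D \<Longrightarrow>
    inverse_mor D X Y f g \<longleftrightarrow> inverse_mor C (V X) (V Y) f g"
  by (simp add: inverse_mor_def structure_eqs)

lemma iso_mor_iff: "X \<in> Obj D \<Longrightarrow> Y \<in> Obj D \<Longrightarrow> iso_mor D X Y f \<longleftrightarrow> iso_mor C (V X) (V Y) f"
  by (simp add: iso_mor_def inverse_mor_iff)

lemma mono_mor_iff: "X \<in> Obj D \<Longrightarrow> Y \<in> Obj D \<Longrightarrow> mono_mor D X Y f \<longleftrightarrow> mono_mor C (V X) (V Y) f"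
  by (simp add: mono_mor_def structure_eqs ball_Obj)

lemma epi_mor_iff: "X \<in> Obj D \<Longrightarrow> Y \<in> Obj D \<Longrightarrow> epi_mor D X Y f \<longleftrightarrow> epi_mor C (V X) (V Y) f"
  by (simp add: epi_mor_def structure_eqs ball_Obj)

lemma zero_object_iff: "X \<in> Obj D \<Longrightarrow> zero_object D X \<longleftrightarrow> zero_object C (V X)"
  by (simp add: zero_object_def structure_eqs ball_Obj V_obj)

lemma direct_sum_iff: "X \<in> Obj D \<Longrightarrow> Y \<in> Obj D \<Longrightarrow> P \<in> Obj D \<Longrightarrow>
    direct_sum D X Y P \<longleftrightarrow> direct_sum C (V X) (V Y) (V P)"
  by (simp add: direct_sum_def structure_eqs V_obj)

lemma is_kernel_iff: "X \<in> Obj D \<Longrightarrow> Y \<in> Obj D \<Longrightarrow> K \<in> Obj D \<Longrightarrow>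
    is_kernel D X Y f K k \<longleftrightarrow> is_kernel C (V X) (V Y) f (V K) k"
  by (simp add: is_kernel_def structure_eqs V_obj ball_Obj)

lemma is_cokernel_iff: "X \<in> Obj D \<Longrightarrow> Y \<in> Obj D \<Longrightarrow> Q \<in> Obj D \<Longrightarrow>
    is_cokernel D X Y f Q q \<longleftrightarrow> is_cokernel C (V X) (V Y) f (V Q) q"
  by (simp add: is_cokernel_def structure_eqs V_obj ball_Obj)

lemma left_dual_iff: "X \<in> Obj D \<Longrightarrow> Y \<in> Obj D \<Longrightarrow> left_dual D X Y \<longleftrightarrow> left_dual C (V X) (V Y)"
  by (simp add: left_dual_def inverse_mor_iff structure_eqs)

lemma simple_object_iff: "X \<in> Obj D \<Longrightarrow> simple_object D X \<longleftrightarrow> simple_object C (V X)"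
  by (simp add: simple_object_def zero_object_iff V_obj ball_Obj mono_mor_iff iso_mor_iff)

text \<open>Every object that occurs in a semisimple decomposition is an object of the category, so \<open>V\<close> maps the
  decomposition summand by summand.\<close>

lemma semisimple_object_transfer:
  "semisimple_object D X \<Longrightarrow> X \<in> Obj D \<Longrightarrow> semisimple_object C (V X)"
proof (induction rule: semisimple_object.induct)
  case (1 X)
  then show ?case by (auto simp: zero_object_iff intro: semisimple_object.intros(1))
next
  case (2 X Y P)
  have "semisimple_object D X \<Longrightarrow> X \<in> Obj D" for X
    by (induction rule: semisimple_object.induct) (auto simp: zero_object_def direct_sum_def)
  with 2 have X: "X \<in> Obj D" by blast
  have Y: "Y \<in> Obj D" using 2 by (simp add: simple_object_def)
  have "semisimple_object C (V X)" using 2 X by blast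
  moreover have "simple_object C (V Y)" using 2(2) simple_object_iff[OF Y] by blast
  moreover have "direct_sum C (V X) (V Y) (V P)" using 2(3) direct_sum_iff[OF X Y 2(5)] by blast
  ultimately show ?case by (rule semisimple_object.intros(2))
qed

lemma linear_category_transport:
  assumes "linear_category C"
  shows "linear_category D"
proof -
  interpret C: linear_category C by fact
  note C_rules = C.id_hom C.comp_hom C.comp_id C.id_comp C.comp_assoc C.hom_group C.scale_hom
    C.scale_add_right C.scale_add_left C.scale_scale C.scale_one C.comp_add_left C.comp_add_right
    C.comp_scale_left C.comp_scale_right
  show ?thesis
    by (rule linear_category.intro; simp add: structure_eqs; blast intro: C_rules dest: V_obj)
qed

lemma monoidal_category_transport:
  assumes "monoidal_category C"
  shows "monoidal_category D"
proof -
  interpret C: monoidal_category C by fact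
  have tens_scale: "Scale C c f \<boxtimes>\<^sub>m\<^bsub>C\<^esub> g = Scale C c (f \<boxtimes>\<^sub>m\<^bsub>C\<^esub> g)" "f \<boxtimes>\<^sub>m\<^bsub>C\<^esub> Scale C c g = Scale C c (f \<boxtimes>\<^sub>m\<^bsub>C\<^esub> g)"
    if "X \<in> Obj C" "X' \<in> Obj C" "Y \<in> Obj C" "Y' \<in> Obj C" "f \<in> Hom C X X'" "g \<in> Hom C Y Y'" for X X' Y Y' f g c
    using C.tens_scale[OF that] by blast+
  note C_rules = C.tens_hom C.tens_id C.tens_comp C.tens_add_left C.tens_add_right tens_scale C.assoc_iso
    C.assoc_natural C.lunit_iso C.lunit_natural C.runit_iso C.runit_natural C.pentagon C.triangle
  show ?thesis
  proof (rule monoidal_category.intro)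
    show "linear_category D" by (rule linear_category_transport) unfold_locales
    show "monoidal_category_axioms D"
      by (rule monoidal_category_axioms.intro; simp add: structure_eqs iso_mor_iff;
          (blast intro: C_rules dest: V_obj)?)
  qed
qed

lemma abelian_category_transport:
  assumes "abelian_category C"
  shows "abelian_category D"
proof -
  interpret C: abelian_category C by fact
  show ?thesis
  proof (rule abelian_category.intro)
    show "linear_category D" by (rule linear_category_transport) unfold_locales
    show "abelian_category_axioms D"
    proof
      obtain Z where "zero_object C Z" using C.has_zero_object by blast
      moreover then have "Z \<in> Obj C" by (simp add: zero_object_def)
      ultimately show "\<exists>Z. zero_object D Z" using obj_lift zero_object_iff by blast
    next
      fix X Y assume XY: "X \<in> Obj D" "Y \<in> Obj D"
      obtain P where P: "direct_sum C (V X) (V Y) P" using C.has_direct_sums XY V_obj by blast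
      then have "P \<in> Obj C" by (simp add: direct_sum_def)
      then obtain P' where "P' \<in> Obj D" "V P' = P" using obj_lift by blast
      then show "\<exists>P. direct_sum D X Y P" using P XY direct_sum_iff by blast
    next
      fix X Y f assume XY: "X \<in> Obj D" "Y \<in> Obj D" and "f \<in> Hom D X Y"
      then have f: "f \<in> Hom C (V X) (V Y)" by (simp add: hom)
      obtain K k where K: "is_kernel C (V X) (V Y) f K k" using C.has_kernels XY V_obj f by blast
      then have "K \<in> Obj C" by (simp add: is_kernel_def)
      then obtain K' where "K' \<in> Obj D" "V K' = K" using obj_lift by blast
      then show "\<exists>K k. is_kernel D X Y f K k" using K XY is_kernel_iff by blast
      obtain Q q where Q: "is_cokernel C (V X) (V Y) f Q q" using C.has_cokernels XY V_obj f by blast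
      then have "Q \<in> Obj C" by (simp add: is_cokernel_def)
      then obtain Q' where "Q' \<in> Obj D" "V Q' = Q" using obj_lift by blast
      then show "\<exists>Q q. is_cokernel D X Y f Q q" using Q XY is_cokernel_iff by blast
    next
      fix X Y f assume XY: "X \<in> Obj D" "Y \<in> Obj D" and "mono_mor D X Y f"
      then have "mono_mor C (V X) (V Y) f" by (simp add: mono_mor_iff)
      then obtain Z g where Z: "Z \<in> Obj C" "g \<in> Hom C (V Y) Z" "is_kernel C (V Y) Z g (V X) f"
        using C.mono_normal XY V_obj by blast
      then obtain Z' where Z': "Z' \<in> Obj D" "V Z' = Z" using obj_lift by blast
      with Z XY have "g \<in> Hom D Y Z'" "is_kernel D Y Z' g X f" by (simp_all add: hom is_kernel_iff)
      with Z' show "\<exists>Z\<in>Obj D. \<exists>g\<in>Hom D Y Z. is_kernel D Y Z g X f" by blast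
    next
      fix X Y f assume XY: "X \<in> Obj D" "Y \<in> Obj D" and "epi_mor D X Y f"
      then have "epi_mor C (V X) (V Y) f" by (simp add: epi_mor_iff)
      then obtain Z g where Z: "Z \<in> Obj C" "g \<in> Hom C Z (V X)" "is_cokernel C Z (V X) g (V Y) f"
        using C.epi_normal XY V_obj by blast
      then obtain Z' where Z': "Z' \<in> Obj D" "V Z' = Z" using obj_lift by blast
      with Z XY have "g \<in> Hom D Z' X" "is_cokernel D Z' X g Y f" by (simp_all add: hom is_cokernel_iff)
      with Z' show "\<exists>Z\<in>Obj D. \<exists>g\<in>Hom D Z X. is_cokernel D Z X g Y f" by blast
    qed
  qed
qed

end

lemma hom_identification_full_subcategory:
  assumes "hom_identification D C V" and T: "T \<subseteq> Obj C" and unitT: "Unit C \<in> T"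
    and tensT: "\<And>X Y. X \<in> T \<Longrightarrow> Y \<in> T \<Longrightarrow> X \<boxtimes>\<^bsub>C\<^esub> Y \<in> T"
    and S: "S = {X \<in> Obj D. V X \<in> T}"
  shows "hom_identification (full_subcategory D S) (full_subcategory C T) V"
proof -
  interpret hom_identification D C V by fact
  have "V ` S = T" using T obj_lift unfolding S by (fastforce simp: image_iff)
  then show ?thesis
    by unfold_locales (auto simp: S structure_eqs unitT tensT)
qed

text \<open>Two categories that are identified with the same monoidal category are tensor equivalent: each object
  of one is sent to an object of the other with the same image, and all constraints are identities.\<close>

lemma tensor_equivalent_if_identified:
  assumes "monoidal_category C" "hom_identification D C V" "hom_identification E C U"
  shows "tensor_equivalent D E"
proof -
  interpret C: monoidal_category C by fact
  interpret D: hom_identification D C V by fact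
  interpret E: hom_identification E C U by fact
  interpret D': monoidal_category D by (rule D.monoidal_category_transport[OF assms(1)])
  interpret E': monoidal_category E by (rule E.monoidal_category_transport[OF assms(1)])
  define FO where "FO X = (SOME Y. Y \<in> Obj E \<and> U Y = V X)" for X
  have "FO X \<in> Obj E \<and> U (FO X) = V X" if "X \<in> Obj D" for X
    using someI_ex[of "\<lambda>Y. Y \<in> Obj E \<and> U Y = V X"] E.obj_lift[OF D.V_obj[OF that]]
    unfolding FO_def by blast
  then have FO: "X \<in> Obj D \<Longrightarrow> FO X \<in> Obj E" "X \<in> Obj D \<Longrightarrow> U (FO X) = V X" for X by auto
  have Id_iso: "inverse_mor E Y Y' (Id C (U Y)) (Id C (U Y))"
    if "Y \<in> Obj E" "Y' \<in> Obj E" "U Y = U Y'" for Y Y'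
    using that C.id_hom[of "U Y'"] C.comp_id[of "U Y'" "U Y'"] E.V_obj[of Y']
    by (simp add: inverse_mor_def E.structure_eqs)
  note eqs = D.structure_eqs E.structure_eqs FO D.V_obj
  show ?thesis
    unfolding tensor_equivalent_def
  proof (intro exI)
    show "tensor_equivalence D E FO (\<lambda>X Y f. f) (\<lambda>X Y. Id C (V X \<boxtimes>\<^bsub>C\<^esub> V Y)) (Id C (Unit C))"
    proof (rule tensor_equivalence.intro)
      show "tensor_equivalence_axioms D E FO (\<lambda>X Y f. f) (\<lambda>X Y. Id C (V X \<boxtimes>\<^bsub>C\<^esub> V Y)) (Id C (Unit C))"
      proof
        fix X assume X: "X \<in> Obj E"
        obtain Y where Y: "Y \<in> Obj D" "V Y = U X" using D.obj_lift[OF E.V_obj[OF X]] by blast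
        then have "iso_mor E (FO Y) X (Id C (U (FO Y)))"
          using Id_iso[of "FO Y" X] FO X unfolding iso_mor_def by auto
        with Y show "\<exists>Y\<in>Obj D. \<exists>f. iso_mor E (FO Y) X f" by blast
      next
        fix X Y assume XY: "X \<in> Obj D" "Y \<in> Obj D"
        show "bij_betw (\<lambda>f. f) (Hom D X Y) (Hom E (FO X) (FO Y))"
          using XY by (simp add: eqs bij_betw_def inj_on_def)
        have "U (FO X \<boxtimes>\<^bsub>E\<^esub> FO Y) = V X \<boxtimes>\<^bsub>C\<^esub> V Y" "U (FO (X \<boxtimes>\<^bsub>D\<^esub> Y)) = V X \<boxtimes>\<^bsub>C\<^esub> V Y"
          using XY by (simp_all add: eqs)
        then show "iso_mor E (FO X \<boxtimes>\<^bsub>E\<^esub> FO Y) (FO (X \<boxtimes>\<^bsub>D\<^esub> Y)) (Id C (V X \<boxtimes>\<^bsub>C\<^esub> V Y))"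
          using Id_iso[of "FO X \<boxtimes>\<^bsub>E\<^esub> FO Y" "FO (X \<boxtimes>\<^bsub>D\<^esub> Y)"] XY
          unfolding iso_mor_def by (auto simp: eqs)
      next
        fix X X' Y Y' f g
        assume XY: "X \<in> Obj D" "X' \<in> Obj D" "Y \<in> Obj D" "Y' \<in> Obj D"
          and "f \<in> Hom D X X'" "g \<in> Hom D Y Y'"
        then have "f \<in> Hom C (V X) (V X')" "g \<in> Hom C (V Y) (V Y')" by (simp_all add: D.hom)
        then have fg: "f \<boxtimes>\<^sub>m\<^bsub>C\<^esub> g \<in> Hom C (V X \<boxtimes>\<^bsub>C\<^esub> V Y) (V X' \<boxtimes>\<^bsub>C\<^esub> V Y')"
          using XY by (intro C.tens_hom) (simp_all add: D.V_obj)
        show "(f \<boxtimes>\<^sub>m\<^bsub>D\<^esub> g) \<star>\<^bsub>E\<^esub> Id C (V X \<boxtimes>\<^bsub>C\<^esub> V Y) = Id C (V X' \<boxtimes>\<^bsub>C\<^esub> V Y') \<star>\<^bsub>E\<^esub> (f \<boxtimes>\<^sub>m\<^bsub>E\<^esub> g)"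
          using XY C.comp_id[OF _ _ fg] C.id_comp[OF _ _ fg] by (simp add: eqs C.tens_obj)
      next
        show "iso_mor E (Unit E) (FO (Unit D)) (Id C (Unit C))"
          using Id_iso[of "Unit E" "FO (Unit D)"] unfolding iso_mor_def by (auto simp: eqs)
      next
        fix X Y Z assume XYZ: "X \<in> Obj D" "Y \<in> Obj D" "Z \<in> Obj D"
        have o: "(V X \<boxtimes>\<^bsub>C\<^esub> V Y) \<boxtimes>\<^bsub>C\<^esub> V Z \<in> Obj C" "V X \<boxtimes>\<^bsub>C\<^esub> V Y \<boxtimes>\<^bsub>C\<^esub> V Z \<in> Obj C"
          using XYZ by (simp_all add: D.V_obj C.tens_obj)
        have a: "Assoc C (V X) (V Y) (V Z) \<in> Hom C ((V X \<boxtimes>\<^bsub>C\<^esub> V Y) \<boxtimes>\<^bsub>C\<^esub> V Z) (V X \<boxtimes>\<^bsub>C\<^esub> V Y \<boxtimes>\<^bsub>C\<^esub> V Z)"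
          using C.assoc_iso[of "V X" "V Y" "V Z"] XYZ by (auto simp: iso_mor_def inverse_mor_def D.V_obj)
        show "Assoc D X Y Z \<star>\<^bsub>E\<^esub> Id C (V (X \<boxtimes>\<^bsub>D\<^esub> Y) \<boxtimes>\<^bsub>C\<^esub> V Z)
            \<star>\<^bsub>E\<^esub> (Id C (V X \<boxtimes>\<^bsub>C\<^esub> V Y) \<boxtimes>\<^sub>m\<^bsub>E\<^esub> Id E (FO Z))
          = Id C (V X \<boxtimes>\<^bsub>C\<^esub> V (Y \<boxtimes>\<^bsub>D\<^esub> Z))
            \<star>\<^bsub>E\<^esub> (Id E (FO X) \<boxtimes>\<^sub>m\<^bsub>E\<^esub> Id C (V Y \<boxtimes>\<^bsub>C\<^esub> V Z)) \<star>\<^bsub>E\<^esub> Assoc E (FO X) (FO Y) (FO Z)"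
          using XYZ o C.comp_id[OF o a] C.id_comp[OF o a] C.comp_id[OF o(1) o(1) C.id_hom]
          by (simp add: eqs C.tens_obj C.tens_id)
      next
        fix X assume X: "X \<in> Obj D"
        have o: "Unit C \<boxtimes>\<^bsub>C\<^esub> V X \<in> Obj C" "V X \<boxtimes>\<^bsub>C\<^esub> Unit C \<in> Obj C" "V X \<in> Obj C"
          using X by (simp_all add: D.V_obj C.tens_obj C.unit_obj)
        have l: "LUnit C (V X) \<in> Hom C (Unit C \<boxtimes>\<^bsub>C\<^esub> V X) (V X)" "RUnit C (V X) \<in> Hom C (V X \<boxtimes>\<^bsub>C\<^esub> Unit C) (V X)"
          using C.lunit_iso[OF o(3)] C.runit_iso[OF o(3)] by (auto simp: iso_mor_def inverse_mor_def)
        show "LUnit E (FO X) = LUnit D X \<star>\<^bsub>E\<^esub> Id C (V (Unit D) \<boxtimes>\<^bsub>C\<^esub> V X) \<star>\<^bsub>E\<^esub> (Id C (Unit C) \<boxtimes>\<^sub>m\<^bsub>E\<^esub> Id E (FO X))"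
          using X o C.comp_id[OF o(1,3) l(1)] C.comp_id[OF o(1) o(1) C.id_hom]
          by (simp add: eqs C.tens_id C.unit_obj)
        show "RUnit E (FO X) = RUnit D X \<star>\<^bsub>E\<^esub> Id C (V X \<boxtimes>\<^bsub>C\<^esub> V (Unit D)) \<star>\<^bsub>E\<^esub> (Id E (FO X) \<boxtimes>\<^sub>m\<^bsub>E\<^esub> Id C (Unit C))"
          using X o C.comp_id[OF o(2,3) l(2)] C.comp_id[OF o(2) o(2) C.id_hom]
          by (simp add: eqs C.tens_id C.unit_obj)
      qed (simp_all add: eqs)
    qed unfold_locales
  qed
qed

subsection \<open>Full subcategories\<close>

lemma linear_category_full_subcategory:
  assumes "linear_category C" "T \<subseteq> Obj C"
  shows "linear_category (full_subcategory C T)"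
proof -
  interpret linear_category C by fact
  note rules = id_hom comp_hom comp_id id_comp comp_assoc hom_group scale_hom scale_add_right
    scale_add_left scale_scale scale_one comp_add_left comp_add_right comp_scale_left comp_scale_right
  show ?thesis
    by (rule linear_category.intro; simp; blast intro: rules dest: subsetD[OF assms(2)])
qed

lemma monoidal_category_full_subcategory:
  assumes "monoidal_category C" and T: "T \<subseteq> Obj C" and unit: "Unit C \<in> T"
    and tens: "\<And>X Y. X \<in> T \<Longrightarrow> Y \<in> T \<Longrightarrow> X \<boxtimes>\<^bsub>C\<^esub> Y \<in> T"
  shows "monoidal_category (full_subcategory C T)"
proof -
  interpret monoidal_category C by fact
  have iso: "iso_mor (full_subcategory C T) X Y f \<longleftrightarrow> iso_mor C X Y f" for X Y f
    by (simp add: iso_mor_def inverse_mor_def)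
  have T': "X \<in> T \<Longrightarrow> X \<in> Obj C" for X using T by blast
  show ?thesis
    by (rule monoidal_category.intro[OF linear_category_full_subcategory[OF linear_category_axioms T]],
        rule monoidal_category_axioms.intro; simp add: iso unit tens;
        (rule tens_hom tens_id tens_comp tens_add_left tens_add_right tens_scale assoc_iso assoc_natural
          lunit_iso lunit_natural runit_iso runit_natural pentagon triangle; (assumption | rule T'; assumption)))
qed

subsection \<open>Tensor subcategories\<close>

text \<open>By uniqueness of kernels, one kernel in the big category that lies in the full subcategory
  suffices for all kernels of the subcategory to be kernels in the big category.\<close>

lemma kernel_in_full_subcategory:
  assumes "linear_category C" and T: "T \<subseteq> Obj C" and XY: "X \<in> T" "Y \<in> T" "f \<in> Hom C X Y"
    and K0: "K0 \<in> T" "is_kernel C X Y f K0 k0"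
    and K: "is_kernel (full_subcategory C T) X Y f K k"
  shows "is_kernel C X Y f K k"
proof -
  interpret C: linear_category C by fact
  have k0: "k0 \<in> Hom C K0 X" "f \<star>\<^bsub>C\<^esub> k0 = Zero C K0 Y"
    and u0: "\<And>Z u. Z \<in> Obj C \<Longrightarrow> u \<in> Hom C Z X \<Longrightarrow> f \<star>\<^bsub>C\<^esub> u = Zero C Z Y \<Longrightarrow> \<exists>!v. v \<in> Hom C Z K0 \<and> k0 \<star>\<^bsub>C\<^esub> v = u"
    using K0(2) by (auto simp: is_kernel_def)
  have k: "K \<in> T" "k \<in> Hom C K X" "f \<star>\<^bsub>C\<^esub> k = Zero C K Y"
    and u: "\<And>Z u. Z \<in> T \<Longrightarrow> u \<in> Hom C Z X \<Longrightarrow> f \<star>\<^bsub>C\<^esub> u = Zero C Z Y \<Longrightarrow> \<exists>!v. v \<in> Hom C Z K \<and> k \<star>\<^bsub>C\<^esub> v = u"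
    using K by (auto simp: is_kernel_def)
  have o: "X \<in> Obj C" "Y \<in> Obj C" "K \<in> Obj C" "K0 \<in> Obj C" using T XY k(1) K0(1) by auto
  obtain v where v: "v \<in> Hom C K K0" "k0 \<star>\<^bsub>C\<^esub> v = k" using u0[OF o(3) k(2,3)] by blast
  obtain w where w: "w \<in> Hom C K0 K" "k \<star>\<^bsub>C\<^esub> w = k0" using u[OF K0(1) k0] by blast
  have "w \<star>\<^bsub>C\<^esub> v = Id C K"
  proof -
    have "w \<star>\<^bsub>C\<^esub> v \<in> Hom C K K" "k \<star>\<^bsub>C\<^esub> (w \<star>\<^bsub>C\<^esub> v) = k"
      using C.comp_hom[OF o(3,4,3) v(1) w(1)] C.comp_assoc[OF o(3,4,3,1) v(1) w(1) k(2)] v w by simp_all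
    moreover have "Id C K \<in> Hom C K K" "k \<star>\<^bsub>C\<^esub> Id C K = k"
      using C.id_hom[OF o(3)] C.comp_id[OF o(3,1) k(2)] by simp_all
    ultimately show ?thesis using u[OF k(1,2,3)] by blast
  qed
  note wv = this
  show ?thesis
    unfolding is_kernel_def
  proof (intro conjI ballI impI)
    fix Z t assume Z: "Z \<in> Obj C" "t \<in> Hom C Z X" "f \<star>\<^bsub>C\<^esub> t = Zero C Z Y"
    obtain s where s: "s \<in> Hom C Z K0" "k0 \<star>\<^bsub>C\<^esub> s = t" using u0[OF Z] by blast
    show "\<exists>!v. v \<in> Hom C Z K \<and> k \<star>\<^bsub>C\<^esub> v = t"
    proof (rule ex1I[of _ "w \<star>\<^bsub>C\<^esub> s"])
      show "w \<star>\<^bsub>C\<^esub> s \<in> Hom C Z K \<and> k \<star>\<^bsub>C\<^esub> (w \<star>\<^bsub>C\<^esub> s) = t"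
        using C.comp_hom[OF Z(1) o(4,3) s(1) w(1)] C.comp_assoc[OF Z(1) o(4,3,1) s(1) w(1) k(2)] s w by simp
      fix r assume r: "r \<in> Hom C Z K \<and> k \<star>\<^bsub>C\<^esub> r = t"
      have "v \<star>\<^bsub>C\<^esub> r \<in> Hom C Z K0" "k0 \<star>\<^bsub>C\<^esub> (v \<star>\<^bsub>C\<^esub> r) = t"
        using C.comp_hom[OF Z(1) o(3,4) _ v(1)] C.comp_assoc[OF Z(1) o(3,4,1) _ v(1) k0(1), of r] r v by auto
      then have "v \<star>\<^bsub>C\<^esub> r = s" using s u0[OF Z] by blast
      then have "w \<star>\<^bsub>C\<^esub> s = (w \<star>\<^bsub>C\<^esub> v) \<star>\<^bsub>C\<^esub> r"
        using C.comp_assoc[OF Z(1) o(3,4,3) _ v(1) w(1), of r] r by simp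
      then show "r = w \<star>\<^bsub>C\<^esub> s" using wv C.id_comp[OF Z(1) o(3)] r by simp
    qed
  qed (use k o in auto)
qed

lemma cokernel_in_full_subcategory:
  assumes "linear_category C" and T: "T \<subseteq> Obj C" and XY: "X \<in> T" "Y \<in> T" "f \<in> Hom C X Y"
    and K0: "K0 \<in> T" "is_cokernel C X Y f K0 k0"
    and K: "is_cokernel (full_subcategory C T) X Y f K k"
  shows "is_cokernel C X Y f K k"
proof -
  interpret C: linear_category C by fact
  have k0: "k0 \<in> Hom C Y K0" "k0 \<star>\<^bsub>C\<^esub> f = Zero C X K0"
    and u0: "\<And>Z u. Z \<in> Obj C \<Longrightarrow> u \<in> Hom C Y Z \<Longrightarrow> u \<star>\<^bsub>C\<^esub> f = Zero C X Z \<Longrightarrow> \<exists>!v. v \<in> Hom C K0 Z \<and> v \<star>\<^bsub>C\<^esub> k0 = u"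
    using K0(2) by (auto simp: is_cokernel_def)
  have k: "K \<in> T" "k \<in> Hom C Y K" "k \<star>\<^bsub>C\<^esub> f = Zero C X K"
    and u: "\<And>Z u. Z \<in> T \<Longrightarrow> u \<in> Hom C Y Z \<Longrightarrow> u \<star>\<^bsub>C\<^esub> f = Zero C X Z \<Longrightarrow> \<exists>!v. v \<in> Hom C K Z \<and> v \<star>\<^bsub>C\<^esub> k = u"
    using K by (auto simp: is_cokernel_def)
  have o: "X \<in> Obj C" "Y \<in> Obj C" "K \<in> Obj C" "K0 \<in> Obj C" using T XY k(1) K0(1) by auto
  obtain v where v: "v \<in> Hom C K0 K" "v \<star>\<^bsub>C\<^esub> k0 = k" using u0[OF o(3) k(2,3)] by blast
  obtain w where w: "w \<in> Hom C K K0" "w \<star>\<^bsub>C\<^esub> k = k0" using u[OF K0(1) k0] by blast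
  have "v \<star>\<^bsub>C\<^esub> w = Id C K"
  proof -
    have "v \<star>\<^bsub>C\<^esub> w \<in> Hom C K K" "(v \<star>\<^bsub>C\<^esub> w) \<star>\<^bsub>C\<^esub> k = k"
      using C.comp_hom[OF o(3,4,3) w(1) v(1)] C.comp_assoc[OF o(2,3,4,3) k(2) w(1) v(1)] v w by simp_all
    moreover have "Id C K \<in> Hom C K K" "Id C K \<star>\<^bsub>C\<^esub> k = k"
      using C.id_hom[OF o(3)] C.id_comp[OF o(2,3) k(2)] by simp_all
    ultimately show ?thesis using u[OF k(1,2,3)] by blast
  qed
  note vw = this
  show ?thesis
    unfolding is_cokernel_def
  proof (intro conjI ballI impI)
    fix Z t assume Z: "Z \<in> Obj C" "t \<in> Hom C Y Z" "t \<star>\<^bsub>C\<^esub> f = Zero C X Z"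
    obtain s where s: "s \<in> Hom C K0 Z" "s \<star>\<^bsub>C\<^esub> k0 = t" using u0[OF Z] by blast
    show "\<exists>!v. v \<in> Hom C K Z \<and> v \<star>\<^bsub>C\<^esub> k = t"
    proof (rule ex1I[of _ "s \<star>\<^bsub>C\<^esub> w"])
      show "s \<star>\<^bsub>C\<^esub> w \<in> Hom C K Z \<and> (s \<star>\<^bsub>C\<^esub> w) \<star>\<^bsub>C\<^esub> k = t"
        using C.comp_hom[OF o(3,4) Z(1) w(1) s(1)] C.comp_assoc[OF o(2,3,4) Z(1) k(2) w(1) s(1)] s w by simp
      fix r assume r: "r \<in> Hom C K Z \<and> r \<star>\<^bsub>C\<^esub> k = t"
      have "r \<star>\<^bsub>C\<^esub> v \<in> Hom C K0 Z" "(r \<star>\<^bsub>C\<^esub> v) \<star>\<^bsub>C\<^esub> k0 = t"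
        using C.comp_hom[OF o(4,3) Z(1) v(1)] C.comp_assoc[OF o(2,4,3) Z(1) k0(1) v(1), of r] r v by auto
      then have "r \<star>\<^bsub>C\<^esub> v = s" using s u0[OF Z] by blast
      then have "s \<star>\<^bsub>C\<^esub> w = r \<star>\<^bsub>C\<^esub> (v \<star>\<^bsub>C\<^esub> w)"
        using C.comp_assoc[OF o(3,4,3) Z(1) w(1) v(1), of r] r by simp
      then show "r = s \<star>\<^bsub>C\<^esub> w" using vw C.comp_id[OF o(3) Z(1)] r by simp
    qed
  qed (use k o in auto)
qed

lemma tensor_subcategory_transport:
  assumes DC: "hom_identification D C V" and T: "tensor_subcategory C T"
    and S: "S = {X \<in> Obj D. V X \<in> T}"
  shows "tensor_subcategory D S"
proof -
  interpret hom_identification D C V by fact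
  note T' = T[unfolded tensor_subcategory_def abelian_subcategory_def]
  have TC: "T \<subseteq> Obj C" using T' by blast
  have lift: "\<exists>X\<in>S. V X = Y" if "Y \<in> T" for Y
    using obj_lift[of Y] TC that unfolding S by blast
  interpret sub: hom_identification "full_subcategory D S" "full_subcategory C T" V
    by (rule hom_identification_full_subcategory[OF DC TC _ _ S]) (use T' in auto)
  have SD: "S \<subseteq> Obj D" by (auto simp: S)
  have VS: "X \<in> S \<Longrightarrow> V X \<in> T" for X by (simp add: S)
  have "abelian_subcategory D S"
    unfolding abelian_subcategory_def
  proof (intro conjI ballI allI impI)
    show "abelian_category (full_subcategory D S)"
      using T' by (intro sub.abelian_category_transport) blast
  next
    fix X Y f K k assume XY: "X \<in> S" "Y \<in> S" "f \<in> Hom D X Y" and K: "is_kernel (full_subcategory D S) X Y f K k"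
    have KS: "K \<in> S" using K by (simp add: is_kernel_def)
    have "is_kernel (full_subcategory C T) (V X) (V Y) f (V K) k"
      using K sub.is_kernel_iff[of X Y K f k] XY KS by simp
    moreover have "f \<in> Hom C (V X) (V Y)" using XY SD hom[of X Y] by auto
    ultimately have "is_kernel C (V X) (V Y) f (V K) k" using T' VS XY by blast
    then show "is_kernel D X Y f K k" using is_kernel_iff[of X Y K f k] XY KS SD by blast
  next
    fix X Y f K k assume XY: "X \<in> S" "Y \<in> S" "f \<in> Hom D X Y" and K: "is_cokernel (full_subcategory D S) X Y f K k"
    have KS: "K \<in> S" using K by (simp add: is_cokernel_def)
    have "is_cokernel (full_subcategory C T) (V X) (V Y) f (V K) k"
      using K sub.is_cokernel_iff[of X Y K f k] XY KS by simp
    moreover have "f \<in> Hom C (V X) (V Y)" using XY SD hom[of X Y] by auto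
    ultimately have "is_cokernel C (V X) (V Y) f (V K) k" using T' VS XY by blast
    then show "is_cokernel D X Y f K k" using is_cokernel_iff[of X Y K f k] XY KS SD by blast
  qed (rule SD)
  moreover have "(\<exists>Y\<in>S. left_dual D X Y) \<and> (\<exists>Y\<in>S. left_dual D Y X)" if X: "X \<in> S" for X
  proof -
    obtain Y Y' where Y: "Y \<in> T" "left_dual C (V X) Y" "Y' \<in> T" "left_dual C Y' (V X)"
      using T' VS[OF X] by blast
    obtain Z Z' where "Z \<in> S" "V Z = Y" "Z' \<in> S" "V Z' = Y'" using lift Y by blast
    with Y X SD show ?thesis using left_dual_iff by blast
  qed
  ultimately show ?thesis
    using T' by (auto simp: tensor_subcategory_def S structure_eqs)
qed

section \<open>Super vector spaces with an odd operator\<close>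

text \<open>A representation of the algebra \<open>A\<close> amounts to a super vector space, whose grading is given by the
  involution \<open>G\<close>, together with an odd operator \<open>M\<close>.  The Koszul sign rule for the odd
  operator on a tensor product is the factor \<open>G\<close> in \<open>G \<otimes> M' + M \<otimes> 1\<close>.\<close>

definition is_super_operator :: "nat \<times> 'k::field mat \<times> 'k mat \<Rightarrow> bool" where
  "is_super_operator = (\<lambda>(n, G, M). G \<in> carrier_mat n n \<and> M \<in> carrier_mat n n \<and>
     G * G = 1\<^sub>m n \<and> G * M = (-1) \<cdot>\<^sub>m (M * G))"

definition SOp :: "('k::field, nat \<times> 'k mat \<times> 'k mat, 'k mat) mon_cat" where
  "SOp = \<lparr>
     Obj = {X. is_super_operator X},
     Hom = (\<lambda>(m, G, M) (n, G', M'). {F \<in> carrier_mat n m. F * G = G' * F \<and> F * M = M' * F}),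
     Comp = (\<lambda>G F. G * F),
     Id = (\<lambda>X. 1\<^sub>m (fst X)),
     Add = (\<lambda>F G. F + G),
     Zero = (\<lambda>X Y. 0\<^sub>m (fst Y) (fst X)),
     Scale = (\<lambda>c F. c \<cdot>\<^sub>m F),
     TensO = (\<lambda>(m, G, M) (n, G', M'). (m * n, kronecker G G', kronecker G M' + kronecker M (1\<^sub>m n))),
     TensM = kronecker,
     Unit = (1, 1\<^sub>m 1, 0\<^sub>m 1 1),
     Assoc = (\<lambda>X Y Z. 1\<^sub>m (fst X * fst Y * fst Z)),
     LUnit = (\<lambda>X. 1\<^sub>m (fst X)),
     RUnit = (\<lambda>X. 1\<^sub>m (fst X)) \<rparr>"

lemma SOp_simps [simp]:
  "Comp SOp = (\<lambda>G F. G * F)" "Id SOp = (\<lambda>X. 1\<^sub>m (fst X))" "Add SOp = (\<lambda>F G. F + G)"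
  "Zero SOp = (\<lambda>X Y. 0\<^sub>m (fst Y) (fst X))" "Scale SOp = (\<lambda>c F. c \<cdot>\<^sub>m F)" "TensM SOp = kronecker"
  "Unit SOp = (1, 1\<^sub>m 1, 0\<^sub>m 1 1)" "Assoc SOp = (\<lambda>X Y Z. 1\<^sub>m (fst X * fst Y * fst Z))"
  "LUnit SOp = (\<lambda>X. 1\<^sub>m (fst X))" "RUnit SOp = (\<lambda>X. 1\<^sub>m (fst X))"
  "TensO SOp (m, G, M) (n, G', M') = (m * n, kronecker G G', kronecker G M' + kronecker M (1\<^sub>m n))"
  by (simp_all add: SOp_def)

lemma SOp_Obj: "(n, G, M) \<in> Obj SOp \<longleftrightarrow> dim_row G = n \<and> dim_col G = n \<and> dim_row M = n \<and> dim_col M = n \<and>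
    G * G = 1\<^sub>m n \<and> G * M = (-1) \<cdot>\<^sub>m (M * G)"
  unfolding SOp_def is_super_operator_def by (auto intro: carrier_matI)

lemma SOp_Hom: "F \<in> Hom SOp (m, G, M) (n, G', M') \<longleftrightarrow>
    dim_row F = n \<and> dim_col F = m \<and> F * G = G' * F \<and> F * M = M' * F"
  unfolding SOp_def by (auto intro: carrier_matI)

lemma SOp_Hom_dims:
  assumes "F \<in> Hom SOp X Y"
  shows "dim_row F = fst Y \<and> dim_col F = fst X"
  using assms by (cases X; cases Y; simp add: SOp_Hom)

text \<open>With all products nested to the right, an equation \<open>A * B = C\<close> has to be applied inside \<open>A * (B * Y)\<close>.\<close>

lemma mat_eq_assoc:
  fixes A B C Y :: "'k::semiring_0 mat"
  assumes "A * B = C" "dim_col A = dim_row B" "dim_col B = dim_row Y"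
  shows "A * (B * Y) = C * Y"
  using assms by (simp add: mat_assoc[symmetric])

lemma neg_neg_smult [simp]: "(-1) \<cdot>\<^sub>m ((-1) \<cdot>\<^sub>m A) = (A :: 'k::ring_1 mat)"
  by (simp add: smult_smult_mat smult_one_mat)

lemma SOp_linear_category: "linear_category (SOp :: ('k::field, nat \<times> 'k mat \<times> 'k mat, 'k mat) mon_cat)"
proof (rule linear_category.intro; (simp only: split_paired_all)?)
  fix m and G M :: "'k mat" assume "(m, G, M) \<in> Obj SOp"
  then show "Id SOp (m, G, M) \<in> Hom SOp (m, G, M) (m, G, M)"
    by (simp add: SOp_Obj SOp_Hom mat_algebra)
next
  fix m1 m2 m3 and G1 M1 G2 M2 G3 M3 F F' :: "'k mat"
  assume "(m1, G1, M1) \<in> Obj SOp" "(m2, G2, M2) \<in> Obj SOp" "(m3, G3, M3) \<in> Obj SOp"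
    and "F \<in> Hom SOp (m1, G1, M1) (m2, G2, M2)" "F' \<in> Hom SOp (m2, G2, M2) (m3, G3, M3)"
  then show "F' \<star>\<^bsub>SOp\<^esub> F \<in> Hom SOp (m1, G1, M1) (m3, G3, M3)"
    by (simp add: SOp_Obj SOp_Hom mat_assoc) (simp add: mat_assoc[symmetric])
next
  fix m n and G M G' M' :: "'k mat"
  assume X: "(m, G, M) \<in> Obj SOp" and Y: "(n, G', M') \<in> Obj SOp"
  note dims = X[unfolded SOp_Obj] Y[unfolded SOp_Obj]
  show "comm_group \<lparr>carrier = Hom SOp (m, G, M) (n, G', M'), mult = Add SOp, one = Zero SOp (m, G, M) (n, G', M')\<rparr>"
  proof (rule comm_groupI; simp)
    show "0\<^sub>m n m \<in> Hom SOp (m, G, M) (n, G', M')" using dims by (simp add: SOp_Hom mat_algebra)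
  next
    fix F F' assume F: "F \<in> Hom SOp (m, G, M) (n, G', M')" and F': "F' \<in> Hom SOp (m, G, M) (n, G', M')"
    show "F + F' \<in> Hom SOp (m, G, M) (n, G', M')"
      using F F' dims by (simp add: SOp_Hom mat_algebra)
    show "F + F' = F' + F" using F F' by (intro mat_add_comm) (simp_all add: SOp_Hom)
    fix F'' assume F'': "F'' \<in> Hom SOp (m, G, M) (n, G', M')"
    show "F + F' + F'' = F + (F' + F'')" using F F' F'' by (intro mat_add_assoc) (simp_all add: SOp_Hom)
  next
    fix F assume F: "F \<in> Hom SOp (m, G, M) (n, G', M')"
    show "0\<^sub>m n m + F = F" using F by (intro left_add_zero_mat carrier_matI) (simp_all add: SOp_Hom)
    show "\<exists>F'\<in>Hom SOp (m, G, M) (n, G', M'). F' + F = 0\<^sub>m n m"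
    proof
      show "(-1) \<cdot>\<^sub>m F \<in> Hom SOp (m, G, M) (n, G', M')" using F dims by (simp add: SOp_Hom mat_algebra)
      show "(-1) \<cdot>\<^sub>m F + F = 0\<^sub>m n m" using F by (intro eq_matI) (simp_all add: SOp_Hom)
    qed
  qed
qed (auto simp: SOp_Obj SOp_Hom mat_algebra smult_smult_mat smult_one_mat intro!: eq_matI simp: algebra_simps)

lemma SOp_tensor_obj:
  assumes "(m, G, M) \<in> Obj SOp" "(n, G', M') \<in> Obj SOp"
  shows "(m, G, M) \<boxtimes>\<^bsub>SOp\<^esub> (n, G', M') \<in> Obj SOp"
proof -
  note X = assms(1)[unfolded SOp_Obj] and Y = assms(2)[unfolded SOp_Obj]
  show ?thesis
    using X Y
    by (simp add: SOp_Obj kronecker_mult kronecker_one mat_algebra kronecker_smult_left kronecker_smult_right)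
       (auto intro!: eq_matI)
qed

text \<open>The mixed terms cancel because \<open>G\<close> and \<open>M\<close> anticommute: \<open>h\<^sup>2\<close> is a primitive element.\<close>

lemma SOp_tensor_square:
  assumes "(m, G, M) \<in> Obj SOp" "(n, G', M') \<in> Obj SOp"
  shows "(kronecker G M' + kronecker M (1\<^sub>m n)) * (kronecker G M' + kronecker M (1\<^sub>m n))
    = kronecker (M * M) (1\<^sub>m n) + kronecker (1\<^sub>m m) (M' * M')"
proof -
  note X = assms(1)[unfolded SOp_Obj] and Y = assms(2)[unfolded SOp_Obj]
  show ?thesis
    using X Y
    by (simp add: kronecker_mult kronecker_one mat_algebra kronecker_smult_left kronecker_smult_right)
       (auto intro!: eq_matI)
qed

lemma SOp_tensor_assoc:
  assumes "(m1, G1, M1) \<in> Obj SOp" "(m2, G2, M2) \<in> Obj SOp" "(m3, G3, M3) \<in> Obj SOp"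
  shows "((m1, G1, M1) \<boxtimes>\<^bsub>SOp\<^esub> (m2, G2, M2)) \<boxtimes>\<^bsub>SOp\<^esub> (m3, G3, M3)
    = (m1, G1, M1) \<boxtimes>\<^bsub>SOp\<^esub> ((m2, G2, M2) \<boxtimes>\<^bsub>SOp\<^esub> (m3, G3, M3))"
  using assms
  by (simp add: SOp_Obj kronecker_add_left kronecker_add_right kronecker_assoc kronecker_one mat_add_assoc)

lemma SOp_tensor_unit:
  assumes "X \<in> Obj SOp"
  shows "Unit SOp \<boxtimes>\<^bsub>SOp\<^esub> X = X" "X \<boxtimes>\<^bsub>SOp\<^esub> Unit SOp = X"
proof -
  obtain n G M where X: "X = (n, G, M)" by (cases X)
  note o = assms[unfolded X SOp_Obj]
  have z: "kronecker (0\<^sub>m 1 1) (1\<^sub>m n) = 0\<^sub>m n n" "kronecker G (0\<^sub>m 1 1) = 0\<^sub>m n n"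
    "0\<^sub>m n n + M = M" "M + 0\<^sub>m n n = M"
    using o by (auto intro!: eq_matI simp: kronecker_entry)
  show "Unit SOp \<boxtimes>\<^bsub>SOp\<^esub> X = X" "X \<boxtimes>\<^bsub>SOp\<^esub> Unit SOp = X"
    using o by (simp_all add: X kronecker_one_left kronecker_one_right z del: One_nat_def)
qed

lemma SOp_iso_one:
  assumes "X \<in> Obj SOp" "n = fst X"
  shows "iso_mor SOp X X (1\<^sub>m n)"
  using assms by (cases X) (auto simp: iso_mor_def inverse_mor_def SOp_Hom SOp_Obj mat_algebra intro!: exI[of _ "1\<^sub>m n"])

lemma SOp_tensor_hom:
  assumes "(m, G, M) \<in> Obj SOp" "(m', G', M') \<in> Obj SOp" "(n, K, L) \<in> Obj SOp" "(n', K', L') \<in> Obj SOp"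
    "F \<in> Hom SOp (m, G, M) (m', G', M')" "E \<in> Hom SOp (n, K, L) (n', K', L')"
  shows "kronecker F E \<in> Hom SOp ((m, G, M) \<boxtimes>\<^bsub>SOp\<^esub> (n, K, L)) ((m', G', M') \<boxtimes>\<^bsub>SOp\<^esub> (n', K', L'))"
  using assms by (simp add: SOp_Obj SOp_Hom mat_algebra kronecker_mult)

lemma SOp_monoidal_category: "monoidal_category (SOp :: ('k::field, nat \<times> 'k mat \<times> 'k mat, 'k mat) mon_cat)"
proof (rule monoidal_category.intro[OF SOp_linear_category], rule monoidal_category_axioms.intro)
  show "Unit SOp \<in> Obj (SOp :: ('k, nat \<times> 'k mat \<times> 'k mat, 'k mat) mon_cat)"
    by (simp add: SOp_Obj mat_algebra del: One_nat_def)
next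
  fix X Y :: "nat \<times> 'k mat \<times> 'k mat" assume XY: "X \<in> Obj SOp" "Y \<in> Obj SOp"
  then show "X \<boxtimes>\<^bsub>SOp\<^esub> Y \<in> Obj SOp" by (cases X; cases Y) (simp only: SOp_tensor_obj)
  show "Id SOp X \<boxtimes>\<^sub>m\<^bsub>SOp\<^esub> Id SOp Y = Id SOp (X \<boxtimes>\<^bsub>SOp\<^esub> Y)"
    by (cases X; cases Y) (simp add: kronecker_one)
  show "(Id SOp X \<boxtimes>\<^sub>m\<^bsub>SOp\<^esub> LUnit SOp Y) \<star>\<^bsub>SOp\<^esub> Assoc SOp X (Unit SOp) Y = RUnit SOp X \<boxtimes>\<^sub>m\<^bsub>SOp\<^esub> Id SOp Y"
    by (simp add: kronecker_one mat_algebra)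
next
  fix X X' Y Y' :: "nat \<times> 'k mat \<times> 'k mat" and f g
  assume o: "X \<in> Obj SOp" "X' \<in> Obj SOp" "Y \<in> Obj SOp" "Y' \<in> Obj SOp"
    and f: "f \<in> Hom SOp X X'" and g: "g \<in> Hom SOp Y Y'"
  then show "f \<boxtimes>\<^sub>m\<^bsub>SOp\<^esub> g \<in> Hom SOp (X \<boxtimes>\<^bsub>SOp\<^esub> Y) (X' \<boxtimes>\<^bsub>SOp\<^esub> Y')"
    by (cases X; cases Y; cases X'; cases Y') (simp only: SOp_simps(6) SOp_tensor_hom)
  fix c
  show "Scale SOp c f \<boxtimes>\<^sub>m\<^bsub>SOp\<^esub> g = Scale SOp c (f \<boxtimes>\<^sub>m\<^bsub>SOp\<^esub> g) \<and> f \<boxtimes>\<^sub>m\<^bsub>SOp\<^esub> Scale SOp c g = Scale SOp c (f \<boxtimes>\<^sub>m\<^bsub>SOp\<^esub> g)"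
    by (simp add: kronecker_smult_left kronecker_smult_right)
next
  fix X X' X'' Y Y' Y'' :: "nat \<times> 'k mat \<times> 'k mat" and f f' g g'
  assume "f \<in> Hom SOp X X'" "f' \<in> Hom SOp X' X''" "g \<in> Hom SOp Y Y'" "g' \<in> Hom SOp Y' Y''"
  then show "(f' \<star>\<^bsub>SOp\<^esub> f) \<boxtimes>\<^sub>m\<^bsub>SOp\<^esub> (g' \<star>\<^bsub>SOp\<^esub> g) = (f' \<boxtimes>\<^sub>m\<^bsub>SOp\<^esub> g') \<star>\<^bsub>SOp\<^esub> (f \<boxtimes>\<^sub>m\<^bsub>SOp\<^esub> g)"
    by (auto dest!: SOp_Hom_dims simp: kronecker_mult)
next
  fix X X' Y Y' :: "nat \<times> 'k mat \<times> 'k mat" and f f' g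
  assume "f \<in> Hom SOp X X'" "f' \<in> Hom SOp X X'"
  then show "Add SOp f f' \<boxtimes>\<^sub>m\<^bsub>SOp\<^esub> g = Add SOp (f \<boxtimes>\<^sub>m\<^bsub>SOp\<^esub> g) (f' \<boxtimes>\<^sub>m\<^bsub>SOp\<^esub> g)"
    by (auto dest!: SOp_Hom_dims simp: kronecker_add_left)
next
  fix X X' Y Y' :: "nat \<times> 'k mat \<times> 'k mat" and f g g'
  assume "g \<in> Hom SOp Y Y'" "g' \<in> Hom SOp Y Y'"
  then show "f \<boxtimes>\<^sub>m\<^bsub>SOp\<^esub> Add SOp g g' = Add SOp (f \<boxtimes>\<^sub>m\<^bsub>SOp\<^esub> g) (f \<boxtimes>\<^sub>m\<^bsub>SOp\<^esub> g')"
    by (auto dest!: SOp_Hom_dims simp: kronecker_add_right)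
next
  fix X Y Z :: "nat \<times> 'k mat \<times> 'k mat"
  assume o: "X \<in> Obj SOp" "Y \<in> Obj SOp" "Z \<in> Obj SOp"
  have eq: "(X \<boxtimes>\<^bsub>SOp\<^esub> Y) \<boxtimes>\<^bsub>SOp\<^esub> Z = X \<boxtimes>\<^bsub>SOp\<^esub> (Y \<boxtimes>\<^bsub>SOp\<^esub> Z)"
    using o SOp_tensor_assoc by (cases X; cases Y; cases Z) blast
  have "X \<boxtimes>\<^bsub>SOp\<^esub> (Y \<boxtimes>\<^bsub>SOp\<^esub> Z) \<in> Obj SOp"
    using o SOp_tensor_obj by (metis prod_cases3)
  moreover have "fst (X \<boxtimes>\<^bsub>SOp\<^esub> (Y \<boxtimes>\<^bsub>SOp\<^esub> Z)) = fst X * fst Y * fst Z"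
    by (cases X; cases Y; cases Z) simp
  ultimately show "iso_mor SOp ((X \<boxtimes>\<^bsub>SOp\<^esub> Y) \<boxtimes>\<^bsub>SOp\<^esub> Z) (X \<boxtimes>\<^bsub>SOp\<^esub> (Y \<boxtimes>\<^bsub>SOp\<^esub> Z)) (Assoc SOp X Y Z)"
    unfolding eq by (simp add: SOp_iso_one)
next
  fix X X' Y Y' Z Z' :: "nat \<times> 'k mat \<times> 'k mat" and f g h
  assume "f \<in> Hom SOp X X'" "g \<in> Hom SOp Y Y'" "h \<in> Hom SOp Z Z'"
  then show "Assoc SOp X' Y' Z' \<star>\<^bsub>SOp\<^esub> ((f \<boxtimes>\<^sub>m\<^bsub>SOp\<^esub> g) \<boxtimes>\<^sub>m\<^bsub>SOp\<^esub> h)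
      = (f \<boxtimes>\<^sub>m\<^bsub>SOp\<^esub> (g \<boxtimes>\<^sub>m\<^bsub>SOp\<^esub> h)) \<star>\<^bsub>SOp\<^esub> Assoc SOp X Y Z"
    by (auto dest!: SOp_Hom_dims simp: kronecker_assoc mat_algebra mult.assoc)
next
  fix X :: "nat \<times> 'k mat \<times> 'k mat" assume X: "X \<in> Obj SOp"
  show "iso_mor SOp (Unit SOp \<boxtimes>\<^bsub>SOp\<^esub> X) X (LUnit SOp X)" "iso_mor SOp (X \<boxtimes>\<^bsub>SOp\<^esub> Unit SOp) X (RUnit SOp X)"
    unfolding SOp_tensor_unit[OF X] using X by (simp_all add: SOp_iso_one)
next
  fix X Y :: "nat \<times> 'k mat \<times> 'k mat" and f assume "f \<in> Hom SOp X Y"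
  then show "LUnit SOp Y \<star>\<^bsub>SOp\<^esub> (Id SOp (Unit SOp) \<boxtimes>\<^sub>m\<^bsub>SOp\<^esub> f) = f \<star>\<^bsub>SOp\<^esub> LUnit SOp X"
    "RUnit SOp Y \<star>\<^bsub>SOp\<^esub> (f \<boxtimes>\<^sub>m\<^bsub>SOp\<^esub> Id SOp (Unit SOp)) = f \<star>\<^bsub>SOp\<^esub> RUnit SOp X"
    by (auto dest!: SOp_Hom_dims simp: kronecker_one_left kronecker_one_right mat_algebra simp del: One_nat_def)
next
  fix W X Y Z :: "nat \<times> 'k mat \<times> 'k mat"
  show "(Id SOp W \<boxtimes>\<^sub>m\<^bsub>SOp\<^esub> Assoc SOp X Y Z) \<star>\<^bsub>SOp\<^esub> Assoc SOp W (X \<boxtimes>\<^bsub>SOp\<^esub> Y) Z \<star>\<^bsub>SOp\<^esub> (Assoc SOp W X Y \<boxtimes>\<^sub>m\<^bsub>SOp\<^esub> Id SOp Z)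
      = Assoc SOp W X (Y \<boxtimes>\<^bsub>SOp\<^esub> Z) \<star>\<^bsub>SOp\<^esub> Assoc SOp (W \<boxtimes>\<^bsub>SOp\<^esub> X) Y Z"
    by (cases W; cases X; cases Y; cases Z) (simp add: kronecker_one mat_algebra mult.assoc)
qed

section \<open>The integral subcategory\<close>

lemma left_inverse_cancel:
  fixes K L A B :: "'k::semiring_1 mat"
  assumes inv: "L * K = 1\<^sub>m r" and d: "dim_col L = dim_row K" "dim_col K = r" "dim_row A = r" "dim_row B = r"
    and eq: "K * A = K * B"
  shows "A = B"
proof -
  have "A = (L * K) * A" using inv d by (simp add: mat_one_left)
  also have "\<dots> = L * (K * A)" using d by (simp add: mat_assoc)
  also have "\<dots> = (L * K) * B" unfolding eq using d by (simp add: mat_assoc)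
  also have "\<dots> = B" using inv d by (simp add: mat_one_left)
  finally show ?thesis .
qed

lemma right_inverse_cancel:
  fixes C D A B :: "'k::semiring_1 mat"
  assumes inv: "C * D = 1\<^sub>m r" and d: "dim_col C = dim_row D" "dim_row C = r" "dim_col A = r" "dim_col B = r"
    and eq: "A * C = B * C"
  shows "A = B"
proof -
  have "A = A * (C * D)" using inv d by (simp add: mat_one_right)
  also have "\<dots> = (A * C) * D" using d by (simp add: mat_assoc)
  also have "\<dots> = B * (C * D)" unfolding eq using d by (simp add: mat_assoc)
  also have "\<dots> = B" using inv d by (simp add: mat_one_right)
  finally show ?thesis .
qed

definition integral_super_operators :: "(nat \<times> 'k::field mat \<times> 'k mat) set" where
  "integral_super_operators = {(n, G, M). (n, G, M) \<in> Obj SOp \<and> int_diagonalizable (M * M)}"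

lemma integral_iff: "(n, G, M) \<in> integral_super_operators \<longleftrightarrow> (n, G, M) \<in> Obj SOp \<and> int_diagonalizable (M * M)"
  by (simp add: integral_super_operators_def)

lemma integral_subset: "integral_super_operators \<subseteq> Obj SOp"
  by (auto simp: integral_super_operators_def)

subsection \<open>Kernels, cokernels and direct sums\<close>

text \<open>Since the kernel of an intertwiner \<open>F\<close> is invariant, \<open>G\<close> and \<open>M\<close> compress to it.  Integrality is inherited
  because it is equivalent to annihilation of \<open>M\<^sup>2\<close> by a product of distinct factors \<open>M\<^sup>2 - i\<close>.\<close>

lemma SOp_kernel:
  fixes F :: "'k::field_char_0 mat"
  assumes X: "(m, G, M) \<in> Obj SOp" and Y: "(n, G', M') \<in> Obj SOp"
    and F: "F \<in> Hom SOp (m, G, M) (n, G', M')"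
  shows "\<exists>r K L R Z. Z \<in> Obj SOp \<and> fst Z = r \<and> K \<in> Hom SOp Z (m, G, M) \<and>
    dim_row L = r \<and> dim_col L = m \<and> dim_row R = m \<and> dim_col R = n \<and>
    F * K = 0\<^sub>m n r \<and> L * K = 1\<^sub>m r \<and> K * L + R * F = 1\<^sub>m m \<and>
    ((m, G, M) \<in> integral_super_operators \<longrightarrow> Z \<in> integral_super_operators)"
proof -
  note X' = X[unfolded SOp_Obj] and Y' = Y[unfolded SOp_Obj] and F' = F[unfolded SOp_Hom]
  have "F \<in> carrier_mat n m" using F' by (auto intro: carrier_matI)
  from kernel_splitting[OF this] obtain r K L R where c: "K \<in> carrier_mat m r" "L \<in> carrier_mat r m" "R \<in> carrier_mat m n"
    and FK: "F * K = 0\<^sub>m n r" and LK: "L * K = 1\<^sub>m r" and one: "K * L + R * F = 1\<^sub>m m" by blast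
  have dims: "dim_row K = m" "dim_col K = r" "dim_row L = r" "dim_col L = m" "dim_row R = m" "dim_col R = n"
    "dim_row G = m" "dim_col G = m" "dim_row M = m" "dim_col M = m"
    "dim_row G' = n" "dim_col G' = n" "dim_row M' = n" "dim_col M' = n" "dim_row F = n" "dim_col F = m"
    using c X' Y' F' by auto
  have invariant: "K * (L * (B * K)) = B * K"
    if "F * B = B' * F" "dim_row B = m" "dim_col B = m" "dim_row B' = n" "dim_col B' = n" for B B' :: "'k mat"
  proof -
    have "F * (B * K) = B' * (F * K)" using mat_eq_assoc[OF that(1), of K] that dims by (simp add: mat_assoc)
    then have z: "F * (B * K) = 0\<^sub>m n r" using FK that by (simp add: mat_zero_right)
    have "B * K = (K * L + R * F) * (B * K)" using one that dims by (simp add: mat_one_left)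
    also have "\<dots> = K * (L * (B * K)) + R * (F * (B * K))" using that dims by (simp add: mat_algebra)
    also have "\<dots> = K * (L * (B * K))" unfolding z using that dims
      by (simp add: mat_zero_right) (auto intro!: eq_matI)
    finally show ?thesis by simp
  qed
  have G: "K * (L * (G * K)) = G * K" using F' dims by (intro invariant[of G G']) auto
  have M: "K * (L * (M * K)) = M * K" using F' dims by (intro invariant[of M M']) auto
  define GK where "GK = L * (G * K)"
  define MK where "MK = L * (M * K)"
  have dZ: "dim_row GK = r" "dim_col GK = r" "dim_row MK = r" "dim_col MK = r"
    by (auto simp: GK_def MK_def dims)
  note dims = dims dZ
  have KG: "K * GK = G * K" "K * MK = M * K" using G M by (simp_all add: GK_def MK_def)
  have cancel: "A = B" if "K * A = K * B" "dim_row A = r" "dim_row B = r" for A B :: "'k mat"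
    by (rule left_inverse_cancel[OF LK _ _ that(2,3,1)]) (simp_all add: dims)
  have KGG: "K * (GK * Y) = G * (K * Y)" "K * (MK * Y) = M * (K * Y)" if "dim_row Y = r" for Y
    using mat_eq_assoc[OF KG(1), of Y] mat_eq_assoc[OF KG(2), of Y] that dims by (simp_all add: mat_assoc)
  have GG: "G * (G * K) = K" using mat_eq_assoc[of G G "1\<^sub>m m" K] X' dims by (simp add: mat_one_left)
  have GM: "G * (M * K) = (-1) \<cdot>\<^sub>m (M * (G * K))"
    using mat_eq_assoc[of G M "(-1) \<cdot>\<^sub>m (M * G)" K] X' dims by (simp add: mat_algebra)
  have Z: "(r, GK, MK) \<in> Obj SOp"
    unfolding SOp_Obj
  proof (intro conjI)
    show "GK * GK = 1\<^sub>m r" by (rule cancel) (simp_all add: KGG KG dims GG mat_algebra)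
    show "GK * MK = (-1) \<cdot>\<^sub>m (MK * GK)"
      by (rule cancel) (simp_all add: KGG KG dims GM mat_smult_right)
  qed (simp_all add: dims)
  have K: "K \<in> Hom SOp (r, GK, MK) (m, G, M)" using KG dims by (simp add: SOp_Hom)
  have "(r, GK, MK) \<in> integral_super_operators" if "(m, G, M) \<in> integral_super_operators"
  proof -
    have "int_diagonalizable (MK * MK)"
    proof (rule int_diagonalizable_restrict[of "M * M" m _ r K L])
      show "M * M * K = K * (MK * MK)" by (simp add: KGG KG dims mat_assoc)
    qed (use that LK in \<open>auto simp: integral_iff dims intro!: carrier_matI\<close>)
    with Z show ?thesis by (simp add: integral_iff)
  qed
  then show ?thesis
    using Z K FK LK one dims
    by (intro exI[of _ r] exI[of _ K] exI[of _ L] exI[of _ R] exI[of _ "(r, GK, MK)"]) simp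
qed

lemma SOp_cokernel:
  fixes F :: "'k::field_char_0 mat"
  assumes X: "(m, G, M) \<in> Obj SOp" and Y: "(n, G', M') \<in> Obj SOp"
    and F: "F \<in> Hom SOp (m, G, M) (n, G', M')"
  shows "\<exists>r C D R Z. Z \<in> Obj SOp \<and> fst Z = r \<and> C \<in> Hom SOp (n, G', M') Z \<and>
    dim_row D = n \<and> dim_col D = r \<and> dim_row R = m \<and> dim_col R = n \<and>
    C * F = 0\<^sub>m r m \<and> C * D = 1\<^sub>m r \<and> D * C + F * R = 1\<^sub>m n \<and>
    ((n, G', M') \<in> integral_super_operators \<longrightarrow> Z \<in> integral_super_operators)"
proof -
  note X' = X[unfolded SOp_Obj] and Y' = Y[unfolded SOp_Obj] and F' = F[unfolded SOp_Hom]
  have "F \<in> carrier_mat n m" using F' by (auto intro: carrier_matI)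
  from cokernel_splitting[OF this] obtain r C D R where c: "C \<in> carrier_mat r n" "D \<in> carrier_mat n r" "R \<in> carrier_mat m n"
    and CF: "C * F = 0\<^sub>m r m" and CD: "C * D = 1\<^sub>m r" and one: "D * C + F * R = 1\<^sub>m n" by blast
  have dims: "dim_row C = r" "dim_col C = n" "dim_row D = n" "dim_col D = r" "dim_row R = m" "dim_col R = n"
    "dim_row G = m" "dim_col G = m" "dim_row M = m" "dim_col M = m"
    "dim_row G' = n" "dim_col G' = n" "dim_row M' = n" "dim_col M' = n" "dim_row F = n" "dim_col F = m"
    using c X' Y' F' by auto
  have invariant: "C * (B' * (D * C)) = C * B'"
    if "F * B = B' * F" "dim_row B = m" "dim_col B = m" "dim_row B' = n" "dim_col B' = n" for B B' :: "'k mat"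
  proof -
    have "C * (B' * F) = (C * F) * B" using that dims by (simp add: mat_assoc)
    then have z: "C * (B' * F) = 0\<^sub>m r m" using CF that dims by (simp add: mat_zero_left)
    have "C * B' = C * (B' * (D * C + F * R))" using one that dims by (simp add: mat_one_right)
    also have "\<dots> = C * (B' * (D * C)) + (C * (B' * F)) * R" using that dims by (simp add: mat_algebra)
    also have "\<dots> = C * (B' * (D * C))" unfolding z using that dims
      by (simp add: mat_zero_left) (auto intro!: eq_matI)
    finally show ?thesis by simp
  qed
  have G: "C * (G' * (D * C)) = C * G'" using F' dims by (intro invariant[of G G']) auto
  have M: "C * (M' * (D * C)) = C * M'" using F' dims by (intro invariant[of M M']) auto
  define GC where "GC = C * (G' * D)"
  define MC where "MC = C * (M' * D)"
  have dZ: "dim_row GC = r" "dim_col GC = r" "dim_row MC = r" "dim_col MC = r"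
    by (auto simp: GC_def MC_def dims)
  note dims = dims dZ
  have GC: "GC * C = C * G'" "MC * C = C * M'" using G M by (simp_all add: GC_def MC_def mat_assoc dims)
  have cancel: "A = B" if "A * C = B * C" "dim_col A = r" "dim_col B = r" for A B :: "'k mat"
    by (rule right_inverse_cancel[OF CD _ _ that(2,3,1)]) (simp_all add: dims)
  have GGC: "GC * (C * Y) = C * (G' * Y)" "MC * (C * Y) = C * (M' * Y)" if "dim_row Y = n" for Y
    using mat_eq_assoc[OF GC(1), of Y] mat_eq_assoc[OF GC(2), of Y] that dims by (simp_all add: mat_assoc)
  have Z: "(r, GC, MC) \<in> Obj SOp"
    unfolding SOp_Obj
  proof (intro conjI)
    show "GC * GC = 1\<^sub>m r" by (rule cancel) (use Y' in \<open>simp_all add: GGC GC dims mat_algebra\<close>)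
    show "GC * MC = (-1) \<cdot>\<^sub>m (MC * GC)"
      by (rule cancel) (use Y' in \<open>simp_all add: GGC GC dims mat_algebra\<close>)
  qed (simp_all add: dims)
  have C: "C \<in> Hom SOp (n, G', M') (r, GC, MC)" using GC dims by (simp add: SOp_Hom)
  have "(r, GC, MC) \<in> integral_super_operators" if "(n, G', M') \<in> integral_super_operators"
  proof -
    have "int_diagonalizable (MC * MC)"
    proof (rule int_diagonalizable_quotient[of "M' * M'" n _ r C D])
      show "C * (M' * M') = MC * MC * C" by (simp add: GGC GC dims mat_assoc)
    qed (use that CD in \<open>auto simp: integral_iff dims intro!: carrier_matI\<close>)
    with Z show ?thesis by (simp add: integral_iff)
  qed
  then show ?thesis
    using Z C CF CD one dims
    by (intro exI[of _ r] exI[of _ C] exI[of _ D] exI[of _ R] exI[of _ "(r, GC, MC)"]) simp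
qed

text \<open>A split injective intertwiner \<open>K\<close> with \<open>F K = 0\<close> is a kernel of \<open>F\<close> once its image is
  exhausted by the null space of \<open>F\<close>; the inverse \<open>R\<close> on the complement need not be an
  intertwiner.\<close>

lemma SOp_is_kernelI:
  assumes T: "T \<subseteq> Obj SOp" and o: "X \<in> T" "Y \<in> T" "Z \<in> T"
    and F: "F \<in> Hom SOp X Y" and K: "K \<in> Hom SOp Z X"
    and dims: "dim_row L = fst Z" "dim_col L = fst X" "dim_row R = fst X" "dim_col R = fst Y"
    and FK: "F * K = 0\<^sub>m (fst Y) (fst Z)" and LK: "L * K = 1\<^sub>m (fst Z)"
    and one: "K * L + R * F = 1\<^sub>m (fst X)"
  shows "is_kernel (full_subcategory SOp T) X Y F Z K"
proof -
  obtain m G M n G' M' r GZ MZ where XYZ: "X = (m, G, M)" "Y = (n, G', M')" "Z = (r, GZ, MZ)"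
    by (cases X; cases Y; cases Z)
  have "X \<in> Obj SOp" "Z \<in> Obj SOp" using T o by auto
  note X' = this[unfolded XYZ SOp_Obj] and K' = K[unfolded XYZ SOp_Hom] and F' = F[unfolded XYZ SOp_Hom]
  note d = dims[unfolded XYZ fst_conv]
  have cancel: "A = B" if "K * A = K * B" "dim_row A = r" "dim_row B = r" for A B
    by (rule left_inverse_cancel[OF LK[unfolded XYZ fst_conv] _ _ that(2,3,1)]) (use K' d in simp_all)
  show ?thesis
    unfolding is_kernel_def
  proof (intro conjI ballI impI; simp)
    fix W U assume W: "W \<in> T" and U: "U \<in> Hom SOp W X" and z: "F * U = 0\<^sub>m (fst Y) (fst W)"
    obtain p GW MW where W': "W = (p, GW, MW)" by (cases W)
    have W'': "(p, GW, MW) \<in> Obj SOp" using W T W' by auto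
    note WO = W''[unfolded SOp_Obj] and U' = U[unfolded W' XYZ SOp_Hom]
    have "U = (K * L + R * F) * U" using one U' by (simp add: XYZ mat_one_left)
    also have "\<dots> = K * (L * U) + R * (F * U)" using U' K' d F' by (simp add: mat_algebra)
    also have "\<dots> = K * (L * U)" unfolding z using U' K' d F'
      by (simp add: mat_zero_right XYZ W') (auto intro!: eq_matI)
    finally have KLU: "K * (L * U) = U" by simp
    have intertwine: "L * U * B = B'' * (L * U)"
      if "U * B = B' * U" "K * B'' = B' * K" "dim_row B = p" "dim_col B = p" "dim_row B' = m" "dim_col B' = m"
        "dim_row B'' = r" "dim_col B'' = r" for B B' B''
    proof (rule cancel)
      have "K * (L * U * B) = (K * (L * U)) * B" using that U' K' d by (simp add: mat_assoc)
      also have "\<dots> = B' * (K * (L * U))" using KLU that(1) by simp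
      also have "\<dots> = K * (B'' * (L * U))"
        using mat_eq_assoc[OF that(2), of "L * U"] that U' K' d by (simp add: mat_assoc)
      finally show "K * (L * U * B) = K * (B'' * (L * U))" .
    qed (use that d in simp_all)
    show "\<exists>!V. V \<in> Hom SOp W Z \<and> K * V = U"
    proof (rule ex1I[of _ "L * U"])
      have "L * U * GW = GZ * (L * U)" "L * U * MW = MZ * (L * U)"
        using intertwine[of GW G GZ] intertwine[of MW M MZ] U' K' X' WO by auto
      then show "L * U \<in> Hom SOp W Z \<and> K * (L * U) = U"
        using KLU U' d by (simp add: W' XYZ SOp_Hom)
    next
      fix V assume V: "V \<in> Hom SOp W Z \<and> K * V = U"
      then have "K * V = K * (L * U)" using KLU by simp
      moreover have "dim_row V = r" using V by (simp add: W' XYZ SOp_Hom)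
      ultimately show "V = L * U" by (rule cancel) (simp add: d)
    qed
  qed (use o K FK in auto)
qed

lemma SOp_is_cokernelI:
  assumes T: "T \<subseteq> Obj SOp" and o: "X \<in> T" "Y \<in> T" "Z \<in> T"
    and F: "F \<in> Hom SOp X Y" and C: "C \<in> Hom SOp Y Z"
    and dims: "dim_row D = fst Y" "dim_col D = fst Z" "dim_row R = fst X" "dim_col R = fst Y"
    and CF: "C * F = 0\<^sub>m (fst Z) (fst X)" and CD: "C * D = 1\<^sub>m (fst Z)"
    and one: "D * C + F * R = 1\<^sub>m (fst Y)"
  shows "is_cokernel (full_subcategory SOp T) X Y F Z C"
proof -
  obtain m G M n G' M' r GZ MZ where XYZ: "X = (m, G, M)" "Y = (n, G', M')" "Z = (r, GZ, MZ)"
    by (cases X; cases Y; cases Z)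
  have "Y \<in> Obj SOp" "Z \<in> Obj SOp" using T o by auto
  note X' = this[unfolded XYZ SOp_Obj] and C' = C[unfolded XYZ SOp_Hom] and F' = F[unfolded XYZ SOp_Hom]
  note d = dims[unfolded XYZ fst_conv]
  have cancel: "A = B" if "A * C = B * C" "dim_col A = r" "dim_col B = r" for A B
    by (rule right_inverse_cancel[OF CD[unfolded XYZ fst_conv] _ _ that(2,3,1)]) (use C' d in simp_all)
  show ?thesis
    unfolding is_cokernel_def
  proof (intro conjI ballI impI; simp)
    fix W U assume W: "W \<in> T" and U: "U \<in> Hom SOp Y W" and z: "U * F = 0\<^sub>m (fst W) (fst X)"
    obtain p GW MW where W': "W = (p, GW, MW)" by (cases W)
    have W'': "(p, GW, MW) \<in> Obj SOp" using W T W' by auto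
    note WO = W''[unfolded SOp_Obj] and U' = U[unfolded W' XYZ SOp_Hom]
    have "U = U * (D * C + F * R)" using one U' by (simp add: XYZ mat_one_right)
    also have "\<dots> = U * (D * C) + (U * F) * R" using U' C' d F' by (simp add: mat_algebra)
    also have "\<dots> = U * (D * C)" unfolding z using U' C' d F'
      by (simp add: mat_zero_left XYZ W') (auto intro!: eq_matI)
    finally have UDC: "U * (D * C) = U" by simp
    have intertwine: "(U * D) * B'' = B * (U * D)"
      if "U * B' = B * U" "C * B' = B'' * C" "dim_row B = p" "dim_col B = p" "dim_row B' = n" "dim_col B' = n"
        "dim_row B'' = r" "dim_col B'' = r" for B B' B''
    proof (rule cancel)
      have "(U * D * B'') * C = (U * D) * (C * B')" using that U' C' d by (simp add: mat_assoc)
      also have "\<dots> = (U * (D * C)) * B'" using that U' C' d by (simp add: mat_assoc)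
      also have "\<dots> = B * (U * (D * C))" using UDC that(1) by simp
      also have "\<dots> = (B * (U * D)) * C" using that U' C' d by (simp add: mat_assoc)
      finally show "(U * D * B'') * C = (B * (U * D)) * C" .
    qed (use that d in simp_all)
    show "\<exists>!V. V \<in> Hom SOp Z W \<and> V * C = U"
    proof (rule ex1I[of _ "U * D"])
      have "U * D * GZ = GW * (U * D)" "U * D * MZ = MW * (U * D)"
        using intertwine[of G' GW GZ] intertwine[of M' MW MZ] U' C' X' WO by auto
      then show "U * D \<in> Hom SOp Z W \<and> (U * D) * C = U"
        using UDC U' d C' by (simp add: W' XYZ SOp_Hom mat_assoc)
    next
      fix V assume V: "V \<in> Hom SOp Z W \<and> V * C = U"
      then have "V * C = (U * D) * C" using UDC U' d C' by (simp add: mat_assoc)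
      moreover have "dim_col V = r" using V by (simp add: W' XYZ SOp_Hom)
      ultimately show "V = U * D" by (rule cancel) (simp add: d)
    qed
  qed (use o C CF in auto)
qed

lemma SOp_direct_sum:
  fixes G :: "'k::field_char_0 mat"
  assumes X: "(m, G, M) \<in> Obj SOp" and Y: "(n, G', M') \<in> Obj SOp"
  shows "\<exists>P. direct_sum SOp (m, G, M) (n, G', M') P \<and>
    ((m, G, M) \<in> integral_super_operators \<and> (n, G', M') \<in> integral_super_operators \<longrightarrow> P \<in> integral_super_operators)"
proof -
  note X' = X[unfolded SOp_Obj] and Y' = Y[unfolded SOp_Obj]
  define i where "i = vcat (1\<^sub>m m) (0\<^sub>m n m :: 'k mat)"
  define j where "j = vcat (0\<^sub>m m n) (1\<^sub>m n :: 'k mat)"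
  define p where "p = hcat (1\<^sub>m m) (0\<^sub>m m n :: 'k mat)"
  define q where "q = hcat (0\<^sub>m n m) (1\<^sub>m n :: 'k mat)"
  have d: "dim_row i = m + n" "dim_col i = m" "dim_row j = m + n" "dim_col j = n"
    "dim_row p = m" "dim_col p = m + n" "dim_row q = n" "dim_col q = m + n"
    by (auto simp: i_def j_def p_def q_def)
  have pi: "p * i = 1\<^sub>m m" and qj: "q * j = 1\<^sub>m n" and pj: "p * j = 0\<^sub>m m n" and qi: "q * i = 0\<^sub>m n m"
    unfolding i_def j_def p_def q_def by (simp_all add: hcat_vcat mat_algebra)
  have one: "i * p + j * q = 1\<^sub>m (m + n)"
    unfolding i_def j_def p_def q_def
    by (simp add: mult_vcat mult_hcat mat_algebra, intro eq_matI) (auto simp: vcat_def hcat_def)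
  note dims = d X'[THEN conjunct1] X' Y'
  have red: "p * (i * B) = B" "q * (i * B) = 0\<^sub>m n (dim_col B)" if "dim_row B = m" for B
    using mat_eq_assoc[OF pi, of B] mat_eq_assoc[OF qi, of B] that d by (simp_all add: mat_algebra)
  have red': "q * (j * B) = B" "p * (j * B) = 0\<^sub>m m (dim_col B)" if "dim_row B = n" for B
    using mat_eq_assoc[OF qj, of B] mat_eq_assoc[OF pj, of B] that d by (simp_all add: mat_algebra)
  have az: "A + 0\<^sub>m (dim_row A) (dim_col A) = A" "0\<^sub>m (dim_row A) (dim_col A) + A = A" for A :: "'k mat"
    by (auto intro!: eq_matI)
  define GP where "GP = i * (G * p) + j * (G' * q)"
  define MP where "MP = i * (M * p) + j * (M' * q)"
  have dP: "dim_row GP = m + n" "dim_col GP = m + n" "dim_row MP = m + n" "dim_col MP = m + n"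
    by (auto simp: GP_def MP_def d)
  have mult: "(i * (B * p) + j * (B' * q)) * (i * (E * p) + j * (E' * q)) = i * (B * E * p) + j * (B' * E' * q)"
    if "dim_row B = m" "dim_col B = m" "dim_row E = m" "dim_col E = m"
      "dim_row B' = n" "dim_col B' = n" "dim_row E' = n" "dim_col E' = n" for B E B' E' :: "'k mat"
    using that by (simp add: mat_algebra d red red') (auto intro!: eq_matI simp: d)
  have P: "(m + n, GP, MP) \<in> Obj SOp"
    unfolding SOp_Obj
  proof (intro conjI)
    show "GP * GP = 1\<^sub>m (m + n)"
      unfolding GP_def using X' Y' by (simp add: mult) (simp add: mat_algebra d one)
    show "GP * MP = (-1) \<cdot>\<^sub>m (MP * GP)"
      unfolding GP_def MP_def using X' Y' by (simp add: mult) (simp add: mat_algebra d, auto intro!: eq_matI simp: d)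
  qed (simp_all add: dP)
  have homs: "i \<in> Hom SOp (m, G, M) (m + n, GP, MP)" "j \<in> Hom SOp (n, G', M') (m + n, GP, MP)"
    "p \<in> Hom SOp (m + n, GP, MP) (m, G, M)" "q \<in> Hom SOp (m + n, GP, MP) (n, G', M')"
    unfolding SOp_Hom GP_def MP_def using X' Y'
    by (simp_all add: mat_algebra d red red' pi qj pj qi) (auto intro!: eq_matI simp: d)
  have "direct_sum SOp (m, G, M) (n, G', M') (m + n, GP, MP)"
    unfolding direct_sum_def using P homs pi qj pj qi one by (simp, blast)
  moreover have "int_diagonalizable (MP * MP)" if "int_diagonalizable (M * M)" "int_diagonalizable (M' * M')"
  proof (rule int_diagonalizable_biproduct[of i "m + n" m p j n q "M * M" "M' * M'"])
    show "MP * MP = i * (M * M) * p + j * (M' * M') * q"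
      unfolding MP_def using X' Y' by (simp add: mult) (simp add: mat_algebra d)
  qed (use X' Y' d pi qj pj qi one that in \<open>auto intro!: carrier_matI\<close>)
  ultimately show ?thesis using P by (intro exI[of _ "(m + n, GP, MP)"]) (simp add: integral_iff)
qed

lemma SOp_zero_object:
  assumes "T \<subseteq> Obj SOp" "(0, G, M) \<in> T"
  shows "zero_object (full_subcategory SOp T) (0, G, M)"
  unfolding zero_object_def
proof (intro conjI ballI)
  have o: "dim_row G = 0 \<and> dim_col G = 0 \<and> dim_row M = 0 \<and> dim_col M = 0" using assms by (auto simp: SOp_Obj)
  fix X assume "X \<in> Obj (full_subcategory SOp T)"
  then have "X \<in> Obj SOp" using assms(1) by auto
  then obtain n G' M' where X: "X = (n, G', M')"
    and X': "dim_row G' = n \<and> dim_col G' = n \<and> dim_row M' = n \<and> dim_col M' = n"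
    by (cases X) (auto simp: SOp_Obj)
  show "Hom (full_subcategory SOp T) X (0, G, M) = {Zero (full_subcategory SOp T) X (0, G, M)}"
    "Hom (full_subcategory SOp T) (0, G, M) X = {Zero (full_subcategory SOp T) (0, G, M) X}"
    using o X' by (auto simp: X SOp_Hom mat_algebra intro!: eq_matI)
qed (use assms in simp)

lemma SOp_zero_object_dim:
  fixes X :: "nat \<times> 'k::field mat \<times> 'k mat"
  assumes "T \<subseteq> Obj SOp" "zero_object (full_subcategory SOp T) X"
  shows "fst X = 0"
proof -
  obtain n G M where X: "X = (n, G, M)" by (cases X)
  have "X \<in> Obj SOp" using assms by (auto simp: zero_object_def)
  then have "1\<^sub>m n \<in> Hom SOp X X" by (simp add: X SOp_Obj SOp_Hom mat_algebra)
  moreover have "Hom SOp X X = {0\<^sub>m n n}" using assms by (simp add: zero_object_def X)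
  ultimately show ?thesis by (simp add: one_mat_zero_iff X)
qed

lemma direct_sum_full_subcategory:
  "direct_sum C X Y P \<Longrightarrow> P \<in> T \<Longrightarrow> direct_sum (full_subcategory C T) X Y P"
  by (simp add: direct_sum_def)

abbreviation IntSOp :: "('k::field, nat \<times> 'k mat \<times> 'k mat, 'k mat) mon_cat" where
  "IntSOp \<equiv> full_subcategory SOp integral_super_operators"

text \<open>The kernel inclusion \<open>K\<close> vanishes by cancellation of \<open>F\<close>, so the splitting \<open>K L + R F = 1\<close> becomes \<open>R F = 1\<close>.\<close>

lemma mono_mor_left_inverse:
  fixes F :: "'k::field_char_0 mat"
  assumes o: "X \<in> integral_super_operators" "Y \<in> integral_super_operators" and F: "mono_mor IntSOp X Y F"
  shows "\<exists>R. dim_row R = fst X \<and> dim_col R = fst Y \<and> R * F = 1\<^sub>m (fst X)"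
proof -
  obtain m G M n G' M' where XY: "X = (m, G, M)" "Y = (n, G', M')" by (cases X; cases Y)
  have FH: "F \<in> Hom SOp X Y" using F by (simp add: mono_mor_def)
  have oX: "(m, G, M) \<in> Obj SOp" and oY: "(n, G', M') \<in> Obj SOp" using o integral_subset XY by auto
  obtain r K L R Z where Z: "Z \<in> Obj SOp" "fst Z = r" "K \<in> Hom SOp Z X"
    and d: "dim_row L = r" "dim_col L = m" "dim_row R = m" "dim_col R = n"
    and FK: "F * K = 0\<^sub>m n r" and one: "K * L + R * F = 1\<^sub>m m" and ZT: "Z \<in> integral_super_operators"
    using SOp_kernel[OF oX oY FH[unfolded XY]] o(1) unfolding XY by metis
  have dK: "dim_row K = m" "dim_col K = r" "dim_row F = n" "dim_col F = m"
    using SOp_Hom_dims[OF Z(3)] SOp_Hom_dims[OF FH] Z(2) by (auto simp: XY)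
  have zero: "0\<^sub>m m r \<in> Hom SOp Z X"
    using Z oX by (cases Z) (simp add: XY SOp_Hom SOp_Obj mat_algebra)
  have "F * K = F * 0\<^sub>m m r" using FK dK by (simp add: mat_zero_right)
  then have "K = 0\<^sub>m m r" using F ZT Z(3) zero by (auto simp: mono_mor_def)
  then have "K * L = 0\<^sub>m m m" using d by (simp add: mat_zero_left)
  moreover have "0\<^sub>m m m + R * F = R * F" using d dK by (intro eq_matI) simp_all
  ultimately have "R * F = 1\<^sub>m m" using one by simp
  then show ?thesis using d by (auto simp: XY)
qed

lemma left_inverse_mono_mor:
  fixes F :: "'k::field_char_0 mat"
  assumes FH: "F \<in> Hom SOp X Y" and R: "dim_row R = fst X" "dim_col R = fst Y" "R * F = 1\<^sub>m (fst X)"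
  shows "mono_mor IntSOp X Y F"
proof -
  note dF = SOp_Hom_dims[OF FH]
  have "U = V" if "U \<in> Hom SOp Z X" "V \<in> Hom SOp Z X" "F * U = F * V" for Z U V
    using left_inverse_cancel[OF R(3) _ _ _ _ that(3)] R dF SOp_Hom_dims[OF that(1)] SOp_Hom_dims[OF that(2)]
    by simp
  then show ?thesis using FH by (auto simp: mono_mor_def)
qed

lemma epi_mor_right_inverse:
  fixes F :: "'k::field_char_0 mat"
  assumes o: "X \<in> integral_super_operators" "Y \<in> integral_super_operators" and F: "epi_mor IntSOp X Y F"
  shows "\<exists>R. dim_row R = fst X \<and> dim_col R = fst Y \<and> F * R = 1\<^sub>m (fst Y)"
proof -
  obtain m G M n G' M' where XY: "X = (m, G, M)" "Y = (n, G', M')" by (cases X; cases Y)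
  have FH: "F \<in> Hom SOp X Y" using F by (simp add: epi_mor_def)
  have oX: "(m, G, M) \<in> Obj SOp" and oY: "(n, G', M') \<in> Obj SOp" using o integral_subset XY by auto
  obtain r C D R Z where Z: "Z \<in> Obj SOp" "fst Z = r" "C \<in> Hom SOp Y Z"
    and d: "dim_row D = n" "dim_col D = r" "dim_row R = m" "dim_col R = n"
    and CF: "C * F = 0\<^sub>m r m" and one: "D * C + F * R = 1\<^sub>m n" and ZT: "Z \<in> integral_super_operators"
    using SOp_cokernel[OF oX oY FH[unfolded XY]] o(2) unfolding XY by metis
  have dC: "dim_row C = r" "dim_col C = n" "dim_row F = n" "dim_col F = m"
    using SOp_Hom_dims[OF Z(3)] SOp_Hom_dims[OF FH] Z(2) by (auto simp: XY)
  have zero: "0\<^sub>m r n \<in> Hom SOp Y Z"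
    using Z oY by (cases Z) (simp add: XY SOp_Hom SOp_Obj mat_algebra)
  have "C * F = 0\<^sub>m r n * F" using CF dC by (simp add: mat_zero_left)
  then have "C = 0\<^sub>m r n" using F ZT Z(3) zero by (auto simp: epi_mor_def)
  then have "D * C = 0\<^sub>m n n" using d by (simp add: mat_zero_right)
  moreover have "0\<^sub>m n n + F * R = F * R" using d dC by (intro eq_matI) simp_all
  ultimately have "F * R = 1\<^sub>m n" using one by simp
  then show ?thesis using d by (auto simp: XY)
qed

text \<open>A monomorphism \<open>F\<close> is split injective as a matrix.  With a cokernel \<open>C\<close> and a splitting \<open>D C + F R = 1\<close>,
  cancelling \<open>F\<close> in \<open>F (R F) = F\<close> gives \<open>R F = 1\<close>, and the same splitting exhibits \<open>F\<close> as a kernel of \<open>C\<close>.\<close>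

lemma IntSOp_abelian_category:
  "abelian_category (IntSOp :: ('k::field_char_0, nat \<times> 'k mat \<times> 'k mat, 'k mat) mon_cat)"
proof (rule abelian_category.intro)
  let ?T = "integral_super_operators :: (nat \<times> 'k mat \<times> 'k mat) set"
  show "linear_category (IntSOp :: ('k, nat \<times> 'k mat \<times> 'k mat, 'k mat) mon_cat)"
    by (rule linear_category_full_subcategory[OF SOp_linear_category integral_subset])
  show "abelian_category_axioms (IntSOp :: ('k, nat \<times> 'k mat \<times> 'k mat, 'k mat) mon_cat)"
  proof
    have "0\<^sub>m 0 0 * 0\<^sub>m 0 0 = of_int 0 \<cdot>\<^sub>m (1\<^sub>m 0 :: 'k mat)" by (intro eq_matI) auto
    then have "int_diagonalizable (0\<^sub>m 0 0 * 0\<^sub>m 0 0 :: 'k mat)" by (simp only: int_diagonalizable_scalar)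
    moreover have "(0, 0\<^sub>m 0 0, 0\<^sub>m 0 0) \<in> Obj (SOp :: ('k, nat \<times> 'k mat \<times> 'k mat, 'k mat) mon_cat)"
      by (auto simp: SOp_Obj intro!: eq_matI)
    ultimately have "(0, 0\<^sub>m 0 0, 0\<^sub>m 0 0) \<in> ?T" by (simp add: integral_iff)
    then show "\<exists>Z. zero_object IntSOp (Z :: nat \<times> 'k mat \<times> 'k mat)"
      using SOp_zero_object[OF integral_subset] by blast
  next
    fix X Y :: "nat \<times> 'k mat \<times> 'k mat" assume XY: "X \<in> Obj IntSOp" "Y \<in> Obj IntSOp"
    obtain m G M n G' M' where eq: "X = (m, G, M)" "Y = (n, G', M')" by (cases X; cases Y)
    have T: "X \<in> ?T" "Y \<in> ?T" using XY by simp_all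
    have o: "(m, G, M) \<in> Obj SOp" "(n, G', M') \<in> Obj SOp" using T integral_subset eq by auto
    obtain P where P: "direct_sum SOp (m, G, M) (n, G', M') P"
      "(m, G, M) \<in> ?T \<and> (n, G', M') \<in> ?T \<longrightarrow> P \<in> ?T"
      using SOp_direct_sum[OF o] by (elim exE conjE)
    have "P \<in> ?T" using P(2) T[unfolded eq] by (intro mp[OF P(2)] conjI)
    with P(1) have "direct_sum IntSOp X Y P" unfolding eq by (rule direct_sum_full_subcategory)
    then show "\<exists>P. direct_sum IntSOp X Y P" by (rule exI)
  next
    fix X Y :: "nat \<times> 'k mat \<times> 'k mat" and F
    assume XY: "X \<in> Obj IntSOp" "Y \<in> Obj IntSOp" and F: "F \<in> Hom IntSOp X Y"
    obtain m G M n G' M' where eq: "X = (m, G, M)" "Y = (n, G', M')" by (cases X; cases Y)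
    have T: "X \<in> ?T" "Y \<in> ?T" using XY by simp_all
    have o: "(m, G, M) \<in> Obj SOp" "(n, G', M') \<in> Obj SOp" using T integral_subset eq by auto
    have F': "F \<in> Hom SOp (m, G, M) (n, G', M')" "F \<in> Hom SOp X Y" using F by (simp_all add: eq)
    obtain r K L R Z where "Z \<in> ?T" "fst Z = r" "K \<in> Hom SOp Z X"
      "dim_row L = r" "dim_col L = m" "dim_row R = m" "dim_col R = n"
      "F * K = 0\<^sub>m n r" "L * K = 1\<^sub>m r" "K * L + R * F = 1\<^sub>m m"
      using SOp_kernel[OF o F'(1)] T unfolding eq by metis
    then have "is_kernel IntSOp X Y F Z K"
      using T F' by (intro SOp_is_kernelI[OF integral_subset, where L = L and R = R]) (simp_all add: eq)
    then show "\<exists>K k. is_kernel IntSOp X Y F K k" by blast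
    obtain r C D R Z where "Z \<in> ?T" "fst Z = r" "C \<in> Hom SOp Y Z"
      "dim_row D = n" "dim_col D = r" "dim_row R = m" "dim_col R = n"
      "C * F = 0\<^sub>m r m" "C * D = 1\<^sub>m r" "D * C + F * R = 1\<^sub>m n"
      using SOp_cokernel[OF o F'(1)] T unfolding eq by metis
    then have "is_cokernel IntSOp X Y F Z C"
      using T F' by (intro SOp_is_cokernelI[OF integral_subset, where D = D and R = R]) (simp_all add: eq)
    then show "\<exists>Q q. is_cokernel IntSOp X Y F Q q" by blast
  next
    fix X Y :: "nat \<times> 'k mat \<times> 'k mat" and F
    assume XY: "X \<in> Obj IntSOp" "Y \<in> Obj IntSOp" and mono: "mono_mor IntSOp X Y F"
    obtain m G M n G' M' where eq: "X = (m, G, M)" "Y = (n, G', M')" by (cases X; cases Y)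
    have T: "X \<in> ?T" "Y \<in> ?T" using XY by simp_all
    have o: "(m, G, M) \<in> Obj SOp" "(n, G', M') \<in> Obj SOp" using T integral_subset eq by auto
    have F: "F \<in> Hom SOp (m, G, M) (n, G', M')" "F \<in> Hom SOp X Y" using mono by (simp_all add: mono_mor_def eq)
    have dF: "dim_row F = n" "dim_col F = m" using F(1) by (simp_all add: SOp_Hom)
    obtain S where S: "dim_row S = m" "dim_col S = n" "S * F = 1\<^sub>m m"
      using mono_mor_left_inverse[OF T mono] by (auto simp: eq)
    obtain r C D R Z where Z: "Z \<in> ?T" "fst Z = r" "C \<in> Hom SOp Y Z"
      and d: "dim_row D = n" "dim_col D = r" "dim_row R = m" "dim_col R = n"
      and eqs: "C * F = 0\<^sub>m r m" "C * D = 1\<^sub>m r" "D * C + F * R = 1\<^sub>m n"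
      using SOp_cokernel[OF o F(1)] T unfolding eq by metis
    have dC: "dim_row C = r" "dim_col C = n" using SOp_Hom_dims[OF Z(3)] Z(2) by (auto simp: eq)
    have "F = (D * C + F * R) * F" using eqs(3) dF by (simp add: mat_one_left)
    also have "\<dots> = D * (C * F) + F * (R * F)" using d dC dF by (simp add: mat_algebra)
    also have "\<dots> = F * (R * F)" unfolding eqs(1) using d dF by (simp add: mat_zero_right) (auto intro!: eq_matI)
    finally have "F * (R * F) = F * 1\<^sub>m m" using dF by (simp add: mat_one_right)
    from left_inverse_cancel[OF S(3) _ _ _ _ this] have RF: "R * F = 1\<^sub>m m" using S d dF by simp
    have "F * R + D * C = 1\<^sub>m n" using eqs(3) d dC dF by (subst mat_add_comm) simp_all
    then have "is_kernel IntSOp Y Z C X F"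
      using T F Z d eqs(1) RF by (intro SOp_is_kernelI[OF integral_subset, where L = R and R = D]) (simp_all add: eq)
    then show "\<exists>Z\<in>Obj IntSOp. \<exists>g\<in>Hom IntSOp Y Z. is_kernel IntSOp Y Z g X F" using Z by auto
  next
    fix X Y :: "nat \<times> 'k mat \<times> 'k mat" and F
    assume XY: "X \<in> Obj IntSOp" "Y \<in> Obj IntSOp" and epi: "epi_mor IntSOp X Y F"
    obtain m G M n G' M' where eq: "X = (m, G, M)" "Y = (n, G', M')" by (cases X; cases Y)
    have T: "X \<in> ?T" "Y \<in> ?T" using XY by simp_all
    have o: "(m, G, M) \<in> Obj SOp" "(n, G', M') \<in> Obj SOp" using T integral_subset eq by auto
    have F: "F \<in> Hom SOp (m, G, M) (n, G', M')" "F \<in> Hom SOp X Y" using epi by (simp_all add: epi_mor_def eq)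
    have dF: "dim_row F = n" "dim_col F = m" using F(1) by (simp_all add: SOp_Hom)
    obtain S where S: "dim_row S = m" "dim_col S = n" "F * S = 1\<^sub>m n"
      using epi_mor_right_inverse[OF T epi] by (auto simp: eq)
    obtain r K L R Z where Z: "Z \<in> ?T" "fst Z = r" "K \<in> Hom SOp Z X"
      and d: "dim_row L = r" "dim_col L = m" "dim_row R = m" "dim_col R = n"
      and eqs: "F * K = 0\<^sub>m n r" "L * K = 1\<^sub>m r" "K * L + R * F = 1\<^sub>m m"
      using SOp_kernel[OF o F(1)] T unfolding eq by metis
    have dK: "dim_row K = m" "dim_col K = r" using SOp_Hom_dims[OF Z(3)] Z(2) by (auto simp: eq)
    have "F = F * (K * L + R * F)" using eqs(3) dF by (simp add: mat_one_right)
    also have "\<dots> = (F * K) * L + (F * R) * F" using d dK dF by (simp add: mat_algebra)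
    also have "\<dots> = (F * R) * F" unfolding eqs(1) using d dF by (simp add: mat_zero_left) (auto intro!: eq_matI)
    finally have "(F * R) * F = 1\<^sub>m n * F" using dF by (simp add: mat_one_left)
    from right_inverse_cancel[OF S(3) _ _ _ _ this] have FR: "F * R = 1\<^sub>m n" using S d dF by simp
    have "R * F + K * L = 1\<^sub>m m" using eqs(3) d dK dF by (subst mat_add_comm) simp_all
    then have "is_cokernel IntSOp Z X K Y F"
      using T F Z d eqs(1) FR by (intro SOp_is_cokernelI[OF integral_subset, where D = R and R = L]) (simp_all add: eq)
    then show "\<exists>Z\<in>Obj IntSOp. \<exists>g\<in>Hom IntSOp Z X. is_cokernel IntSOp Z X g Y F" using Z by auto
  qed
qed

subsection \<open>Duals\<close>

definition row_vec_of_mat :: "nat \<Rightarrow> 'k mat \<Rightarrow> 'k mat" where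
  "row_vec_of_mat n A = mat 1 (n * n) (\<lambda>(_, k). A $$ (k div n, k mod n))"

lemma dim_row_vec_of_mat [simp]:
  "dim_row (row_vec_of_mat n A) = 1" "dim_col (row_vec_of_mat n A) = n * n"
  by (auto simp: row_vec_of_mat_def)

text \<open>The standard pairing moves one tensor factor to the other side as its transpose.\<close>

lemma row_vec_kronecker:
  fixes A B :: "'k::comm_semiring_1 mat"
  assumes "dim_row A = n" "dim_col A = n" "dim_row B = n" "dim_col B = n"
  shows "row_vec_of_mat n (1\<^sub>m n) * kronecker A B = row_vec_of_mat n (transpose_mat A * B)"
proof (intro eq_matI)
  fix a l assume "a < dim_row (row_vec_of_mat n (transpose_mat A * B))" "l < dim_col (row_vec_of_mat n (transpose_mat A * B))"
  then have a: "a = 0" and l: "l < n * n" by auto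
  note b = pair_index_bounds[OF l]
  have "(row_vec_of_mat n (1\<^sub>m n) * kronecker A B) $$ (a, l)
      = (\<Sum>k<n * n. (\<lambda>i j. 1\<^sub>m n $$ (i, j) * (A $$ (i, l div n) * B $$ (j, l mod n))) (k div n) (k mod n))"
    using assms a l by (simp add: mat_entry) (auto simp: row_vec_of_mat_def kronecker_entry intro!: sum.cong)
  also have "\<dots> = (\<Sum>i<n. \<Sum>j<n. 1\<^sub>m n $$ (i, j) * (A $$ (i, l div n) * B $$ (j, l mod n)))"
    by (rule sum_pair_index)
  also have "\<dots> = (\<Sum>i<n. \<Sum>j<n. if j = i then A $$ (i, l div n) * B $$ (i, l mod n) else 0)"
    by (intro sum.cong) auto
  also have "\<dots> = (transpose_mat A * B) $$ (l div n, l mod n)"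
    using assms b by (simp add: mat_entry sum.delta)
  finally show "(row_vec_of_mat n (1\<^sub>m n) * kronecker A B) $$ (a, l) = row_vec_of_mat n (transpose_mat A * B) $$ (a, l)"
    using a l by (simp add: row_vec_of_mat_def)
qed (use assms in auto)

lemma kronecker_transpose: "transpose_mat (kronecker A B) = kronecker (transpose_mat A) (transpose_mat B)"
  using pair_index_bounds[of _ "dim_row A" "dim_row B"] pair_index_bounds[of _ "dim_col A" "dim_col B"]
  by (intro eq_matI) (auto simp: kronecker_entry)

lemma transpose_mat_mult:
  fixes A B :: "'k::comm_semiring_0 mat"
  shows "dim_col A = dim_row B \<Longrightarrow> transpose_mat (A * B) = transpose_mat B * transpose_mat A"
  by (intro transpose_mult[of _ "dim_row A" "dim_col A" _ "dim_col B"]) auto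

lemma transpose_mat_add:
  "dim_row A = dim_row B \<Longrightarrow> dim_col A = dim_col B \<Longrightarrow> transpose_mat (A + B) = transpose_mat A + transpose_mat B"
  by (intro eq_matI) auto

lemma row_vec_add:
  "dim_row A = n \<Longrightarrow> dim_col A = n \<Longrightarrow> dim_row B = n \<Longrightarrow> dim_col B = n \<Longrightarrow>
    row_vec_of_mat n A + row_vec_of_mat n B = row_vec_of_mat n (A + B)"
  by (intro eq_matI) (auto simp: row_vec_of_mat_def dest: pair_index_bounds)

text \<open>The snake identity for the pairing \<open>\<Sum> e\<^sub>i \<otimes> e\<^sub>i\<close> of \<open>k\<^sup>n\<close> with itself.  Among the threefold indices only
  \<open>(j, j, j)\<close>, with number \<open>(j n + j) n + j\<close>, contributes.\<close>

lemma zigzag: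
  "kronecker (1\<^sub>m n) (row_vec_of_mat n (1\<^sub>m n)) * kronecker (transpose_mat (row_vec_of_mat n (1\<^sub>m n))) (1\<^sub>m n)
    = (1\<^sub>m n :: 'k::comm_semiring_1 mat)" (is "?A * ?B = _")
proof (intro eq_matI)
  fix i j assume "i < dim_row (1\<^sub>m n :: 'k mat)" "j < dim_col (1\<^sub>m n :: 'k mat)"
  then have ij: "i < n" "j < n" by auto
  define k0 where "k0 = (j * n + j) * n + j"
  have "k0 < n * (n * n)"
  proof -
    have "j * n + j < n * n" using ij mult_le_mono1[of "Suc j" n n] by simp
    then have "(j * n + j) * n + j < (n * n) * n" using ij mult_le_mono1[of "Suc (j * n + j)" "n * n" n] by simp
    then show ?thesis by (simp add: k0_def mult.assoc)
  qed
  have "(?A * ?B) $$ (i, j) = (\<Sum>k<n * (n * n). ?A $$ (i, k) * ?B $$ (k, j))"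
    using ij by (simp add: mat_entry mult.assoc)
  also have "\<dots> = (\<Sum>k<n * (n * n). if k = k0 then (if i = j then 1 else 0) else 0)"
  proof (intro sum.cong refl)
    fix k assume "k \<in> {..<n * (n * n)}"
    then have k: "k < n * (n * n)" "k < n * n * n" by (auto simp: mult.assoc)
    note kb = pair_index_bounds[OF k(1)] pair_index_bounds[OF k(2)]
    define a b c where "a = k div n div n" and "b = k div n mod n" and "c = k mod n"
    have k_eq: "k = (a * n + b) * n + c" unfolding a_def b_def c_def by simp
    have digits: "k div (n * n) = a" "k mod (n * n) div n = b" "k mod (n * n) mod n = c"
      using div_mult2_eq[of k n n] mod_mult2_eq[of k n n] ij by (auto simp: a_def b_def c_def)
    have lt: "b < n" "c < n" using ij by (auto simp: b_def c_def)
    have "?A $$ (i, k) * ?B $$ (k, j) = (if i = a \<and> b = c \<and> a = b \<and> c = j then 1 else 0)"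
      using ij k kb digits pair_index_bounds[OF kb(2)] pair_index_bounds[OF kb(3)]
      by (simp add: kronecker_entry row_vec_of_mat_def a_def[symmetric] b_def[symmetric] c_def[symmetric])
    also have "(i = a \<and> b = c \<and> a = b \<and> c = j) \<longleftrightarrow> (k = k0 \<and> i = j)"
    proof
      assume "k = k0 \<and> i = j"
      then have eq: "(a * n + b) * n + c = (j * n + j) * n + j" by (simp add: k_eq k0_def)
      then have "((a * n + b) * n + c) mod n = ((j * n + j) * n + j) mod n"
        "((a * n + b) * n + c) div n = ((j * n + j) * n + j) div n" by simp_all
      then have cj: "c = j" and eq': "a * n + b = j * n + j" using lt ij by simp_all
      then have "(a * n + b) mod n = (j * n + j) mod n" "(a * n + b) div n = (j * n + j) div n" by simp_all
      then have "b = j" "a = j" using lt ij by simp_all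
      with cj \<open>k = k0 \<and> i = j\<close> show "i = a \<and> b = c \<and> a = b \<and> c = j" by simp
    qed (auto simp: k_eq k0_def)
    finally show "?A $$ (i, k) * ?B $$ (k, j) = (if k = k0 then (if i = j then 1 else 0) else 0)" by simp
  qed
  also have "\<dots> = 1\<^sub>m n $$ (i, j)" using \<open>k0 < n * (n * n)\<close> ij by (simp add: sum.delta)
  finally show "(?A * ?B) $$ (i, j) = 1\<^sub>m n $$ (i, j)" .
qed auto

text \<open>The dual of \<open>(G, M)\<close> is the transpose twisted by the antipode \<open>h \<mapsto> - g h\<close>.  Evaluation and
  coevaluation are the standard ones of vector spaces.\<close>

definition super_dual :: "nat \<times> 'k::field mat \<times> 'k mat \<Rightarrow> nat \<times> 'k mat \<times> 'k mat" where
  "super_dual = (\<lambda>(n, G, M). (n, transpose_mat G, (-1) \<cdot>\<^sub>m (transpose_mat M * transpose_mat G)))"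

lemma transpose_smult_mat: "transpose_mat (c \<cdot>\<^sub>m A) = c \<cdot>\<^sub>m transpose_mat A"
  by (intro eq_matI) auto

lemma super_dual_obj:
  assumes "(n, G, M) \<in> Obj SOp"
  shows "super_dual (n, G, M) \<in> Obj SOp"
    and "transpose_mat M * transpose_mat G = (-1) \<cdot>\<^sub>m (transpose_mat G * transpose_mat M)"
    and "transpose_mat G * transpose_mat G = 1\<^sub>m n"
proof -
  note X = assms[unfolded SOp_Obj]
  show GG: "transpose_mat G * transpose_mat G = 1\<^sub>m n"
    using X by (simp add: transpose_mat_mult[symmetric])
  have "transpose_mat M * transpose_mat G = transpose_mat (G * M)"
    by (rule transpose_mat_mult[symmetric]) (use X in simp)
  also have "G * M = (-1) \<cdot>\<^sub>m (M * G)" using X by blast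
  also have "transpose_mat \<dots> = (-1) \<cdot>\<^sub>m (transpose_mat G * transpose_mat M)"
    using X by (simp add: transpose_mat_mult transpose_smult_mat)
  finally show MG: "transpose_mat M * transpose_mat G = (-1) \<cdot>\<^sub>m (transpose_mat G * transpose_mat M)" .
  have "transpose_mat G * (transpose_mat M * transpose_mat G) = (-1) \<cdot>\<^sub>m transpose_mat M"
    unfolding MG using X by (simp add: mat_algebra mat_eq_assoc[OF GG])
  moreover have "transpose_mat M * transpose_mat G * transpose_mat G = transpose_mat M"
    using X GG by (simp add: mat_assoc mat_one_right)
  ultimately show "super_dual (n, G, M) \<in> Obj SOp"
    unfolding super_dual_def using X GG by (simp add: SOp_Obj mat_smult_left mat_smult_right)
qed

lemma SOp_left_dual:
  assumes X: "X \<in> Obj SOp"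
  shows "left_dual SOp X (super_dual X)"
proof -
  obtain n G M where XE: "X = (n, G, M)" by (cases X)
  note X' = X[unfolded XE SOp_Obj]
  have o: "(n, G, M) \<in> Obj SOp" using X XE by simp
  define Gd where "Gd = transpose_mat G"
  define Md where "Md = (-1) \<cdot>\<^sub>m (transpose_mat M * transpose_mat G)"
  have Y: "super_dual (n, G, M) = (n, Gd, Md)" by (simp add: super_dual_def Gd_def Md_def)
  have Yo: "(n, Gd, Md) \<in> Obj SOp" using super_dual_obj(1)[OF o] Y XE by simp
  have d: "dim_row G = n" "dim_col G = n" "dim_row M = n" "dim_col M = n"
    "dim_row Gd = n" "dim_col Gd = n" "dim_row Md = n" "dim_col Md = n"
    using X' by (auto simp: Gd_def Md_def)
  have tr: "transpose_mat Gd = G" "transpose_mat Md = (-1) \<cdot>\<^sub>m (G * M)"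
    using X' by (simp_all add: Gd_def Md_def transpose_smult_mat transpose_mat_mult)
  let ?ev = "row_vec_of_mat n (1\<^sub>m n) :: 'a mat"
  let ?co = "transpose_mat ?ev"
  have zero: "row_vec_of_mat n ((-1) \<cdot>\<^sub>m A + A) = 0\<^sub>m 1 (n * n)" if "dim_row A = n" "dim_col A = n" for A :: "'a mat"
    using that by (intro eq_matI) (auto simp: row_vec_of_mat_def dest: pair_index_bounds)
  have ev: "?ev \<in> Hom SOp (super_dual X \<boxtimes>\<^bsub>SOp\<^esub> X) (Unit SOp)"
    unfolding Y XE using d X'
    by (simp add: SOp_Hom mat_algebra row_vec_kronecker row_vec_add zero tr del: One_nat_def)
  have co: "?co \<in> Hom SOp (Unit SOp) (X \<boxtimes>\<^bsub>SOp\<^esub> super_dual X)"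
  proof -
    have "?ev * kronecker (transpose_mat G) (transpose_mat Gd) = ?ev"
      using d X' by (simp add: row_vec_kronecker tr)
    from arg_cong[OF this, of transpose_mat] have 1: "kronecker G Gd * ?co = ?co"
      using d by (simp add: transpose_mat_mult kronecker_transpose)
    have eqM: "G * transpose_mat Md = (-1) \<cdot>\<^sub>m M" unfolding tr
      using mat_eq_assoc[of G G "1\<^sub>m n" M] X'[THEN conjunct2, THEN conjunct2, THEN conjunct2, THEN conjunct2, THEN conjunct1] d
      by (simp add: mat_smult_right mat_one_left)
    have "?ev * (kronecker (transpose_mat G) (transpose_mat Md) + kronecker (transpose_mat M) (1\<^sub>m n))
        = row_vec_of_mat n ((-1) \<cdot>\<^sub>m M + M)"
      using d eqM by (simp add: mat_dist_right row_vec_kronecker row_vec_add mat_one_right)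
    also have "row_vec_of_mat n ((-1) \<cdot>\<^sub>m M + M) = 0\<^sub>m 1 (n * n)" using d by (intro zero)
    finally have "?ev * (kronecker (transpose_mat G) (transpose_mat Md) + kronecker (transpose_mat M) (1\<^sub>m n)) = 0\<^sub>m 1 (n * n)" .
    from arg_cong[OF this, of transpose_mat] have 2: "(kronecker G Md + kronecker M (1\<^sub>m n)) * ?co = 0\<^sub>m (n * n) 1"
      using d by (simp add: transpose_mat_mult kronecker_transpose transpose_mat_add)
    show ?thesis unfolding Y XE using d 1 2 by (simp add: SOp_Hom mat_algebra del: One_nat_def)
  qed
  have z1: "kronecker (1\<^sub>m n) ?ev * kronecker ?co (1\<^sub>m n) = 1\<^sub>m n" by (rule zigzag)
  have z2: "kronecker ?ev (1\<^sub>m n) * kronecker (1\<^sub>m n) ?co = 1\<^sub>m n"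
    using arg_cong[OF z1, of transpose_mat] by (simp add: transpose_mat_mult kronecker_transpose)
  have inv: "inverse_mor SOp ((super_dual X \<boxtimes>\<^bsub>SOp\<^esub> X) \<boxtimes>\<^bsub>SOp\<^esub> super_dual X) (super_dual X \<boxtimes>\<^bsub>SOp\<^esub> (X \<boxtimes>\<^bsub>SOp\<^esub> super_dual X))
      (Assoc SOp (super_dual X) X (super_dual X)) (1\<^sub>m (n * n * n))"
  proof -
    have eq: "(super_dual X \<boxtimes>\<^bsub>SOp\<^esub> X) \<boxtimes>\<^bsub>SOp\<^esub> super_dual X = super_dual X \<boxtimes>\<^bsub>SOp\<^esub> (X \<boxtimes>\<^bsub>SOp\<^esub> super_dual X)"
      unfolding Y XE by (rule SOp_tensor_assoc[OF Yo o Yo])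
    obtain Gt Mt where t: "(super_dual X \<boxtimes>\<^bsub>SOp\<^esub> X) \<boxtimes>\<^bsub>SOp\<^esub> super_dual X = (n * n * n, Gt, Mt)" by (simp add: Y XE)
    have "(n * n * n, Gt, Mt) \<in> Obj SOp"
      unfolding t[symmetric] using SOp_tensor_obj[OF Yo o] Yo unfolding Y XE SOp_simps by (rule SOp_tensor_obj[unfolded SOp_simps])
    then show ?thesis
      unfolding eq[symmetric] t by (simp add: inverse_mor_def SOp_Hom SOp_Obj mat_algebra Y XE)
  qed
  show ?thesis
    unfolding left_dual_def
  proof (intro bexI[OF _ ev] bexI[OF _ co] exI conjI)
    show "inverse_mor SOp ((super_dual X \<boxtimes>\<^bsub>SOp\<^esub> X) \<boxtimes>\<^bsub>SOp\<^esub> super_dual X) (super_dual X \<boxtimes>\<^bsub>SOp\<^esub> (X \<boxtimes>\<^bsub>SOp\<^esub> super_dual X))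
      (Assoc SOp (super_dual X) X (super_dual X)) (1\<^sub>m (n * n * n))" by (rule inv)
    show "RUnit SOp X \<star>\<^bsub>SOp\<^esub> (Id SOp X \<boxtimes>\<^sub>m\<^bsub>SOp\<^esub> ?ev) \<star>\<^bsub>SOp\<^esub> Assoc SOp X (super_dual X) X \<star>\<^bsub>SOp\<^esub> (?co \<boxtimes>\<^sub>m\<^bsub>SOp\<^esub> Id SOp X) = LUnit SOp X"
      using z1 by (simp add: Y XE mat_algebra mult.assoc)
    show "LUnit SOp (super_dual X) \<star>\<^bsub>SOp\<^esub> (?ev \<boxtimes>\<^sub>m\<^bsub>SOp\<^esub> Id SOp (super_dual X)) \<star>\<^bsub>SOp\<^esub> 1\<^sub>m (n * n * n)
        \<star>\<^bsub>SOp\<^esub> (Id SOp (super_dual X) \<boxtimes>\<^sub>m\<^bsub>SOp\<^esub> ?co) = RUnit SOp (super_dual X)"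
      using z2 by (simp add: Y XE mat_algebra mult.assoc)
  qed
qed

text \<open>The square of the antipode changes the sign of \<open>h\<close>.  The twofold dual does the same to \<open>M\<close>, and the
  fourfold dual is the identity; hence the threefold dual of \<open>X\<close> is an object whose left dual is \<open>X\<close>.\<close>

lemma super_dual_twice:
  assumes "(n, G, M) \<in> Obj SOp"
  shows "super_dual (super_dual (n, G, M)) = (n, G, (-1) \<cdot>\<^sub>m M)"
proof -
  note X' = assms[unfolded SOp_Obj]
  have d: "dim_row G = n" "dim_col G = n" "dim_row M = n" "dim_col M = n" using X' by blast+
  have "(G * M) * G = (-1) \<cdot>\<^sub>m M" using X' by (simp add: mat_algebra)
  then show ?thesis
    by (simp add: super_dual_def transpose_smult_mat transpose_mat_mult mat_smult_left d)
qed

lemma super_dual_fourfold: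
  assumes "X \<in> Obj SOp"
  shows "super_dual (super_dual (super_dual (super_dual X))) = X"
proof -
  obtain n G M where XE: "X = (n, G, M)" by (cases X)
  have o: "(n, G, M) \<in> Obj SOp" using assms XE by simp
  obtain G' M' where Y: "super_dual X = (n, G', M')" by (simp add: XE super_dual_def)
  have Yo: "(n, G', M') \<in> Obj SOp" using super_dual_obj(1)[OF o] Y XE by simp
  have YY: "super_dual (n, G', M') = (n, G, (-1) \<cdot>\<^sub>m M)" using super_dual_twice[OF o] Y XE by simp
  have "(n, G, (-1) \<cdot>\<^sub>m M) \<in> Obj SOp" using super_dual_obj(1)[OF Yo] YY by simp
  from super_dual_twice[OF this] show ?thesis using Y YY by (simp add: XE)
qed

lemma super_dual_integral:
  assumes "X \<in> integral_super_operators"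
  shows "super_dual X \<in> (integral_super_operators :: (nat \<times> 'k::field_char_0 mat \<times> 'k mat) set)"
proof -
  obtain n G M where XE: "X = (n, G, M)" by (cases X)
  have o: "(n, G, M) \<in> Obj SOp" and int: "int_diagonalizable (M * M)" using assms by (simp_all add: XE integral_iff)
  note X' = o[unfolded SOp_Obj] and dual = super_dual_obj[OF o]
  let ?N = "transpose_mat M * transpose_mat G"
  have "?N * ?N = transpose_mat M * (transpose_mat G * (transpose_mat M * transpose_mat G))"
    using X' by (simp add: mat_assoc)
  also have "\<dots> = (-1) \<cdot>\<^sub>m (transpose_mat M * transpose_mat M)"
    unfolding dual(2) using X' by (simp add: mat_algebra mat_eq_assoc[OF dual(3)])
  also have "\<dots> = (-1) \<cdot>\<^sub>m transpose_mat (M * M)" using X' by (simp add: transpose_mat_mult)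
  finally have eq: "?N * ?N = (-1) \<cdot>\<^sub>m transpose_mat (M * M)" .
  have "((-1) \<cdot>\<^sub>m ?N) * ((-1) \<cdot>\<^sub>m ?N) = (-1) \<cdot>\<^sub>m transpose_mat (M * M)"
    unfolding eq[symmetric] using X' by (simp add: mat_smult_left mat_smult_right)
  moreover have "int_diagonalizable ((-1) \<cdot>\<^sub>m transpose_mat (M * M))"
    using int X' by (intro int_diagonalizable_neg_transpose[of _ n] carrier_matI) simp_all
  ultimately show ?thesis using dual(1) by (simp add: XE super_dual_def integral_iff)
qed

lemma integral_tensor:
  assumes "X \<in> integral_super_operators" "Y \<in> integral_super_operators"
  shows "X \<boxtimes>\<^bsub>SOp\<^esub> Y \<in> (integral_super_operators :: (nat \<times> 'k::field_char_0 mat \<times> 'k mat) set)"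
proof -
  obtain m G M n G' M' where eq: "X = (m, G, M)" "Y = (n, G', M')" by (cases X; cases Y)
  have o: "(m, G, M) \<in> Obj SOp" "(n, G', M') \<in> Obj SOp"
    and int: "int_diagonalizable (M * M)" "int_diagonalizable (M' * M')" using assms by (simp_all add: eq integral_iff)
  have "M * M \<in> carrier_mat m m" "M' * M' \<in> carrier_mat n n"
    by (intro carrier_matI; use o in \<open>simp add: SOp_Obj\<close>)+
  then have "int_diagonalizable (kronecker (M * M) (1\<^sub>m n) + kronecker (1\<^sub>m m) (M' * M'))"
    using int by (intro int_diagonalizable_kronecker_sum)
  then show ?thesis using SOp_tensor_obj[OF o] by (simp add: eq integral_iff SOp_tensor_square[OF o])
qed

lemma integral_unit: "Unit SOp \<in> (integral_super_operators :: (nat \<times> 'k::field_char_0 mat \<times> 'k mat) set)"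
proof -
  have "0\<^sub>m 1 1 * 0\<^sub>m 1 1 = of_int 0 \<cdot>\<^sub>m (1\<^sub>m 1 :: 'k mat)" by (intro eq_matI) (auto simp: mat_entry)
  then have "int_diagonalizable (0\<^sub>m 1 1 * 0\<^sub>m 1 1 :: 'k mat)" by (simp only: int_diagonalizable_scalar)
  then show ?thesis by (simp add: integral_iff SOp_Obj mat_algebra del: One_nat_def)
qed

lemma integral_tensor_subcategory:
  "tensor_subcategory (SOp :: ('k::field_char_0, nat \<times> 'k mat \<times> 'k mat, 'k mat) mon_cat) integral_super_operators"
proof -
  let ?T = "integral_super_operators :: (nat \<times> 'k mat \<times> 'k mat) set"
  have "abelian_subcategory (SOp :: ('k, nat \<times> 'k mat \<times> 'k mat, 'k mat) mon_cat) ?T"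
    unfolding abelian_subcategory_def
  proof (intro conjI ballI allI impI)
    show "?T \<subseteq> Obj SOp" by (rule integral_subset)
    show "abelian_category (IntSOp :: ('k, nat \<times> 'k mat \<times> 'k mat, 'k mat) mon_cat)" by (rule IntSOp_abelian_category)
  next
    fix X Y :: "nat \<times> 'k mat \<times> 'k mat" and F Z K
    assume T: "X \<in> ?T" "Y \<in> ?T" and F: "F \<in> Hom SOp X Y" and K: "is_kernel IntSOp X Y F Z K"
    obtain m G M n G' M' where eq: "X = (m, G, M)" "Y = (n, G', M')" by (cases X; cases Y)
    have o: "(m, G, M) \<in> Obj SOp" "(n, G', M') \<in> Obj SOp" using T integral_subset eq by auto
    obtain r K0 L R Z0 where Z0: "Z0 \<in> ?T" "fst Z0 = r" "K0 \<in> Hom SOp Z0 X"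
      "dim_row L = r" "dim_col L = m" "dim_row R = m" "dim_col R = n"
      "F * K0 = 0\<^sub>m n r" "L * K0 = 1\<^sub>m r" "K0 * L + R * F = 1\<^sub>m m"
      using SOp_kernel[OF o F[unfolded eq]] T unfolding eq by metis
    then have "is_kernel (full_subcategory SOp (Obj SOp)) X Y F Z0 K0"
      using T F integral_subset by (intro SOp_is_kernelI[where L = L and R = R]) (auto simp: eq)
    then have "is_kernel SOp X Y F Z0 K0" by (simp add: is_kernel_def)
    then show "is_kernel SOp X Y F Z K"
      by (rule kernel_in_full_subcategory[OF SOp_linear_category integral_subset T F Z0(1) _ K])
  next
    fix X Y :: "nat \<times> 'k mat \<times> 'k mat" and F Z C
    assume T: "X \<in> ?T" "Y \<in> ?T" and F: "F \<in> Hom SOp X Y" and C: "is_cokernel IntSOp X Y F Z C"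
    obtain m G M n G' M' where eq: "X = (m, G, M)" "Y = (n, G', M')" by (cases X; cases Y)
    have o: "(m, G, M) \<in> Obj SOp" "(n, G', M') \<in> Obj SOp" using T integral_subset eq by auto
    obtain r C0 D R Z0 where Z0: "Z0 \<in> ?T" "fst Z0 = r" "C0 \<in> Hom SOp Y Z0"
      "dim_row D = n" "dim_col D = r" "dim_row R = m" "dim_col R = n"
      "C0 * F = 0\<^sub>m r m" "C0 * D = 1\<^sub>m r" "D * C0 + F * R = 1\<^sub>m n"
      using SOp_cokernel[OF o F[unfolded eq]] T unfolding eq by metis
    then have "is_cokernel (full_subcategory SOp (Obj SOp)) X Y F Z0 C0"
      using T F integral_subset by (intro SOp_is_cokernelI[where D = D and R = R]) (auto simp: eq)
    then have "is_cokernel SOp X Y F Z0 C0" by (simp add: is_cokernel_def)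
    then show "is_cokernel SOp X Y F Z C"
      by (rule cokernel_in_full_subcategory[OF SOp_linear_category integral_subset T F Z0(1) _ C])
  qed
  moreover have "\<exists>Y\<in>?T. left_dual SOp X Y" "\<exists>Y\<in>?T. left_dual SOp Y X" if "X \<in> ?T" for X
  proof -
    have o: "X \<in> Obj SOp" using that integral_subset by blast
    have T: "super_dual X \<in> ?T" using super_dual_integral[OF that] .
    have T3: "super_dual (super_dual (super_dual X)) \<in> ?T" by (intro super_dual_integral that)
    then have o3: "super_dual (super_dual (super_dual X)) \<in> Obj SOp" using integral_subset by blast
    show "\<exists>Y\<in>?T. left_dual SOp X Y" using SOp_left_dual[OF o] T by blast
    show "\<exists>Y\<in>?T. left_dual SOp Y X" 
      using SOp_left_dual[OF o3] T3 unfolding super_dual_fourfold[OF o] by blast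
  qed
  ultimately show ?thesis
    unfolding tensor_subcategory_def
    by (intro conjI ballI integral_unit integral_tensor)
qed

section \<open>Simple objects and semisimple tensor products\<close>

text \<open>One half of Schur's lemma: an intertwiner out of a simple object vanishes or is injective, because
  its kernel is a subobject.\<close>

lemma simple_object_hom:
  fixes F :: "'k::field_char_0 mat"
  assumes simple: "simple_object IntSOp X" and Y: "Y \<in> Obj SOp" and F: "F \<in> Hom SOp X Y"
  shows "F = 0\<^sub>m (fst Y) (fst X) \<or> (\<exists>R. dim_row R = fst X \<and> dim_col R = fst Y \<and> R * F = 1\<^sub>m (fst X))"
proof -
  obtain m G M n G' M' where eq: "X = (m, G, M)" "Y = (n, G', M')" by (cases X; cases Y)
  have T: "X \<in> integral_super_operators" using simple by (simp add: simple_object_def)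
  have o: "(m, G, M) \<in> Obj SOp" "(n, G', M') \<in> Obj SOp" using T Y integral_subset eq by auto
  obtain r K L R Z where Z: "Z \<in> integral_super_operators" "fst Z = r" "K \<in> Hom SOp Z X"
    and d: "dim_row L = r" "dim_col L = m" "dim_row R = m" "dim_col R = n"
    and FK: "F * K = 0\<^sub>m n r" and LK: "L * K = 1\<^sub>m r" and one: "K * L + R * F = 1\<^sub>m m"
    using SOp_kernel[OF o F[unfolded eq]] T unfolding eq by metis
  have dK: "dim_row K = m" "dim_col K = r" "dim_row F = n" "dim_col F = m"
    using SOp_Hom_dims[OF Z(3)] SOp_Hom_dims[OF F] Z(2) by (auto simp: eq)
  have mono: "mono_mor IntSOp Z X K"
    using left_inverse_mono_mor[OF Z(3), of L] d LK Z(2) by (simp add: eq)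
  have "Z \<in> Obj IntSOp" using Z(1) by simp
  with simple mono have "zero_object IntSOp Z \<or> iso_mor IntSOp Z X K"
    unfolding simple_object_def by blast
  then show ?thesis
  proof
    assume "zero_object IntSOp Z"
    then have "fst Z = 0" by (rule SOp_zero_object_dim[OF integral_subset])
    then have "r = 0" using Z(2) by simp
    then have "K * L = 0\<^sub>m m m" using d dK by (intro eq_matI) (simp_all add: mat_entry)
    moreover have "0\<^sub>m m m + R * F = R * F" using d dK by (intro eq_matI) simp_all
    ultimately have "R * F = 1\<^sub>m m" using one by simp
    then show ?thesis using d by (auto simp: eq)
  next
    assume "iso_mor IntSOp Z X K"
    then obtain S where S: "S \<in> Hom SOp X Z" "K * S = 1\<^sub>m m" by (auto simp: iso_mor_def inverse_mor_def eq)
    have dS: "dim_row S = r" "dim_col S = m" using SOp_Hom_dims[OF S(1)] Z(2) by (auto simp: eq)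
    have "F = F * (K * S)" using S(2) dK by (simp add: mat_one_right)
    also have "\<dots> = (F * K) * S" using dK dS by (simp add: mat_assoc)
    also have "\<dots> = 0\<^sub>m n m" using FK dS by (simp add: mat_zero_left)
    finally show ?thesis by (simp add: eq)
  qed
qed

text \<open>\<open>M\<close> is an intertwiner to the parity-shifted object \<open>(-G, M)\<close>, so it vanishes or is injective; in the second
  case \<open>M\<^sup>2 = 0\<close> leaves only the zero-dimensional space.\<close>

lemma simple_object_square_zero:
  fixes M :: "'k::field_char_0 mat"
  assumes simple: "simple_object IntSOp (n, G, M)" and sq: "M * M = 0\<^sub>m n n"
  shows "M = 0\<^sub>m n n"
proof -
  have o: "(n, G, M) \<in> Obj SOp" using simple integral_subset by (auto simp: simple_object_def)
  note X = o[unfolded SOp_Obj]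
  have Y: "(n, (-1) \<cdot>\<^sub>m G, M) \<in> Obj SOp" using X by (simp add: SOp_Obj mat_algebra)
  have "M * G = (-1) \<cdot>\<^sub>m (G * M)" using X by simp
  then have "M \<in> Hom SOp (n, G, M) (n, (-1) \<cdot>\<^sub>m G, M)" using X by (simp add: SOp_Hom mat_algebra)
  from simple_object_hom[OF simple Y this] show ?thesis
  proof
    assume "\<exists>R. dim_row R = fst (n, G, M) \<and> dim_col R = fst (n, (-1) \<cdot>\<^sub>m G, M) \<and> R * M = 1\<^sub>m (fst (n, G, M))"
    then obtain R where R: "dim_row R = n" "dim_col R = n" "R * M = 1\<^sub>m n" by auto
    have "M = R * (M * M)" using mat_eq_assoc[OF R(3), of M] R X by (simp add: mat_one_left)
    then show ?thesis using sq R by (simp add: mat_zero_right)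
  qed simp
qed

text \<open>The factors \<open>M\<^sup>2 - i\<close> of an annihilating product are intertwiners, each zero or injective.  Injective ones can
  be cancelled, so one of them is zero unless the space itself is zero.\<close>

lemma simple_object_square_scalar:
  fixes M :: "'k::field_char_0 mat"
  assumes simple: "simple_object IntSOp (n, G, M)"
  shows "\<exists>N::int. M * M = of_int N \<cdot>\<^sub>m 1\<^sub>m n"
proof -
  have T: "(n, G, M) \<in> integral_super_operators" using simple by (simp add: simple_object_def)
  then have o: "(n, G, M) \<in> Obj SOp" and int: "int_diagonalizable (M * M)" by (simp_all add: integral_iff)
  have d: "dim_row G = n" "dim_col G = n" "dim_row M = n" "dim_col M = n"
    and GM: "G * M = (-1) \<cdot>\<^sub>m (M * G)" using o[unfolded SOp_Obj] by blast+
  have "G * (M * M) = (-1) \<cdot>\<^sub>m (M * (G * M))" using mat_eq_assoc[OF GM, of M] d by (simp add: mat_smult_left mat_assoc)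
  also have "\<dots> = M * (M * G)" unfolding GM using d by (simp add: mat_smult_right)
  finally have GMM: "G * (M * M) = M * (M * G)" .
  define F where "F i = M * M + (- of_int i) \<cdot>\<^sub>m 1\<^sub>m n" for i
  have dF: "dim_row (F i) = n" "dim_col (F i) = n" for i by (simp_all add: F_def)
  have F: "F i \<in> Hom SOp (n, G, M) (n, G, M)" for i
    using d by (simp add: SOp_Hom F_def mat_algebra GMM)
  have "\<exists>N::int. M * M = of_int N \<cdot>\<^sub>m 1\<^sub>m n" if "root_product is (M * M) = 0\<^sub>m n n" for "is"
    using that
  proof (induction "is")
    case Nil
    then have "n = 0" using one_mat_zero_iff[of n, where 'k = 'k] d by simp
    then have "M * M = of_int 0 \<cdot>\<^sub>m 1\<^sub>m n" using d by (intro eq_matI) simp_all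
    then show ?case ..
  next
    case (Cons i "is")
    from simple_object_hom[OF simple o F[of i]] show ?case
    proof
      assume z: "F i = 0\<^sub>m (fst (n, G, M)) (fst (n, G, M))"
      have "M * M = of_int i \<cdot>\<^sub>m 1\<^sub>m n"
      proof (intro eq_matI)
        fix a b assume ab: "a < dim_row (of_int i \<cdot>\<^sub>m 1\<^sub>m n :: 'k mat)" "b < dim_col (of_int i \<cdot>\<^sub>m 1\<^sub>m n :: 'k mat)"
        then have "F i $$ (a, b) = 0" using z by simp
        then show "(M * M) $$ (a, b) = (of_int i \<cdot>\<^sub>m 1\<^sub>m n) $$ (a, b)" using ab d by (simp add: F_def)
      qed (simp_all add: d)
      then show ?thesis ..
    next
      assume "\<exists>R. dim_row R = fst (n, G, M) \<and> dim_col R = fst (n, G, M) \<and> R * F i = 1\<^sub>m (fst (n, G, M))"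
      then obtain R where R: "dim_row R = n" "dim_col R = n" "R * F i = 1\<^sub>m n" by auto
      have "F i * root_product is (M * M) = 0\<^sub>m n n" using Cons.prems d by (simp add: F_def)
      then have "R * (F i * root_product is (M * M)) = 0\<^sub>m n n" using R by (simp add: mat_zero_right)
      then have "root_product is (M * M) = 0\<^sub>m n n"
        using mat_eq_assoc[OF R(3), of "root_product is (M * M)"] R d dF by (simp add: mat_one_left)
      then show ?thesis by (rule Cons.IH)
    qed
  qed
  moreover have "M * M \<in> carrier_mat n n" by (intro carrier_matI; simp add: d)
  ultimately show ?thesis using int_diagonalizable_imp_root_product[OF int] by blast
qed

subsection \<open>The two-dimensional simple objects\<close>

definition two_dim_object :: "int \<Rightarrow> nat \<times> 'k::field mat \<times> 'k mat" where
  "two_dim_object c = (2, mat 2 2 (\<lambda>(i, j). if i = j then (if i = 0 then 1 else -1) else 0),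
     mat 2 2 (\<lambda>(i, j). if i = j then 0 else if i = 0 then of_int c else 1))"

lemma two_dim_object_integral:
  "two_dim_object c \<in> (integral_super_operators :: (nat \<times> 'k::field_char_0 mat \<times> 'k mat) set)"
  and two_dim_object_square:
  "two_dim_object c = (n, G, M :: 'k::field_char_0 mat) \<Longrightarrow> M * M = of_int c \<cdot>\<^sub>m 1\<^sub>m 2"
proof -
  let ?G = "fst (snd (two_dim_object c)) :: 'k mat" and ?M = "snd (snd (two_dim_object c)) :: 'k mat"
  have eq: "two_dim_object c = (2, ?G, ?M)" by (simp add: two_dim_object_def)
  have two: "i < 2 \<longleftrightarrow> i = 0 \<or> i = 1" for i :: nat by auto
  have MM: "?M * ?M = of_int c \<cdot>\<^sub>m 1\<^sub>m 2"
    by (intro eq_matI) (auto simp: mat_entry two_dim_object_def two numeral_2_eq_2)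
  have "(2, ?G, ?M) \<in> Obj SOp"
    unfolding SOp_Obj
  proof (intro conjI)
    show "?G * ?G = 1\<^sub>m 2" "?G * ?M = (-1) \<cdot>\<^sub>m (?M * ?G)"
      by (intro eq_matI; auto simp: mat_entry two_dim_object_def two numeral_2_eq_2)+
  qed (simp_all add: two_dim_object_def)
  moreover have "int_diagonalizable (?M * ?M)" unfolding MM by (rule int_diagonalizable_scalar)
  ultimately have "(2, ?G, ?M) \<in> integral_super_operators" unfolding integral_iff by (rule conjI)
  then show "two_dim_object c \<in> (integral_super_operators :: (nat \<times> 'k mat \<times> 'k mat) set)"
    unfolding eq[symmetric] .
  show "M * M = of_int c \<cdot>\<^sub>m 1\<^sub>m 2" if "two_dim_object c = (n, G, M :: 'k mat)" for n G M
    using MM eq that by simp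
qed

text \<open>A nonzero subobject contains one of the two homogeneous basis vectors, and for \<open>c \<noteq> 0\<close> the odd
  operator maps each of them to a nonzero multiple of the other one.\<close>

lemma two_dim_object_simple:
  assumes c: "c \<noteq> 0"
  shows "simple_object IntSOp (two_dim_object c :: nat \<times> 'k::field_char_0 mat \<times> 'k mat)"
proof -
  define G where "G = (mat 2 2 (\<lambda>(i, j). if i = j then (if i = 0 then 1 else -1) else 0) :: 'k mat)"
  define M where "M = (mat 2 2 (\<lambda>(i, j). if i = j then 0 else if i = 0 then of_int c else 1) :: 'k mat)"
  have eq: "two_dim_object c = (2, G, M)" by (simp add: two_dim_object_def G_def M_def)
  have d: "dim_row G = 2" "dim_col G = 2" "dim_row M = 2" "dim_col M = 2" by (auto simp: G_def M_def)
  have XT: "(2, G, M) \<in> integral_super_operators" using two_dim_object_integral[of c, where 'k = 'k] eq by simp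
  then have XO: "(2, G, M) \<in> Obj SOp" using integral_subset by blast
  have "zero_object IntSOp Y \<or> iso_mor IntSOp Y (2, G, M) F"
    if YT: "Y \<in> integral_super_operators" and mono: "mono_mor IntSOp Y (2, G, M) F" for Y F
  proof -
    obtain m G' M' where Y: "Y = (m, G', M')" by (cases Y)
    have FH: "F \<in> Hom SOp (m, G', M') (2, G, M)" using mono by (simp add: mono_mor_def Y)
    have YO: "(m, G', M') \<in> Obj SOp" using YT integral_subset Y by auto
    have dF: "dim_row F = 2" "dim_col F = m" "F * G' = G * F" using FH by (simp_all add: SOp_Hom)
    obtain R where R: "dim_row R = m" "dim_col R = 2" "R * F = 1\<^sub>m m"
      using mono_mor_left_inverse[OF YT XT mono] by (auto simp: Y)
    show ?thesis
    proof (cases "m = 0")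
      case True
      have "zero_object IntSOp (0, G', M')"
        by (rule SOp_zero_object[OF integral_subset]) (use YT Y True in simp)
      then show ?thesis by (simp add: Y True)
    next
      case False
      obtain r C D S Z where Z: "Z \<in> Obj SOp" "fst Z = r" "C \<in> Hom SOp (2, G, M) Z"
        and dD: "dim_row D = 2" "dim_col D = r" "dim_row S = m" "dim_col S = 2"
        and CF: "C * F = 0\<^sub>m r m" and CD: "C * D = 1\<^sub>m r" and one: "D * C + F * S = 1\<^sub>m 2"
        using SOp_cokernel[OF YO XO FH] by metis
      obtain GZ MZ where Z': "Z = (r, GZ, MZ)" using Z(2) by (cases Z) auto
      have dC: "dim_row C = r" "dim_col C = 2" and CG: "C * G = GZ * C" and CM: "C * M = MZ * C"
        using Z(3) by (simp_all add: Z' SOp_Hom)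
      have dZ: "dim_row MZ = r" "dim_col MZ = r" "dim_row GZ = r" "dim_col GZ = r"
        using Z(1) by (simp_all add: Z' SOp_Obj)
      have CGF: "C * (G * F) = 0\<^sub>m r m"
        using mat_eq_assoc[OF CG, of F] CF d dC dF dZ by (simp add: mat_assoc mat_zero_right)
      have F0: "F \<noteq> 0\<^sub>m 2 m"
      proof
        assume "F = 0\<^sub>m 2 m"
        then have "R * F = 0\<^sub>m m m" using R by (simp add: mat_zero_right)
        then show False using R(3) False one_mat_zero_iff[of m, where 'k = 'k] by simp
      qed
      obtain l k where lk: "l < 2" "k < m" "F $$ (l, k) \<noteq> 0"
      proof (rule ccontr)
        assume "\<not> thesis"
        then have "\<And>l k. l < 2 \<Longrightarrow> k < m \<Longrightarrow> F $$ (l, k) = 0" using that by blast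
        then have "F = 0\<^sub>m 2 m" using dF by (intro eq_matI) simp_all
        with F0 show False by simp
      qed
      have zero_both: "C $$ (i, 0) * F $$ (0, k) = 0 \<and> C $$ (i, 1) * F $$ (1, k) = 0" if i: "i < r" for i
      proof -
        have "(C * F) $$ (i, k) = C $$ (i, 0) * F $$ (0, k) + C $$ (i, 1) * F $$ (1, k)"
          using i lk dC dF by (simp add: mat_entry numeral_2_eq_2)
        then have 1: "C $$ (i, 0) * F $$ (0, k) + C $$ (i, 1) * F $$ (1, k) = 0" using CF i lk by simp
        have GF: "(G * F) $$ (0, k) = F $$ (0, k)" "(G * F) $$ (1, k) = - F $$ (1, k)"
          using lk dF d by (simp_all add: mat_entry numeral_2_eq_2) (simp_all add: G_def)
        have "(C * (G * F)) $$ (i, k) = C $$ (i, 0) * F $$ (0, k) - C $$ (i, 1) * F $$ (1, k)"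
          using i lk dC dF d GF by (simp add: mat_entry[of _ C] numeral_2_eq_2)
        then have 2: "C $$ (i, 0) * F $$ (0, k) - C $$ (i, 1) * F $$ (1, k) = 0" using CGF i lk by simp
        have "x = 0 \<and> y = 0" if "x + y = 0" "x - y = 0" for x y :: 'k
        proof -
          have "x = y" using that(2) by simp
          with that(1) have "2 * y = 0" by (simp only: mult_2)
          with \<open>x = y\<close> show ?thesis by simp
        qed
        from this[OF 1 2] show ?thesis .
      qed
      have CMi: "C $$ (i, 1) = (\<Sum>j<r. MZ $$ (i, j) * C $$ (j, 0))"
        "of_int c * C $$ (i, 0) = (\<Sum>j<r. MZ $$ (i, j) * C $$ (j, 1))" if i: "i < r" for i
      proof -
        have "(C * M) $$ (i, 0) = C $$ (i, 1)" "(C * M) $$ (i, 1) = of_int c * C $$ (i, 0)"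
          using i d dC by (simp_all add: mat_entry numeral_2_eq_2) (simp_all add: M_def)
        then show "C $$ (i, 1) = (\<Sum>j<r. MZ $$ (i, j) * C $$ (j, 0))"
          "of_int c * C $$ (i, 0) = (\<Sum>j<r. MZ $$ (i, j) * C $$ (j, 1))"
          unfolding CM using i dZ dC by (simp_all add: mat_entry)
      qed
      have "l = 0 \<or> l = 1" using lk by auto
      then have "C $$ (i, 0) = 0 \<and> C $$ (i, 1) = 0" if "i < r" for i
      proof
        assume "l = 0"
        then have "\<And>j. j < r \<Longrightarrow> C $$ (j, 0) = 0" using zero_both lk by auto
        then show ?thesis using CMi(1)[OF that] that by simp
      next
        assume "l = 1"
        then have "\<And>j. j < r \<Longrightarrow> C $$ (j, 1) = 0" using zero_both lk by auto
        then show ?thesis using CMi(2)[OF that] that c by simp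
      qed
      then have "C = 0\<^sub>m r 2" using dC by (intro eq_matI) (auto simp: numeral_2_eq_2 less_Suc_eq)
      then have "D * C = 0\<^sub>m 2 2" using dD by (simp add: mat_zero_right)
      moreover have "0\<^sub>m 2 2 + F * S = F * S" using dF dD by (intro eq_matI) simp_all
      ultimately have FS: "F * S = 1\<^sub>m 2" using one by simp
      have "R = R * (F * S)" using FS R by (simp add: mat_one_right)
      also have "\<dots> = S" using mat_eq_assoc[OF R(3), of S] R dF dD by (simp add: mat_one_left)
      finally have FR: "F * R = 1\<^sub>m 2" using FS by simp
      have "R * B = B' * R" if "F * B' = B * F" "dim_row B = 2" "dim_col B = 2" "dim_row B' = m" "dim_col B' = m" for B B'
      proof -
        have "R * B = R * (B * (F * R))" using FR that by (simp add: mat_one_right)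
        also have "\<dots> = R * ((F * B') * R)" unfolding that(1) using that R dF by (simp add: mat_assoc)
        also have "\<dots> = B' * R" using mat_eq_assoc[OF R(3), of "B' * R"] that(2-) R dF by (simp add: mat_assoc mat_one_left)
        finally show ?thesis .
      qed
      then have "R \<in> Hom SOp (2, G, M) (m, G', M')"
        using R FH XO YO by (simp add: SOp_Hom SOp_Obj)
      then have "iso_mor IntSOp Y (2, G, M) F"
        unfolding iso_mor_def inverse_mor_def using FH R(3) FR by (auto simp: Y intro!: exI[of _ R])
      then show ?thesis ..
    qed
  qed
  moreover have "\<not> zero_object IntSOp (2, G, M)" using SOp_zero_object_dim[OF integral_subset, of "(2, G, M)"] by auto
  ultimately show ?thesis using XT by (auto simp: simple_object_def eq)
qed

subsection \<open>Nilpotent odd operators are not semisimple\<close>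

text \<open>\<open>M\<close> is the direct sum of its restrictions to simple summands, where \<open>simple_object_square_zero\<close> applies.\<close>

lemma semisimple_object_square_zero:
  fixes M :: "'k::field_char_0 mat"
  assumes "semisimple_object IntSOp (n, G, M)" "M * M = 0\<^sub>m n n"
  shows "M = 0\<^sub>m n n"
proof -
  have "M = 0\<^sub>m n n" if "semisimple_object IntSOp P" "P = (n, G, M)" "M * M = 0\<^sub>m n n" for P n and G M :: "'k mat"
    using that
  proof (induction arbitrary: n G M rule: semisimple_object.induct)
    case (1 X)
    have "fst X = 0" by (rule SOp_zero_object_dim[OF integral_subset 1(1)])
    then have "n = 0" using 1(2) by simp
    moreover have "(n, G, M) \<in> Obj SOp" using 1 integral_subset by (auto simp: zero_object_def)
    ultimately show ?case by (auto simp: SOp_Obj intro!: eq_matI)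
  next
    case (2 X Y P)
    have XT: "X \<in> integral_super_operators"
      using 2(1) by (induction rule: semisimple_object.induct) (auto simp: zero_object_def direct_sum_def)
    have YT: "Y \<in> integral_super_operators" using 2(2) by (simp add: simple_object_def)
    obtain n1 G1 M1 n2 G2 M2 where XY: "X = (n1, G1, M1)" "Y = (n2, G2, M2)" by (cases X; cases Y)
    have PO: "(n, G, M) \<in> Obj SOp" using 2(3,5) integral_subset by (auto simp: direct_sum_def)
    obtain i j p q where h: "i \<in> Hom SOp X P" "j \<in> Hom SOp Y P" "p \<in> Hom SOp P X" "q \<in> Hom SOp P Y"
      and pi: "p * i = 1\<^sub>m n1" and qj: "q * j = 1\<^sub>m n2" and one: "i * p + j * q = 1\<^sub>m n"
      using 2(3) unfolding direct_sum_def by (auto simp: XY 2(5))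
    note h' = h[unfolded XY 2(5) SOp_Hom]
    have o: "(n1, G1, M1) \<in> Obj SOp" "(n2, G2, M2) \<in> Obj SOp" using XT YT integral_subset XY by auto
    have d: "dim_row M1 = n1" "dim_col M1 = n1" "dim_row M2 = n2" "dim_col M2 = n2" "dim_row M = n" "dim_col M = n"
      "dim_row i = n" "dim_col i = n1" "dim_row j = n" "dim_col j = n2"
      "dim_row p = n1" "dim_col p = n" "dim_row q = n2" "dim_col q = n"
      and pM: "p * M = M1 * p" and qM: "q * M = M2 * q"
      and iM: "i * M1 = M * i" and jM: "j * M2 = M * j"
      using o PO h' unfolding SOp_Obj by blast+
    have square: "B * B = 0\<^sub>m k k"
      if "q' * M = B * q'" "q' * j' = 1\<^sub>m k" "dim_row q' = k" "dim_col q' = n" "dim_row j' = n" "dim_col j' = k"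
        "dim_row B = k" "dim_col B = k" for B q' j' k
    proof -
      have "B * B = (B * B) * (q' * j')" using that by (simp add: mat_one_right)
      also have "\<dots> = B * ((B * q') * j')" using that by (simp add: mat_assoc)
      also have "\<dots> = B * ((q' * M) * j')" unfolding that(1) ..
      also have "\<dots> = (B * q') * (M * j')" using that(2-) d by (simp add: mat_assoc)
      also have "\<dots> = (q' * M) * (M * j')" unfolding that(1) ..
      also have "\<dots> = q' * ((M * M) * j')" using that(2-) d by (simp add: mat_assoc)
      also have "\<dots> = 0\<^sub>m k k" unfolding 2(6) using that by (simp add: mat_zero_left mat_zero_right)
      finally show ?thesis .
    qed
    have "M1 * M1 = 0\<^sub>m n1 n1" by (rule square[OF pM pi]) (simp_all add: d)
    then have M1: "M1 = 0\<^sub>m n1 n1" using 2(4) XY(1) by blast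
    have "M2 * M2 = 0\<^sub>m n2 n2" by (rule square[OF qM qj]) (simp_all add: d)
    then have M2: "M2 = 0\<^sub>m n2 n2" using simple_object_square_zero 2(2) XY(2) by blast
    have "M = M * (i * p + j * q)" using one d by (simp add: mat_one_right)
    also have "\<dots> = (M * i) * p + (M * j) * q" using d by (simp add: mat_algebra)
    also have "\<dots> = 0\<^sub>m n n"
      unfolding iM[symmetric] jM[symmetric] M1 M2 using d by (simp add: mat_zero_left mat_zero_right)
    finally show ?case .
  qed
  with assms show ?thesis by blast
qed

text \<open>If \<open>M\<^sup>2 = N \<noteq> 0\<close> on a simple object \<open>W\<close>, then on \<open>V \<otimes> W\<close>, where \<open>V\<close> is the two-dimensional
  simple object with parameter \<open>-N\<close>, the odd operator is nonzero with square \<open>-N + N = 0\<close>.\<close>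

lemma socle_object_square_zero:
  fixes M :: "'k::field_char_0 mat"
  assumes simple: "simple_object IntSOp (n, G, M)"
    and ss: "\<And>V. simple_object IntSOp V \<Longrightarrow> semisimple_object IntSOp (V \<boxtimes>\<^bsub>SOp\<^esub> (n, G, M))"
  shows "M * M = 0\<^sub>m n n"
proof -
  have o: "(n, G, M) \<in> Obj SOp" using simple integral_subset by (auto simp: simple_object_def)
  then have d: "dim_row M = n" "dim_col M = n" by (simp_all add: SOp_Obj)
  obtain N :: int where N: "M * M = of_int N \<cdot>\<^sub>m 1\<^sub>m n" using simple_object_square_scalar[OF simple] by blast
  show ?thesis
  proof (cases "N = 0")
    case True
    then show ?thesis unfolding N by (intro eq_matI) simp_all
  next
    case False
    obtain G' M' :: "'k mat" where V: "two_dim_object (- N) = (2, G', M')" by (simp add: two_dim_object_def)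
    have Vo: "(2, G', M') \<in> Obj SOp" using two_dim_object_integral[of "- N", where 'k = 'k] integral_subset V by auto
    then have d': "dim_row G' = 2" "dim_col G' = 2" "dim_row M' = 2" "dim_col M' = 2" by (simp_all add: SOp_Obj)
    let ?M = "kronecker G' M + kronecker M' (1\<^sub>m n)"
    have sim: "simple_object IntSOp (2, G', M')" using two_dim_object_simple[of "- N", where 'k = 'k] False V by simp
    have "semisimple_object IntSOp ((2, G', M') \<boxtimes>\<^bsub>SOp\<^esub> (n, G, M))" by (rule ss[OF sim])
    then have "semisimple_object IntSOp (2 * n, kronecker G' G, ?M)" by simp
    moreover have "?M * ?M = 0\<^sub>m (2 * n) (2 * n)"
      unfolding SOp_tensor_square[OF Vo o] N two_dim_object_square[OF V]
      by (simp add: kronecker_smult_left kronecker_smult_right kronecker_one) (intro eq_matI, simp_all)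
    ultimately have z: "?M = 0\<^sub>m (2 * n) (2 * n)" by (rule semisimple_object_square_zero)
    have "M $$ (i, j) = 0" if ij: "i < n" "j < n" for i j
    proof -
      have "?M $$ (i, j) = G' $$ (0, 0) * M $$ (i, j) + M' $$ (0, 0) * 1\<^sub>m n $$ (i, j)"
        using ij d d' by (simp add: kronecker_entry)
      also have "\<dots> = M $$ (i, j)" using V by (auto simp: two_dim_object_def)
      finally show ?thesis using z ij by simp
    qed
    then have "M = 0\<^sub>m n n" using d by (intro eq_matI) simp_all
    then show ?thesis by (simp add: mat_zero_left)
  qed
qed

section \<open>Formal sums of tensors\<close>

subsection \<open>Linear extension\<close>

definition lin_ext :: "('k::field \<Rightarrow> 'v::ab_group_add \<Rightarrow> 'v) \<Rightarrow> ('x \<Rightarrow> 'v) \<Rightarrow> ('x \<Rightarrow>\<^sub>0 'k) \<Rightarrow> 'v" where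
  "lin_ext s F p = (\<Sum>w\<in>Poly_Mapping.keys p. s (Poly_Mapping.lookup p w) (F w))"

lemma poly_mapping_sum_monomials:
  "(\<Sum>u\<in>Poly_Mapping.keys p. Poly_Mapping.single u (Poly_Mapping.lookup p u)) = p"
proof (rule poly_mapping_eqI)
  fix k
  have "(\<Sum>u\<in>Poly_Mapping.keys p. Poly_Mapping.lookup (Poly_Mapping.single u (Poly_Mapping.lookup p u)) k)
      = (\<Sum>u\<in>Poly_Mapping.keys p. if u = k then Poly_Mapping.lookup p k else 0)"
    by (intro sum.cong) (auto simp: lookup_single when_def)
  then show "Poly_Mapping.lookup (\<Sum>u\<in>Poly_Mapping.keys p. Poly_Mapping.single u (Poly_Mapping.lookup p u)) k
      = Poly_Mapping.lookup p k"
    by (simp add: lookup_sum sum.delta in_keys_iff)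
qed

context vector_space
begin

lemma lin_ext_superset:
  assumes "finite S" "Poly_Mapping.keys p \<subseteq> S"
  shows "lin_ext scale F p = (\<Sum>w\<in>S. scale (Poly_Mapping.lookup p w) (F w))"
  unfolding lin_ext_def using assms by (intro sum.mono_neutral_left) (auto simp: in_keys_iff)

lemma lin_ext_add: "lin_ext scale F (p + q) = lin_ext scale F p + lin_ext scale F q"
proof -
  let ?S = "Poly_Mapping.keys p \<union> Poly_Mapping.keys q"
  have "Poly_Mapping.keys (p + q) \<subseteq> ?S" by (rule keys_add)
  then show ?thesis
    by (simp add: lin_ext_superset[of ?S] lookup_add scale_left_distrib sum.distrib)
qed

lemma lin_ext_zero: "lin_ext scale F 0 = 0"
  by (simp add: lin_ext_def)

lemma lin_ext_diff: "lin_ext scale F (p - q) = lin_ext scale F p - lin_ext scale F q"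
  using lin_ext_add[of F "p - q" q] by (simp add: algebra_simps)

lemma lin_ext_single: "lin_ext scale F (Poly_Mapping.single w c) = scale c (F w)"
  by (simp add: lin_ext_def)

lemma lin_ext_sum: "lin_ext scale F (sum f S) = (\<Sum>x\<in>S. lin_ext scale F (f x))"
  by (induction S rule: infinite_finite_induct) (auto simp: lin_ext_add lin_ext_zero)

lemma lin_ext_mult:
  fixes p q :: "'x::monoid_add \<Rightarrow>\<^sub>0 'a"
  shows "lin_ext scale F (p * q) = (\<Sum>u\<in>Poly_Mapping.keys p. \<Sum>v\<in>Poly_Mapping.keys q.
    scale (Poly_Mapping.lookup p u * Poly_Mapping.lookup q v) (F (u + v)))"
proof -
  have "p * q = (\<Sum>u\<in>Poly_Mapping.keys p. Poly_Mapping.single u (Poly_Mapping.lookup p u))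
      * (\<Sum>v\<in>Poly_Mapping.keys q. Poly_Mapping.single v (Poly_Mapping.lookup q v))"
    by (simp only: poly_mapping_sum_monomials)
  also have "\<dots> = (\<Sum>u\<in>Poly_Mapping.keys p. \<Sum>v\<in>Poly_Mapping.keys q.
      Poly_Mapping.single (u + v) (Poly_Mapping.lookup p u * Poly_Mapping.lookup q v))"
    by (simp only: sum_product mult_single)
  finally show ?thesis by (simp add: lin_ext_sum lin_ext_single)
qed

end

subsection \<open>Multilinear functionals separate tensors\<close>

lemma two_sided_ideal_hull: "two_sided_ideal (two_sided_ideal hull R)"
  by (rule hull_in) (unfold two_sided_ideal_def, blast)

text \<open>A function on words that is linear in every letter extends to a functional on the free algebra which
  kills the ideal defining the tensor algebra: the elements \<open>p\<close> such that the functional kills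
  \<open>u p v\<close> for all words \<open>u\<close>, \<open>v\<close> form an ideal containing the relations.\<close>

lemma multilinear_vanishes_on_ideal:
  fixes F :: "'v::ab_group_add word \<Rightarrow> 'k::field" and s :: "'k \<Rightarrow> 'v \<Rightarrow> 'v"
  assumes add: "\<And>u v x y. F (u + Word [x + y] + v) = F (u + Word [x] + v) + F (u + Word [y] + v)"
    and scale: "\<And>u v c x. F (u + Word [s c x] + v) = c * F (u + Word [x] + v)"
    and p: "p \<in> two_sided_ideal hull (linear_relations s)"
  shows "lin_ext (*) F p = 0"
proof -
  interpret vs: vector_space "(*) :: 'k \<Rightarrow> 'k \<Rightarrow> 'k" by unfold_locales (simp_all add: algebra_simps)
  define I where "I = {p. \<forall>u v. lin_ext (*) (\<lambda>w. F (u + w + v)) p = 0}"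
  have "two_sided_ideal I"
    unfolding two_sided_ideal_def
  proof (intro conjI ballI allI)
    show "0 \<in> I" by (simp add: I_def vs.lin_ext_zero)
    show "p + q \<in> I" if "p \<in> I" "q \<in> I" for p q using that by (simp add: I_def vs.lin_ext_add)
    fix r p assume p: "p \<in> I"
    have "lin_ext (*) (\<lambda>w. F (u + w + v)) (r * p)
        = (\<Sum>a\<in>Poly_Mapping.keys r. Poly_Mapping.lookup r a * lin_ext (*) (\<lambda>w. F ((u + a) + w + v)) p)" for u v
      by (subst vs.lin_ext_mult, unfold lin_ext_def sum_distrib_left, rule sum.cong[OF refl],
          rule sum.cong[OF refl], simp only: add.assoc mult.assoc)
    then show "r * p \<in> I" using p by (simp add: I_def)
    have "lin_ext (*) (\<lambda>w. F (u + w + v)) (p * r)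
        = (\<Sum>a\<in>Poly_Mapping.keys r. Poly_Mapping.lookup r a * lin_ext (*) (\<lambda>w. F (u + w + (a + v))) p)" for u v
      by (subst vs.lin_ext_mult, unfold lin_ext_def sum_distrib_left, subst sum.swap, rule sum.cong[OF refl],
          rule sum.cong[OF refl], simp only: add.assoc mult.assoc mult.left_commute)
    then show "p * r \<in> I" using p by (simp add: I_def)
  qed
  moreover have "linear_relations s \<subseteq> I"
    unfolding linear_relations_def I_def monomial_def
    by (auto simp: vs.lin_ext_diff vs.lin_ext_single mult_single add scale)
  ultimately have "two_sided_ideal hull (linear_relations s) \<subseteq> I" by (intro hull_minimal)
  with p have "p \<in> I" by blast
  then have "lin_ext (*) (\<lambda>w. F (0 + w + 0)) p = 0" unfolding I_def by blast
  then show ?thesis by simp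
qed

definition bilinear_form :: "('k::field \<Rightarrow> 'v::ab_group_add \<Rightarrow> 'v) \<Rightarrow> ('v \<Rightarrow> 'v \<Rightarrow> 'k) \<Rightarrow> bool" where
  "bilinear_form s B \<longleftrightarrow> (\<forall>x y z. B (x + y) z = B x z + B y z) \<and> (\<forall>x y z. B x (y + z) = B x y + B x z) \<and>
     (\<forall>c x y. B (s c x) y = c * B x y) \<and> (\<forall>c x y. B x (s c y) = c * B x y)"

text \<open>\<open>comult\<close> returns one representative of a tensor; a bilinear form takes the same value on all of them.  This is
  how the comultiplication of an abstract Hopf algebra is used in computations.\<close>

lemma same_tensor2_bilinear:
  assumes st: "same_tensor2 H ts us" and B: "bilinear_form (scale H) B"
  shows "(\<Sum>(x, y)\<leftarrow>ts. B x y) = (\<Sum>(x, y)\<leftarrow>us. B x y)"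
proof -
  interpret vs: vector_space "(*) :: 'a \<Rightarrow> 'a \<Rightarrow> 'a" by unfold_locales (simp_all add: algebra_simps)
  define F where "F w = (case letters w of [x, y] \<Rightarrow> B x y | _ \<Rightarrow> 0)" for w
  have F: "F (u + Word [x] + v) = (case (letters u, letters v) of ([], [y]) \<Rightarrow> B x y | ([y], []) \<Rightarrow> B y x | _ \<Rightarrow> 0)" for u v x
    by (auto simp: F_def plus_word_def split: list.splits)
  let ?p = "sum_list (map monomial (map (\<lambda>(x, y). [x, y]) ts)) :: ('a, 'b) free_algebra"
  let ?q = "sum_list (map monomial (map (\<lambda>(x, y). [x, y]) us)) :: ('a, 'b) free_algebra"
  have "?p - ?q \<in> two_sided_ideal hull (linear_relations (scale H))"
    using st by (simp add: same_tensor2_def same_tensor_def)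
  then have "lin_ext (*) F (?p - ?q) = 0"
    using B by (intro multilinear_vanishes_on_ideal[where s = "scale H"])
      (auto simp: F bilinear_form_def split: list.splits)
  moreover have "lin_ext (*) F (sum_list (map monomial (map (\<lambda>(x, y). [x, y]) vs))) = (\<Sum>(x, y)\<leftarrow>vs. B x y)" for vs
    by (induction vs) (auto simp: vs.lin_ext_zero vs.lin_ext_add monomial_def vs.lin_ext_single F_def)
  ultimately show ?thesis by (simp add: vs.lin_ext_diff)
qed

section \<open>Representations of the algebra A\<close>

locale clifford_hopf =
  fixes A :: "('k::field_char_0, 'a::ab_group_add) hopf_alg" and g h :: 'a
  assumes hopf: "hopf_algebra A"
    and presented: "presented_by A (case_gen g h) relations_A"
    and g_group_like: "group_like A g"
    and comult_h: "same_tensor2 A (comult A h) [(g, h), (h, hone A)]"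
begin

sublocale hopf_algebra A by (rule hopf)

abbreviation evaluate :: "('k, gen) free_algebra \<Rightarrow> 'a" where
  "evaluate \<equiv> free_eval A (case_gen g h)"

definition word_value :: "gen word \<Rightarrow> 'a" where
  "word_value w = foldr (\<lambda>x. hmult A (case_gen g h x)) (letters w) (hone A)"

lemma evaluate_lin_ext: "evaluate p = lin_ext (scale A) word_value p"
  by (simp add: free_eval_def lin_ext_def word_value_def)

lemma word_value_add: "word_value (u + v) = hmult A (word_value u) (word_value v)"
proof -
  have "foldr (\<lambda>x. hmult A (\<phi> x)) xs b = hmult A (foldr (\<lambda>x. hmult A (\<phi> x)) xs (hone A)) b" for \<phi> :: "gen \<Rightarrow> 'a" and xs b
    by (induction xs) (simp_all add: one_mult mult_assoc)
  from this[of "case_gen g h" "letters u" "foldr (\<lambda>x. hmult A (case_gen g h x)) (letters v) (hone A)"]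
  show ?thesis unfolding word_value_def plus_word_def word.sel foldr_append o_apply .
qed

lemma hmult_sum_left: "hmult A (sum f S) y = (\<Sum>x\<in>S. hmult A (f x) y)"
proof -
  interpret additive "\<lambda>x. hmult A x y" by unfold_locales (rule mult_add_left)
  show ?thesis by (rule sum)
qed

lemma hmult_sum_right: "hmult A y (sum f S) = (\<Sum>x\<in>S. hmult A y (f x))"
proof -
  interpret additive "\<lambda>x. hmult A y x" by unfold_locales (rule mult_add_right)
  show ?thesis by (rule sum)
qed

lemma evaluate_add: "evaluate (p + q) = evaluate p + evaluate q"
  by (simp add: evaluate_lin_ext lin_ext_add)

lemma evaluate_diff: "evaluate (p - q) = evaluate p - evaluate q"
  by (simp add: evaluate_lin_ext lin_ext_diff)

lemma evaluate_mult: "evaluate (p * q) = hmult A (evaluate p) (evaluate q)"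
  unfolding evaluate_lin_ext lin_ext_mult word_value_add unfolding lin_ext_def
  unfolding hmult_sum_left unfolding hmult_sum_right by (simp add: mult_scale_left mult_scale_right mult.commute)

lemma evaluate_single: "evaluate (Poly_Mapping.single w c) = scale A c (word_value w)"
  by (simp add: evaluate_lin_ext lin_ext_single)

lemma word_value_simps: "word_value 0 = hone A" "word_value (Word []) = hone A"
  "word_value (Word (x # xs)) = hmult A (case_gen g h x) (word_value (Word xs))"
  by (simp_all add: word_value_def zero_word_def)

lemma evaluate_surj: "\<exists>p. evaluate p = a"
  using presented unfolding presented_by_def surj_def by metis

lemma evaluate_kernel: "evaluate p = 0 \<longleftrightarrow> p \<in> two_sided_ideal hull relations_A"
  using presented unfolding presented_by_def by blast

lemma generated_induct [case_names one g h add scale mult]: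
  assumes one: "P (hone A)" and g: "P g" and h: "P h"
    and add: "\<And>a b. P a \<Longrightarrow> P b \<Longrightarrow> P (a + b)" and scale: "\<And>c a. P a \<Longrightarrow> P (scale A c a)"
    and mult: "\<And>a b. P a \<Longrightarrow> P b \<Longrightarrow> P (hmult A a b)"
  shows "P a"
proof -
  have w: "P (word_value (Word xs))" for xs
  proof (induction xs)
    case (Cons x xs)
    then show ?case by (cases x) (simp_all add: word_value_simps mult g h)
  qed (simp add: word_value_simps one)
  have zero: "P 0" using scale[OF one, of 0] by simp
  obtain p where p: "evaluate p = a" using evaluate_surj by blast
  have "P (\<Sum>w\<in>S. scale A (Poly_Mapping.lookup p w) (word_value w))" if "finite S" for S
    using that
  proof (induction S)
    case (insert w S)
    obtain xs where "w = Word xs" by (cases w)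
    with insert show ?case by (simp add: add scale w)
  qed (simp add: zero)
  then show ?thesis unfolding p[symmetric] evaluate_lin_ext lin_ext_def by simp
qed

lemma relations_hold: "hmult A g g = hone A" "hmult A g h = - hmult A h g"
proof -
  have "relations_A \<subseteq> two_sided_ideal hull relations_A" by (rule hull_subset)
  then have "evaluate r = 0" if "r \<in> relations_A" for r using that evaluate_kernel by blast
  then have 1: "evaluate (monomial [Gen_g, Gen_g] - 1) = 0"
    and 2: "evaluate (monomial [Gen_g, Gen_h] + monomial [Gen_h, Gen_g]) = 0"
    unfolding relations_A_def by blast+
  have one: "(1 :: ('k, gen) free_algebra) = Poly_Mapping.single 0 1" by (rule single_one[symmetric])
  show "hmult A g g = hone A"
    using 1 unfolding one evaluate_diff monomial_def evaluate_single by (simp add: word_value_simps mult_one)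
  show "hmult A g h = - hmult A h g"
    using 2 unfolding evaluate_add monomial_def evaluate_single
    by (simp add: word_value_simps mult_one eq_neg_iff_add_eq_0)
qed

lemma counit_g: "counit A g = 1"
  using g_group_like by (simp add: group_like_def)

lemma counit_h: "counit A h = 0"
proof -
  interpret cl: Vector_Spaces.linear "scale A" "(*)" "counit A" by (rule counit_linear)
  have "counit A (hmult A g h) = - counit A (hmult A h g)" unfolding relations_hold(2) by (rule cl.neg)
  then have "counit A h + counit A h = 0" by (simp add: counit_mult counit_g)
  then have "2 * counit A h = 0" by (simp only: mult_2)
  then show ?thesis by simp
qed

subsection \<open>Modules from pairs of matrices\<close>

lemma module_props:
  assumes "(n, \<rho>) \<in> Obj (Rep A)"
  shows "\<rho> a \<in> carrier_mat n n" "dim_row (\<rho> a) = n" "dim_col (\<rho> a) = n"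
    "\<rho> (a + b) = \<rho> a + \<rho> b" "\<rho> (scale A c a) = c \<cdot>\<^sub>m \<rho> a" "\<rho> (hone A) = 1\<^sub>m n" "\<rho> (hmult A a b) = \<rho> a * \<rho> b"
proof -
  have *: "is_fd_module A (n, \<rho>)" using assms by (simp add: Rep_def)
  then have c: "\<And>a. \<rho> a \<in> carrier_mat n n" by (simp add: is_fd_module_def)
  then show "\<rho> a \<in> carrier_mat n n" "dim_row (\<rho> a) = n" "dim_col (\<rho> a) = n" by (auto dest: carrier_matD)
  show "\<rho> (a + b) = \<rho> a + \<rho> b" "\<rho> (scale A c a) = c \<cdot>\<^sub>m \<rho> a" "\<rho> (hone A) = 1\<^sub>m n" "\<rho> (hmult A a b) = \<rho> a * \<rho> b"
    using * unfolding is_fd_module_def by auto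
qed

definition operator_pair :: "('k, 'a) fd_module \<Rightarrow> nat \<times> 'k mat \<times> 'k mat" where
  "operator_pair = (\<lambda>(n, \<rho>). (n, \<rho> g, \<rho> h))"

lemma operator_pair_obj:
  assumes "(n, \<rho>) \<in> Obj (Rep A)"
  shows "operator_pair (n, \<rho>) \<in> Obj SOp"
proof -
  note \<rho> = module_props[OF assms]
  have "\<rho> g * \<rho> g = 1\<^sub>m n" unfolding \<rho>(7)[symmetric] relations_hold \<rho>(6) ..
  moreover have "- hmult A h g = scale A (-1) (hmult A h g)" by simp
  then have "\<rho> g * \<rho> h = (-1) \<cdot>\<^sub>m (\<rho> h * \<rho> g)"
    unfolding \<rho>(7)[symmetric] relations_hold by (simp only: \<rho>(5))
  ultimately show ?thesis using \<rho>(2,3) by (simp add: operator_pair_def SOp_Obj)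
qed

text \<open>A pair of matrices satisfying the relations defines a matrix representation of the free algebra; its
  kernel is an ideal containing the relations, so by the presentation it factors through \<open>A\<close>.\<close>

lemma operator_pair_lift:
  assumes o: "(n, G, M) \<in> Obj SOp"
  shows "\<exists>\<rho>. (n, \<rho>) \<in> Obj (Rep A) \<and> operator_pair (n, \<rho>) = (n, G, M)"
proof -
  interpret vs: vector_space "(*) :: 'k \<Rightarrow> 'k \<Rightarrow> 'k" by unfold_locales (simp_all add: algebra_simps)
  note X = o[unfolded SOp_Obj]
  define W where "W w = foldr (\<lambda>x. (*) (case_gen G M x)) (letters w) (1\<^sub>m n)" for w
  have W_simps: "W 0 = 1\<^sub>m n" "W (Word []) = 1\<^sub>m n" "W (Word (x # xs)) = case_gen G M x * W (Word xs)" for x xs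
    by (simp_all add: W_def zero_word_def)
  have dW: "dim_row (W w) = n \<and> dim_col (W w) = n" for w
  proof -
    have "dim_row (W (Word xs)) = n \<and> dim_col (W (Word xs)) = n" for xs
      by (induction xs) (use X in \<open>auto simp: W_simps split: gen.splits\<close>)
    then show ?thesis by (cases w) simp
  qed
  have Wadd: "W (u + v) = W u * W v" for u v
  proof -
    have "W (Word (xs @ ys)) = W (Word xs) * W (Word ys)" for xs ys
    proof (induction xs)
      case (Cons x xs)
      then show ?case using X dW by (cases x) (simp_all add: W_simps mat_assoc)
    qed (use dW in \<open>simp add: W_simps mat_one_left\<close>)
    then show ?thesis by (cases u; cases v) (simp add: plus_word_def)
  qed
  define R where "R p = mat n n (\<lambda>ij. lin_ext (*) (\<lambda>w. W w $$ ij) p)" for p :: "('k, gen) free_algebra"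
  have dR: "dim_row (R p) = n" "dim_col (R p) = n" for p by (simp_all add: R_def)
  have R_entry: "i < n \<Longrightarrow> j < n \<Longrightarrow> R p $$ (i, j) = lin_ext (*) (\<lambda>w. W w $$ (i, j)) p" for i j p
    by (simp add: R_def)
  have Radd: "R (p + q) = R p + R q" for p q
    by (intro eq_matI) (simp_all add: R_entry vs.lin_ext_add dR)
  have Rdiff: "R (p - q) = R p + (-1) \<cdot>\<^sub>m R q" for p q
    by (intro eq_matI) (simp_all add: R_entry vs.lin_ext_diff dR)
  have Rsingle: "R (Poly_Mapping.single w c) = c \<cdot>\<^sub>m W w" for w c
    using dW by (intro eq_matI) (simp_all add: R_entry vs.lin_ext_single dR)
  have Rmult: "R (p * q) = R p * R q" for p q
  proof (intro eq_matI)
    fix i j assume "i < dim_row (R p * R q)" "j < dim_col (R p * R q)"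
    then have ij: "i < n" "j < n" by (auto simp: dR)
    have W_entry: "W (u + v) $$ (i, j) = (\<Sum>k<n. W u $$ (i, k) * W v $$ (k, j))" for u v
      unfolding Wadd using ij dW by (simp add: mat_entry)
    have "R (p * q) $$ (i, j) = (\<Sum>u\<in>Poly_Mapping.keys p. \<Sum>v\<in>Poly_Mapping.keys q. \<Sum>k<n.
        (Poly_Mapping.lookup p u * W u $$ (i, k)) * (Poly_Mapping.lookup q v * W v $$ (k, j)))"
      unfolding R_entry[OF ij] vs.lin_ext_mult W_entry sum_distrib_left
      by (rule sum.cong[OF refl], rule sum.cong[OF refl], rule sum.cong[OF refl], simp only: ac_simps)
    also have "\<dots> = (\<Sum>u\<in>Poly_Mapping.keys p. \<Sum>k<n. \<Sum>v\<in>Poly_Mapping.keys q.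
        (Poly_Mapping.lookup p u * W u $$ (i, k)) * (Poly_Mapping.lookup q v * W v $$ (k, j)))"
      by (rule sum.cong[OF refl], rule sum.swap)
    also have "\<dots> = (\<Sum>k<n. \<Sum>u\<in>Poly_Mapping.keys p. \<Sum>v\<in>Poly_Mapping.keys q.
        (Poly_Mapping.lookup p u * W u $$ (i, k)) * (Poly_Mapping.lookup q v * W v $$ (k, j)))"
      by (rule sum.swap)
    also have "\<dots> = (R p * R q) $$ (i, j)"
      using ij by (simp add: mat_entry dR R_entry lin_ext_def sum_product)
    finally show "R (p * q) $$ (i, j) = (R p * R q) $$ (i, j)" .
  qed (simp_all add: dR)
  have kernel: "R p = 0\<^sub>m n n" if "evaluate p = 0" for p
  proof -
    have "two_sided_ideal {p. R p = 0\<^sub>m n n}"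
      unfolding two_sided_ideal_def
    proof (intro conjI ballI allI)
      have "R 0 = 0\<^sub>m n n" by (intro eq_matI) (simp_all add: R_entry vs.lin_ext_zero dR)
      then show "0 \<in> {p. R p = 0\<^sub>m n n}" by simp
    qed (auto simp: Radd Rmult dR mat_zero_left mat_zero_right)
    moreover have "relations_A \<subseteq> {p. R p = 0\<^sub>m n n}"
    proof -
      have one: "(1 :: ('k, gen) free_algebra) = Poly_Mapping.single 0 1" by (rule single_one[symmetric])
      have GG: "R (monomial [Gen_g, Gen_g] - 1) = 1\<^sub>m n + (-1) \<cdot>\<^sub>m 1\<^sub>m n"
        unfolding one monomial_def Rdiff Rsingle using X by (simp add: W_simps mat_one_right smult_one_mat)
      have GM: "R (monomial [Gen_g, Gen_h] + monomial [Gen_h, Gen_g]) = (-1) \<cdot>\<^sub>m (M * G) + M * G"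
        unfolding monomial_def Radd Rsingle using X by (simp add: W_simps mat_one_right smult_one_mat)
      have "1\<^sub>m n + (-1) \<cdot>\<^sub>m 1\<^sub>m n = (0\<^sub>m n n :: 'k mat)" "(-1) \<cdot>\<^sub>m (M * G) + M * G = 0\<^sub>m n n"
        using X by (auto intro!: eq_matI)
      then show ?thesis using GG GM by (simp add: relations_A_def)
    qed
    ultimately have "two_sided_ideal hull relations_A \<subseteq> {p. R p = 0\<^sub>m n n}" by (intro hull_minimal)
    then show ?thesis using that evaluate_kernel by blast
  qed
  have R_cong: "R p = R q" if "evaluate p = evaluate q" for p q
  proof -
    have "R (p - q) = 0\<^sub>m n n" using that by (intro kernel) (simp add: evaluate_diff)
    then have z: "R p + (-1) \<cdot>\<^sub>m R q = 0\<^sub>m n n" by (simp add: Rdiff)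
    show ?thesis
    proof (intro eq_matI)
      fix i j assume "i < dim_row (R q)" "j < dim_col (R q)"
      moreover from this have "(R p + (-1) \<cdot>\<^sub>m R q) $$ (i, j) = 0" unfolding z by (simp add: dR)
      ultimately show "R p $$ (i, j) = R q $$ (i, j)" by (simp add: dR)
    qed (simp_all add: dR)
  qed
  define \<rho> where "\<rho> a = R (SOME p. evaluate p = a)" for a
  have \<rho>_eval: "\<rho> (evaluate p) = R p" for p
    unfolding \<rho>_def by (rule R_cong) (rule someI[of "\<lambda>q. evaluate q = evaluate p" p], rule refl)
  have "is_fd_module A (n, \<rho>)"
    unfolding is_fd_module_def
  proof (simp only: prod.case, intro conjI allI)
    fix a b c
    obtain p q where pq: "evaluate p = a" "evaluate q = b" using evaluate_surj by metis
    show "\<rho> a \<in> carrier_mat n n" unfolding \<rho>_def by (intro carrier_matI; simp add: dR)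
    show "\<rho> (a + b) = \<rho> a + \<rho> b" unfolding pq[symmetric] evaluate_add[symmetric] \<rho>_eval by (rule Radd)
    show "\<rho> (hmult A a b) = \<rho> a * \<rho> b" unfolding pq[symmetric] evaluate_mult[symmetric] \<rho>_eval by (rule Rmult)
    have "scale A c a = evaluate (Poly_Mapping.single 0 c * p)"
      unfolding evaluate_mult evaluate_single pq by (simp add: word_value_simps mult_scale_left one_mult)
    then show "\<rho> (scale A c a) = c \<cdot>\<^sub>m \<rho> a"
      using \<rho>_eval[of p] dR[of p] unfolding pq by (simp add: \<rho>_eval Rmult Rsingle W_simps mat_smult_left mat_one_left)
  next
    have "hone A = evaluate (Poly_Mapping.single 0 1)" unfolding evaluate_single word_value_simps by simp
    then show "\<rho> (hone A) = 1\<^sub>m n" by (simp only: \<rho>_eval Rsingle W_simps smult_one_mat)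
  qed
  moreover have "\<rho> g = G" "\<rho> h = M"
  proof -
    have "g = evaluate (Poly_Mapping.single (Word [Gen_g]) 1)" "h = evaluate (Poly_Mapping.single (Word [Gen_h]) 1)"
      by (simp_all add: evaluate_single word_value_simps mult_one)
    then show "\<rho> g = G" "\<rho> h = M"
      using \<rho>_eval[of "Poly_Mapping.single (Word [Gen_g]) 1"] \<rho>_eval[of "Poly_Mapping.single (Word [Gen_h]) 1"] X
      by (simp_all add: Rsingle W_simps smult_one_mat mat_one_right)
  qed
  ultimately show ?thesis by (intro exI[of _ \<rho>]) (simp add: Rep_def operator_pair_def)
qed

text \<open>The elements whose action commutes with \<open>F\<close> form a subalgebra, so it suffices that it contains \<open>g\<close> and \<open>h\<close>.\<close>

lemma Rep_Hom_iff:
  assumes X: "(m, \<rho>) \<in> Obj (Rep A)" and Y: "(n, \<sigma>) \<in> Obj (Rep A)"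
  shows "Hom (Rep A) (m, \<rho>) (n, \<sigma>) = Hom SOp (operator_pair (m, \<rho>)) (operator_pair (n, \<sigma>))"
proof -
  note \<rho> = module_props[OF X] and \<sigma> = module_props[OF Y]
  have "F * \<rho> a = \<sigma> a * F" if F: "dim_row F = n" "dim_col F = m" "F * \<rho> g = \<sigma> g * F" "F * \<rho> h = \<sigma> h * F" for F a
  proof (induction a rule: generated_induct)
    case (mult a b)
    have "F * \<rho> (hmult A a b) = (F * \<rho> a) * \<rho> b" using F \<rho>(2,3) by (simp add: \<rho>(7) mat_assoc)
    also have "\<dots> = \<sigma> a * (F * \<rho> b)" unfolding mult(1) using F \<rho>(2,3) \<sigma>(2,3) by (simp add: mat_assoc)
    also have "\<dots> = \<sigma> (hmult A a b) * F" unfolding mult(2) using F \<sigma>(2,3) by (simp add: \<sigma>(7) mat_assoc)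
    finally show ?case .
  qed (use F \<rho>(2,3) \<sigma>(2,3) in \<open>simp_all add: \<rho>(4-6) \<sigma>(4-6) mat_algebra\<close>)
  then show ?thesis by (auto simp: operator_pair_def SOp_Hom Rep_def intro!: carrier_matI)
qed

subsection \<open>Tensor products of modules\<close>

lemma bilinear_kronecker_entry:
  assumes X: "(m, \<rho>) \<in> Obj (Rep A)" and Y: "(n, \<sigma>) \<in> Obj (Rep A)" and ij: "i < m * n" "j < m * n"
  shows "bilinear_form (scale A) (\<lambda>a b. kronecker (\<rho> a) (\<sigma> b) $$ (i, j))"
  using module_props(2-5)[OF X] module_props(2-5)[OF Y] ij
  by (simp add: bilinear_form_def kronecker_add_left kronecker_add_right kronecker_smult_left kronecker_smult_right)

lemma sum_list_pair_distrib:
  "(\<Sum>(x, y)\<leftarrow>xs. \<Sum>k\<in>S. f x y k) = (\<Sum>k\<in>S. \<Sum>(x, y)\<leftarrow>xs. f x y k :: 'c::comm_monoid_add)"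
  by (induction xs) (auto simp: sum.distrib)

text \<open>Entries of \<open>\<rho> a \<otimes> \<sigma> b\<close> are bilinear in \<open>(a, b)\<close>, so \<open>\<Delta>(a)\<close> can be replaced by any representative: by the given
  ones for \<open>g\<close> and \<open>h\<close>, and by products of representatives for \<open>\<Delta>(a b)\<close>.\<close>

lemma module_tensor_obj:
  assumes X: "(m, \<rho>) \<in> Obj (Rep A)" and Y: "(n, \<sigma>) \<in> Obj (Rep A)"
  shows "module_tensor A (m, \<rho>) (n, \<sigma>) \<in> Obj (Rep A)"
    and "operator_pair (module_tensor A (m, \<rho>) (n, \<sigma>)) = operator_pair (m, \<rho>) \<boxtimes>\<^bsub>SOp\<^esub> operator_pair (n, \<sigma>)"
proof -
  note \<rho> = module_props[OF X] and \<sigma> = module_props[OF Y]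
  define B where "B i j a b = kronecker (\<rho> a) (\<sigma> b) $$ (i, j)" for i j a b
  define \<tau> where "\<tau> a = mat (m * n) (m * n) (\<lambda>ij. \<Sum>(a\<^sub>1, a\<^sub>2)\<leftarrow>comult A a. kronecker (\<rho> a\<^sub>1) (\<sigma> a\<^sub>2) $$ ij)" for a
  have tensor: "module_tensor A (m, \<rho>) (n, \<sigma>) = (m * n, \<tau>)" by (simp add: module_tensor_def \<tau>_def fun_eq_iff)
  have d\<tau>: "dim_row (\<tau> a) = m * n" "dim_col (\<tau> a) = m * n" for a by (simp_all add: \<tau>_def)
  have \<tau>_eq: "\<tau> a $$ (i, j) = (\<Sum>(x, y)\<leftarrow>us. B i j x y)"
    if "same_tensor2 A (comult A a) us" "i < m * n" "j < m * n" for a us i j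
    using same_tensor2_bilinear[OF that(1) bilinear_kronecker_entry[OF X Y that(2,3)]] that(2,3)
    by (simp add: \<tau>_def B_def)
  have refl: "same_tensor2 A us us" for us
    using two_sided_ideal_hull[of "linear_relations (scale A)"]
    by (simp add: same_tensor2_def same_tensor_def two_sided_ideal_def)
  have dk: "dim_row (kronecker (\<rho> a) (\<sigma> b)) = m * n" "dim_col (kronecker (\<rho> a) (\<sigma> b)) = m * n" for a b
    using \<rho>(2,3) \<sigma>(2,3) by simp_all
  have sum_cmult: "(\<Sum>(x, y)\<leftarrow>us. c * f x y) = c * (\<Sum>(x, y)\<leftarrow>us. f x y)" for us :: "('a \<times> 'a) list" and c :: 'k and f
    by (induction us) (auto simp: algebra_simps)
  have sum_mult: "(\<Sum>(x, y)\<leftarrow>us. f x y) * (\<Sum>(x, y)\<leftarrow>vs. f' x y)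
      = (\<Sum>(x, y)\<leftarrow>us. \<Sum>(x', y')\<leftarrow>vs. f x y * f' x' y')" for us vs :: "('a \<times> 'a) list" and f f' :: "'a \<Rightarrow> 'a \<Rightarrow> 'k"
    by (induction us) (auto simp: distrib_right sum_cmult)
  have "is_fd_module A (m * n, \<tau>)"
    unfolding is_fd_module_def
  proof (simp only: prod.case, intro conjI allI)
    show "\<tau> a \<in> carrier_mat (m * n) (m * n)" for a by (intro carrier_matI; simp add: d\<tau>)
    show "\<tau> (a + b) = \<tau> a + \<tau> b" for a b
    proof (intro eq_matI)
      fix i j assume "i < dim_row (\<tau> a + \<tau> b)" "j < dim_col (\<tau> a + \<tau> b)"
      then have ij: "i < m * n" "j < m * n" by (auto simp: d\<tau>)
      show "\<tau> (a + b) $$ (i, j) = (\<tau> a + \<tau> b) $$ (i, j)"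
        unfolding \<tau>_eq[OF comult_add ij] using ij by (simp add: d\<tau> \<tau>_eq[OF refl])
    qed (simp_all add: d\<tau>)
    show "\<tau> (scale A c a) = c \<cdot>\<^sub>m \<tau> a" for c a
    proof (intro eq_matI)
      fix i j assume "i < dim_row (c \<cdot>\<^sub>m \<tau> a)" "j < dim_col (c \<cdot>\<^sub>m \<tau> a)"
      then have ij: "i < m * n" "j < m * n" by (auto simp: d\<tau>)
      have "B i j (scale A c x) y = c * B i j x y" for x y
        using ij dk by (simp add: B_def \<rho>(5) kronecker_smult_left)
      then have sum_scale: "(\<Sum>(x, y)\<leftarrow>map (\<lambda>(x\<^sub>1, x\<^sub>2). (scale A c x\<^sub>1, x\<^sub>2)) us. B i j x y)
          = c * (\<Sum>(x, y)\<leftarrow>us. B i j x y)" for us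
        by (induction us) (auto simp: algebra_simps)
      show "\<tau> (scale A c a) $$ (i, j) = (c \<cdot>\<^sub>m \<tau> a) $$ (i, j)"
        unfolding \<tau>_eq[OF comult_scale ij]
        using ij sum_scale by (simp add: d\<tau> \<tau>_eq[OF refl])
    qed (simp_all add: d\<tau>)
    show "\<tau> (hone A) = 1\<^sub>m (m * n)"
      by (intro eq_matI) (simp_all add: d\<tau> \<tau>_eq[OF comult_one] B_def \<rho>(6) \<sigma>(6) kronecker_one)
    show "\<tau> (hmult A a b) = \<tau> a * \<tau> b" for a b
    proof (intro eq_matI)
      fix i j assume "i < dim_row (\<tau> a * \<tau> b)" "j < dim_col (\<tau> a * \<tau> b)"
      then have ij: "i < m * n" "j < m * n" by (auto simp: d\<tau>)
      have mult: "B i j (hmult A x x') (hmult A y y') = (\<Sum>k<m * n. B i k x y * B k j x' y')" for x y x' y'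
      proof -
        have "kronecker (\<rho> (hmult A x x')) (\<sigma> (hmult A y y')) = kronecker (\<rho> x) (\<sigma> y) * kronecker (\<rho> x') (\<sigma> y')"
          using \<rho>(2,3) \<sigma>(2,3) by (simp add: \<rho>(7) \<sigma>(7) kronecker_mult)
        then show ?thesis using ij dk by (simp add: B_def mat_entry)
      qed
      have concat: "(\<Sum>(x, y)\<leftarrow>concat (map (\<lambda>(x\<^sub>1, x\<^sub>2). map (\<lambda>(y\<^sub>1, y\<^sub>2). (hmult A x\<^sub>1 y\<^sub>1, hmult A x\<^sub>2 y\<^sub>2)) vs) us). B i j x y)
          = (\<Sum>(x, y)\<leftarrow>us. \<Sum>(x', y')\<leftarrow>vs. B i j (hmult A x x') (hmult A y y'))" for us vs
        by (induction us) (auto simp: o_def case_prod_beta)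
      have "\<tau> (hmult A a b) $$ (i, j)
          = (\<Sum>(x, y)\<leftarrow>comult A a. \<Sum>(x', y')\<leftarrow>comult A b. \<Sum>k<m * n. B i k x y * B k j x' y')"
        unfolding \<tau>_eq[OF comult_mult ij] concat mult ..
      also have "\<dots> = (\<Sum>k<m * n. (\<Sum>(x, y)\<leftarrow>comult A a. \<Sum>(x', y')\<leftarrow>comult A b. B i k x y * B k j x' y'))"
        by (simp add: sum_list_pair_distrib)
      also have "\<dots> = (\<tau> a * \<tau> b) $$ (i, j)"
        using ij by (simp add: mat_entry d\<tau> \<tau>_eq[OF refl] sum_mult)
      finally show "\<tau> (hmult A a b) $$ (i, j) = (\<tau> a * \<tau> b) $$ (i, j)" .
    qed (simp_all add: d\<tau>)
  qed
  then show "module_tensor A (m, \<rho>) (n, \<sigma>) \<in> Obj (Rep A)" by (simp add: tensor Rep_def)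
  have "same_tensor2 A (comult A g) [(g, g)]" using g_group_like by (simp add: group_like_def)
  from \<tau>_eq[OF this] have "\<tau> g = kronecker (\<rho> g) (\<sigma> g)"
    by (intro eq_matI) (simp_all add: d\<tau> dk B_def \<rho>(2,3) \<sigma>(2,3))
  moreover have "\<tau> h = kronecker (\<rho> g) (\<sigma> h) + kronecker (\<rho> h) (1\<^sub>m n)"
    by (intro eq_matI) (simp_all add: \<tau>_eq[OF comult_h] d\<tau> dk B_def \<rho>(2,3) \<sigma>(2,3,6))
  ultimately show "operator_pair (module_tensor A (m, \<rho>) (n, \<sigma>)) = operator_pair (m, \<rho>) \<boxtimes>\<^bsub>SOp\<^esub> operator_pair (n, \<sigma>)"
    by (simp add: tensor operator_pair_def)
qed

lemma unit_module:
  "Unit (Rep A) \<in> Obj (Rep A)" "operator_pair (Unit (Rep A)) = Unit SOp"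
proof -
  interpret cl: Vector_Spaces.linear "scale A" "(*)" "counit A" by (rule counit_linear)
  have "is_fd_module A (1, \<lambda>a. mat 1 1 (\<lambda>_. counit A a))"
    unfolding is_fd_module_def
    by (auto simp: cl.add cl.scale counit_mult counit_one mat_entry intro!: eq_matI)
  then show "Unit (Rep A) \<in> Obj (Rep A)" by (simp add: Rep_def)
  show "operator_pair (Unit (Rep A)) = Unit SOp"
    by (auto simp: Rep_def operator_pair_def counit_g counit_h intro!: eq_matI)
qed

lemma Rep_identification: "hom_identification (Rep A) SOp operator_pair"
proof
  show "operator_pair ` Obj (Rep A) = Obj SOp"
  proof (intro equalityI subsetI)
    fix X assume "X \<in> operator_pair ` Obj (Rep A)"
    then obtain n \<rho> where "(n, \<rho>) \<in> Obj (Rep A)" "X = operator_pair (n, \<rho>)" by auto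
    then show "X \<in> Obj SOp" using operator_pair_obj by simp
  next
    fix X :: "nat \<times> 'k mat \<times> 'k mat" assume X: "X \<in> Obj SOp"
    obtain n G M where eq: "X = (n, G, M)" by (cases X)
    obtain \<rho> where "(n, \<rho>) \<in> Obj (Rep A)" "operator_pair (n, \<rho>) = X" using operator_pair_lift X eq by metis
    then show "X \<in> operator_pair ` Obj (Rep A)" by force
  qed
  show "Hom (Rep A) X Y = Hom SOp (operator_pair X) (operator_pair Y)" if "X \<in> Obj (Rep A)" "Y \<in> Obj (Rep A)" for X Y
    using that Rep_Hom_iff by (cases X; cases Y) simp
  show "X \<boxtimes>\<^bsub>Rep A\<^esub> Y \<in> Obj (Rep A)" "operator_pair (X \<boxtimes>\<^bsub>Rep A\<^esub> Y) = operator_pair X \<boxtimes>\<^bsub>SOp\<^esub> operator_pair Y"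
    if "X \<in> Obj (Rep A)" "Y \<in> Obj (Rep A)" for X Y
    using that module_tensor_obj by (cases X; cases Y; simp add: Rep_def)+
  show "Unit (Rep A) \<in> Obj (Rep A)" "operator_pair (Unit (Rep A)) = Unit SOp" by (rule unit_module)+
qed (auto simp: Rep_def operator_pair_def split: prod.splits)

text \<open>\<open>h\<^sup>2\<close> acts by \<open>M\<^sup>2\<close>.\<close>

lemma integral_h2_modules_eq:
  "integral_h2_modules A h = {X \<in> Obj (Rep A). operator_pair X \<in> integral_super_operators}"
proof -
  have "(n, \<rho>) \<in> integral_h2_modules A h \<longleftrightarrow> operator_pair (n, \<rho>) \<in> integral_super_operators"
    if o: "(n, \<rho>) \<in> Obj (Rep A)" for n \<rho>
  proof -
    note \<rho> = module_props[OF o]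
    have "\<rho> h * \<rho> h \<in> carrier_mat n n" using \<rho>(1) by (rule mult_carrier_mat[OF _ \<rho>(1)])
    from int_diagonalizable_iff[OF this] show ?thesis
      using o operator_pair_obj[OF o] by (simp add: integral_h2_modules_def operator_pair_def integral_iff \<rho>(7))
  qed
  then show ?thesis by (auto simp: integral_h2_modules_def)
qed

end

section \<open>The Hopf algebra H\<close>

text \<open>The matrix coefficients of the integral modules span the restricted dual \<open>H\<close> of \<open>A\<close>.  A basis is given by
  the functionals \<open>x(N, a, b) : g\<^sup>c h\<^sup>2\<^sup>k\<^sup>+\<^sup>d \<mapsto> (-1)\<^sup>a\<^sup>c N\<^sup>k \<delta>(b, d)\<close> for an integer \<open>N\<close> and
  bits \<open>a\<close>, \<open>b\<close>; all structure constants below are obtained by dualizing those of \<open>A\<close>.  The basis is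
  indexed by natural numbers through a bijection.\<close>

type_synonym coef_index = "int \<times> bool \<times> bool"

definition index_code :: "coef_index \<Rightarrow> nat" where
  "index_code = to_nat_on UNIV"

definition index_decode :: "nat \<Rightarrow> coef_index" where
  "index_decode = inv_into UNIV index_code"

lemma bij_index_code: "bij index_code"
proof -
  have "infinite (UNIV :: coef_index set)" by (simp add: finite_prod infinite_UNIV_int)
  then show ?thesis unfolding index_code_def by (intro to_nat_on_infinite) simp_all
qed

lemma index_decode_code [simp]: "index_decode (index_code \<iota>) = \<iota>"
  unfolding index_decode_def using bij_index_code by (simp add: bij_is_inj)

lemma index_code_decode [simp]: "index_code (index_decode i) = i"
  unfolding index_decode_def using bij_index_code by (intro f_inv_into_f) (simp add: bij_is_surj)

lemma index_code_inject [simp]: "index_code \<iota> = index_code \<kappa> \<longleftrightarrow> \<iota> = \<kappa>"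
  using bij_index_code by (simp add: bij_is_inj inj_eq)

definition hscale :: "'k::field \<Rightarrow> (nat \<Rightarrow>\<^sub>0 'k) \<Rightarrow> (nat \<Rightarrow>\<^sub>0 'k)" where
  "hscale c p = Poly_Mapping.map ((*) c) p"

abbreviation coef :: "(nat \<Rightarrow>\<^sub>0 'k::field) \<Rightarrow> coef_index \<Rightarrow> 'k" where
  "coef p \<iota> \<equiv> Poly_Mapping.lookup p (index_code \<iota>)"

definition bas :: "coef_index \<Rightarrow> (nat \<Rightarrow>\<^sub>0 'k::field)" where
  "bas \<iota> = Poly_Mapping.single (index_code \<iota>) 1"

lemma lookup_hscale [simp]: "Poly_Mapping.lookup (hscale c p) i = c * Poly_Mapping.lookup p i"
  unfolding hscale_def by (simp add: Poly_Mapping.map.rep_eq when_def)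

lemma coef_bas [simp]: "coef (bas \<iota>) \<kappa> = (if \<iota> = \<kappa> then 1 else 0)"
  by (simp add: bas_def lookup_single when_def)

lemma coef_eqI: "(\<And>\<iota>. coef p \<iota> = coef q \<iota>) \<Longrightarrow> p = q"
  by (rule poly_mapping_eqI) (metis index_code_decode)

interpretation hspace: vector_space "hscale :: 'k::field \<Rightarrow> _"
  by unfold_locales (auto intro!: poly_mapping_eqI simp: lookup_add algebra_simps)

interpretation kspace: vector_space "(*) :: 'k::field \<Rightarrow> 'k \<Rightarrow> 'k"
  by unfold_locales (simp_all add: algebra_simps)

definition linear_on_H :: "('k::field \<Rightarrow> 'v::ab_group_add \<Rightarrow> 'v) \<Rightarrow> ((nat \<Rightarrow>\<^sub>0 'k) \<Rightarrow> 'v) \<Rightarrow> bool" where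
  "linear_on_H s f \<longleftrightarrow> (\<forall>x y. f (x + y) = f x + f y) \<and> (\<forall>c x. f (hscale c x) = s c (f x))"

lemma linear_on_HD:
  assumes "linear_on_H s f"
  shows "f (x + y) = f x + f y" "f (hscale c x) = s c (f x)" "f 0 = 0"
proof -
  show "f (x + y) = f x + f y" for x y using assms by (simp add: linear_on_H_def)
  from this[of 0 0] show "f 0 = 0" by simp
  show "f (hscale c x) = s c (f x)" using assms by (simp add: linear_on_H_def)
qed

lemma linear_on_H_iff_linear:
  "vector_space s \<Longrightarrow> Vector_Spaces.linear hscale s f \<longleftrightarrow> linear_on_H s f"
  by (simp add: Vector_Spaces.linear_iff linear_on_H_def hspace.vector_space_axioms)

lemma H_expansion: "x = (\<Sum>i\<in>Poly_Mapping.keys x. hscale (Poly_Mapping.lookup x i) (bas (index_decode i)))"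
proof -
  have "hscale (Poly_Mapping.lookup x i) (bas (index_decode i)) = Poly_Mapping.single i (Poly_Mapping.lookup x i)" for i
    by (rule poly_mapping_eqI) (simp add: bas_def lookup_single when_def)
  then show ?thesis by (simp add: poly_mapping_sum_monomials)
qed

lemma linear_on_H_expansion:
  assumes f: "linear_on_H s f"
  shows "f x = (\<Sum>i\<in>Poly_Mapping.keys x. s (Poly_Mapping.lookup x i) (f (bas (index_decode i))))"
proof -
  have "f (sum u S) = (\<Sum>i\<in>S. f (u i))" for u and S :: "nat set"
    by (induction S rule: infinite_finite_induct) (auto simp: linear_on_HD[OF f])
  then have "f (\<Sum>i\<in>Poly_Mapping.keys x. hscale (Poly_Mapping.lookup x i) (bas (index_decode i)))
      = (\<Sum>i\<in>Poly_Mapping.keys x. s (Poly_Mapping.lookup x i) (f (bas (index_decode i))))"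
    by (simp add: linear_on_HD[OF f])
  then show ?thesis by (simp only: H_expansion[symmetric])
qed

lemma linear_on_H_eqI:
  assumes "linear_on_H s f" "linear_on_H s f'" "\<And>N a b. f (bas (N, a, b)) = f' (bas (N, a, b))"
  shows "f x = f' x"
proof -
  have "f (bas \<iota>) = f' (bas \<iota>)" for \<iota> using assms(3) by (cases \<iota>) auto
  then show ?thesis
    by (simp add: linear_on_H_expansion[OF assms(1), of x] linear_on_H_expansion[OF assms(2), of x])
qed

subsection \<open>Structure maps\<close>

abbreviation sgn_bit :: "bool \<Rightarrow> 'k::field" where
  "sgn_bit a \<equiv> (if a then -1 else 1)"

fun bas_mult :: "coef_index \<Rightarrow> coef_index \<Rightarrow> (nat \<Rightarrow>\<^sub>0 'k::field)" where
  "bas_mult (N, a, b) (N', a', b') =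
     (if b \<and> b' then 0 else hscale (if b' then sgn_bit a else 1) (bas (N + N', a \<noteq> a', b \<or> b')))"

fun bas_comult :: "coef_index \<Rightarrow> ((nat \<Rightarrow>\<^sub>0 'k::field) \<times> (nat \<Rightarrow>\<^sub>0 'k)) list" where
  "bas_comult (N, a, b) = (if b then [(bas (N, a, False), bas (N, a, True)), (bas (N, a, True), bas (N, \<not> a, False))]
     else [(bas (N, a, False), bas (N, a, False)), (hscale (of_int N) (bas (N, a, True)), bas (N, \<not> a, True))])"

fun bas_antipode :: "coef_index \<Rightarrow> (nat \<Rightarrow>\<^sub>0 'k::field)" where
  "bas_antipode (N, a, b) = (if b then hscale (- sgn_bit a) (bas (- N, \<not> a, True)) else bas (- N, a, False))"

definition H_mult :: "(nat \<Rightarrow>\<^sub>0 'k::field) \<Rightarrow> (nat \<Rightarrow>\<^sub>0 'k) \<Rightarrow> (nat \<Rightarrow>\<^sub>0 'k)" where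
  "H_mult p q = lin_ext hscale (\<lambda>i. lin_ext hscale (\<lambda>j. bas_mult (index_decode i) (index_decode j)) q) p"

definition H_comult :: "(nat \<Rightarrow>\<^sub>0 'k::field) \<Rightarrow> ((nat \<Rightarrow>\<^sub>0 'k) \<times> (nat \<Rightarrow>\<^sub>0 'k)) list" where
  "H_comult p = concat (map (\<lambda>i. map (\<lambda>(x, y). (hscale (Poly_Mapping.lookup p i) x, y)) (bas_comult (index_decode i)))
     (sorted_list_of_set (Poly_Mapping.keys p)))"

definition H_counit :: "(nat \<Rightarrow>\<^sub>0 'k::field) \<Rightarrow> 'k" where
  "H_counit p = lin_ext (*) (\<lambda>i. if snd (snd (index_decode i)) then 0 else 1) p"

definition H_antipode :: "(nat \<Rightarrow>\<^sub>0 'k::field) \<Rightarrow> (nat \<Rightarrow>\<^sub>0 'k)" where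
  "H_antipode p = lin_ext hscale (\<lambda>i. bas_antipode (index_decode i)) p"

definition H_alg :: "('k::field, nat \<Rightarrow>\<^sub>0 'k) hopf_alg" where
  "H_alg = \<lparr>scale = hscale, hmult = H_mult, hone = bas (0, False, False), comult = H_comult,
     counit = H_counit, antipode = H_antipode\<rparr>"

lemma H_alg_simps [simp]:
  "scale H_alg = hscale" "hmult H_alg = H_mult" "hone H_alg = bas (0, False, False)"
  "comult H_alg = H_comult" "counit H_alg = H_counit" "antipode H_alg = H_antipode"
  by (simp_all add: H_alg_def)

lemma lin_ext_hscale:
  assumes "vector_space s"
  shows "lin_ext s F (hscale c p) = s c (lin_ext s F p)"
proof -
  interpret v: vector_space s by fact
  have "lin_ext s F (hscale c p) = (\<Sum>w\<in>Poly_Mapping.keys p. s (Poly_Mapping.lookup (hscale c p) w) (F w))"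
    by (intro v.lin_ext_superset) (auto simp: in_keys_iff)
  then show ?thesis by (simp add: lin_ext_def v.scale_sum_right)
qed

lemma linear_on_H_lin_ext: "vector_space s \<Longrightarrow> linear_on_H s (lin_ext s F)"
  by (simp add: linear_on_H_def vector_space.lin_ext_add lin_ext_hscale)

lemma lin_ext_bas: "vector_space s \<Longrightarrow> lin_ext s F (bas \<iota>) = F (index_code \<iota>)"
proof -
  assume "vector_space s"
  then interpret v: vector_space s .
  show ?thesis by (simp add: bas_def v.lin_ext_single)
qed

lemma linear_H_counit: "linear_on_H (*) (H_counit :: _ \<Rightarrow> 'k::field)"
  and linear_H_antipode: "linear_on_H hscale (H_antipode :: _ \<Rightarrow> nat \<Rightarrow>\<^sub>0 'k::field)"
  unfolding H_counit_def[abs_def] H_antipode_def[abs_def]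
  by (intro linear_on_H_lin_ext kspace.vector_space_axioms hspace.vector_space_axioms)+

lemma H_counit_bas [simp]: "H_counit (bas (N, a, b)) = (if b then 0 else 1)"
  by (simp add: H_counit_def lin_ext_bas[OF kspace.vector_space_axioms])

lemma H_antipode_bas [simp]: "H_antipode (bas \<iota>) = bas_antipode \<iota>"
  by (simp add: H_antipode_def lin_ext_bas[OF hspace.vector_space_axioms])

lemma linear_H_mult_left: "linear_on_H hscale (\<lambda>x. H_mult x y)"
  unfolding H_mult_def by (intro linear_on_H_lin_ext hspace.vector_space_axioms)

lemma linear_H_mult_right: "linear_on_H hscale (\<lambda>y. H_mult x y)"
proof -
  have add: "lin_ext hscale (\<lambda>i. F i + G i) x = lin_ext hscale F x + lin_ext hscale G x" for F G
    unfolding lin_ext_def hspace.scale_right_distrib sum.distrib ..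
  have scale: "lin_ext hscale (\<lambda>i. hscale c (F i)) x = hscale c (lin_ext hscale F x)" for c F
    unfolding lin_ext_def hspace.scale_sum_right hspace.scale_scale by (simp only: mult.commute)
  show ?thesis
    unfolding linear_on_H_def H_mult_def hspace.lin_ext_add lin_ext_hscale[OF hspace.vector_space_axioms] add scale
    by blast
qed

lemma H_mult_bas [simp]: "H_mult (bas \<iota>) (bas \<kappa>) = bas_mult \<iota> \<kappa>"
  by (simp add: H_mult_def lin_ext_bas[OF hspace.vector_space_axioms])

lemmas linear_simps [simp] =
  linear_on_HD[OF linear_H_counit] linear_on_HD[OF linear_H_antipode]
  linear_on_HD[OF linear_H_mult_left] linear_on_HD[OF linear_H_mult_right]

text \<open>Sums over the Sweedler components of \<open>x\<close> are linear in \<open>x\<close>, so it suffices to know them on the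
  basis.\<close>

lemma H_comult_sum:
  assumes s: "vector_space s" and B: "\<And>c x y. B (hscale c x) y = s c (B x y)"
  shows "linear_on_H s (\<lambda>x. \<Sum>(u, v)\<leftarrow>H_comult x. B u v)"
    and "(\<Sum>(u, v)\<leftarrow>H_comult (bas \<iota>). B u v) = (\<Sum>(u, v)\<leftarrow>bas_comult \<iota>. B u v)"
proof -
  interpret v: vector_space s by fact
  have scale: "(\<Sum>(u, v)\<leftarrow>map (\<lambda>(x, y). (hscale c x, y)) us. B u v) = s c (\<Sum>(u, v)\<leftarrow>us. B u v)" for c us
    by (induction us) (auto simp: B v.scale_right_distrib)
  have "(\<Sum>(u, v)\<leftarrow>H_comult x. B u v) = (\<Sum>i\<leftarrow>sorted_list_of_set (Poly_Mapping.keys x).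
      s (Poly_Mapping.lookup x i) (\<Sum>(u, v)\<leftarrow>bas_comult (index_decode i). B u v))" for x
  proof -
    have "(\<Sum>(u, v)\<leftarrow>concat (map (\<lambda>i. map (\<lambda>(x, y). (hscale (c i) x, y)) (F i)) xs). B u v)
        = (\<Sum>i\<leftarrow>xs. s (c i) (\<Sum>(u, v)\<leftarrow>F i. B u v))" for c F and xs :: "nat list"
      by (induction xs) (auto simp: scale simp del: map_map)
    then show ?thesis by (simp add: H_comult_def)
  qed
  also have "\<dots> x = lin_ext s (\<lambda>i. \<Sum>(u, v)\<leftarrow>bas_comult (index_decode i). B u v) x" for x
    by (simp add: lin_ext_def sum_list_distinct_conv_sum_set)
  finally have eq: "(\<Sum>(u, v)\<leftarrow>H_comult x. B u v) = lin_ext s (\<lambda>i. \<Sum>(u, v)\<leftarrow>bas_comult (index_decode i). B u v) x" for x .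
  show "linear_on_H s (\<lambda>x. \<Sum>(u, v)\<leftarrow>H_comult x. B u v)"
    unfolding eq by (rule linear_on_H_lin_ext[OF s])
  show "(\<Sum>(u, v)\<leftarrow>H_comult (bas \<iota>). B u v) = (\<Sum>(u, v)\<leftarrow>bas_comult \<iota>. B u v)"
    unfolding eq by (simp add: lin_ext_bas[OF s])
qed

subsection \<open>Equality of tensors over a space with a basis\<close>

text \<open>Modulo the relations of the tensor algebra, a word of vectors equals its expansion in words of basis
  vectors.  Hence tensors with the same coefficients are equal.\<close>

context
  fixes J :: "('k::field, nat \<Rightarrow>\<^sub>0 'k) free_algebra set"
  defines "J \<equiv> two_sided_ideal hull (linear_relations hscale)"
begin

lemma J_ideal: "0 \<in> J" "x \<in> J \<Longrightarrow> y \<in> J \<Longrightarrow> x + y \<in> J" "x \<in> J \<Longrightarrow> r * x \<in> J" "x \<in> J \<Longrightarrow> x * r \<in> J"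
  "x \<in> J \<Longrightarrow> - x \<in> J"
proof -
  have *: "two_sided_ideal J" unfolding J_def by (rule two_sided_ideal_hull)
  then show "0 \<in> J" "x \<in> J \<Longrightarrow> y \<in> J \<Longrightarrow> x + y \<in> J" and l: "\<And>x r. x \<in> J \<Longrightarrow> r * x \<in> J" and "x \<in> J \<Longrightarrow> x * r \<in> J"
    unfolding two_sided_ideal_def by blast+
  show "x \<in> J \<Longrightarrow> - x \<in> J" using l[of x "-1"] by simp
qed

lemma J_sum: "(\<And>i. i \<in> S \<Longrightarrow> f i - f' i \<in> J) \<Longrightarrow> sum f S - sum f' S \<in> J"
proof (induction S rule: infinite_finite_induct)
  case (insert i S)
  then have "(f i - f' i) + (sum f S - sum f' S) \<in> J" by (intro J_ideal(2)) auto
  then show ?case using insert by (simp add: algebra_simps)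
qed (auto simp: J_ideal)

lemma J_trans: "p - q \<in> J \<Longrightarrow> q - r \<in> J \<Longrightarrow> p - r \<in> J"
  using J_ideal(2)[of "p - q" "q - r"] by simp

lemma J_mult: "p - q \<in> J \<Longrightarrow> p' - q' \<in> J \<Longrightarrow> p * p' - q * q' \<in> J"
  using J_ideal(2)[OF J_ideal(4)[of "p - q" p'] J_ideal(3)[of "p' - q'" q]]
  by (simp add: algebra_simps)

lemma monomial_add: "monomial [x + y] - (monomial [x] + monomial [y]) \<in> J"
proof -
  have "monomial [x + y] - monomial [x] - monomial [y] \<in> linear_relations hscale"
    unfolding linear_relations_def by blast
  then have "monomial [x + y] - monomial [x] - monomial [y] \<in> J" unfolding J_def by (rule subsetD[OF hull_subset])
  then show ?thesis by (simp only: diff_diff_eq)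
qed

lemma monomial_scale: "monomial [hscale c x] - Poly_Mapping.single (Word [x]) c \<in> J"
proof -
  have "monomial [hscale c x] - Poly_Mapping.single 0 c * monomial [x] \<in> linear_relations hscale"
    unfolding linear_relations_def by blast
  then have "monomial [hscale c x] - Poly_Mapping.single 0 c * monomial [x] \<in> J" unfolding J_def by (rule subsetD[OF hull_subset])
  then show ?thesis by (simp add: monomial_def mult_single)
qed

lemma monomial_sum: "finite S \<Longrightarrow> monomial [sum f S] - (\<Sum>i\<in>S. monomial [f i]) \<in> J"
proof (induction S rule: finite_induct)
  case empty
  show ?case using monomial_scale[of 0 0] by simp
next
  case (insert i S)
  have "(monomial [f i] + monomial [sum f S]) - (monomial [f i] + (\<Sum>i\<in>S. monomial [f i])) \<in> J"
    using insert.IH by simp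
  from J_trans[OF monomial_add this] show ?case
    unfolding sum.insert[OF insert.hyps] .
qed

definition expand :: "nat set \<Rightarrow> (nat \<Rightarrow>\<^sub>0 'k) \<Rightarrow> ('k, nat \<Rightarrow>\<^sub>0 'k) free_algebra" where
  "expand S x = (\<Sum>i\<in>S. Poly_Mapping.single (Word [bas (index_decode i)]) (Poly_Mapping.lookup x i))"

lemma monomial_expand:
  assumes "finite S" "Poly_Mapping.keys x \<subseteq> S"
  shows "monomial [x] - expand S x \<in> J"
proof -
  have x: "(\<Sum>i\<in>S. hscale (Poly_Mapping.lookup x i) (bas (index_decode i))) = x"
  proof -
    have "(\<Sum>i\<in>S. hscale (Poly_Mapping.lookup x i) (bas (index_decode i)))
        = (\<Sum>i\<in>Poly_Mapping.keys x. hscale (Poly_Mapping.lookup x i) (bas (index_decode i)))"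
      using assms by (intro sum.mono_neutral_right) (auto simp: in_keys_iff)
    also have "\<dots> = x" by (rule H_expansion[symmetric])
    finally show ?thesis .
  qed
  have "monomial [x] - (\<Sum>i\<in>S. monomial [hscale (Poly_Mapping.lookup x i) (bas (index_decode i))]) \<in> J"
    using monomial_sum[OF assms(1), of "\<lambda>i. hscale (Poly_Mapping.lookup x i) (bas (index_decode i))"] x by simp
  moreover have "(\<Sum>i\<in>S. monomial [hscale (Poly_Mapping.lookup x i) (bas (index_decode i))]) - expand S x \<in> J"
    unfolding expand_def by (intro J_sum monomial_scale)
  ultimately show ?thesis by (rule J_trans)
qed

lemma monomial_Cons: "monomial (x # xs) = monomial [x] * monomial xs"
  by (simp add: monomial_def mult_single plus_word_def)

lemma sum_list_J: "(\<And>t. t \<in> set ts \<Longrightarrow> f t - f' t \<in> J) \<Longrightarrow> (\<Sum>t\<leftarrow>ts. f t) - (\<Sum>t\<leftarrow>ts. f' t) \<in> J"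
proof (induction ts)
  case (Cons t ts)
  then have "(f t - f' t) + ((\<Sum>t\<leftarrow>ts. f t) - (\<Sum>t\<leftarrow>ts. f' t)) \<in> J" by (intro J_ideal(2)) auto
  then show ?case by (simp add: algebra_simps)
qed (simp add: J_ideal)

lemma same_tensor2I:
  fixes ts us :: "((nat \<Rightarrow>\<^sub>0 'k) \<times> (nat \<Rightarrow>\<^sub>0 'k)) list"
  assumes eq: "\<And>i j. (\<Sum>(x, y)\<leftarrow>ts. Poly_Mapping.lookup x i * Poly_Mapping.lookup y j)
    = (\<Sum>(x, y)\<leftarrow>us. Poly_Mapping.lookup x i * Poly_Mapping.lookup y j)"
  shows "same_tensor hscale (map (\<lambda>(x, y). [x, y]) ts) (map (\<lambda>(x, y). [x, y]) us)"
proof -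
  define S where "S = (\<Union>(x, y)\<in>set (ts @ us). Poly_Mapping.keys x \<union> Poly_Mapping.keys y)"
  have S: "finite S" unfolding S_def by (intro finite_UN_I) auto
  define E where "E vs = (\<Sum>i\<in>S. \<Sum>j\<in>S. Poly_Mapping.single (Word [bas (index_decode i), bas (index_decode j)])
      (\<Sum>(x, y)\<leftarrow>vs. Poly_Mapping.lookup x i * Poly_Mapping.lookup y j) :: ('k, nat \<Rightarrow>\<^sub>0 'k) free_algebra)"
    for vs :: "((nat \<Rightarrow>\<^sub>0 'k) \<times> (nat \<Rightarrow>\<^sub>0 'k)) list"
  have expand2: "expand S x * expand S y = (\<Sum>i\<in>S. \<Sum>j\<in>S. Poly_Mapping.single
      (Word [bas (index_decode i), bas (index_decode j)]) (Poly_Mapping.lookup x i * Poly_Mapping.lookup y j))" for x y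
    by (simp add: expand_def sum_product mult_single plus_word_def)
  have "(\<Sum>t\<leftarrow>vs. monomial [fst t, snd t]) - E vs \<in> J" if "set vs \<subseteq> set (ts @ us)" for vs
  proof -
    have "(\<Sum>t\<leftarrow>vs. monomial [fst t, snd t]) - (\<Sum>t\<leftarrow>vs. expand S (fst t) * expand S (snd t)) \<in> J"
    proof (rule sum_list_J)
      fix t assume "t \<in> set vs"
      then have "Poly_Mapping.keys (fst t) \<subseteq> S" "Poly_Mapping.keys (snd t) \<subseteq> S"
        using that by (force simp: S_def)+
      then show "monomial [fst t, snd t] - expand S (fst t) * expand S (snd t) \<in> J"
        unfolding monomial_Cons[of _ "[_]"] by (intro J_mult monomial_expand S)
    qed
    also have "(\<Sum>t\<leftarrow>vs. expand S (fst t) * expand S (snd t)) = E vs"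
      unfolding expand2 E_def
      by (induction vs) (auto simp: single_add sum.distrib)
    finally show ?thesis .
  qed
  from this[of ts] this[of us] have "(\<Sum>t\<leftarrow>ts. monomial [fst t, snd t]) - E ts \<in> J" "(\<Sum>t\<leftarrow>us. monomial [fst t, snd t]) - E us \<in> J"
    by auto
  moreover have "E ts = E us" unfolding E_def eq ..
  ultimately have "((\<Sum>t\<leftarrow>ts. monomial [fst t, snd t]) - E us) + - ((\<Sum>t\<leftarrow>us. monomial [fst t, snd t]) - E us) \<in> J"
    by (intro J_ideal) simp_all
  then show ?thesis
    unfolding same_tensor_def J_def[symmetric] by (simp add: o_def split_def)
qed

lemma same_tensor3I:
  fixes ts us :: "((nat \<Rightarrow>\<^sub>0 'k) \<times> (nat \<Rightarrow>\<^sub>0 'k) \<times> (nat \<Rightarrow>\<^sub>0 'k)) list"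
  assumes eq: "\<And>i j k. (\<Sum>(x, y, z)\<leftarrow>ts. Poly_Mapping.lookup x i * Poly_Mapping.lookup y j * Poly_Mapping.lookup z k)
    = (\<Sum>(x, y, z)\<leftarrow>us. Poly_Mapping.lookup x i * Poly_Mapping.lookup y j * Poly_Mapping.lookup z k)"
  shows "same_tensor hscale (map (\<lambda>(x, y, z). [x, y, z]) ts) (map (\<lambda>(x, y, z). [x, y, z]) us)"
proof -
  define S where "S = (\<Union>(x, y, z)\<in>set (ts @ us). Poly_Mapping.keys x \<union> Poly_Mapping.keys y \<union> Poly_Mapping.keys z)"
  have S: "finite S" unfolding S_def by (intro finite_UN_I) auto
  define E where "E vs = (\<Sum>i\<in>S. \<Sum>j\<in>S. \<Sum>k\<in>S. Poly_Mapping.single (Word [bas (index_decode i), bas (index_decode j), bas (index_decode k)])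
      (\<Sum>(x, y, z)\<leftarrow>vs. Poly_Mapping.lookup x i * Poly_Mapping.lookup y j * Poly_Mapping.lookup z k) :: ('k, nat \<Rightarrow>\<^sub>0 'k) free_algebra)"
    for vs :: "((nat \<Rightarrow>\<^sub>0 'k) \<times> (nat \<Rightarrow>\<^sub>0 'k) \<times> (nat \<Rightarrow>\<^sub>0 'k)) list"
  have expand3: "expand S x * (expand S y * expand S z) = (\<Sum>i\<in>S. \<Sum>j\<in>S. \<Sum>k\<in>S. Poly_Mapping.single
      (Word [bas (index_decode i), bas (index_decode j), bas (index_decode k)])
      (Poly_Mapping.lookup x i * Poly_Mapping.lookup y j * Poly_Mapping.lookup z k))" for x y z
  proof -
    have e2: "expand S y * expand S z = (\<Sum>j\<in>S. \<Sum>k\<in>S. Poly_Mapping.single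
        (Word [bas (index_decode j), bas (index_decode k)]) (Poly_Mapping.lookup y j * Poly_Mapping.lookup z k))"
      by (simp add: expand_def sum_product mult_single plus_word_def)
    show ?thesis
      unfolding e2 unfolding expand_def sum_product unfolding sum_distrib_left mult_single
      by (simp only: plus_word_def word.sel append.simps mult.assoc)
  qed
  have "(\<Sum>t\<leftarrow>vs. monomial [fst t, fst (snd t), snd (snd t)]) - E vs \<in> J" if "set vs \<subseteq> set (ts @ us)" for vs
  proof -
    have "(\<Sum>t\<leftarrow>vs. monomial [fst t, fst (snd t), snd (snd t)])
        - (\<Sum>t\<leftarrow>vs. expand S (fst t) * (expand S (fst (snd t)) * expand S (snd (snd t)))) \<in> J"
    proof (rule sum_list_J)
      fix t assume "t \<in> set vs"
      then have "t \<in> set (ts @ us)" using that by blast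
      then have "(case t of (x, y, z) \<Rightarrow> Poly_Mapping.keys x \<union> Poly_Mapping.keys y \<union> Poly_Mapping.keys z) \<subseteq> S"
        unfolding S_def by (rule UN_upper)
      then have "Poly_Mapping.keys (fst t) \<subseteq> S" "Poly_Mapping.keys (fst (snd t)) \<subseteq> S" "Poly_Mapping.keys (snd (snd t)) \<subseteq> S"
        by (simp_all add: split_def)
      then show "monomial [fst t, fst (snd t), snd (snd t)]
          - expand S (fst t) * (expand S (fst (snd t)) * expand S (snd (snd t))) \<in> J"
        unfolding monomial_Cons[of _ "[_, _]"] monomial_Cons[of _ "[_]"] by (intro J_mult monomial_expand S)
    qed
    also have "(\<Sum>t\<leftarrow>vs. expand S (fst t) * (expand S (fst (snd t)) * expand S (snd (snd t)))) = E vs"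
      unfolding expand3 E_def
      by (induction vs) (auto simp: single_add sum.distrib)
    finally show ?thesis .
  qed
  from this[of ts] this[of us] have "(\<Sum>t\<leftarrow>ts. monomial [fst t, fst (snd t), snd (snd t)]) - E ts \<in> J"
    "(\<Sum>t\<leftarrow>us. monomial [fst t, fst (snd t), snd (snd t)]) - E us \<in> J"
    by auto
  moreover have "E ts = E us" unfolding E_def eq ..
  ultimately have "((\<Sum>t\<leftarrow>ts. monomial [fst t, fst (snd t), snd (snd t)]) - E us)
      + - ((\<Sum>t\<leftarrow>us. monomial [fst t, fst (snd t), snd (snd t)]) - E us) \<in> J"
    by (intro J_ideal) simp_all
  then show ?thesis
    unfolding same_tensor_def J_def[symmetric] by (simp add: o_def split_def)
qed

end

text \<open>Equality in the tensor square of \<open>H\<close> becomes equality of coordinates, so the Hopf algebra axioms can be checked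
  by computing with functionals.\<close>

lemma same_tensor2_H_iff:
  "same_tensor2 H_alg ts us \<longleftrightarrow> (\<forall>\<iota> \<kappa>. (\<Sum>(x, y)\<leftarrow>ts. coef x \<iota> * coef y \<kappa>) = (\<Sum>(x, y)\<leftarrow>us. coef x \<iota> * coef y \<kappa>))"
proof
  assume st: "same_tensor2 H_alg ts us"
  show "\<forall>\<iota> \<kappa>. (\<Sum>(x, y)\<leftarrow>ts. coef x \<iota> * coef y \<kappa>) = (\<Sum>(x, y)\<leftarrow>us. coef x \<iota> * coef y \<kappa>)"
  proof (intro allI)
    fix \<iota> \<kappa>
    have "bilinear_form (scale H_alg) (\<lambda>x y. coef x \<iota> * coef y \<kappa>)"
      unfolding bilinear_form_def H_alg_simps lookup_add lookup_hscale distrib_left distrib_right by simp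
    then show "(\<Sum>(x, y)\<leftarrow>ts. coef x \<iota> * coef y \<kappa>) = (\<Sum>(x, y)\<leftarrow>us. coef x \<iota> * coef y \<kappa>)"
      by (rule same_tensor2_bilinear[OF st])
  qed
next
  assume eq: "\<forall>\<iota> \<kappa>. (\<Sum>(x, y)\<leftarrow>ts. coef x \<iota> * coef y \<kappa>) = (\<Sum>(x, y)\<leftarrow>us. coef x \<iota> * coef y \<kappa>)"
  show "same_tensor2 H_alg ts us"
    unfolding same_tensor2_def H_alg_simps
  proof (rule same_tensor2I)
    fix i j
    show "(\<Sum>(x, y)\<leftarrow>ts. Poly_Mapping.lookup x i * Poly_Mapping.lookup y j)
        = (\<Sum>(x, y)\<leftarrow>us. Poly_Mapping.lookup x i * Poly_Mapping.lookup y j)"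
      using eq[rule_format, of "index_decode i" "index_decode j"] by simp
  qed
qed

subsection \<open>The Hopf algebra axioms\<close>

text \<open>The product of the algebra dual to \<open>H\<close>, of which \<open>A\<close> is a subalgebra.  Since tensors are determined by their coefficients, it
  captures the comultiplication completely; coassociativity says that it is associative.\<close>

definition convolve :: "((nat \<Rightarrow>\<^sub>0 'k::field) \<Rightarrow> 'k) \<Rightarrow> ((nat \<Rightarrow>\<^sub>0 'k) \<Rightarrow> 'k) \<Rightarrow> (nat \<Rightarrow>\<^sub>0 'k) \<Rightarrow> 'k" where
  "convolve f f' x = (\<Sum>(u, v)\<leftarrow>H_comult x. f u * f' v)"

lemma linear_convolve:
  assumes "linear_on_H (*) f"
  shows "linear_on_H (*) (convolve f f')"
  unfolding convolve_def
  by (rule H_comult_sum(1)[OF kspace.vector_space_axioms]) (simp add: linear_on_HD(2)[OF assms])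

lemma convolve_bas:
  assumes "linear_on_H (*) f"
  shows "convolve f f' (bas (N, a, b)) = (if b
    then f (bas (N, a, False)) * f' (bas (N, a, True)) + f (bas (N, a, True)) * f' (bas (N, \<not> a, False))
    else f (bas (N, a, False)) * f' (bas (N, a, False)) + of_int N * (f (bas (N, a, True)) * f' (bas (N, \<not> a, True))))"
proof -
  have "convolve f f' (bas (N, a, b)) = (\<Sum>(u, v)\<leftarrow>bas_comult (N, a, b). f u * f' v)"
    unfolding convolve_def
    by (rule H_comult_sum(2)[OF kspace.vector_space_axioms]) (simp add: linear_on_HD(2)[OF assms])
  then show ?thesis by (simp add: linear_on_HD(2)[OF assms])
qed

lemma linear_on_H_uminus:
  assumes "vector_space s" "linear_on_H s f"
  shows "f (- x) = - f x"
proof -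
  interpret v: vector_space s by fact
  have "f (hscale (- 1) x) = s (- 1) (f x)" by (rule linear_on_HD(2)[OF assms(2)])
  then show ?thesis by simp
qed

lemmas H_uminus [simp] =
  linear_on_H_uminus[OF hspace.vector_space_axioms linear_H_mult_left]
  linear_on_H_uminus[OF hspace.vector_space_axioms linear_H_mult_right]
  linear_on_H_uminus[OF hspace.vector_space_axioms linear_H_antipode]
  linear_on_H_uminus[OF kspace.vector_space_axioms linear_H_counit]

lemma linear_on_H_compose:
  "linear_on_H s f \<Longrightarrow> linear_on_H hscale l \<Longrightarrow> linear_on_H s (\<lambda>x. f (l x))"
  unfolding linear_on_H_def by metis

lemma linear_on_H_times:
  assumes "linear_on_H (*) f"
  shows "linear_on_H (*) (\<lambda>x. f x * k)" "linear_on_H (*) (\<lambda>x. k * f x)"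
  unfolding linear_on_H_def linear_on_HD[OF assms] distrib_left distrib_right
  by (simp_all only: mult.assoc mult.left_commute simp_thms)

lemma linear_lookup: "linear_on_H (*) (\<lambda>x. Poly_Mapping.lookup x i)"
  by (simp add: linear_on_H_def lookup_add)

lemma H_mult_assoc: "H_mult (H_mult x y) z = H_mult x (H_mult y z)"
proof (rule linear_on_H_eqI[of hscale "\<lambda>x. H_mult (H_mult x y) z"])
  fix N a b
  show "H_mult (H_mult (bas (N, a, b)) y) z = H_mult (bas (N, a, b)) (H_mult y z)"
  proof (rule linear_on_H_eqI[of hscale "\<lambda>y. H_mult (H_mult (bas (N, a, b)) y) z"])
    fix N' a' b'
    show "H_mult (H_mult (bas (N, a, b)) (bas (N', a', b'))) z = H_mult (bas (N, a, b)) (H_mult (bas (N', a', b')) z)"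
    proof (rule linear_on_H_eqI[of hscale "\<lambda>z. H_mult (H_mult (bas (N, a, b)) (bas (N', a', b'))) z"])
      fix N'' a'' b''
      show "H_mult (H_mult (bas (N, a, b)) (bas (N', a', b'))) (bas (N'', a'', b''))
          = H_mult (bas (N, a, b)) (H_mult (bas (N', a', b')) (bas (N'', a'', b'')))"
        by (cases a; cases a'; cases a''; cases b; cases b'; cases b''; simp add: add.assoc)
    qed (simp_all add: linear_on_H_def)
  qed (simp_all add: linear_on_H_def)
qed (simp_all add: linear_on_H_def)

lemma linear_H_id: "linear_on_H hscale (\<lambda>x. x)"
  by (simp add: linear_on_H_def)

lemma H_one_mult: "H_mult (bas (0, False, False)) x = x"
  by (rule linear_on_H_eqI[of hscale, OF linear_H_mult_right linear_H_id]) simp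

lemma H_mult_one: "H_mult x (bas (0, False, False)) = x"
  by (rule linear_on_H_eqI[of hscale, OF linear_H_mult_left linear_H_id]) simp

lemma H_unital_algebra: "unital_algebra (H_alg :: ('k::field, nat \<Rightarrow>\<^sub>0 'k) hopf_alg)"
proof (rule unital_algebra.intro)
  show "vector_space (scale (H_alg :: ('k, nat \<Rightarrow>\<^sub>0 'k) hopf_alg))" by (simp add: hspace.vector_space_axioms)
  show "unital_algebra_axioms (H_alg :: ('k, nat \<Rightarrow>\<^sub>0 'k) hopf_alg)"
    by (rule unital_algebra_axioms.intro) (simp_all add: H_mult_assoc H_one_mult H_mult_one)
qed

lemma sum_list_concat_pairs:
  "sum_list (map f (concat (map (\<lambda>(x, y). F x y) xs))) = (\<Sum>(x, y)\<leftarrow>xs. sum_list (map f (F x y)) :: 'b::monoid_add)"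
  by (induction xs) auto

lemma H_coassoc:
  "same_tensor hscale
    [[x\<^sub>1\<^sub>1, x\<^sub>1\<^sub>2, x\<^sub>2]. (x\<^sub>1, x\<^sub>2) \<leftarrow> H_comult x, (x\<^sub>1\<^sub>1, x\<^sub>1\<^sub>2) \<leftarrow> H_comult x\<^sub>1]
    [[x\<^sub>1, x\<^sub>2\<^sub>1, x\<^sub>2\<^sub>2]. (x\<^sub>1, x\<^sub>2) \<leftarrow> H_comult x, (x\<^sub>2\<^sub>1, x\<^sub>2\<^sub>2) \<leftarrow> H_comult x\<^sub>2]"
proof -
  define L where "L = concat (map (\<lambda>(x\<^sub>1, x\<^sub>2). map (\<lambda>(u, v). (u, v, x\<^sub>2)) (H_comult x\<^sub>1)) (H_comult x))"
  define R where "R = concat (map (\<lambda>(x\<^sub>1, x\<^sub>2). map (\<lambda>(u, v). (x\<^sub>1, u, v)) (H_comult x\<^sub>2)) (H_comult x))"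
  have "same_tensor hscale (map (\<lambda>(x, y, z). [x, y, z]) L) (map (\<lambda>(x, y, z). [x, y, z]) R)"
  proof (rule same_tensor3I)
    fix i j k
    let ?f = "\<lambda>i x :: nat \<Rightarrow>\<^sub>0 'a. Poly_Mapping.lookup x i"
    have "(\<Sum>(x, y, z)\<leftarrow>L. ?f i x * ?f j y * ?f k z) = convolve (convolve (?f i) (?f j)) (?f k) x"
      unfolding L_def convolve_def sum_list_concat_pairs
      by (simp add: o_def split_def sum_list_mult_const)
    also have "\<dots> = convolve (?f i) (convolve (?f j) (?f k)) x"
    proof (rule linear_on_H_eqI[of "(*)" "convolve (convolve (?f i) (?f j)) (?f k)" "convolve (?f i) (convolve (?f j) (?f k))"])
      fix N a b
      show "convolve (convolve (?f i) (?f j)) (?f k) (bas (N, a, b)) = convolve (?f i) (convolve (?f j) (?f k)) (bas (N, a, b))"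
        unfolding convolve_bas[OF linear_lookup] convolve_bas[OF linear_convolve[OF linear_lookup]]
        by (cases b) (simp_all only: if_True if_False distrib_left distrib_right ac_simps simp_thms)
    qed (intro linear_convolve linear_lookup)+
    also have "\<dots> = (\<Sum>(x\<^sub>1, x\<^sub>2)\<leftarrow>H_comult x. \<Sum>(u, v)\<leftarrow>H_comult x\<^sub>2. ?f i x\<^sub>1 * ?f j u * ?f k v)"
      unfolding convolve_def by (simp only: split_def sum_list_const_mult[symmetric] mult.assoc)
    also have "\<dots> = (\<Sum>(x, y, z)\<leftarrow>R. ?f i x * ?f j y * ?f k z)"
      unfolding R_def sum_list_concat_pairs by (simp add: o_def split_def)
    finally show "(\<Sum>(x, y, z)\<leftarrow>L. ?f i x * ?f j y * ?f k z) = (\<Sum>(x, y, z)\<leftarrow>R. ?f i x * ?f j y * ?f k z)" .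
  qed
  then show ?thesis by (simp add: L_def R_def map_concat o_def split_def)
qed

lemma sum_list_linear:
  assumes "\<And>u v. linear_on_H (*) (\<lambda>y. F u v y)"
  shows "linear_on_H (*) (\<lambda>y. \<Sum>(u, v)\<leftarrow>us. F u v y)"
  by (induction us) (auto simp: linear_on_H_def linear_on_HD[OF assms] algebra_simps)

text \<open>Both sides are bilinear in \<open>(x, y)\<close>, which leaves the finitely many sign patterns of two basis elements.\<close>

lemma H_comult_mult:
  fixes x y :: "nat \<Rightarrow>\<^sub>0 'k::field"
  shows "convolve (\<lambda>x. coef x \<iota>) (\<lambda>x. coef x \<kappa>) (H_mult x y)
    = (\<Sum>(u, v)\<leftarrow>H_comult x. \<Sum>(u', v')\<leftarrow>H_comult y. coef (H_mult u u') \<iota> * coef (H_mult v v') \<kappa>)"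
proof -
  have inner: "linear_on_H (*) (\<lambda>y. \<Sum>(u', v')\<leftarrow>H_comult y. coef (H_mult u u') \<iota> * coef (H_mult v v') \<kappa>)"
    "(\<Sum>(u', v')\<leftarrow>H_comult (bas \<mu>). coef (H_mult u u') \<iota> * coef (H_mult v v') \<kappa>)
      = (\<Sum>(u', v')\<leftarrow>bas_comult \<mu>. coef (H_mult u u') \<iota> * coef (H_mult v v') \<kappa>)" for u v \<mu>
    by (rule H_comult_sum[OF kspace.vector_space_axioms]; simp)+
  have hom: "(\<Sum>(u', v')\<leftarrow>us. coef (H_mult (hscale c u) u') \<iota> * coef (H_mult v v') \<kappa>)
      = c * (\<Sum>(u', v')\<leftarrow>us. coef (H_mult u u') \<iota> * coef (H_mult v v') \<kappa>)" for c u v and us :: "((nat \<Rightarrow>\<^sub>0 'k) \<times> (nat \<Rightarrow>\<^sub>0 'k)) list"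
    by (simp only: linear_on_HD[OF linear_H_mult_left] lookup_hscale mult.assoc split_def sum_list_const_mult)
  note outer = H_comult_sum[OF kspace.vector_space_axioms,
    of "\<lambda>u v. \<Sum>(u', v')\<leftarrow>H_comult y. coef (H_mult u u') \<iota> * coef (H_mult v v') \<kappa>", OF hom]
  show ?thesis
  proof (rule linear_on_H_eqI[of "(*)" "\<lambda>x. convolve (\<lambda>x. coef x \<iota>) (\<lambda>x. coef x \<kappa>) (H_mult x y)"])
    show "linear_on_H (*) (\<lambda>x. convolve (\<lambda>x. coef x \<iota>) (\<lambda>x. coef x \<kappa>) (H_mult x y))"
      by (simp add: linear_on_H_def linear_on_HD[OF linear_convolve[OF linear_lookup]])
    show "linear_on_H (*) (\<lambda>x. \<Sum>(u, v)\<leftarrow>H_comult x. \<Sum>(u', v')\<leftarrow>H_comult y. coef (H_mult u u') \<iota> * coef (H_mult v v') \<kappa>)"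
      by (rule outer(1))
    fix N a b
    show "convolve (\<lambda>x. coef x \<iota>) (\<lambda>x. coef x \<kappa>) (H_mult (bas (N, a, b)) y)
        = (\<Sum>(u, v)\<leftarrow>H_comult (bas (N, a, b)). \<Sum>(u', v')\<leftarrow>H_comult y. coef (H_mult u u') \<iota> * coef (H_mult v v') \<kappa>)"
      unfolding outer(2)
    proof (rule linear_on_H_eqI[of "(*)" "\<lambda>y. convolve (\<lambda>x. coef x \<iota>) (\<lambda>x. coef x \<kappa>) (H_mult (bas (N, a, b)) y)"])
      show "linear_on_H (*) (\<lambda>y. convolve (\<lambda>x. coef x \<iota>) (\<lambda>x. coef x \<kappa>) (H_mult (bas (N, a, b)) y))"
        by (simp add: linear_on_H_def linear_on_HD[OF linear_convolve[OF linear_lookup]])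
      show "linear_on_H (*) (\<lambda>y. \<Sum>(u, v)\<leftarrow>bas_comult (N, a, b). \<Sum>(u', v')\<leftarrow>H_comult y. coef (H_mult u u') \<iota> * coef (H_mult v v') \<kappa>)"
        by (rule sum_list_linear) (rule inner(1))
      fix N' a' b'
      show "convolve (\<lambda>x. coef x \<iota>) (\<lambda>x. coef x \<kappa>) (H_mult (bas (N, a, b)) (bas (N', a', b')))
        = (\<Sum>(u, v)\<leftarrow>bas_comult (N, a, b). \<Sum>(u', v')\<leftarrow>H_comult (bas (N', a', b')). coef (H_mult u u') \<iota> * coef (H_mult v v') \<kappa>)"
        unfolding inner(2)
        by (cases a; cases a'; cases b; cases b';
            simp add: convolve_bas[OF linear_lookup] linear_on_HD[OF linear_convolve[OF linear_lookup]]
              linear_on_H_uminus[OF kspace.vector_space_axioms linear_convolve[OF linear_lookup]]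
              distrib_right add.commute del: coef_bas)
    qed
  qed
qed

lemma sum_list_scale_first:
  fixes us :: "((nat \<Rightarrow>\<^sub>0 'k::field) \<times> (nat \<Rightarrow>\<^sub>0 'k)) list"
  shows "(\<Sum>(u, v)\<leftarrow>map (\<lambda>(x\<^sub>1, x\<^sub>2). (hscale c x\<^sub>1, x\<^sub>2)) us. coef u \<iota> * coef v \<kappa>)
    = c * (\<Sum>(u, v)\<leftarrow>us. coef u \<iota> * coef v \<kappa>)"
proof (induction us)
  case (Cons t us)
  then show ?case by (cases t) (simp only: list.map prod.case sum_list.Cons distrib_left lookup_hscale mult.assoc)
qed simp

lemma H_counit_mult: "H_counit (H_mult x y) = H_counit x * H_counit y"
proof (rule linear_on_H_eqI[of "(*)" "\<lambda>x. H_counit (H_mult x y)" "\<lambda>x. H_counit x * H_counit y"])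
  fix N a b
  show "H_counit (H_mult (bas (N, a, b)) y) = H_counit (bas (N, a, b)) * H_counit y"
  proof (rule linear_on_H_eqI[of "(*)" "\<lambda>y. H_counit (H_mult (bas (N, a, b)) y)" "\<lambda>y. H_counit (bas (N, a, b)) * H_counit y"])
    fix N' a' b'
    show "H_counit (H_mult (bas (N, a, b)) (bas (N', a', b'))) = H_counit (bas (N, a, b)) * H_counit (bas (N', a', b'))"
      by simp
  next
    show "linear_on_H (*) (\<lambda>y. H_counit (H_mult (bas (N, a, b)) y))"
      by (rule linear_on_H_compose[OF linear_H_counit linear_H_mult_right])
    show "linear_on_H (*) (\<lambda>y. H_counit (bas (N, a, b)) * H_counit y)"
      by (rule linear_on_H_times(2)[OF linear_H_counit])
  qed
next
  show "linear_on_H (*) (\<lambda>x. H_counit (H_mult x y))"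
    by (rule linear_on_H_compose[OF linear_H_counit linear_H_mult_left])
  show "linear_on_H (*) (\<lambda>x. H_counit x * H_counit y)"
    by (rule linear_on_H_times(1)[OF linear_H_counit])
qed

lemma H_hopf_algebra: "hopf_algebra (H_alg :: ('k::field, nat \<Rightarrow>\<^sub>0 'k) hopf_alg)"
proof (rule hopf_algebra.intro[OF H_unital_algebra], rule hopf_algebra_axioms.intro; (unfold H_alg_simps)?)
  note hv = hspace.vector_space_axioms and kv = kspace.vector_space_axioms
  have conv: "(\<Sum>(u, v)\<leftarrow>H_comult x. coef u \<iota> * coef v \<kappa>) = convolve (\<lambda>x. coef x \<iota>) (\<lambda>x. coef x \<kappa>) x" for x :: "nat \<Rightarrow>\<^sub>0 'k" and \<iota> \<kappa>
    by (simp add: convolve_def)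
  note conv_linear = linear_on_HD[OF linear_convolve[OF linear_lookup]]
  fix x y :: "nat \<Rightarrow>\<^sub>0 'k" and c :: 'k
  show "same_tensor2 H_alg (H_comult (x + y)) (H_comult x @ H_comult y)"
    by (simp add: same_tensor2_H_iff conv conv_linear)
  show "same_tensor2 H_alg (H_comult (hscale c x)) (map (\<lambda>(x\<^sub>1, x\<^sub>2). (hscale c x\<^sub>1, x\<^sub>2)) (H_comult x))"
    unfolding same_tensor2_H_iff sum_list_scale_first conv conv_linear by blast
  show "same_tensor hscale
    [[x\<^sub>1\<^sub>1, x\<^sub>1\<^sub>2, x\<^sub>2]. (x\<^sub>1, x\<^sub>2) \<leftarrow> H_comult x, (x\<^sub>1\<^sub>1, x\<^sub>1\<^sub>2) \<leftarrow> H_comult x\<^sub>1]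
    [[x\<^sub>1, x\<^sub>2\<^sub>1, x\<^sub>2\<^sub>2]. (x\<^sub>1, x\<^sub>2) \<leftarrow> H_comult x, (x\<^sub>2\<^sub>1, x\<^sub>2\<^sub>2) \<leftarrow> H_comult x\<^sub>2]"
    by (rule H_coassoc)
  show "Vector_Spaces.linear hscale (*) (H_counit :: _ \<Rightarrow> 'k)"
    using linear_on_H_iff_linear[OF kv] linear_H_counit by blast
  show "Vector_Spaces.linear hscale hscale (H_antipode :: _ \<Rightarrow> nat \<Rightarrow>\<^sub>0 'k)"
    using linear_on_H_iff_linear[OF hv] linear_H_antipode by blast
  show "(\<Sum>(x\<^sub>1, x\<^sub>2)\<leftarrow>H_comult x. hscale (H_counit x\<^sub>1) x\<^sub>2) = x"
  proof (rule linear_on_H_eqI[of hscale "\<lambda>x. \<Sum>(x\<^sub>1, x\<^sub>2)\<leftarrow>H_comult x. hscale (H_counit x\<^sub>1) x\<^sub>2" "\<lambda>x. x"])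
    show "linear_on_H hscale (\<lambda>x :: nat \<Rightarrow>\<^sub>0 'k. \<Sum>(x\<^sub>1, x\<^sub>2)\<leftarrow>H_comult x. hscale (H_counit x\<^sub>1) x\<^sub>2)"
      by (rule H_comult_sum(1)[OF hv]) simp
    show "(\<Sum>(x\<^sub>1, x\<^sub>2)\<leftarrow>H_comult (bas (N, a, b)). hscale (H_counit x\<^sub>1) x\<^sub>2) = bas (N, a, b)" for N a b
      by (subst H_comult_sum(2)[OF hv]) simp_all
  qed (rule linear_H_id)
  show "(\<Sum>(x\<^sub>1, x\<^sub>2)\<leftarrow>H_comult x. hscale (H_counit x\<^sub>2) x\<^sub>1) = x"
  proof (rule linear_on_H_eqI[of hscale "\<lambda>x. \<Sum>(x\<^sub>1, x\<^sub>2)\<leftarrow>H_comult x. hscale (H_counit x\<^sub>2) x\<^sub>1" "\<lambda>x. x"])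
    show "linear_on_H hscale (\<lambda>x :: nat \<Rightarrow>\<^sub>0 'k. \<Sum>(x\<^sub>1, x\<^sub>2)\<leftarrow>H_comult x. hscale (H_counit x\<^sub>2) x\<^sub>1)"
      by (rule H_comult_sum(1)[OF hv]) (simp add: mult.commute)
    show "(\<Sum>(x\<^sub>1, x\<^sub>2)\<leftarrow>H_comult (bas (N, a, b)). hscale (H_counit x\<^sub>2) x\<^sub>1) = bas (N, a, b)" for N a b
      by (subst H_comult_sum(2)[OF hv]) (simp_all add: mult.commute)
  qed (rule linear_H_id)
  show "same_tensor2 (H_alg :: ('k, nat \<Rightarrow>\<^sub>0 'k) hopf_alg) (H_comult (bas (0, False, False))) [(bas (0, False, False), bas (0, False, False))]"
    unfolding same_tensor2_H_iff conv convolve_bas[OF linear_lookup] by simp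
  have "(\<Sum>(u, v)\<leftarrow>concat (map (\<lambda>(x\<^sub>1, x\<^sub>2). map (\<lambda>(y\<^sub>1, y\<^sub>2). (H_mult x\<^sub>1 y\<^sub>1, H_mult x\<^sub>2 y\<^sub>2)) (H_comult y)) (H_comult x)). coef u \<iota> * coef v \<kappa>)
      = (\<Sum>(u, v)\<leftarrow>H_comult x. \<Sum>(u', v')\<leftarrow>H_comult y. coef (H_mult u u') \<iota> * coef (H_mult v v') \<kappa>)" for \<iota> \<kappa>
    unfolding sum_list_concat_pairs by (simp add: o_def split_def)
  then show "same_tensor2 H_alg (H_comult (H_mult x y))
      [(H_mult x\<^sub>1 y\<^sub>1, H_mult x\<^sub>2 y\<^sub>2). (x\<^sub>1, x\<^sub>2) \<leftarrow> H_comult x, (y\<^sub>1, y\<^sub>2) \<leftarrow> H_comult y]"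
    unfolding same_tensor2_H_iff conv by (simp add: H_comult_mult)
  show "H_counit (bas (0, False, False)) = (1 :: 'k)" by simp
  show "H_counit (H_mult x y) = H_counit x * H_counit y" by (rule H_counit_mult)
  show "(\<Sum>(x\<^sub>1, x\<^sub>2)\<leftarrow>H_comult x. H_mult (H_antipode x\<^sub>1) x\<^sub>2) = hscale (H_counit x) (bas (0, False, False))"
  proof (rule linear_on_H_eqI[of hscale "\<lambda>x. \<Sum>(x\<^sub>1, x\<^sub>2)\<leftarrow>H_comult x. H_mult (H_antipode x\<^sub>1) x\<^sub>2" "\<lambda>x. hscale (H_counit x) (bas (0, False, False))"])
    show "linear_on_H hscale (\<lambda>x :: nat \<Rightarrow>\<^sub>0 'k. \<Sum>(x\<^sub>1, x\<^sub>2)\<leftarrow>H_comult x. H_mult (H_antipode x\<^sub>1) x\<^sub>2)"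
      by (rule H_comult_sum(1)[OF hv]) simp
    show "(\<Sum>(x\<^sub>1, x\<^sub>2)\<leftarrow>H_comult (bas (N, a, b)). H_mult (H_antipode x\<^sub>1) x\<^sub>2)
        = hscale (H_counit (bas (N, a, b))) (bas (0, False, False) :: nat \<Rightarrow>\<^sub>0 'k)" for N a b
      by (subst H_comult_sum(2)[OF hv]) auto
  qed (simp add: linear_on_H_def hspace.scale_left_distrib)
  show "(\<Sum>(x\<^sub>1, x\<^sub>2)\<leftarrow>H_comult x. H_mult x\<^sub>1 (H_antipode x\<^sub>2)) = hscale (H_counit x) (bas (0, False, False))"
  proof (rule linear_on_H_eqI[of hscale "\<lambda>x. \<Sum>(x\<^sub>1, x\<^sub>2)\<leftarrow>H_comult x. H_mult x\<^sub>1 (H_antipode x\<^sub>2)" "\<lambda>x. hscale (H_counit x) (bas (0, False, False))"])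
    show "linear_on_H hscale (\<lambda>x :: nat \<Rightarrow>\<^sub>0 'k. \<Sum>(x\<^sub>1, x\<^sub>2)\<leftarrow>H_comult x. H_mult x\<^sub>1 (H_antipode x\<^sub>2))"
      by (rule H_comult_sum(1)[OF hv]) simp
    show "(\<Sum>(x\<^sub>1, x\<^sub>2)\<leftarrow>H_comult (bas (N, a, b)). H_mult x\<^sub>1 (H_antipode x\<^sub>2))
        = hscale (H_counit (bas (N, a, b))) (bas (0, False, False) :: nat \<Rightarrow>\<^sub>0 'k)" for N a b
      by (subst H_comult_sum(2)[OF hv]) auto
  qed (simp add: linear_on_H_def hspace.scale_left_distrib)
qed

text \<open>The square of the antipode is \<open>-1\<close> on the \<open>x(N, a, 1)\<close> and \<open>1\<close> on the \<open>x(N, a, 0)\<close>, so the third power of the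
  antipode is its inverse.\<close>

lemma bij_H_antipode: "bij (H_antipode :: _ \<Rightarrow> nat \<Rightarrow>\<^sub>0 'k::field)"
proof -
  let ?S = "H_antipode :: _ \<Rightarrow> nat \<Rightarrow>\<^sub>0 'k"
  have four: "?S (?S (?S (?S x))) = x" for x
  proof (rule linear_on_H_eqI[of hscale "\<lambda>x. ?S (?S (?S (?S x)))" "\<lambda>x. x"])
    show "linear_on_H hscale (\<lambda>x. ?S (?S (?S (?S x))))" by (simp add: linear_on_H_def)
    show "?S (?S (?S (?S (bas (N, a, b))))) = bas (N, a, b)" for N a b by (cases a; cases b; simp)
  qed (rule linear_H_id)
  show ?thesis
    by (rule o_bij[of "\<lambda>x. ?S (?S (?S x))"]) (simp_all add: fun_eq_iff four)
qed

text \<open>In the dual algebra the coefficient at \<open>x(0, 0, 1)\<close> is the product \<open>(1/2) (1 + g) P h\<close>, where \<open>P\<close> projects to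
  the eigenvalue \<open>0\<close> of \<open>h\<^sup>2\<close>.  Left multiplication by \<open>g\<close> fixes it, and left multiplication by \<open>h\<close> kills it
  because \<open>h\<^sup>2 P = 0\<close>; so it is an integral.\<close>

lemma H_co_Frobenius: "co_Frobenius (H_alg :: ('k::field, nat \<Rightarrow>\<^sub>0 'k) hopf_alg)"
proof -
  let ?f = "\<lambda>x :: nat \<Rightarrow>\<^sub>0 'k. coef x (0, False, True)"
  have "(\<Sum>(x\<^sub>1, x\<^sub>2)\<leftarrow>H_comult x. hscale (?f x\<^sub>2) x\<^sub>1) = hscale (?f x) (bas (0, False, False))" for x
  proof (rule linear_on_H_eqI[of hscale "\<lambda>x. \<Sum>(x\<^sub>1, x\<^sub>2)\<leftarrow>H_comult x. hscale (?f x\<^sub>2) x\<^sub>1" "\<lambda>x. hscale (?f x) (bas (0, False, False))"])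
    show "linear_on_H hscale (\<lambda>x :: nat \<Rightarrow>\<^sub>0 'k. \<Sum>(x\<^sub>1, x\<^sub>2)\<leftarrow>H_comult x. hscale (?f x\<^sub>2) x\<^sub>1)"
      by (rule H_comult_sum(1)[OF hspace.vector_space_axioms]) (simp add: mult.commute)
    show "linear_on_H hscale (\<lambda>x. hscale (?f x) (bas (0, False, False)))"
      by (simp add: linear_on_H_def lookup_add hspace.scale_left_distrib)
    show "(\<Sum>(x\<^sub>1, x\<^sub>2)\<leftarrow>H_comult (bas (N, a, b)). hscale (?f x\<^sub>2) x\<^sub>1) = hscale (?f (bas (N, a, b))) (bas (0, False, False))" for N a b
      by (subst H_comult_sum(2)[OF hspace.vector_space_axioms]) (auto simp: mult.commute)
  qed
  moreover have "Vector_Spaces.linear hscale (*) ?f"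
    using linear_on_H_iff_linear[OF kspace.vector_space_axioms] linear_lookup by blast
  ultimately have "is_integral (H_alg :: ('k, nat \<Rightarrow>\<^sub>0 'k) hopf_alg) ?f" by (simp add: is_integral_def)
  moreover have "?f (bas (0, False, True)) \<noteq> 0" by simp
  ultimately show ?thesis unfolding co_Frobenius_def by blast
qed

section \<open>Comodules as super vector spaces with an odd operator\<close>

text \<open>The values at \<open>g\<close> and \<open>h\<close> of an element of \<open>H\<close>, seen as a functional on \<open>A\<close>: a character of the algebra \<open>H\<close>
  and a skew derivation.\<close>

definition at_g :: "(nat \<Rightarrow>\<^sub>0 'k::field) \<Rightarrow> 'k" where
  "at_g p = lin_ext (*) (\<lambda>i. case index_decode i of (N, a, b) \<Rightarrow> if b then 0 else sgn_bit a) p"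

definition at_h :: "(nat \<Rightarrow>\<^sub>0 'k::field) \<Rightarrow> 'k" where
  "at_h p = lin_ext (*) (\<lambda>i. case index_decode i of (N, a, b) \<Rightarrow> if b then 1 else 0) p"

text \<open>The functional that gives the action of the spectral projection of \<open>h\<^sup>2\<close> for the eigenvalue \<open>N\<close>.\<close>

definition at_eigenvalue :: "int \<Rightarrow> (nat \<Rightarrow>\<^sub>0 'k::field) \<Rightarrow> 'k" where
  "at_eigenvalue N p = coef p (N, False, False) + coef p (N, True, False)"

lemma linear_functionals:
  "linear_on_H (*) (at_g :: _ \<Rightarrow> 'k::field)" "linear_on_H (*) (at_h :: _ \<Rightarrow> 'k)"
  "linear_on_H (*) (at_eigenvalue N :: _ \<Rightarrow> 'k)" "linear_on_H (*) (\<lambda>x. coef x \<iota> :: 'k)"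
proof -
  show "linear_on_H (*) (at_g :: _ \<Rightarrow> 'k)" "linear_on_H (*) (at_h :: _ \<Rightarrow> 'k)"
    unfolding at_g_def[abs_def] at_h_def[abs_def] by (intro linear_on_H_lin_ext kspace.vector_space_axioms)+
  show "linear_on_H (*) (at_eigenvalue N :: _ \<Rightarrow> 'k)"
    unfolding linear_on_H_def at_eigenvalue_def lookup_add lookup_hscale distrib_left by simp
qed (rule linear_lookup)

lemma functionals_bas [simp]:
  "at_g (bas (N, a, b)) = (if b then 0 else sgn_bit a)" "at_h (bas (N, a, b)) = (if b then 1 else 0)"
  "at_eigenvalue L (bas (N, a, b)) = (if L = N \<and> \<not> b then 1 else 0)"
  by (auto simp: at_g_def at_h_def at_eigenvalue_def lin_ext_bas[OF kspace.vector_space_axioms])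

lemmas linear_functionals_simps [simp] =
  linear_on_HD[OF linear_functionals(1)] linear_on_HD[OF linear_functionals(2)] linear_on_HD[OF linear_functionals(3)]
  linear_on_H_uminus[OF kspace.vector_space_axioms linear_functionals(1)]
  linear_on_H_uminus[OF kspace.vector_space_axioms linear_functionals(2)]

lemma at_g_mult: "at_g (H_mult x y) = at_g x * at_g y"
proof (rule linear_on_H_eqI[of "(*)" "\<lambda>x. at_g (H_mult x y)" "\<lambda>x. at_g x * at_g y"])
  fix N a b
  show "at_g (H_mult (bas (N, a, b)) y) = at_g (bas (N, a, b)) * at_g y"
  proof (rule linear_on_H_eqI[of "(*)" "\<lambda>y. at_g (H_mult (bas (N, a, b)) y)" "\<lambda>y. at_g (bas (N, a, b)) * at_g y"])
    fix N' a' b'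
    show "at_g (H_mult (bas (N, a, b)) (bas (N', a', b'))) = at_g (bas (N, a, b)) * at_g (bas (N', a', b'))"
      by (cases a; cases a'; cases b; cases b'; simp)
  next
    show "linear_on_H (*) (\<lambda>y. at_g (H_mult (bas (N, a, b)) y))"
      by (rule linear_on_H_compose[OF linear_functionals(1) linear_H_mult_right])
    show "linear_on_H (*) (\<lambda>y. at_g (bas (N, a, b)) * at_g y)" by (rule linear_on_H_times(2)[OF linear_functionals(1)])
  qed
next
  show "linear_on_H (*) (\<lambda>x. at_g (H_mult x y))"
    by (rule linear_on_H_compose[OF linear_functionals(1) linear_H_mult_left])
  show "linear_on_H (*) (\<lambda>x. at_g x * at_g y)" by (rule linear_on_H_times(1)[OF linear_functionals(1)])
qed

lemma linear_on_H_plus: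
  "linear_on_H (*) f \<Longrightarrow> linear_on_H (*) f' \<Longrightarrow> linear_on_H (*) (\<lambda>x. f x + f' x)"
  by (simp add: linear_on_H_def distrib_left)

lemma at_h_mult: "at_h (H_mult x y) = at_g x * at_h y + at_h x * H_counit y"
proof (rule linear_on_H_eqI[of "(*)" "\<lambda>x. at_h (H_mult x y)" "\<lambda>x. at_g x * at_h y + at_h x * H_counit y"])
  fix N a b
  show "at_h (H_mult (bas (N, a, b)) y) = at_g (bas (N, a, b)) * at_h y + at_h (bas (N, a, b)) * H_counit y"
  proof (rule linear_on_H_eqI[of "(*)" "\<lambda>y. at_h (H_mult (bas (N, a, b)) y)"
        "\<lambda>y. at_g (bas (N, a, b)) * at_h y + at_h (bas (N, a, b)) * H_counit y"])
    fix N' a' b'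
    show "at_h (H_mult (bas (N, a, b)) (bas (N', a', b')))
        = at_g (bas (N, a, b)) * at_h (bas (N', a', b')) + at_h (bas (N, a, b)) * H_counit (bas (N', a', b'))"
      by (cases a; cases a'; cases b; cases b'; simp)
  next
    show "linear_on_H (*) (\<lambda>y. at_h (H_mult (bas (N, a, b)) y))"
      by (rule linear_on_H_compose[OF linear_functionals(2) linear_H_mult_right])
    show "linear_on_H (*) (\<lambda>y. at_g (bas (N, a, b)) * at_h y + at_h (bas (N, a, b)) * H_counit y)"
      by (rule linear_on_H_plus[OF linear_on_H_times(2)[OF linear_functionals(2)] linear_on_H_times(2)[OF linear_H_counit]])
  qed
next
  show "linear_on_H (*) (\<lambda>x. at_h (H_mult x y))"
    by (rule linear_on_H_compose[OF linear_functionals(2) linear_H_mult_left])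
  show "linear_on_H (*) (\<lambda>x. at_g x * at_h y + at_h x * H_counit y)"
    by (rule linear_on_H_plus[OF linear_on_H_times(1)[OF linear_functionals(1)] linear_on_H_times(1)[OF linear_functionals(2)]])
qed

subsection \<open>Matrices of a comodule\<close>

lemma comodule_props:
  assumes "is_fd_comodule H_alg (n, c)"
  shows "c \<in> carrier_mat n n" "dim_row c = n" "dim_col c = n"
    "\<And>i j. i < n \<Longrightarrow> j < n \<Longrightarrow> same_tensor2 H_alg (H_comult (c $$ (i, j))) (map (\<lambda>l. (c $$ (i, l), c $$ (l, j))) [0..<n])"
    "\<And>i j. i < n \<Longrightarrow> j < n \<Longrightarrow> H_counit (c $$ (i, j)) = (if i = j then 1 else 0)"
  using assms by (auto simp: is_fd_comodule_def dest: carrier_matD)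

text \<open>A comodule is a module over the dual algebra: a functional \<open>f\<close> acts by the matrix \<open>map_mat f c\<close>.\<close>

lemma map_mat_convolve:
  assumes c: "is_fd_comodule H_alg (n, c)" and f: "linear_on_H (*) f" and f': "linear_on_H (*) f'"
  shows "map_mat (convolve f f') c = map_mat f c * map_mat f' c"
proof (intro eq_matI)
  note c' = comodule_props[OF c]
  fix i j assume "i < dim_row (map_mat f c * map_mat f' c)" "j < dim_col (map_mat f c * map_mat f' c)"
  then have ij: "i < n" "j < n" using c' by auto
  have "bilinear_form (scale H_alg) (\<lambda>u v. f u * f' v)"
    unfolding bilinear_form_def H_alg_simps linear_on_HD[OF f] linear_on_HD[OF f'] distrib_left distrib_right
    by (simp only: mult.assoc mult.left_commute simp_thms)
  from same_tensor2_bilinear[OF c'(4)[OF ij] this]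
  have "convolve f f' (c $$ (i, j)) = (\<Sum>l\<leftarrow>[0..<n]. f (c $$ (i, l)) * f' (c $$ (l, j)))"
    by (simp add: convolve_def o_def)
  also have "\<dots> = (map_mat f c * map_mat f' c) $$ (i, j)"
    using ij c' by (simp add: mat_entry interv_sum_list_conv_sum_set_nat lessThan_atLeast0)
  finally show "map_mat (convolve f f') c $$ (i, j) = (map_mat f c * map_mat f' c) $$ (i, j)"
    using ij c' by simp
qed simp_all

lemma map_mat_counit:
  assumes "is_fd_comodule H_alg (n, c)"
  shows "map_mat H_counit c = 1\<^sub>m n"
  using comodule_props[OF assms] by (intro eq_matI) simp_all

text \<open>The relations \<open>g\<^sup>2 = 1\<close> and \<open>g h = - h g\<close>, and the eigenvalue equation of the spectral projections, in the algebra
  dual to \<open>H\<close>.\<close>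

lemma convolve_identities:
  "convolve at_g at_g = (H_counit :: _ \<Rightarrow> 'k::field)"
  "convolve at_g at_h = (\<lambda>x. (-1) * convolve at_h at_g x :: 'k)"
  "convolve (convolve at_h at_h) (at_eigenvalue N) = (\<lambda>x. of_int N * at_eigenvalue N x :: 'k)"
  "convolve (at_eigenvalue N) (convolve at_h at_h) = (\<lambda>x. of_int N * at_eigenvalue N x :: 'k)"
proof -
  note lin = linear_functionals[where 'k = 'k]
  show "convolve at_g at_g = (H_counit :: _ \<Rightarrow> 'k)"
  proof
    fix x :: "nat \<Rightarrow>\<^sub>0 'k"
    show "convolve at_g at_g x = H_counit x"
      by (rule linear_on_H_eqI[OF linear_convolve[OF lin(1)] linear_H_counit]) (simp add: convolve_bas[OF lin(1)])
  qed
  show "convolve at_g at_h = (\<lambda>x. (-1) * convolve at_h at_g x :: 'k)"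
  proof
    fix x :: "nat \<Rightarrow>\<^sub>0 'k"
    show "convolve at_g at_h x = (-1) * convolve at_h at_g x"
      by (rule linear_on_H_eqI[OF linear_convolve[OF lin(1)] linear_on_H_times(2)[OF linear_convolve[OF lin(2)]]])
         (simp add: convolve_bas[OF lin(1)] convolve_bas[OF lin(2)])
  qed
  show "convolve (convolve at_h at_h) (at_eigenvalue N) = (\<lambda>x. of_int N * at_eigenvalue N x :: 'k)"
  proof
    fix x :: "nat \<Rightarrow>\<^sub>0 'k"
    show "convolve (convolve at_h at_h) (at_eigenvalue N) x = of_int N * at_eigenvalue N x"
      by (rule linear_on_H_eqI[OF linear_convolve[OF linear_convolve[OF lin(2)]] linear_on_H_times(2)[OF lin(3)]])
         (simp add: convolve_bas[OF linear_convolve[OF lin(2)]] convolve_bas[OF lin(2)])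
  qed
  show "convolve (at_eigenvalue N) (convolve at_h at_h) = (\<lambda>x. of_int N * at_eigenvalue N x :: 'k)"
  proof
    fix x :: "nat \<Rightarrow>\<^sub>0 'k"
    show "convolve (at_eigenvalue N) (convolve at_h at_h) x = of_int N * at_eigenvalue N x"
      by (rule linear_on_H_eqI[OF linear_convolve[OF lin(3)] linear_on_H_times(2)[OF lin(3)]])
         (simp add: convolve_bas[OF lin(3)] convolve_bas[OF lin(2)])
  qed
qed

definition comodule_pair :: "(nat \<Rightarrow>\<^sub>0 'k::field) fd_comodule \<Rightarrow> nat \<times> 'k mat \<times> 'k mat" where
  "comodule_pair = (\<lambda>(n, c). (n, map_mat at_g c, map_mat at_h c))"

text \<open>Only finitely many \<open>N\<close> occur in the entries of \<open>c\<close>, and the counit is the sum of the functionals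
  \<open>at_eigenvalue N\<close>; so the projections sum to the identity.\<close>

lemma comodule_spectral_family:
  fixes c :: "(nat \<Rightarrow>\<^sub>0 'k::field_char_0) mat"
  assumes c: "is_fd_comodule H_alg (n, c)"
  shows "\<exists>I. spectral_family n (map_mat at_h c * map_mat at_h c) I (\<lambda>N. map_mat (at_eigenvalue N) c)"
proof -
  note c' = comodule_props[OF c] and lin = linear_functionals[where 'k = 'k]
  define I where "I = (\<Union>x\<in>elements_mat c. (\<lambda>i. fst (index_decode i)) ` Poly_Mapping.keys x)"
  have "elements_mat c = (\<lambda>(i, j). c $$ (i, j)) ` ({0..<n} \<times> {0..<n})"
    using c'(2,3) unfolding elements_mat_def by force
  then have fin: "finite I" unfolding I_def by auto
  let ?P = "\<lambda>N. map_mat (at_eigenvalue N) c"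
  have one: "msum n n ?P I = 1\<^sub>m n"
  proof (intro eq_matI)
    fix i j assume "i < dim_row (1\<^sub>m n :: 'k mat)" "j < dim_col (1\<^sub>m n :: 'k mat)"
    then have ij: "i < n" "j < n" by auto
    let ?x = "c $$ (i, j)"
    have "?x \<in> elements_mat c" using ij c' by (auto intro: elements_matI)
    then have keys: "(\<lambda>i. fst (index_decode i)) ` Poly_Mapping.keys ?x \<subseteq> I" unfolding I_def by blast
    have eig: "at_eigenvalue N ?x = (\<Sum>k\<in>Poly_Mapping.keys ?x. Poly_Mapping.lookup ?x k *
        (if N = fst (index_decode k) then H_counit (bas (index_decode k)) else 0))" for N
    proof -
      have "at_eigenvalue N (bas (index_decode k)) = (if N = fst (index_decode k) then H_counit (bas (index_decode k)) else 0 :: 'k)" for k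
        by (cases "index_decode k") auto
      then show ?thesis by (subst linear_on_H_expansion[OF lin(3)]) simp
    qed
    have "(\<Sum>N\<in>I. at_eigenvalue N ?x) = (\<Sum>k\<in>Poly_Mapping.keys ?x. \<Sum>N\<in>I. Poly_Mapping.lookup ?x k *
        (if N = fst (index_decode k) then H_counit (bas (index_decode k)) else 0))"
      unfolding eig by (rule sum.swap)
    also have "\<dots> = (\<Sum>k\<in>Poly_Mapping.keys ?x. Poly_Mapping.lookup ?x k * H_counit (bas (index_decode k)))"
      using fin keys by (intro sum.cong) (auto simp: sum_distrib_left[symmetric] sum.delta)
    also have "\<dots> = H_counit ?x" by (rule linear_on_H_expansion[OF linear_H_counit, symmetric])
    also have "\<dots> = 1\<^sub>m n $$ (i, j)" using c'(5)[OF ij] ij by simp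
    finally show "msum n n ?P I $$ (i, j) = 1\<^sub>m n $$ (i, j)" using ij c' by (simp add: msum_def)
  qed simp_all
  have scale: "map_mat (\<lambda>x. k * f x) c = k \<cdot>\<^sub>m map_mat f c" for k and f :: "_ \<Rightarrow> 'k"
    by (intro eq_matI) simp_all
  have MM: "map_mat at_h c * map_mat at_h c = map_mat (convolve at_h at_h) c"
    by (rule map_mat_convolve[OF c lin(2) lin(2), symmetric])
  have "map_mat (convolve at_h at_h) c * ?P N = of_int N \<cdot>\<^sub>m ?P N" "?P N * map_mat (convolve at_h at_h) c = of_int N \<cdot>\<^sub>m ?P N" for N
    unfolding map_mat_convolve[OF c linear_convolve[OF lin(2)] lin(3), symmetric]
      map_mat_convolve[OF c lin(3) linear_convolve[OF lin(2)], symmetric] convolve_identities scale by simp_all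
  moreover have "map_mat (convolve at_h at_h) c \<in> carrier_mat n n" "\<And>N. ?P N \<in> carrier_mat n n" using c'(1) by simp_all
  ultimately show ?thesis
    unfolding spectral_family_def MM using fin one by blast
qed

lemma comodule_pair_integral:
  fixes c :: "(nat \<Rightarrow>\<^sub>0 'k::field_char_0) mat"
  assumes c: "is_fd_comodule H_alg (n, c)"
  shows "comodule_pair (n, c) \<in> integral_super_operators"
proof -
  note c' = comodule_props[OF c] and lin = linear_functionals[where 'k = 'k]
  obtain I where I: "spectral_family n (map_mat at_h c * map_mat at_h c) I (\<lambda>N. map_mat (at_eigenvalue N) c)"
    using comodule_spectral_family[OF c] by blast
  have fin: "finite I" and Q: "map_mat at_h c * map_mat at_h c \<in> carrier_mat n n"
    using I unfolding spectral_family_def by blast+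
  have "distinct (sorted_list_of_set I)" by simp
  from root_product_imp_int_diagonalizable[OF this Q spectral_family_root_product[OF I]]
  have int: "int_diagonalizable (map_mat at_h c * map_mat at_h c)" .
  have scale: "map_mat (\<lambda>x. k * f x) c = k \<cdot>\<^sub>m map_mat f c" for k and f :: "_ \<Rightarrow> 'k"
    by (intro eq_matI) simp_all
  have GG: "map_mat at_g c * map_mat at_g c = 1\<^sub>m n"
    unfolding map_mat_convolve[OF c lin(1) lin(1), symmetric] convolve_identities map_mat_counit[OF c] ..
  have GM: "map_mat at_g c * map_mat at_h c = (-1) \<cdot>\<^sub>m (map_mat at_h c * map_mat at_g c)"
    unfolding map_mat_convolve[OF c lin(1) lin(2), symmetric] map_mat_convolve[OF c lin(2) lin(1), symmetric]
      convolve_identities(2) scale ..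
  show ?thesis unfolding comodule_pair_def prod.case integral_iff SOp_Obj using GG GM int c'(2,3) by simp
qed

text \<open>The coefficient functionals are convolution polynomials in the evaluations, so the two matrices of a
  comodule determine its coaction.\<close>

lemma coef_functional:
  "(\<lambda>x. coef x (N, a, False)) = (\<lambda>x. (1/2) * (at_eigenvalue N x + sgn_bit a * convolve at_g (at_eigenvalue N) x) :: 'k::field_char_0)"
  "(\<lambda>x. coef x (N, a, True)) = (convolve (\<lambda>x. coef x (N, a, False)) at_h :: _ \<Rightarrow> 'k)"
proof -
  note lin = linear_functionals[where 'k = 'k]
  show "(\<lambda>x. coef x (N, a, False)) = (\<lambda>x. (1/2) * (at_eigenvalue N x + sgn_bit a * convolve at_g (at_eigenvalue N) x) :: 'k)"
  proof
    fix x :: "nat \<Rightarrow>\<^sub>0 'k"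
    show "coef x (N, a, False) = (1/2) * (at_eigenvalue N x + sgn_bit a * convolve at_g (at_eigenvalue N) x)"
      by (rule linear_on_H_eqI[OF lin(4) linear_on_H_times(2)[OF linear_on_H_plus[OF lin(3) linear_on_H_times(2)[OF linear_convolve[OF lin(1)]]]]])
         (auto simp: convolve_bas[OF lin(1)])
  qed
  show "(\<lambda>x. coef x (N, a, True)) = (convolve (\<lambda>x. coef x (N, a, False)) at_h :: _ \<Rightarrow> 'k)"
  proof
    fix x :: "nat \<Rightarrow>\<^sub>0 'k"
    show "coef x (N, a, True) = convolve (\<lambda>x. coef x (N, a, False)) at_h x"
      by (rule linear_on_H_eqI[OF lin(4) linear_convolve[OF lin(4)]]) (auto simp: convolve_bas[OF lin(4)])
  qed
qed

lemma comodule_coef_mats: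
  fixes c :: "(nat \<Rightarrow>\<^sub>0 'k::field_char_0) mat"
  assumes c: "is_fd_comodule H_alg (n, c)"
  shows "map_mat (\<lambda>x. coef x (N, a, False)) c
      = (1/2) \<cdot>\<^sub>m (map_mat (at_eigenvalue N) c + sgn_bit a \<cdot>\<^sub>m (map_mat at_g c * map_mat (at_eigenvalue N) c))"
    and "map_mat (\<lambda>x. coef x (N, a, True)) c = map_mat (\<lambda>x. coef x (N, a, False)) c * map_mat at_h c"
proof -
  note lin = linear_functionals[where 'k = 'k]
  have "map_mat (\<lambda>x. (1/2) * (f x + k * f' x)) c = (1/2) \<cdot>\<^sub>m (map_mat f c + k \<cdot>\<^sub>m map_mat f' c)" for k and f f' :: "_ \<Rightarrow> 'k"
    by (intro eq_matI) simp_all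
  then show "map_mat (\<lambda>x. coef x (N, a, False)) c
      = (1/2) \<cdot>\<^sub>m (map_mat (at_eigenvalue N) c + sgn_bit a \<cdot>\<^sub>m (map_mat at_g c * map_mat (at_eigenvalue N) c))"
    unfolding map_mat_convolve[OF c lin(1) lin(3), symmetric] coef_functional(1) .
  show "map_mat (\<lambda>x. coef x (N, a, True)) c = map_mat (\<lambda>x. coef x (N, a, False)) c * map_mat at_h c"
    unfolding map_mat_convolve[OF c lin(4) lin(2), symmetric] coef_functional(2)[symmetric] ..
qed

lemma Comod_Hom:
  fixes c d :: "(nat \<Rightarrow>\<^sub>0 'k::field) mat"
  assumes c: "is_fd_comodule H_alg (m, c)" and d: "is_fd_comodule H_alg (n, d)" and F: "dim_row F = n" "dim_col F = m"
  shows "F \<in> Hom (Comod H_alg) (m, c) (n, d) \<longleftrightarrow> (\<forall>\<iota>. F * map_mat (\<lambda>x. coef x \<iota>) c = map_mat (\<lambda>x. coef x \<iota>) d * F)"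
proof -
  note c' = comodule_props[OF c] and d' = comodule_props[OF d]
  have entries: "(F * map_mat (\<lambda>x. coef x \<iota>) c) $$ (i, j) = coef (\<Sum>l<m. hscale (F $$ (i, l)) (c $$ (l, j))) \<iota>"
    "(map_mat (\<lambda>x. coef x \<iota>) d * F) $$ (i, j) = coef (\<Sum>l<n. hscale (F $$ (l, j)) (d $$ (i, l))) \<iota>"
    if "i < n" "j < m" for i j \<iota>
    using that F c' d' by (simp_all add: mat_entry lookup_sum mult.commute)
  have ext: "x = y \<longleftrightarrow> (\<forall>\<iota>. coef x \<iota> = coef y \<iota>)" for x y :: "nat \<Rightarrow>\<^sub>0 'k"
    using coef_eqI[of x y] by blast
  from entries have "(\<forall>\<iota>. F * map_mat (\<lambda>x. coef x \<iota>) c = map_mat (\<lambda>x. coef x \<iota>) d * F) \<longleftrightarrow>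
      (\<forall>\<iota>. \<forall>i<n. \<forall>j<m. coef (\<Sum>l<m. hscale (F $$ (i, l)) (c $$ (l, j))) \<iota> = coef (\<Sum>l<n. hscale (F $$ (l, j)) (d $$ (i, l))) \<iota>)"
    using F c' d' by (simp add: mat_eq_iff)
  also have "\<dots> \<longleftrightarrow> (\<forall>i<n. \<forall>j<m. (\<Sum>l<m. hscale (F $$ (i, l)) (c $$ (l, j))) = (\<Sum>l<n. hscale (F $$ (l, j)) (d $$ (i, l))))"
    unfolding ext by blast
  also have "\<dots> \<longleftrightarrow> F \<in> Hom (Comod H_alg) (m, c) (n, d)"
    using F by (auto simp: Comod_def intro: carrier_matI)
  finally show ?thesis by simp
qed

lemma Comod_Hom_functional:
  assumes c: "is_fd_comodule H_alg (m, c)" and d: "is_fd_comodule H_alg (n, d)"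
    and F: "F \<in> Hom (Comod H_alg) (m, c) (n, d)" and f: "linear_on_H (*) f"
  shows "F * map_mat f c = map_mat f d * F"
proof -
  note c' = comodule_props[OF c] and d' = comodule_props[OF d]
  have F': "dim_row F = n" "dim_col F = m"
    "\<And>i j. i < n \<Longrightarrow> j < m \<Longrightarrow> (\<Sum>l<m. hscale (F $$ (i, l)) (c $$ (l, j))) = (\<Sum>l<n. hscale (F $$ (l, j)) (d $$ (i, l)))"
    using F by (auto simp: Comod_def)
  have f_sum: "f (sum u S) = (\<Sum>l\<in>S. f (u l))" for u and S :: "nat set"
    by (induction S rule: infinite_finite_induct) (auto simp: linear_on_HD[OF f])
  show ?thesis
  proof (intro eq_matI)
    fix i j assume "i < dim_row (map_mat f d * F)" "j < dim_col (map_mat f d * F)"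
    then have ij: "i < n" "j < m" using d' F' by auto
    show "(F * map_mat f c) $$ (i, j) = (map_mat f d * F) $$ (i, j)"
    proof -
      have "(\<Sum>l<m. F $$ (i, l) * f (c $$ (l, j))) = f (\<Sum>l<m. hscale (F $$ (i, l)) (c $$ (l, j)))"
        unfolding f_sum linear_on_HD(2)[OF f] ..
      also have "\<dots> = (\<Sum>l<n. F $$ (l, j) * f (d $$ (i, l)))"
        unfolding F'(3)[OF ij] f_sum linear_on_HD(2)[OF f] ..
      finally show ?thesis using ij F'(1,2) c'(2,3) d'(2,3) by (simp add: mat_entry mult.commute)
    qed
  qed (use F' c' d' in simp_all)
qed

text \<open>A matrix that commutes with \<open>M\<close> commutes with the spectral projections of \<open>M\<^sup>2\<close>; together with \<open>G\<close> and \<open>M\<close>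
  these generate all coefficient matrices of the coaction.\<close>

lemma Comod_Hom_iff:
  fixes c d :: "(nat \<Rightarrow>\<^sub>0 'k::field_char_0) mat"
  assumes c: "is_fd_comodule H_alg (m, c)" and d: "is_fd_comodule H_alg (n, d)"
  shows "Hom (Comod H_alg) (m, c) (n, d) = Hom SOp (comodule_pair (m, c)) (comodule_pair (n, d))"
proof (intro equalityI subsetI)
  note lin = linear_functionals[where 'k = 'k]
  fix F assume F: "F \<in> Hom (Comod H_alg) (m, c) (n, d)"
  then have "dim_row F = n" "dim_col F = m" by (auto simp: Comod_def)
  then show "F \<in> Hom SOp (comodule_pair (m, c)) (comodule_pair (n, d))"
    using Comod_Hom_functional[OF c d F lin(1)] Comod_Hom_functional[OF c d F lin(2)]
    by (simp add: comodule_pair_def SOp_Hom)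
next
  note c' = comodule_props[OF c] and d' = comodule_props[OF d]
  fix F assume F: "F \<in> Hom SOp (comodule_pair (m, c)) (comodule_pair (n, d))"
  let ?G = "map_mat at_g c" and ?M = "map_mat at_h c" and ?G' = "map_mat at_g d" and ?M' = "map_mat at_h d"
  have F': "dim_row F = n" "dim_col F = m" and FG: "F * ?G = ?G' * F" and FM: "F * ?M = ?M' * F"
    using F by (simp_all add: comodule_pair_def SOp_Hom)
  have FMM: "F * (?M * ?M) = ?M' * ?M' * F"
    using mat_eq_assoc[OF FM, of ?M] F' c' d' FM by (simp add: mat_assoc)
  obtain I I' where "spectral_family m (?M * ?M) I (\<lambda>N. map_mat (at_eigenvalue N) c)"
    "spectral_family n (?M' * ?M') I' (\<lambda>N. map_mat (at_eigenvalue N) d)"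
    using comodule_spectral_family[OF c] comodule_spectral_family[OF d] by blast
  from spectral_family_intertwine[OF this carrier_matI[OF F'] FMM]
  have FP: "F * map_mat (at_eigenvalue N) c = map_mat (at_eigenvalue N) d * F" for N .
  have FGP: "F * (?G * map_mat (at_eigenvalue N) c) = ?G' * (map_mat (at_eigenvalue N) d * F)" for N
    using mat_eq_assoc[OF FG, of "map_mat (at_eigenvalue N) c"] F' c' d' FP[of N] by (simp add: mat_assoc)
  have even: "F * map_mat (\<lambda>x. coef x (N, a, False)) c = map_mat (\<lambda>x. coef x (N, a, False)) d * F" for N a
    unfolding comodule_coef_mats(1)[OF c] comodule_coef_mats(1)[OF d]
    using F' c' d' by (simp add: mat_algebra FP FGP)
  have odd: "F * map_mat (\<lambda>x. coef x (N, a, True)) c = map_mat (\<lambda>x. coef x (N, a, True)) d * F" for N a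
    unfolding comodule_coef_mats(2)[OF c] comodule_coef_mats(2)[OF d]
    using mat_eq_assoc[OF even[of N a], of ?M] F' c' d' FM by (simp add: mat_assoc)
  have "F * map_mat (\<lambda>x. coef x \<iota>) c = map_mat (\<lambda>x. coef x \<iota>) d * F" for \<iota>
  proof -
    obtain N a b where "\<iota> = (N, a, b)" by (cases \<iota>)
    then show ?thesis using even[of N a] odd[of N a] by (cases b) simp_all
  qed
  then show "F \<in> Hom (Comod H_alg) (m, c) (n, d)" using Comod_Hom[OF c d F'] by blast
qed

subsection \<open>Reconstruction of a comodule from its matrices\<close>

lemma convolve_coef:
  "convolve (\<lambda>x. coef x (N, a, b)) (\<lambda>x. coef x (N', a', b')) x = (if N \<noteq> N' \<or> (if b then a' = a else a' \<noteq> a) then 0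
    else if b \<and> b' then of_int N * coef x (N, a, False) else coef x (N, a, b \<or> b'))"
  (is "?l x = ?r x")
proof (rule linear_on_H_eqI[of "(*)" ?l ?r])
  show "linear_on_H (*) ?l" by (rule linear_convolve[OF linear_lookup])
  show "linear_on_H (*) ?r" by (auto simp: linear_on_H_def lookup_add distrib_left)
  show "?l (bas (L, p, q)) = ?r (bas (L, p, q))" for L p q
    by (cases a; cases a'; cases b; cases b'; cases p; cases q) (auto simp: convolve_bas[OF linear_lookup])
qed

text \<open>With \<open>e N a\<close> the projection onto the vectors on which \<open>M\<^sup>2\<close> acts by \<open>N\<close> and \<open>G\<close> by \<open>(-1)\<^sup>a\<close>, the coaction is
  \<open>\<Sum> e N a \<otimes> x(N, a, 0) + e N a * M \<otimes> x(N, a, 1)\<close>.\<close>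

lemma comodule_pair_surj:
  fixes G M :: "'k::field_char_0 mat"
  assumes "(n, G, M) \<in> integral_super_operators"
  shows "\<exists>c. is_fd_comodule H_alg (n, c) \<and> comodule_pair (n, c) = (n, G, M)"
proof -
  have o: "(n, G, M) \<in> Obj SOp" and int: "int_diagonalizable (M * M)" using assms by (simp_all add: integral_iff)
  have d: "dim_row G = n" "dim_col G = n" "dim_row M = n" "dim_col M = n"
    and GG: "G * G = 1\<^sub>m n" and GM: "G * M = (-1) \<cdot>\<^sub>m (M * G)" using o unfolding SOp_Obj by blast+
  have "M * M \<in> carrier_mat n n" by (intro carrier_matI; simp add: d)
  then obtain I P where fam: "spectral_family n (M * M) I P" using spectral_family_exists[OF int] by blast
  note p = fam[unfolded spectral_family_def]
  have fin: "finite I" and PC: "\<And>N. P N \<in> carrier_mat n n" and Psum: "msum n n P I = 1\<^sub>m n"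
    and PQ: "\<And>N. P N * (M * M) = of_int N \<cdot>\<^sub>m P N" using p by blast+
  have dP: "dim_row (P N) = n" "dim_col (P N) = n" for N using PC[of N] by auto
  note dims = d dP
  note orth = spectral_family_orthogonal[OF fam]
  have GMM: "G * (M * M) = M * M * G"
    using mat_eq_assoc[OF GM, of M] d by (simp add: mat_smult_left mat_smult_right mat_assoc GM)
  have GP: "G * P N = P N * G" for N
    by (rule spectral_family_intertwine[OF fam fam carrier_matI[OF d(1,2)] GMM])
  have MP: "M * P N = P N * M" for N
    by (rule spectral_family_intertwine[OF fam fam carrier_matI[OF d(3,4)]]) (simp add: mat_assoc d)
  have MG: "M * G = (-1) \<cdot>\<^sub>m (G * M)" using GM by simp
  have P0: "P N = 0\<^sub>m n n" if "N \<notin> I" for N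
  proof -
    have "P N = msum n n P I * P N" using Psum by (simp add: mat_one_left dP)
    also have "\<dots> = msum n n (\<lambda>L. P L * P N) I" using PC dP by (subst msum_mult_right) simp_all
    also have "\<dots> = msum n n (\<lambda>L. 0\<^sub>m n n) I" using that by (intro msum_cong) (auto simp: orth)
    also have "\<dots> = 0\<^sub>m n n" by (auto simp: msum_def intro!: eq_matI)
    finally show ?thesis .
  qed
  define e where "e N a = (1/2) \<cdot>\<^sub>m (P N + sgn_bit a \<cdot>\<^sub>m (G * P N))" for N a
  have de: "dim_row (e N a) = n" "dim_col (e N a) = n" for N a by (simp_all add: e_def dims)
  have Ge: "G * e N a = sgn_bit a \<cdot>\<^sub>m e N a" for N a
  proof -
    have "G * e N a = (1/2) \<cdot>\<^sub>m (G * P N + sgn_bit a \<cdot>\<^sub>m P N)"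
      by (simp add: e_def mat_dist_right mat_smult_right dims mat_eq_assoc[OF GG] mat_one_left)
    also have "\<dots> = sgn_bit a \<cdot>\<^sub>m e N a" by (intro eq_matI) (auto simp: e_def dims)
    finally show ?thesis .
  qed
  have Pe: "P N * e L a = (if N = L then e N a else 0\<^sub>m n n)" for N L a
  proof -
    have "P N * (G * P L) = G * (P N * P L)" using mat_eq_assoc[OF GP[of N, symmetric], of "P L"] by (simp add: mat_assoc dims)
    then have "P N * e L a = (1/2) \<cdot>\<^sub>m (P N * P L + sgn_bit a \<cdot>\<^sub>m (G * (P N * P L)))"
      by (simp add: e_def mat_dist_right mat_smult_right dims)
    then show ?thesis by (auto simp: orth e_def mat_zero_right dims intro!: eq_matI)
  qed
  have ee: "e N a * e L a' = (if N = L \<and> a = a' then e N a else 0\<^sub>m n n)" for N L a a'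
  proof -
    have "e N a * e L a' = (1/2) \<cdot>\<^sub>m (P N * e L a' + sgn_bit a \<cdot>\<^sub>m (P N * (G * e L a')))"
      unfolding e_def[of N a] using GP[of N] de by (simp add: mat_dist_left mat_smult_left mat_assoc dims)
    also have "\<dots> = (1/2) \<cdot>\<^sub>m (P N * e L a' + (sgn_bit a * sgn_bit a') \<cdot>\<^sub>m (P N * e L a'))"
      unfolding Ge by (simp add: mat_smult_right smult_smult_mat dims de)
    also have "\<dots> = (if N = L \<and> a = a' then e N a else 0\<^sub>m n n)"
      unfolding Pe by (intro eq_matI) (auto simp: de)
    finally show ?thesis .
  qed
  have Me: "M * e N a = e N (\<not> a) * M" for N a
  proof -
    have "M * (G * P N) = (-1) \<cdot>\<^sub>m (G * (P N * M))"
      using mat_eq_assoc[OF MG, of "P N"] MP[of N] by (simp add: mat_assoc mat_smult_left dims)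
    then have "M * e N a = (1/2) \<cdot>\<^sub>m (P N * M + sgn_bit a \<cdot>\<^sub>m ((-1) \<cdot>\<^sub>m (G * (P N * M))))"
      by (simp add: e_def mat_dist_right mat_smult_right dims MP)
    also have "\<dots> = e N (\<not> a) * M"
      by (simp add: e_def mat_dist_left mat_smult_left mat_assoc dims) (auto simp: dims intro!: eq_matI)
    finally show ?thesis .
  qed
  have eMM: "e N a * (M * M) = of_int N \<cdot>\<^sub>m e N a" for N a
  proof -
    have "e N a * (M * M) = (1/2) \<cdot>\<^sub>m (P N * (M * M) + sgn_bit a \<cdot>\<^sub>m (G * (P N * (M * M))))"
      by (simp add: e_def mat_dist_left mat_smult_left mat_assoc dims)
    also have "\<dots> = of_int N \<cdot>\<^sub>m e N a"
      unfolding PQ by (simp add: mat_smult_right dims) (auto simp: e_def dims algebra_simps intro!: eq_matI)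
    finally show ?thesis .
  qed
  define C where "C = (\<lambda>(N, a, b). if b then e N a * M else e N a)"
  have dC: "dim_row (C \<iota>) = n" "dim_col (C \<iota>) = n" for \<iota> by (cases \<iota>; simp add: C_def de d)+
  have e0: "N \<notin> I \<Longrightarrow> e N a = 0\<^sub>m n n" for N a
    by (intro eq_matI) (simp_all add: e_def P0 mat_zero_right d)
  have C0: "C (N, a, b) = 0\<^sub>m n n" if "N \<notin> I" for N a b
    using e0[OF that, of a] by (simp add: C_def mat_zero_left d)
  define c where "c = mat n n (\<lambda>ij. \<Sum>N\<in>I. \<Sum>a\<in>UNIV. \<Sum>b\<in>UNIV. hscale (C (N, a, b) $$ ij) (bas (N, a, b)))"
  have dc: "dim_row c = n" "dim_col c = n" by (simp_all add: c_def)
  have f_c: "f (c $$ (i, j)) = (\<Sum>N\<in>I. \<Sum>a\<in>UNIV. \<Sum>b\<in>UNIV. C (N, a, b) $$ (i, j) * f (bas (N, a, b)))"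
    if f: "linear_on_H (*) f" and ij: "i < n" "j < n" for f i j
  proof -
    have f_sum: "f (sum u S) = (\<Sum>l\<in>S. f (u l))" for u and S :: "'b set"
      by (induction S rule: infinite_finite_induct) (auto simp: linear_on_HD[OF f])
    have f_sum': "f (sum u S) = (\<Sum>l\<in>S. f (u l))" for u and S :: "bool set"
      by (induction S rule: infinite_finite_induct) (auto simp: linear_on_HD[OF f])
    have f_sum'': "f (sum u S) = (\<Sum>l\<in>S. f (u l))" for u and S :: "int set"
      by (induction S rule: infinite_finite_induct) (auto simp: linear_on_HD[OF f])
    show ?thesis using ij by (simp add: c_def f_sum' f_sum'' linear_on_HD(2)[OF f] del: UNIV_bool)
  qed
  have coef_c: "coef (c $$ (i, j)) (N, a, b) = C (N, a, b) $$ (i, j)" if ij: "i < n" "j < n" for i j N a b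
  proof -
    have "coef (c $$ (i, j)) (N, a, b) = (\<Sum>L\<in>I. if L = N then C (N, a, b) $$ (i, j) else 0)"
      unfolding f_c[OF linear_lookup ij] by (rule sum.cong[OF refl], cases a; cases b; simp add: UNIV_bool)
    also have "\<dots> = C (N, a, b) $$ (i, j)"
      using C0[of N a b] ij by (cases "N \<in> I") (simp_all add: fin)
    finally show ?thesis .
  qed
  have CC: "(C (N, a, b) * C (N', a', b')) = (if N \<noteq> N' \<or> (if b then a' = a else a' \<noteq> a) then 0\<^sub>m n n
    else if b \<and> b' then of_int N \<cdot>\<^sub>m C (N, a, False) else C (N, a, b \<or> b'))" for N a b N' a' b'
  proof -
    have MeL: "M * (e N' a' * Y) = e N' (\<not> a') * (M * Y)" if "dim_row Y = n" for Y
      using mat_eq_assoc[OF Me[of N' a'], of Y] that by (simp add: mat_assoc dims de)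
    have eeL: "e N a * (e N' x * Y) = (if N = N' \<and> a = x then e N a * Y else 0\<^sub>m n (dim_col Y))" if "dim_row Y = n" for x Y
      using mat_eq_assoc[OF ee[of N a N' x], of Y] that by (simp add: mat_zero_left dims de)
    show ?thesis
      by (cases b; cases b')
         (auto simp: C_def mat_assoc mat_smult_right dims de Me MeL ee eeL eMM)
  qed
  have "is_fd_comodule H_alg (n, c)"
    unfolding is_fd_comodule_def prod.case
  proof (intro conjI allI impI)
    show "c \<in> carrier_mat n n" by (intro carrier_matI dc)
    fix i j assume ij: "i < n" "j < n"
    show "same_tensor2 H_alg (comult H_alg (c $$ (i, j))) (map (\<lambda>l. (c $$ (i, l), c $$ (l, j))) [0..<n])"
      unfolding same_tensor2_H_iff H_alg_simps
    proof (intro allI)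
      fix \<iota> \<kappa> :: coef_index
      obtain N a b N' a' b' where idx: "\<iota> = (N, a, b)" "\<kappa> = (N', a', b')" by (cases \<iota>; cases \<kappa>)
      have "(\<Sum>(x, y)\<leftarrow>H_comult (c $$ (i, j)). coef x \<iota> * coef y \<kappa>) = (C \<iota> * C \<kappa>) $$ (i, j)"
        using convolve_coef[of N a b N' a' b' "c $$ (i, j)"] ij
        unfolding idx convolve_def CC by (auto simp: coef_c dC)
      also have "\<dots> = (\<Sum>l<n. coef (c $$ (i, l)) \<iota> * coef (c $$ (l, j)) \<kappa>)"
        using ij by (simp add: mat_entry dC idx coef_c)
      also have "\<dots> = (\<Sum>(x, y)\<leftarrow>map (\<lambda>l. (c $$ (i, l), c $$ (l, j))) [0..<n]. coef x \<iota> * coef y \<kappa>)"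
        by (simp add: o_def interv_sum_list_conv_sum_set_nat lessThan_atLeast0)
      finally show "(\<Sum>(x, y)\<leftarrow>H_comult (c $$ (i, j)). coef x \<iota> * coef y \<kappa>)
          = (\<Sum>(x, y)\<leftarrow>map (\<lambda>l. (c $$ (i, l), c $$ (l, j))) [0..<n]. coef x \<iota> * coef y \<kappa>)" .
    qed
    have "H_counit (c $$ (i, j)) = (\<Sum>N\<in>I. e N False $$ (i, j) + e N True $$ (i, j))"
      unfolding f_c[OF linear_H_counit ij] by (simp add: UNIV_bool C_def add.commute)
    also have "\<dots> = (\<Sum>N\<in>I. P N $$ (i, j))"
      using ij by (intro sum.cong) (simp_all add: e_def dims field_simps)
    also have "\<dots> = msum n n P I $$ (i, j)" using ij by (simp add: msum_def)
    finally show "counit H_alg (c $$ (i, j)) = (if i = j then 1 else 0)" using ij by (simp add: Psum)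
  qed
  moreover have "map_mat at_g c = G"
  proof (intro eq_matI)
    fix i j assume "i < dim_row G" "j < dim_col G"
    then have ij: "i < n" "j < n" by (auto simp: d)
    have "at_g (c $$ (i, j)) = (\<Sum>N\<in>I. e N False $$ (i, j) - e N True $$ (i, j))"
      unfolding f_c[OF linear_functionals(1) ij] by (simp add: UNIV_bool C_def)
    also have "\<dots> = (\<Sum>N\<in>I. (G * P N) $$ (i, j))"
      using ij by (intro sum.cong) (simp_all add: e_def dims field_simps)
    also have "\<dots> = msum n n (\<lambda>N. G * P N) I $$ (i, j)" using ij by (simp add: msum_def)
    also have "msum n n (\<lambda>N. G * P N) I = G * msum n n P I" using PC d by (subst msum_mult_left) simp_all
    finally show "map_mat at_g c $$ (i, j) = G $$ (i, j)" using ij by (simp add: Psum mat_one_right d dc)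
  qed (simp_all add: d dc)
  moreover have "map_mat at_h c = M"
  proof (intro eq_matI)
    fix i j assume "i < dim_row M" "j < dim_col M"
    then have ij: "i < n" "j < n" by (auto simp: d)
    have eP: "e N False * M + e N True * M = P N * M" for N
    proof -
      have "e N False + e N True = P N" by (intro eq_matI) (simp_all add: e_def dims field_simps)
      then show ?thesis by (simp add: mat_dist_left[symmetric] de d)
    qed
    have "at_h (c $$ (i, j)) = (\<Sum>N\<in>I. (e N False * M) $$ (i, j) + (e N True * M) $$ (i, j))"
      unfolding f_c[OF linear_functionals(2) ij] by (simp add: UNIV_bool C_def add.commute)
    also have "\<dots> = (\<Sum>N\<in>I. (P N * M) $$ (i, j))"
      using ij by (intro sum.cong) (simp_all add: eP[symmetric] de d)
    also have "\<dots> = msum n n (\<lambda>N. P N * M) I $$ (i, j)" using ij by (simp add: msum_def)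
    also have "msum n n (\<lambda>N. P N * M) I = msum n n P I * M" using PC d by (subst msum_mult_right) simp_all
    finally show "map_mat at_h c $$ (i, j) = M $$ (i, j)" using ij by (simp add: Psum mat_one_left d dc)
  qed (simp_all add: d dc)
  ultimately show ?thesis by (intro exI[of _ c]) (simp add: comodule_pair_def)
qed

section \<open>Tensor products of comodules\<close>

text \<open>Bilinearity allows replacing \<open>\<Delta>\<close> of the two entries by the representatives that the comodule axioms provide.\<close>

lemma comodule_tensor_coassociative:
  fixes c d :: "(nat \<Rightarrow>\<^sub>0 'k::field) mat"
  assumes c: "is_fd_comodule H_alg (m, c)" and d: "is_fd_comodule H_alg (n, d)"
    and ij: "i < m" "j < m" "i' < n" "j' < n"
  shows "convolve (\<lambda>x. coef x \<iota>) (\<lambda>x. coef x \<kappa>) (H_mult (c $$ (i, j)) (d $$ (i', j')))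
    = (\<Sum>l<m. \<Sum>l'<n. coef (H_mult (c $$ (i, l)) (d $$ (i', l'))) \<iota> * coef (H_mult (c $$ (l, j)) (d $$ (l', j'))) \<kappa>)"
proof -
  have sum_swap: "(\<Sum>(x, y)\<leftarrow>xs. \<Sum>l<N. f x y l) = (\<Sum>l<N. \<Sum>(x, y)\<leftarrow>xs. f x y l)"
    for xs :: "((nat \<Rightarrow>\<^sub>0 'k) \<times> (nat \<Rightarrow>\<^sub>0 'k)) list" and f :: "_ \<Rightarrow> _ \<Rightarrow> nat \<Rightarrow> 'k" and N
    by (induction xs) (auto simp: sum.distrib)
  have sum_upt: "(\<Sum>(x, y)\<leftarrow>map (\<lambda>l. (f l, f' l)) [0..<N]. B x y) = (\<Sum>l<N. B (f l) (f' l))"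
    for f f' :: "nat \<Rightarrow> (nat \<Rightarrow>\<^sub>0 'k)" and B :: "_ \<Rightarrow> _ \<Rightarrow> 'k" and N
    by (simp add: o_def interv_sum_list_conv_sum_set_nat lessThan_atLeast0)
  note lin = linear_on_HD[OF linear_H_mult_left] linear_on_HD[OF linear_H_mult_right]
  have B_right: "bilinear_form (scale H_alg) (\<lambda>u' v'. coef (H_mult u u') \<iota> * coef (H_mult v v') \<kappa>)"
    and B_left: "bilinear_form (scale H_alg) (\<lambda>u v. coef (H_mult u u') \<iota> * coef (H_mult v v') \<kappa>)"
    for u v u' v' :: "nat \<Rightarrow>\<^sub>0 'k"
    unfolding bilinear_form_def H_alg_simps lin lookup_add lookup_hscale distrib_left distrib_right
    by (simp_all only: mult.assoc mult.left_commute simp_thms)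
  have "convolve (\<lambda>x. coef x \<iota>) (\<lambda>x. coef x \<kappa>) (H_mult (c $$ (i, j)) (d $$ (i', j')))
      = (\<Sum>(u, v)\<leftarrow>H_comult (c $$ (i, j)). \<Sum>(u', v')\<leftarrow>H_comult (d $$ (i', j')). coef (H_mult u u') \<iota> * coef (H_mult v v') \<kappa>)"
    by (rule H_comult_mult)
  also have "\<dots> = (\<Sum>(u, v)\<leftarrow>H_comult (c $$ (i, j)). \<Sum>l'<n. coef (H_mult u (d $$ (i', l'))) \<iota> * coef (H_mult v (d $$ (l', j'))) \<kappa>)"
    unfolding same_tensor2_bilinear[OF comodule_props(4)[OF d ij(3,4)] B_right] sum_upt ..
  also have "\<dots> = (\<Sum>l'<n. \<Sum>l<m. coef (H_mult (c $$ (i, l)) (d $$ (i', l'))) \<iota> * coef (H_mult (c $$ (l, j)) (d $$ (l', j'))) \<kappa>)"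
    unfolding sum_swap same_tensor2_bilinear[OF comodule_props(4)[OF c ij(1,2)] B_left] sum_upt ..
  also have "\<dots> = (\<Sum>l<m. \<Sum>l'<n. coef (H_mult (c $$ (i, l)) (d $$ (i', l'))) \<iota> * coef (H_mult (c $$ (l, j)) (d $$ (l', j'))) \<kappa>)"
    by (rule sum.swap)
  finally show ?thesis .
qed

lemma comodule_tensor_pair:
  fixes c d :: "(nat \<Rightarrow>\<^sub>0 'k::field) mat"
  assumes c: "is_fd_comodule H_alg (m, c)" and d: "is_fd_comodule H_alg (n, d)"
  shows "is_fd_comodule H_alg (comodule_tensor H_alg (m, c) (n, d))"
    and "comodule_pair (comodule_tensor H_alg (m, c) (n, d)) = comodule_pair (m, c) \<boxtimes>\<^bsub>SOp\<^esub> comodule_pair (n, d)"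
proof -
  note c' = comodule_props[OF c] and d' = comodule_props[OF d]
  define t where "t = mat (m * n) (m * n) (\<lambda>(i, j). H_mult (c $$ (i div n, j div n)) (d $$ (i mod n, j mod n)))"
  have tensor: "comodule_tensor H_alg (m, c) (n, d) = (m * n, t)" by (simp add: comodule_tensor_def t_def)
  have dt: "dim_row t = m * n" "dim_col t = m * n" by (simp_all add: t_def)
  have t: "t $$ (i, j) = H_mult (c $$ (i div n, j div n)) (d $$ (i mod n, j mod n))" if "i < m * n" "j < m * n" for i j
    using that by (simp add: t_def)
  note idx = pair_index_bounds[of _ m n]
  have "is_fd_comodule H_alg (m * n, t)"
    unfolding is_fd_comodule_def prod.case
  proof (intro conjI allI impI)
    show "t \<in> carrier_mat (m * n) (m * n)" by (intro carrier_matI dt)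
    fix i j assume ij: "i < m * n" "j < m * n"
    show "same_tensor2 H_alg (comult H_alg (t $$ (i, j))) (map (\<lambda>l. (t $$ (i, l), t $$ (l, j))) [0..<m * n])"
      unfolding same_tensor2_H_iff H_alg_simps
    proof (intro allI)
      fix \<iota> \<kappa> :: coef_index
      have "(\<Sum>(x, y)\<leftarrow>H_comult (t $$ (i, j)). coef x \<iota> * coef y \<kappa>) = convolve (\<lambda>x. coef x \<iota>) (\<lambda>x. coef x \<kappa>) (t $$ (i, j))"
        unfolding convolve_def ..
      also have "\<dots> = (\<Sum>l<m. \<Sum>l'<n. coef (H_mult (c $$ (i div n, l)) (d $$ (i mod n, l'))) \<iota>
          * coef (H_mult (c $$ (l, j div n)) (d $$ (l', j mod n))) \<kappa>)"
        unfolding t[OF ij] by (rule comodule_tensor_coassociative[OF c d]; rule idx; rule ij)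
      also have "\<dots> = (\<Sum>l<m * n. coef (H_mult (c $$ (i div n, l div n)) (d $$ (i mod n, l mod n))) \<iota>
          * coef (H_mult (c $$ (l div n, j div n)) (d $$ (l mod n, j mod n))) \<kappa>)"
        by (rule sum_pair_index[symmetric])
      also have "\<dots> = (\<Sum>l<m * n. coef (t $$ (i, l)) \<iota> * coef (t $$ (l, j)) \<kappa>)"
        by (rule sum.cong[OF refl]) (simp add: t ij)
      also have "\<dots> = (\<Sum>(x, y)\<leftarrow>map (\<lambda>l. (t $$ (i, l), t $$ (l, j))) [0..<m * n]. coef x \<iota> * coef y \<kappa>)"
        by (simp add: o_def interv_sum_list_conv_sum_set_nat lessThan_atLeast0)
      finally show "(\<Sum>(x, y)\<leftarrow>H_comult (t $$ (i, j)). coef x \<iota> * coef y \<kappa>)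
          = (\<Sum>(x, y)\<leftarrow>map (\<lambda>l. (t $$ (i, l), t $$ (l, j))) [0..<m * n]. coef x \<iota> * coef y \<kappa>)" .
    qed
    have "i = j \<longleftrightarrow> i div n = j div n \<and> i mod n = j mod n" by (metis div_mult_mod_eq)
    then show "counit H_alg (t $$ (i, j)) = (if i = j then 1 else 0)"
      using idx[OF ij(1)] idx[OF ij(2)] by (simp add: t[OF ij] H_counit_mult c'(5) d'(5))
  qed
  then show "is_fd_comodule H_alg (comodule_tensor H_alg (m, c) (n, d))" unfolding tensor .
  have "map_mat at_g t = kronecker (map_mat at_g c) (map_mat at_g d)"
    by (intro eq_matI) (simp_all add: kronecker_entry dt t at_g_mult idx c'(2,3) d'(2,3))
  moreover have "map_mat at_h t = kronecker (map_mat at_g c) (map_mat at_h d) + kronecker (map_mat at_h c) (1\<^sub>m n)"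
    by (intro eq_matI) (simp_all add: kronecker_entry dt t at_h_mult idx c'(2,3) d'(2,3,5))
  ultimately show "comodule_pair (comodule_tensor H_alg (m, c) (n, d)) = comodule_pair (m, c) \<boxtimes>\<^bsub>SOp\<^esub> comodule_pair (n, d)"
    unfolding tensor by (simp add: comodule_pair_def)
qed

lemma unit_comodule:
  "is_fd_comodule H_alg (1, mat 1 1 (\<lambda>_. hone H_alg :: nat \<Rightarrow>\<^sub>0 'k::field))"
  "comodule_pair (1, mat 1 1 (\<lambda>_. hone H_alg :: nat \<Rightarrow>\<^sub>0 'k::field)) = Unit SOp"
proof -
  interpret hopf_algebra "H_alg :: ('k, nat \<Rightarrow>\<^sub>0 'k) hopf_alg" by (rule H_hopf_algebra)
  show "is_fd_comodule H_alg (1, mat 1 1 (\<lambda>_. hone H_alg :: nat \<Rightarrow>\<^sub>0 'k))"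
    using comult_one counit_one by (simp add: is_fd_comodule_def)
  show "comodule_pair (1, mat 1 1 (\<lambda>_. hone H_alg :: nat \<Rightarrow>\<^sub>0 'k)) = Unit SOp"
    by (auto simp: comodule_pair_def intro!: eq_matI)
qed

lemma Comod_identification:
  "hom_identification (Comod H_alg) (IntSOp :: ('k::field_char_0, _, _) mon_cat) comodule_pair"
proof
  have Obj: "X \<in> Obj (Comod H_alg) \<longleftrightarrow> is_fd_comodule H_alg X" for X :: "(nat \<Rightarrow>\<^sub>0 'k) fd_comodule"
    by (simp add: Comod_def)
  have TensO: "X \<boxtimes>\<^bsub>Comod H_alg\<^esub> Y = comodule_tensor H_alg X Y" for X Y :: "(nat \<Rightarrow>\<^sub>0 'k) fd_comodule"
    by (simp add: Comod_def)
  have Unit: "Unit (Comod H_alg) = (1, mat 1 1 (\<lambda>_. hone H_alg :: nat \<Rightarrow>\<^sub>0 'k))" by (simp add: Comod_def)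
  show "comodule_pair ` Obj (Comod H_alg) = Obj (IntSOp :: ('k, _, _) mon_cat)"
  proof (intro equalityI subsetI)
    fix X :: "nat \<times> 'k mat \<times> 'k mat" assume "X \<in> comodule_pair ` Obj (Comod H_alg)"
    then obtain n c where "is_fd_comodule H_alg (n, c)" "X = comodule_pair (n, c)" unfolding Obj image_iff Bex_def by auto
    then show "X \<in> Obj IntSOp" using comodule_pair_integral by simp
  next
    fix X :: "nat \<times> 'k mat \<times> 'k mat" assume X: "X \<in> Obj IntSOp"
    obtain n G M where eq: "X = (n, G, M)" by (cases X)
    have "(n, G, M) \<in> integral_super_operators" using X eq by simp
    then obtain c where "is_fd_comodule H_alg (n, c)" "comodule_pair (n, c) = X"
      using comodule_pair_surj eq by metis
    then show "X \<in> comodule_pair ` Obj (Comod H_alg)" using Obj by (intro image_eqI[of _ _ "(n, c)"]) simp_all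
  qed
  show "Hom (Comod H_alg) X Y = Hom IntSOp (comodule_pair X) (comodule_pair Y)"
    if "X \<in> Obj (Comod H_alg)" "Y \<in> Obj (Comod H_alg)" for X Y :: "(nat \<Rightarrow>\<^sub>0 'k) fd_comodule"
    using that Comod_Hom_iff unfolding Obj by (cases X; cases Y) simp
  show "X \<boxtimes>\<^bsub>Comod H_alg\<^esub> Y \<in> Obj (Comod H_alg)" "comodule_pair (X \<boxtimes>\<^bsub>Comod H_alg\<^esub> Y) = comodule_pair X \<boxtimes>\<^bsub>IntSOp\<^esub> comodule_pair Y"
    if "X \<in> Obj (Comod H_alg)" "Y \<in> Obj (Comod H_alg)" for X Y :: "(nat \<Rightarrow>\<^sub>0 'k) fd_comodule"
  proof -
    obtain m c n d where eq: "X = (m, c)" "Y = (n, d)" by (cases X; cases Y)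
    show "X \<boxtimes>\<^bsub>Comod H_alg\<^esub> Y \<in> Obj (Comod H_alg)"
      using that comodule_tensor_pair(1)[of m c n d] unfolding Obj TensO eq by blast
    have "comodule_pair (X \<boxtimes>\<^bsub>Comod H_alg\<^esub> Y) = comodule_pair X \<boxtimes>\<^bsub>SOp\<^esub> comodule_pair Y"
      using that comodule_tensor_pair(2)[of m c n d] unfolding Obj TensO eq by blast
    then show "comodule_pair (X \<boxtimes>\<^bsub>Comod H_alg\<^esub> Y) = comodule_pair X \<boxtimes>\<^bsub>IntSOp\<^esub> comodule_pair Y" by simp
  qed
  show "Unit (Comod H_alg) \<in> Obj (Comod H_alg :: ('k, _, _) mon_cat)" unfolding Obj Unit by (rule unit_comodule(1))
  show "comodule_pair (Unit (Comod H_alg)) = Unit (IntSOp :: ('k, _, _) mon_cat)"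
    unfolding Unit unit_comodule(2) by simp
qed (auto simp: Comod_def comodule_pair_def split: prod.splits)

section \<open>The socle lies in degree zero\<close>

text \<open>By \<open>socle_object_square_zero\<close>, \<open>h\<^sup>2\<close> acts as zero on every simple comodule that contributes to the socle, so its
  spectral projections for \<open>N \<noteq> 0\<close> vanish and its matrix coefficients only involve the \<open>x(0, a, b)\<close>.\<close>

lemma hopf_socle_degree_zero:
  fixes x :: "nat \<Rightarrow>\<^sub>0 'k::field_char_0"
  assumes "x \<in> hopf_socle H_alg" and "N \<noteq> 0"
  shows "coef x (N, a, b) = 0"
proof -
  interpret hom_identification "Comod H_alg" "IntSOp :: ('k, _, _) mon_cat" comodule_pair by (rule Comod_identification)
  let ?Z = "{x :: nat \<Rightarrow>\<^sub>0 'k. \<forall>N a b. N \<noteq> 0 \<longrightarrow> coef x (N, a, b) = 0}"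
  have sub: "hspace.subspace ?Z"
    by (rule hspace.subspaceI) (simp_all add: lookup_add)
  have "elements_mat (snd W) \<subseteq> ?Z"
    if W: "simple_object (Comod H_alg) W" and ss: "\<And>V. simple_object (Comod H_alg) V \<Longrightarrow>
      semisimple_object (Comod H_alg) (V \<boxtimes>\<^bsub>Comod H_alg\<^esub> W)" for W :: "(nat \<Rightarrow>\<^sub>0 'k) fd_comodule"
  proof -
    obtain n c where eq: "W = (n, c)" by (cases W)
    have WO: "W \<in> Obj (Comod H_alg)" using W by (simp add: simple_object_def)
    then have c: "is_fd_comodule H_alg (n, c)" by (simp add: Comod_def eq)
    note c' = comodule_props[OF c]
    let ?G = "map_mat at_g c" and ?M = "map_mat at_h c"
    have pair: "comodule_pair W = (n, ?G, ?M)" by (simp add: eq comodule_pair_def)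
    have "simple_object IntSOp (n, ?G, ?M)" using W simple_object_iff[OF WO] by (simp add: pair)
    then have MM: "?M * ?M = 0\<^sub>m n n"
    proof (rule socle_object_square_zero)
      fix V' :: "nat \<times> 'k mat \<times> 'k mat" assume V': "simple_object IntSOp V'"
      then have "V' \<in> Obj IntSOp" by (simp add: simple_object_def)
      from obj_lift[OF this] obtain V where V: "V \<in> Obj (Comod H_alg)" "comodule_pair V = V'" by blast
      have "simple_object (Comod H_alg) V" using V' simple_object_iff[OF V(1)] by (simp add: V(2))
      from semisimple_object_transfer[OF ss[OF this] tens_closed[OF V(1) WO]]
      show "semisimple_object IntSOp (V' \<boxtimes>\<^bsub>SOp\<^esub> (n, ?G, ?M))"
        unfolding tens[OF V(1) WO] V(2) pair by simp
    qed
    have P: "map_mat (at_eigenvalue N) c = 0\<^sub>m n n" if "N \<noteq> 0" for N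
    proof -
      obtain I where "spectral_family n (?M * ?M) I (\<lambda>N. map_mat (at_eigenvalue N) c)"
        using comodule_spectral_family[OF c] by blast
      then have "?M * ?M * map_mat (at_eigenvalue N) c = of_int N \<cdot>\<^sub>m map_mat (at_eigenvalue N) c"
        unfolding spectral_family_def by blast
      then have zero: "of_int N \<cdot>\<^sub>m map_mat (at_eigenvalue N) c = 0\<^sub>m n n" by (simp add: MM mat_zero_left c'(2,3))
      have "map_mat (at_eigenvalue N) c $$ (i, j) = 0" if "i < n" "j < n" for i j
        using arg_cong[OF zero, of "\<lambda>A. A $$ (i, j)"] that \<open>N \<noteq> 0\<close> c'(2,3) by simp
      then show ?thesis using c'(2,3) by (intro eq_matI) simp_all
    qed
    have even: "map_mat (\<lambda>x. coef x (N, a, False)) c = 0\<^sub>m n n" if "N \<noteq> 0" for N a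
      unfolding comodule_coef_mats(1)[OF c] P[OF that] using c'(2,3)
      by (intro eq_matI) (simp_all add: mat_zero_right)
    have odd: "map_mat (\<lambda>x. coef x (N, a, True)) c = 0\<^sub>m n n" if "N \<noteq> 0" for N a
      unfolding comodule_coef_mats(2)[OF c] even[OF that] using c'(2,3) by (simp add: mat_zero_left)
    have "coef (c $$ (i, j)) (N, a, b) = 0" if "i < n" "j < n" "N \<noteq> 0" for i j N a b
      using arg_cong[OF even[OF that(3), of a], of "\<lambda>A. A $$ (i, j)"]
        arg_cong[OF odd[OF that(3), of a], of "\<lambda>A. A $$ (i, j)"] that(1,2) c'(2,3) by (cases b) simp_all
    then show ?thesis using c'(2,3) by (auto simp: eq elements_mat_def)
  qed
  then have "(\<Union>W \<in> {W. simple_object (Comod H_alg) W \<and> (\<forall>V. simple_object (Comod H_alg) V \<longrightarrow>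
      semisimple_object (Comod H_alg) (V \<boxtimes>\<^bsub>Comod H_alg\<^esub> W) \<and> semisimple_object (Comod H_alg) (W \<boxtimes>\<^bsub>Comod H_alg\<^esub> V))}.
      elements_mat (snd W)) \<subseteq> ?Z" by blast
  from hspace.span_minimal[OF this sub] assms show ?thesis
    unfolding hopf_socle_def H_alg_simps by blast
qed

text \<open>\<open>H\<close> is graded by \<open>N\<close>.\<close>

lemma coef_mult_degree_zero:
  fixes x y :: "nat \<Rightarrow>\<^sub>0 'k::field"
  assumes x: "\<And>a b. coef x (N, a, b) = 0" and y: "\<And>L a b. L \<noteq> 0 \<Longrightarrow> coef y (L, a, b) = 0"
  shows "coef (H_mult x y) (N, a, b) = 0"
proof -
  have i: "i = index_code (fst (index_decode i), fst (snd (index_decode i)), snd (snd (index_decode i)))" for i by simp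
  have x0: "Poly_Mapping.lookup x i = 0" if "fst (index_decode i) = N" for i
    by (subst i, unfold that) (rule x)
  have y0: "Poly_Mapping.lookup y j = 0" if "fst (index_decode j) \<noteq> 0" for j
    by (subst i) (rule y[OF that])
  have bas: "coef (bas_mult \<iota> \<kappa>) (N, a, b) = (0 :: 'k)" if "fst \<iota> \<noteq> N" "fst \<kappa> = 0" for \<iota> \<kappa>
    using that by (cases \<iota>; cases \<kappa>) auto
  have terms: "Poly_Mapping.lookup x i * (Poly_Mapping.lookup y j * coef (bas_mult (index_decode i) (index_decode j)) (N, a, b)) = 0" for i j
    by (cases "fst (index_decode i) = N"; cases "fst (index_decode j) = 0") (simp_all add: x0 y0 bas)
  have "coef (H_mult u y) (N, a, b) = (\<Sum>j\<in>Poly_Mapping.keys y. Poly_Mapping.lookup y j * coef (H_mult u (bas (index_decode j))) (N, a, b))" for u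
    by (rule linear_on_H_expansion[OF linear_on_H_compose[OF linear_lookup linear_H_mult_right]])
  moreover have "coef (H_mult x y) (N, a, b) = (\<Sum>i\<in>Poly_Mapping.keys x. Poly_Mapping.lookup x i * coef (H_mult (bas (index_decode i)) y) (N, a, b))"
    by (rule linear_on_H_expansion[OF linear_on_H_compose[OF linear_lookup linear_H_mult_left]])
  ultimately show ?thesis by (simp only: H_mult_bas sum_distrib_left terms sum.neutral_const)
qed

text \<open>Finitely many generators involve finitely many degrees, and multiplication by elements of degree zero
  reaches no further ones, whereas \<open>H\<close> is nonzero in all degrees.\<close>

lemma H_not_finite_type:
  "\<not> finite_type_over H_alg (hopf_socle (H_alg :: ('k::field_char_0, nat \<Rightarrow>\<^sub>0 'k) hopf_alg))"
proof
  assume "finite_type_over H_alg (hopf_socle (H_alg :: ('k, nat \<Rightarrow>\<^sub>0 'k) hopf_alg))"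
  then obtain F :: "(nat \<Rightarrow>\<^sub>0 'k) set" where fin: "finite F"
    and gen: "\<And>x. \<exists>k. (\<forall>f\<in>F. k f \<in> hopf_socle H_alg) \<and> x = (\<Sum>f\<in>F. H_mult f (k f))"
    unfolding finite_type_over_def H_alg_simps by blast
  define T where "T = (\<Union>f\<in>F. (\<lambda>i. fst (index_decode i)) ` Poly_Mapping.keys f)"
  have "finite T" using fin by (simp add: T_def)
  then obtain N :: int where N: "N \<notin> T" using ex_new_if_finite[OF infinite_UNIV_int] by blast
  have coef_F: "coef f (N, a, b) = 0" if "f \<in> F" for f a b
  proof (rule ccontr)
    assume "coef f (N, a, b) \<noteq> 0"
    then have "index_code (N, a, b) \<in> Poly_Mapping.keys f" by (simp add: in_keys_iff)
    then have "fst (index_decode (index_code (N, a, b))) \<in> T" unfolding T_def using that by blast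
    then show False using N by simp
  qed
  obtain k where k: "\<And>f. f \<in> F \<Longrightarrow> k f \<in> hopf_socle H_alg"
    and eq: "bas (N, False, False) = (\<Sum>f\<in>F. H_mult f (k f))" using gen[of "bas (N, False, False)"] by blast
  have "(1 :: 'k) = coef (bas (N, False, False)) (N, False, False)" by simp
  also have "\<dots> = (\<Sum>f\<in>F. coef (H_mult f (k f)) (N, False, False))" unfolding eq by (simp add: lookup_sum)
  also have "\<dots> = 0"
    by (intro sum.neutral ballI coef_mult_degree_zero coef_F hopf_socle_degree_zero[OF k])
  finally show False by simp
qed

theorem theorem3p1:
  fixes A :: "('k::field_char_0, 'a::ab_group_add) hopf_alg" and g h :: 'a
  assumes "hopf_algebra A"
    and "presented_by A (case_gen g h) relations_A"
    and "group_like A g"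
    and "same_tensor2 A (comult A h) [(g, h), (h, hone A)]"
  shows "tensor_subcategory (Rep A) (integral_h2_modules A h) \<and>
    (\<exists>H :: ('k, nat \<Rightarrow>\<^sub>0 'k) hopf_alg.
       hopf_algebra H \<and> bij (antipode H) \<and> co_Frobenius H \<and>
       tensor_equivalent (full_subcategory (Rep A) (integral_h2_modules A h)) (Comod H) \<and>
       \<not> finite_type_over H (hopf_socle H))"
proof -
  interpret clifford_hopf A g h by (rule clifford_hopf.intro[OF assms])
  let ?S = "integral_h2_modules A h"
  have modules: "hom_identification (full_subcategory (Rep A) ?S) IntSOp operator_pair"
    by (rule hom_identification_full_subcategory[OF Rep_identification integral_subset integral_unit
          integral_tensor integral_h2_modules_eq])
  have "monoidal_category (IntSOp :: ('k, _, _) mon_cat)"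
    by (rule monoidal_category_full_subcategory[OF SOp_monoidal_category integral_subset integral_unit integral_tensor])
  then have "tensor_equivalent (full_subcategory (Rep A) ?S) (Comod (H_alg :: ('k, nat \<Rightarrow>\<^sub>0 'k) hopf_alg))"
    by (rule tensor_equivalent_if_identified[OF _ modules Comod_identification])
  moreover have "bij (antipode (H_alg :: ('k, nat \<Rightarrow>\<^sub>0 'k) hopf_alg))" using bij_H_antipode by simp
  moreover have "tensor_subcategory (Rep A) ?S"
    by (rule tensor_subcategory_transport[OF Rep_identification integral_tensor_subcategory integral_h2_modules_eq])
  ultimately show ?thesis
    using H_hopf_algebra H_co_Frobenius H_not_finite_type by blast
qed

end
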